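(* A graph $\Gamma$ is a strongly regular Cayley graph whose adjacency matrix has least eigenvalue at least $-2$ if and only if $\Gamma$ is isomorphic to one of the following graphs: (i) the cycle $C_5$, the Clebsch graph, the Shrikhande graph, or the Schl\"afli graph; (ii) the cocktail party graph $CP(n)$, with $n\ge 2$; (iii) the triangular graph $T(n)$, with $n=4$, or with $n>4$, $n\equiv 3 \pmod 4$ and $n$ a prime power; (iv) the lattice graph $L_2(n)$, with $n\ge 2$.
   Context: For a finite group $G$ with identity $e$ and an inverse-closed subset $S\subseteq G\setminus\{e\}$, the Cayley graph $\mathrm{Cay}(G,S)$ has vertex set $G$, with $a\sim b$ iff $ab^{-1}\in S$; a graph is a Cayley graph if it is isomorphic to some $\mathrm{Cay}(G,S)$. A strongly regular graph with parameters $(v,k,\lambda,\mu)$ is a $k$-regular graph on $v$ vertices in which adjacent vertices have exactly $\lambda$ common neighbours and non-adjacent vertices have exactly $\mu$ common neighbours; disjoint unions of complete graphs and edgeless graphs are excluded (so strongly regular graphs are connected of diameter two). The cocktail party graph $CP(n)$ is the complete multipartite graph with $n$ parts of size two; the triangular graph $T(n)$ is the line graph of $K_n$; the lattice graph $L_2(n)$ is the line graph of $K_{n,n}$. The Clebsch graph is the complement of the folded $5$-cube (the strongly regular graph with parameters $(16,10,6,6)$); the Shrikhande graph is the strongly regular graph with parameters $(16,6,2,2)$ not isomorphic to $L_2(4)$; the Schl\"afli graph is the unique strongly regular graph with parameters $(27,16,10,8)$. *)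

theory Defs
  imports
    "Graph_Theory.Digraph_Isomorphism"
    "Graph_Theory.Pair_Digraph"
    "Jordan_Normal_Form.Char_Poly"
    "HOL-Algebra.Group"
    "HOL-Number_Theory.Number_Theory"
    "HOL-Library.Disjoint_Sets"
begin

text \<open>
  Finite simple graphs are the \<^locale>\<open>pair_graph\<close>s of the library: finite, loop-free, symmetric
  sets of ordered pairs, each undirected edge being represented by its two arcs.
\<close>

abbreviation graph_iso :: "'a pair_pre_digraph \<Rightarrow> 'b pair_pre_digraph \<Rightarrow> bool" where
  "graph_iso G H \<equiv> digraph_iso (with_proj G) (with_proj H)"

lemma graph_iso_iff:
  assumes "pair_wf_digraph G" "pair_wf_digraph H"
  shows "graph_iso G H \<longleftrightarrow>
    (\<exists>f. bij_betw f (pverts G) (pverts H) \<and>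
      (\<forall>u\<in>pverts G. \<forall>v\<in>pverts G. (u, v) \<in> parcs G \<longleftrightarrow> (f u, f v) \<in> parcs H))"
    (is "_ \<longleftrightarrow> (\<exists>f. ?iso f)")
proof
  interpret G: pair_wf_digraph G by (rule assms)
  assume "graph_iso G H"
  then obtain h where h: "pre_digraph.digraph_isomorphism (with_proj G) h"
      "with_proj H = app_iso h (with_proj G)"
    unfolding digraph_iso_def by blast
  let ?f = "iso_verts h"
  have inj: "inj_on ?f (pverts G)"
    using h(1) by (auto simp: pre_digraph.digraph_isomorphism_def)
  have V: "pverts H = ?f ` pverts G" and A: "parcs H = iso_arcs h ` parcs G"
    and t: "iso_tail h = fst" "iso_head h = snd"
    using h(2) by (auto simp: with_proj_def app_iso_def)
  have "iso_arcs h a = (?f (fst a), ?f (snd a))" if "a \<in> parcs G" for a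
    using h(1) that by (auto simp: pre_digraph.digraph_isomorphism_def t prod_eq_iff)
  with A have A': "parcs H = (\<lambda>a. (?f (fst a), ?f (snd a))) ` parcs G"
    by (metis (no_types, lifting) image_cong)
  have "(u, v) \<in> parcs G \<longleftrightarrow> (?f u, ?f v) \<in> parcs H" if "u \<in> pverts G" "v \<in> pverts G" for u v
  proof
    assume "(?f u, ?f v) \<in> parcs H"
    then obtain a b where "(a, b) \<in> parcs G" "?f a = ?f u" "?f b = ?f v"
      unfolding A' by auto
    with that inj show "(u, v) \<in> parcs G"
      by (metis G.in_arcsD1 G.in_arcsD2 inj_onD)
  qed (auto simp: A' image_iff intro: rev_bexI)
  with inj V show "\<exists>f. ?iso f" by (auto simp: bij_betw_def intro!: exI[of _ ?f])
next
  interpret G: pair_wf_digraph G by (rule assms)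
  interpret H: pair_wf_digraph H by (rule assms)
  assume "\<exists>f. ?iso f"
  then obtain f where f: "?iso f" by blast
  define h where "h = \<lparr>iso_verts = f, iso_arcs = map_prod f f, iso_head = snd, iso_tail = fst\<rparr>"
  have inj: "inj_on f (pverts G)" and V: "pverts H = f ` pverts G"
    using f by (auto simp: bij_betw_def)
  have "inj_on (map_prod f f) (parcs G)"
    using map_prod_inj_on[OF inj inj] by (rule inj_on_subset) (auto dest: G.in_arcsD1 G.in_arcsD2)
  then have "pre_digraph.digraph_isomorphism (with_proj G) h"
    using inj G.wf_digraph_axioms
    by (auto simp: pre_digraph.digraph_isomorphism_def h_def wf_digraph_wp_iff assms)
  moreover have "parcs H = map_prod f f ` parcs G"
  proof (intro equalityI subsetI)
    fix e assume e: "e \<in> parcs H"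
    then obtain u v where "e = (f u, f v)" "u \<in> pverts G" "v \<in> pverts G"
      using H.in_arcsD1 H.in_arcsD2 V by (cases e) blast
    with e f show "e \<in> map_prod f f ` parcs G" by (auto intro!: rev_image_eqI[of "(u, v)"])
  next
    fix e assume "e \<in> map_prod f f ` parcs G"
    with f show "e \<in> parcs H" by (auto dest: G.in_arcsD1 G.in_arcsD2)
  qed
  with V have "with_proj H = app_iso h (with_proj G)"
    by (simp add: with_proj_def app_iso_def h_def)
  ultimately show "graph_iso G H" unfolding digraph_iso_def by blast
qed


section \<open>Cayley graphs\<close>

definition cayley_graph :: "('a, 'm) monoid_scheme \<Rightarrow> 'a set \<Rightarrow> 'a pair_pre_digraph" where
  "cayley_graph G S =
    \<lparr>pverts = carrier G,
     parcs = {(a, b). a \<in> carrier G \<and> b \<in> carrier G \<and> a \<otimes>\<^bsub>G\<^esub> inv\<^bsub>G\<^esub> b \<in> S}\<rparr>"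

definition connection_set :: "('a, 'm) monoid_scheme \<Rightarrow> 'a set \<Rightarrow> bool" where
  "connection_set G S \<longleftrightarrow> S \<subseteq> carrier G - {\<one>\<^bsub>G\<^esub>} \<and> (\<forall>s\<in>S. inv\<^bsub>G\<^esub> s \<in> S)"

text \<open>
  The group is sought on the vertex type of the graph. This is no restriction: a group on any other
  type can be transported along the graph isomorphism, see \<open>is_cayley_graphI\<close>.
\<close>

definition is_cayley_graph :: "'a pair_pre_digraph \<Rightarrow> bool" where
  "is_cayley_graph \<Gamma> \<longleftrightarrow>
    (\<exists>(G :: 'a monoid) S. group G \<and> finite (carrier G) \<and> connection_set G S \<and>
      graph_iso \<Gamma> (cayley_graph G S))"

lemma pair_wf_digraph_cayley_graph: "pair_wf_digraph (cayley_graph G S)"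
  by unfold_locales (auto simp: cayley_graph_def)

lemma is_cayley_graphI:
  fixes \<Gamma> :: "'a pair_pre_digraph" and H :: "('b, 'm) monoid_scheme"
  assumes \<Gamma>: "pair_wf_digraph \<Gamma>"
    and H: "group H" "finite (carrier H)" "connection_set H T"
    and iso: "graph_iso \<Gamma> (cayley_graph H T)"
  shows "is_cayley_graph \<Gamma>"
proof -
  interpret H: group H by (rule H)
  obtain f where bij: "bij_betw f (pverts \<Gamma>) (carrier H)"
    and arcs: "\<And>u v. u \<in> pverts \<Gamma> \<Longrightarrow> v \<in> pverts \<Gamma> \<Longrightarrow>
      (u, v) \<in> parcs \<Gamma> \<longleftrightarrow> (f u, f v) \<in> parcs (cayley_graph H T)"
    using iso graph_iso_iff[OF \<Gamma> pair_wf_digraph_cayley_graph[of H T]]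
    by (auto simp: cayley_graph_def)
  define g where "g = the_inv_into (pverts \<Gamma>) f"
  have inj: "inj_on f (pverts \<Gamma>)" and img: "f ` pverts \<Gamma> = carrier H"
    using bij by (auto simp: bij_betw_def)
  have fV: "f u \<in> carrier H" if "u \<in> pverts \<Gamma>" for u using that img by blast
  have gV: "g a \<in> pverts \<Gamma>" if "a \<in> carrier H" for a
    using that inj img the_inv_into_into unfolding g_def by (metis order_refl)
  have fg: "f (g a) = a" if "a \<in> carrier H" for a
    using that inj img f_the_inv_into_f unfolding g_def by metis
  have gf: "g (f u) = u" if "u \<in> pverts \<Gamma>" for u
    using that inj the_inv_into_f_f unfolding g_def by metis
  define G :: "'a monoid" where
    "G = \<lparr>carrier = pverts \<Gamma>, mult = (\<lambda>x y. g (f x \<otimes>\<^bsub>H\<^esub> f y)), one = g \<one>\<^bsub>H\<^esub>\<rparr>"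
  have G: "group G"
  proof (rule groupI)
    fix x y z assume "x \<in> carrier G" "y \<in> carrier G" "z \<in> carrier G"
    then show "x \<otimes>\<^bsub>G\<^esub> y \<otimes>\<^bsub>G\<^esub> z = x \<otimes>\<^bsub>G\<^esub> (y \<otimes>\<^bsub>G\<^esub> z)"
      by (simp add: G_def fg fV H.m_assoc)
  next
    fix x assume x: "x \<in> carrier G"
    then have "g (inv\<^bsub>H\<^esub> f x) \<in> carrier G" "g (inv\<^bsub>H\<^esub> f x) \<otimes>\<^bsub>G\<^esub> x = \<one>\<^bsub>G\<^esub>"
      by (simp_all add: G_def fg fV gV)
    then show "\<exists>y\<in>carrier G. y \<otimes>\<^bsub>G\<^esub> x = \<one>\<^bsub>G\<^esub>" by blast
  qed (simp_all add: G_def fg fV gV gf)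
  interpret G: group G by (rule G)
  have inv: "inv\<^bsub>G\<^esub> x = g (inv\<^bsub>H\<^esub> f x)" if "x \<in> pverts \<Gamma>" for x
    by (rule G.inv_equality) (use that in \<open>simp_all add: G_def fg fV gV\<close>)
  define S where "S = g ` T"
  have T: "T \<subseteq> carrier H" "\<one>\<^bsub>H\<^esub> \<notin> T" "\<And>t. t \<in> T \<Longrightarrow> inv\<^bsub>H\<^esub> t \<in> T"
    using H(3) by (auto simp: connection_set_def)
  have gS: "g a \<in> S \<longleftrightarrow> a \<in> T" if "a \<in> carrier H" for a
    using that fg T(1) unfolding S_def by (metis imageE imageI subsetD)
  have "connection_set G S"
    unfolding connection_set_def
  proof (intro conjI ballI subsetI)
    fix s assume "s \<in> S"
    then obtain t where t: "t \<in> T" "s = g t" by (auto simp: S_def)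
    then have tc: "t \<in> carrier H" using T by blast
    with t show "inv\<^bsub>G\<^esub> s \<in> S" using T by (simp add: inv gV fg gS)
    show "s \<in> carrier G - {\<one>\<^bsub>G\<^esub>}"
      using t tc T(2) gV fg by (auto simp: G_def) (metis H.one_closed)
  qed
  moreover have "\<Gamma> = cayley_graph G S"
  proof (rule pair_pre_digraph.equality)
    show "parcs \<Gamma> = parcs (cayley_graph G S)"
    proof (rule Set.set_eqI)
      interpret \<Gamma>: pair_wf_digraph \<Gamma> by (rule \<Gamma>)
      fix e :: "'a \<times> 'a"
      obtain u v where e: "e = (u, v)" by force
      show "e \<in> parcs \<Gamma> \<longleftrightarrow> e \<in> parcs (cayley_graph G S)"
      proof (cases "u \<in> pverts \<Gamma> \<and> v \<in> pverts \<Gamma>")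
        case True
        then show ?thesis
          using arcs[of u v] by (simp add: e cayley_graph_def inv fV) (simp add: G_def gS fV fg)
      next
        case False
        then show ?thesis
          by (auto simp: e cayley_graph_def G_def dest: \<Gamma>.in_arcsD1 \<Gamma>.in_arcsD2)
      qed
    qed
  qed (simp_all add: cayley_graph_def G_def)
  moreover have "finite (carrier G)"
    using H(2) bij by (simp add: G_def bij_betw_finite)
  moreover have "graph_iso \<Gamma> \<Gamma>"
    using graph_iso_iff[OF \<Gamma> \<Gamma>] by (auto intro!: exI[of _ id])
  ultimately show ?thesis
    using G unfolding is_cayley_graph_def by metis
qed


section \<open>Strongly regular graphs\<close>

definition nbrs :: "'a pair_pre_digraph \<Rightarrow> 'a \<Rightarrow> 'a set" where
  "nbrs G u = {w. (u, w) \<in> parcs G}"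

definition disjoint_union_of_complete_graphs :: "'a pair_pre_digraph \<Rightarrow> bool" where
  "disjoint_union_of_complete_graphs G \<longleftrightarrow>
    (\<exists>P. partition_on (pverts G) P \<and>
      parcs G = {(u, w). u \<noteq> w \<and> (\<exists>B\<in>P. u \<in> B \<and> w \<in> B)})"

definition srg :: "'a pair_pre_digraph \<Rightarrow> nat \<Rightarrow> nat \<Rightarrow> nat \<Rightarrow> nat \<Rightarrow> bool" where
  "srg G v k l m \<longleftrightarrow>
    pair_graph G \<and>
    card (pverts G) = v \<and>
    (\<forall>u\<in>pverts G. card (nbrs G u) = k) \<and>
    (\<forall>u\<in>pverts G. \<forall>w\<in>pverts G. (u, w) \<in> parcs G \<longrightarrow>
      card (nbrs G u \<inter> nbrs G w) = l) \<and>
    (\<forall>u\<in>pverts G. \<forall>w\<in>pverts G. u \<noteq> w \<and> (u, w) \<notin> parcs G \<longrightarrow>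
      card (nbrs G u \<inter> nbrs G w) = m) \<and>
    \<not> disjoint_union_of_complete_graphs G \<and>
    parcs G \<noteq> {}"

definition strongly_regular :: "'a pair_pre_digraph \<Rightarrow> bool" where
  "strongly_regular G \<longleftrightarrow> (\<exists>v k l m. srg G v k l m)"


section \<open>The adjacency matrix\<close>

text \<open>
  The rows and columns follow an arbitrary enumeration of the vertices; the eigenvalues do not
  depend on its choice, see \<open>eigenvalue_adjacency_matrix_iff\<close>.
\<close>

definition vertex_list :: "'a pair_pre_digraph \<Rightarrow> 'a list" where
  "vertex_list G = (SOME xs. distinct xs \<and> set xs = pverts G)"

definition adjacency_matrix :: "'a pair_pre_digraph \<Rightarrow> real mat" where
  "adjacency_matrix G = (let xs = vertex_list G in
    mat (length xs) (length xs) (\<lambda>(i, j). if (xs ! i, xs ! j) \<in> parcs G then 1 else 0))"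

definition least_eigenvalue :: "real mat \<Rightarrow> real" where
  "least_eigenvalue A = Min {\<theta>. eigenvalue A \<theta>}"

lemma eigenvalue_adjacency_matrix_iff:
  assumes "pair_fin_digraph G"
  shows "eigenvalue (adjacency_matrix G) \<theta> \<longleftrightarrow>
    (\<exists>f. (\<exists>u\<in>pverts G. f u \<noteq> 0) \<and>
      (\<forall>u\<in>pverts G. (\<Sum>w\<in>nbrs G u. f w) = \<theta> * f u))"
proof -
  interpret pair_fin_digraph G by (rule assms)
  define xs where "xs = vertex_list G"
  define n where "n = length xs"
  have "\<exists>xs. distinct xs \<and> set xs = pverts G"
    using finite_distinct_list[OF pair_finite_verts] by blast
  then have xs: "distinct xs" "set xs = pverts G"
    unfolding xs_def vertex_list_def by (metis (mono_tags, lifting) someI_ex)+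
  have bij: "bij_betw (\<lambda>i. xs ! i) {..<n} (pverts G)"
    using bij_betw_nth[OF xs(1)] xs(2) by (simp add: n_def)
  have A: "adjacency_matrix G =
      mat n n (\<lambda>(i, j). if (xs ! i, xs ! j) \<in> parcs G then 1 else 0)"
    by (simp add: adjacency_matrix_def Let_def xs_def n_def)
  have sub: "nbrs G u \<subseteq> pverts G" for u
    using in_arcsD2 by (auto simp: nbrs_def)
  have row: "(adjacency_matrix G *\<^sub>v v) $ i = (\<Sum>w\<in>nbrs G (xs ! i). f w)"
    if "i < n" "v \<in> carrier_vec n" "\<And>j. j < n \<Longrightarrow> v $ j = f (xs ! j)" for i v f
  proof -
    have "(adjacency_matrix G *\<^sub>v v) $ i =
        (\<Sum>j\<in>{..<n}. if (xs ! i, xs ! j) \<in> parcs G then f (xs ! j) else 0)"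
      using that by (auto simp: A scalar_prod_def atLeast0LessThan intro!: sum.cong)
    also have "\<dots> = (\<Sum>w\<in>pverts G. if (xs ! i, w) \<in> parcs G then f w else 0)"
      by (rule sum.reindex_bij_betw[OF bij])
    also have "\<dots> = (\<Sum>w\<in>nbrs G (xs ! i). f w)"
      using sub[of "xs ! i"] pair_finite_verts
      by (intro sum.mono_neutral_cong_right) (auto simp: nbrs_def)
    finally show ?thesis .
  qed
  have dim: "dim_row (adjacency_matrix G) = n" by (simp add: A)
  show ?thesis
  proof
    assume "eigenvalue (adjacency_matrix G) \<theta>"
    then obtain v where v: "v \<in> carrier_vec n" "v \<noteq> 0\<^sub>v n"
        "adjacency_matrix G *\<^sub>v v = \<theta> \<cdot>\<^sub>v v"
      by (auto simp: eigenvalue_def eigenvector_def dim)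
    define f where "f = (\<lambda>u. v $ the_inv_into {..<n} (\<lambda>i. xs ! i) u)"
    have f: "f (xs ! j) = v $ j" if "j < n" for j
      using bij that by (auto simp: f_def bij_betw_def the_inv_into_f_f)
    obtain i where i: "i < n" "v $ i \<noteq> 0"
      using v(1,2) by (metis carrier_vecD eq_vecI index_zero_vec(1) index_zero_vec(2))
    have "xs ! i \<in> pverts G" using i(1) bij by (auto simp: bij_betw_def)
    then have "\<exists>u\<in>pverts G. f u \<noteq> 0" using i f by metis
    moreover have "(\<Sum>w\<in>nbrs G u. f w) = \<theta> * f u" if u: "u \<in> pverts G" for u
    proof -
      obtain j where j: "j < n" "u = xs ! j" using u bij by (auto simp: bij_betw_def)
      then show ?thesis using row[of j v f] v f by simp
    qed
    ultimately show "\<exists>f. (\<exists>u\<in>pverts G. f u \<noteq> 0) \<and>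
      (\<forall>u\<in>pverts G. (\<Sum>w\<in>nbrs G u. f w) = \<theta> * f u)" by blast
  next
    assume "\<exists>f. (\<exists>u\<in>pverts G. f u \<noteq> 0) \<and>
      (\<forall>u\<in>pverts G. (\<Sum>w\<in>nbrs G u. f w) = \<theta> * f u)"
    then obtain f where f: "\<exists>u\<in>pverts G. f u \<noteq> 0"
      "\<And>u. u \<in> pverts G \<Longrightarrow> (\<Sum>w\<in>nbrs G u. f w) = \<theta> * f u" by blast
    define v where "v = vec n (\<lambda>i. f (xs ! i))"
    have v: "v \<in> carrier_vec n" by (simp add: v_def)
    obtain i where i: "i < n" "f (xs ! i) \<noteq> 0"
      using f(1) bij unfolding bij_betw_def by (metis imageE lessThan_iff)
    then have "v \<noteq> 0\<^sub>v n" by (metis index_vec index_zero_vec(1) v_def)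
    moreover have "adjacency_matrix G *\<^sub>v v = \<theta> \<cdot>\<^sub>v v"
    proof (rule eq_vecI)
      fix j assume "j < dim_vec (\<theta> \<cdot>\<^sub>v v)"
      then have j: "j < n" by (simp add: v_def)
      then have "xs ! j \<in> pverts G" using bij by (auto simp: bij_betw_def)
      then show "(adjacency_matrix G *\<^sub>v v) $ j = (\<theta> \<cdot>\<^sub>v v) $ j"
        using row[OF j v, of f] f(2) j by (simp add: v_def)
    qed (simp add: A v_def)
    ultimately show "eigenvalue (adjacency_matrix G) \<theta>"
      using v by (auto simp: eigenvalue_def eigenvector_def dim)
  qed
qed


section \<open>The graphs in the classification\<close>

definition cycle_graph :: "nat \<Rightarrow> nat pair_pre_digraph" where
  "cycle_graph n =
    \<lparr>pverts = {..<n},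
     parcs = {(i, j). i < n \<and> j < n \<and> (j = (i + 1) mod n \<or> i = (j + 1) mod n)}\<rparr>"

definition complete_graph :: "nat \<Rightarrow> nat pair_pre_digraph" where
  "complete_graph n =
    \<lparr>pverts = {..<n}, parcs = {(i, j). i < n \<and> j < n \<and> i \<noteq> j}\<rparr>"

text \<open>The parts of the following graph are the fibres of the first projection.\<close>

definition complete_multipartite_graph :: "nat \<Rightarrow> nat \<Rightarrow> (nat \<times> nat) pair_pre_digraph" where
  "complete_multipartite_graph n s =
    \<lparr>pverts = {..<n} \<times> {..<s},
     parcs = {(x, y). x \<in> {..<n} \<times> {..<s} \<and> y \<in> {..<n} \<times> {..<s} \<and> fst x \<noteq> fst y}\<rparr>"

definition cocktail_party_graph :: "nat \<Rightarrow> (nat \<times> nat) pair_pre_digraph" where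
  "cocktail_party_graph n = complete_multipartite_graph n 2"

definition line_graph :: "'a pair_pre_digraph \<Rightarrow> 'a set pair_pre_digraph" where
  "line_graph G = (let E = {{u, w} | u w. (u, w) \<in> parcs G} in
    \<lparr>pverts = E, parcs = {(e, f). e \<in> E \<and> f \<in> E \<and> e \<noteq> f \<and> e \<inter> f \<noteq> {}}\<rparr>)"

definition triangular_graph :: "nat \<Rightarrow> nat set pair_pre_digraph" where
  "triangular_graph n = line_graph (complete_graph n)"

definition lattice_graph :: "nat \<Rightarrow> (nat \<times> nat) set pair_pre_digraph" where
  "lattice_graph n = line_graph (complete_multipartite_graph 2 n)"

definition complement_graph :: "'a pair_pre_digraph \<Rightarrow> 'a pair_pre_digraph" where
  "complement_graph G =
    \<lparr>pverts = pverts G,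
     parcs = {(u, w). u \<in> pverts G \<and> w \<in> pverts G \<and> u \<noteq> w \<and> (u, w) \<notin> parcs G}\<rparr>"

definition cube_graph :: "nat \<Rightarrow> nat set pair_pre_digraph" where
  "cube_graph n =
    \<lparr>pverts = Pow {..<n},
     parcs = {(A, B). A \<subseteq> {..<n} \<and> B \<subseteq> {..<n} \<and> card ((A - B) \<union> (B - A)) = 1}\<rparr>"

text \<open>The folded cube is the quotient of the cube by its antipodal map, which is complementation.\<close>

definition folded_cube_graph :: "nat \<Rightarrow> nat set set pair_pre_digraph" where
  "folded_cube_graph n = (let W = {{A, {..<n} - A} | A. A \<subseteq> {..<n}} in
    \<lparr>pverts = W,
     parcs = {(P, Q). P \<in> W \<and> Q \<in> W \<and> P \<noteq> Q \<and> (\<exists>A\<in>P. \<exists>B\<in>Q. (A, B) \<in> parcs (cube_graph n))}\<rparr>)"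

definition clebsch_graph :: "nat set set pair_pre_digraph" where
  "clebsch_graph = complement_graph (folded_cube_graph 5)"

text \<open>
  The next two graphs are specified by a description that is unique only up to isomorphism, hence
  the choice operator; \<open>shrikhande_graph_spec\<close> and \<open>schlaefli_graph_spec\<close> below show that the
  descriptions are satisfiable.
\<close>

definition shrikhande_graph :: "nat pair_pre_digraph" where
  "shrikhande_graph = (SOME G. srg G 16 6 2 2 \<and> \<not> graph_iso G (lattice_graph 4))"

definition schlaefli_graph :: "nat pair_pre_digraph" where
  "schlaefli_graph = (SOME G. srg G 27 16 10 8)"


section \<open>Existence of the Shrikhande and Schlaefli graphs\<close>

definition graph_of_list :: "'a list \<Rightarrow> ('a \<Rightarrow> 'a \<Rightarrow> bool) \<Rightarrow> 'a pair_pre_digraph" where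
  "graph_of_list xs adj =
    \<lparr>pverts = set xs, parcs = {(u, w). u \<in> set xs \<and> w \<in> set xs \<and> adj u w}\<rparr>"

definition srg_check :: "'a list \<Rightarrow> ('a \<Rightarrow> 'a \<Rightarrow> bool) \<Rightarrow> nat \<Rightarrow> nat \<Rightarrow> nat \<Rightarrow> bool" where
  "srg_check xs adj k l m \<longleftrightarrow>
    (\<forall>u\<in>set xs. let N = filter (adj u) xs in
      length N = k \<and>
      (\<forall>w\<in>set xs. if u = w then \<not> adj u w
        else adj u w = adj w u \<and>
          length (filter (adj w) N) = (if adj u w then l else m)))"

lemma srg_graph_of_list:
  assumes "distinct xs" and chk: "srg_check xs adj k l m"
    and path: "{u, v, w} \<subseteq> set xs" "adj u v" "adj v w" "u \<noteq> w" "\<not> adj u w"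
  shows "srg (graph_of_list xs adj) (length xs) k l m"
proof -
  let ?G = "graph_of_list xs adj"
  have irr: "\<not> adj u u" if "u \<in> set xs" for u
    using chk that by (auto simp: srg_check_def Let_def)
  have sym: "adj w u" if "u \<in> set xs" "w \<in> set xs" "adj u w" for u w
    using chk that unfolding srg_check_def Let_def by (metis (full_types))
  have nb: "nbrs ?G u = set (filter (adj u) xs)" if "u \<in> set xs" for u
    using that by (auto simp: nbrs_def graph_of_list_def)
  have com: "nbrs ?G u \<inter> nbrs ?G w = set (filter (adj w) (filter (adj u) xs))"
    if "u \<in> set xs" "w \<in> set xs" for u w
    using that by (auto simp: nb)
  have card_set: "card (set (filter P xs)) = length (filter P xs)"
    "card (set (filter Q (filter P xs))) = length (filter Q (filter P xs))" for P Q
    using \<open>distinct xs\<close> by (intro distinct_card distinct_filter; simp)+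
  have "pair_graph ?G"
  proof unfold_locales
    show "finite (parcs ?G)"
      by (rule finite_subset[of _ "set xs \<times> set xs"]) (auto simp: graph_of_list_def)
    show "symmetric (with_proj ?G)"
      by (auto simp: symmetric_def graph_of_list_def intro!: symI sym)
  qed (auto simp: graph_of_list_def irr)
  moreover have "\<not> disjoint_union_of_complete_graphs ?G"
  proof
    assume "disjoint_union_of_complete_graphs ?G"
    then obtain P where P: "partition_on (set xs) P"
      "parcs ?G = {(u, w). u \<noteq> w \<and> (\<exists>B\<in>P. u \<in> B \<and> w \<in> B)}"
      by (auto simp: disjoint_union_of_complete_graphs_def graph_of_list_def)
    have uv: "(u, v) \<in> parcs ?G" "(v, w) \<in> parcs ?G" "(u, w) \<notin> parcs ?G"
      using path by (auto simp: graph_of_list_def)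
    then obtain B C where "B \<in> P" "u \<in> B" "v \<in> B" "C \<in> P" "v \<in> C" "w \<in> C"
      unfolding P(2) by blast
    moreover from this P(1) have "B = C"
      by (metis disjointD disjoint_iff partition_onD2)
    ultimately show False using uv(3) path(4) unfolding P(2) by blast
  qed
  moreover have "parcs ?G \<noteq> {}" using path by (auto simp: graph_of_list_def)
  moreover have V: "pverts ?G = set xs" and
    E: "\<And>u w. u \<in> set xs \<Longrightarrow> w \<in> set xs \<Longrightarrow> (u, w) \<in> parcs ?G \<longleftrightarrow> adj u w"
    by (auto simp: graph_of_list_def)
  moreover have "length (filter (adj u) xs) = k" if "u \<in> set xs" for u
    using chk that by (auto simp: srg_check_def Let_def)
  moreover have "length (filter (adj w) (filter (adj u) xs)) = (if adj u w then l else m)"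
    if "u \<in> set xs" "w \<in> set xs" "u \<noteq> w" for u w
    using chk that unfolding srg_check_def Let_def by metis
  ultimately show ?thesis
    using \<open>distinct xs\<close> irr unfolding srg_def
    by (metis (no_types, lifting) nb com card_set distinct_card)
qed


lemma srg_check_map:
  assumes "srg_check (map f xs) adj k l m" "inj_on f (set xs)"
  shows "srg_check xs (\<lambda>x y. adj (f x) (f y)) k l m"
  using assms(1)
  by (simp add: srg_check_def Let_def filter_map o_def inj_on_eq_iff[OF assms(2)] cong: if_cong)

text \<open>The Cayley graph of \<open>(Z/4)\<^sup>2\<close> with connection set \<open>{\<plusminus>(1,0), \<plusminus>(0,1), \<plusminus>(1,1)}\<close>:\<close>

definition shrikhande_pts :: "(int \<times> int) list" where
  "shrikhande_pts = List.product [0, 1, 2, 3] [0, 1, 2, 3]"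

fun shrikhande_adj :: "int \<times> int \<Rightarrow> int \<times> int \<Rightarrow> bool" where
  "shrikhande_adj (a, b) (c, d) \<longleftrightarrow> (let s = (\<lambda>x. if x = 3 then 0 else x + 1) in
     a = c \<and> (d = s b \<or> b = s d) \<or> b = d \<and> (c = s a \<or> a = s c) \<or>
     c = s a \<and> d = s b \<or> a = s c \<and> b = s d)"

lemma srg_check_shrikhande: "srg_check shrikhande_pts shrikhande_adj 6 2 2"
  by code_simp

lemma shrikhande_no_K4: "\<forall>u\<in>set shrikhande_pts. let N = filter (shrikhande_adj u) shrikhande_pts in
   \<forall>x\<in>set N. let M = filter (shrikhande_adj x) N in \<forall>y\<in>set M. filter (shrikhande_adj y) M = []"
  by code_simp

text \<open>
  The line graph of \<open>K\<^sub>8\<close> on \<open>{0,\<dots>,7}\<close> without its vertex \<open>{6,7}\<close>, switched with respect to the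
  neighbours of that vertex:
\<close>

definition schlaefli_pts :: "(int \<times> int) list" where
  "schlaefli_pts = [(0,1),(0,2),(0,3),(0,4),(0,5),(0,6),(0,7),(1,2),(1,3),(1,4),(1,5),(1,6),(1,7),
     (2,3),(2,4),(2,5),(2,6),(2,7),(3,4),(3,5),(3,6),(3,7),(4,5),(4,6),(4,7),(5,6),(5,7)]"

fun schlaefli_adj :: "int \<times> int \<Rightarrow> int \<times> int \<Rightarrow> bool" where
  "schlaefli_adj (a, b) (c, d) \<longleftrightarrow> (a, b) \<noteq> (c, d) \<and>
     ((a = c \<or> a = d \<or> b = c \<or> b = d) \<longleftrightarrow> ((b \<ge> 6) = (d \<ge> 6)))"

lemma srg_check_schlaefli: "srg_check schlaefli_pts schlaefli_adj 16 10 8"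
  by code_simp

lemma srg_nat_graph:
  assumes "distinct ps" "srg_check ps adj k l m"
    and "u < length ps" "v < length ps" "w < length ps"
    and "adj (ps ! u) (ps ! v)" "adj (ps ! v) (ps ! w)" "u \<noteq> w" "\<not> adj (ps ! u) (ps ! w)"
  shows "srg (graph_of_list [0..<length ps] (\<lambda>i j. adj (ps ! i) (ps ! j))) (length ps) k l m"
proof -
  have "srg_check (map ((!) ps) [0..<length ps]) adj k l m" using assms(2) by (simp add: map_nth)
  then have "srg_check [0..<length ps] (\<lambda>i j. adj (ps ! i) (ps ! j)) k l m"
    by (rule srg_check_map) (use assms(1) in \<open>auto simp: inj_on_def nth_eq_iff_index_eq\<close>)
  from srg_graph_of_list[OF _ this, of u v w] assms show ?thesis by simp
qed

lemma schlaefli_graph_spec: "srg schlaefli_graph 27 16 10 8"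
proof -
  let ?G = "graph_of_list [0..<length schlaefli_pts] (\<lambda>i j. schlaefli_adj (schlaefli_pts ! i) (schlaefli_pts ! j))"
  have "srg ?G (length schlaefli_pts) 16 10 8"
    by (rule srg_nat_graph[where u = 0 and v = 1 and w = 13, OF _ srg_check_schlaefli]) (simp_all add: schlaefli_pts_def)
  moreover have "length schlaefli_pts = 27" by (simp add: schlaefli_pts_def)
  ultimately have "srg ?G 27 16 10 8" by simp
  then show ?thesis unfolding schlaefli_graph_def by (rule someI)
qed

lemma shrikhande_graph_spec:
  "srg shrikhande_graph 16 6 2 2" "\<not> graph_iso shrikhande_graph (lattice_graph 4)"
proof -
  let ?adj = "\<lambda>i j. shrikhande_adj (shrikhande_pts ! i) (shrikhande_pts ! j)"
  let ?G = "graph_of_list [0..<length shrikhande_pts] ?adj"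
  have len: "length shrikhande_pts = 16" by (simp add: shrikhande_pts_def)
  have "srg ?G (length shrikhande_pts) 6 2 2"
    by (rule srg_nat_graph[where u = 0 and v = 1 and w = 2, OF _ srg_check_shrikhande]) (simp_all add: shrikhande_pts_def)
  then have srg: "srg ?G 16 6 2 2" by (simp add: len)
  moreover have "\<not> graph_iso ?G (lattice_graph 4)"
  proof
    assume iso: "graph_iso ?G (lattice_graph 4)"
    have "pair_wf_digraph ?G" by unfold_locales (auto simp: graph_of_list_def)
    moreover have "pair_wf_digraph (lattice_graph 4)"
      by unfold_locales (auto simp: lattice_graph_def line_graph_def Let_def)
    ultimately obtain f where f: "bij_betw f (pverts ?G) (pverts (lattice_graph 4))"
      "\<And>u w. u \<in> pverts ?G \<Longrightarrow> w \<in> pverts ?G \<Longrightarrow>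
        (u, w) \<in> parcs ?G \<longleftrightarrow> (f u, f w) \<in> parcs (lattice_graph 4)"
      using iso by (subst (asm) graph_iso_iff) auto
    define e where "e = (\<lambda>j. {(0 :: nat, 0 :: nat), (1, j)})"
    have eV: "e j \<in> pverts (lattice_graph 4)" if "j < 4" for j
    proof -
      have "((0, 0), (1, j)) \<in> parcs (complete_multipartite_graph 2 4)"
        using that by (simp add: complete_multipartite_graph_def)
      then show ?thesis unfolding e_def lattice_graph_def line_graph_def Let_def by auto
    qed
    have eE: "(e i, e j) \<in> parcs (lattice_graph 4)" if "i < 4" "j < 4" "i \<noteq> j" for i j
      using eV[OF that(1)] eV[OF that(2)] that(3)
      by (auto simp: e_def lattice_graph_def line_graph_def Let_def doubleton_eq_iff)
    define g where "g = (\<lambda>j. the_inv_into (pverts ?G) f (e j))"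
    have g: "g j \<in> pverts ?G" "f (g j) = e j" if "j < 4" for j
      using f(1) eV[OF that] unfolding g_def bij_betw_def
      by (auto simp: the_inv_into_into f_the_inv_into_f)
    have adj: "?adj (g i) (g j)" if "i < 4" "j < 4" "i \<noteq> j" for i j
      using f(2)[of "g i" "g j"] g that eE by (auto simp: graph_of_list_def)
    have mem: "shrikhande_pts ! g j \<in> set shrikhande_pts" if "j < 4" for j
      using g(1)[OF that] by (simp add: graph_of_list_def)
    have no_K4: False if "u \<in> set shrikhande_pts" "x \<in> set shrikhande_pts"
        "y \<in> set shrikhande_pts" "z \<in> set shrikhande_pts"
        "shrikhande_adj u x" "shrikhande_adj u y" "shrikhande_adj u z"
        "shrikhande_adj x y" "shrikhande_adj x z" "shrikhande_adj y z" for u x y z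
    proof -
      let ?N = "filter (shrikhande_adj u) shrikhande_pts"
      let ?M = "filter (shrikhande_adj x) ?N"
      have "x \<in> set ?N" "y \<in> set ?M" and z: "z \<in> set (filter (shrikhande_adj y) ?M)"
        using that by (simp_all del: filter_filter shrikhande_adj.simps)
      then have "filter (shrikhande_adj y) ?M = []"
        using shrikhande_no_K4 that(1) unfolding Let_def by meson
      with z show False by (metis empty_iff empty_set)
    qed
    show False
      by (rule no_K4[OF mem[of 0] mem[of 1] mem[of 2] mem[of 3] adj[of 0 1] adj[of 0 2] adj[of 0 3]
            adj[of 1 2] adj[of 1 3] adj[of 2 3]]) (simp_all del: shrikhande_adj.simps)
  qed
  ultimately have "srg ?G 16 6 2 2 \<and> \<not> graph_iso ?G (lattice_graph 4)" by (rule conjI)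
  then have "srg shrikhande_graph 16 6 2 2 \<and> \<not> graph_iso shrikhande_graph (lattice_graph 4)"
    unfolding shrikhande_graph_def by (rule someI)
  then show "srg shrikhande_graph 16 6 2 2" "\<not> graph_iso shrikhande_graph (lattice_graph 4)"
    by blast+
qed

end

theory Submission
  imports Defs "Jordan_Normal_Form.Spectral_Radius" "HOL-Algebra.Sylow" "HOL-Algebra.Algebraic_Closure"
    "HOL-Number_Theory.Residues"
begin

text \<open>
  The smaller root \<open>s\<close> of \<open>x\<^sup>2 - (\<lambda> - \<mu>) x - (k - \<mu>)\<close> is an eigenvalue, so least eigenvalue at least \<open>-2\<close>
  means \<open>k + \<mu> \<le> 2 \<lambda> + 4\<close>. Counting in the neighbourhood of a vertex gives \<open>k + \<mu> \<ge> 2 \<lambda> + 3\<close> unless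
  \<open>\<mu> = k\<close>, which is the cocktail party case. If \<open>k + \<mu> = 2 \<lambda> + 3\<close>, the eigenvalues are irrational and their
  multiplicities agree, which leaves the pentagon. Otherwise \<open>s = -2\<close>, and two non-adjacent neighbours of a
  vertex \<open>u\<close> have either one common neighbour at distance two from \<open>u\<close>, or lie in a unique claw at \<open>u\<close>.
  Without claws the complements of the local graphs are triangle-free and highly structured, which yields lattice graphs,
  triangular graphs, and the parameters of the Clebsch and the Schlaefli graph. A claw forces \<open>\<mu> = r\<close>,
  \<open>k = 3 r\<close>, \<open>v = 6 r + 4\<close> with \<open>r \<in> {1, 2, 4}\<close>: the Petersen graph and the Chang graphs
  are not Cayley graphs, and \<open>r = 2\<close> gives the Shrikhande graph.

  A group acting regularly on the vertices of \<open>T(n)\<close>, \<open>n \<ge> 5\<close>, permutes the \<open>n\<close> maximal cliques; only the identity fixes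
  two of them, and there are no involutions, so the group is a Frobenius group of odd order in which the fixed-point-free
  elements are all conjugate up to inversion; hence \<open>n\<close> is a prime power congruent to 3 modulo 4. Conversely
  the maps \<open>x \<mapsto> a x + b\<close> with \<open>a\<close> a nonzero square act regularly on the pairs of elements of a field of such an order.
\<close>

section \<open>Strongly regular graphs as relations\<close>

text \<open>Integrality alone does not settle the claw case: with \<open>m = r\<close> it says that
  \<open>r + 2\<close> divides 12, which still admits \<open>r = 10\<close>. That value is removed
  geometrically: \<open>A + 2 I\<close> is positive semidefinite, hence the Gram matrix of vectors
  of squared length 2 with inner products 0 and 1, and a claw with large \<open>r\<close> would give
  five orthonormal vectors having inner products \<open>1/2\<close> or \<open>-1/2\<close> with one
  unit vector, against Bessel. The uniqueness theorems label the vertices from one base vertex. They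
  serve twice: in the classification, and to show that the sporadic graphs are Cayley graphs, since
  it then suffices to compute the parameters of one explicit Cayley graph; they also identify the
  two graphs defined by a choice operator. The Petersen graph is excluded by calculating with words
  in its three generators, the Chang graphs through the orbits of a subgroup of order 7, whose
  quotient matrix forces a clique of seven vertices. The field of order \<open>q\<close> is the set
  of roots of \<open>x^q = x\<close> in an algebraic closure of the prime field.\<close>

lemma double_count:
  assumes "finite A" "finite B"
  shows "(\<Sum>a\<in>A. card {b \<in> B. R a b}) = (\<Sum>b\<in>B. card {a \<in> A. R a b})"
proof -
  have "(\<Sum>a\<in>A. card {b \<in> B. R a b}) = (\<Sum>a\<in>A. \<Sum>b\<in>B. if R a b then 1 else 0)"
    using assms by (intro sum.cong refl) (simp add: sum.If_cases Int_def)
  also have "\<dots> = (\<Sum>b\<in>B. \<Sum>a\<in>A. if R a b then 1 else 0)" by (rule sum.swap)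
  also have "\<dots> = (\<Sum>b\<in>B. card {a \<in> A. R a b})"
    using assms by (intro sum.cong refl) (simp add: sum.If_cases Int_def)
  finally show ?thesis .
qed

text \<open>The relations are compared on \<open>V\<close> and \<open>W\<close> only, so label
  models such as \<open>rook\<close> or \<open>shrikhande_rel\<close> need not be restricted to
  their vertex sets.\<close>

definition rel_iso :: "'a set \<Rightarrow> ('a \<Rightarrow> 'a \<Rightarrow> bool) \<Rightarrow> 'b set \<Rightarrow> ('b \<Rightarrow> 'b \<Rightarrow> bool) \<Rightarrow> bool" where
  "rel_iso V E W F \<longleftrightarrow> (\<exists>f. bij_betw f V W \<and> (\<forall>x\<in>V. \<forall>y\<in>V. E x y \<longleftrightarrow> F (f x) (f y)))"

lemma rel_isoI:
  assumes "bij_betw f V W" "\<And>x y. x \<in> V \<Longrightarrow> y \<in> V \<Longrightarrow> E x y \<longleftrightarrow> F (f x) (f y)"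
  shows "rel_iso V E W F"
  using assms unfolding rel_iso_def by blast

lemma rel_iso_sym:
  assumes "rel_iso V E W F" shows "rel_iso W F V E"
proof -
  obtain f where f: "bij_betw f V W" "\<And>x y. x \<in> V \<Longrightarrow> y \<in> V \<Longrightarrow> E x y \<longleftrightarrow> F (f x) (f y)"
    using assms unfolding rel_iso_def by blast
  show ?thesis
  proof (rule rel_isoI[OF bij_betw_inv_into[OF f(1)]])
    fix x y assume xy: "x \<in> W" "y \<in> W"
    then have "f (inv_into V f x) = x" "f (inv_into V f y) = y"
      using f(1) by (simp_all add: bij_betw_inv_into_right)
    moreover have "inv_into V f x \<in> V" "inv_into V f y \<in> V"
      using f(1) xy by (auto simp: bij_betw_def inv_into_into)
    ultimately show "F x y \<longleftrightarrow> E (inv_into V f x) (inv_into V f y)" using f(2) by metis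
  qed
qed

lemma rel_iso_trans:
  assumes "rel_iso V E W F" "rel_iso W F U K" shows "rel_iso V E U K"
proof -
  obtain f where f: "bij_betw f V W" "\<And>x y. x \<in> V \<Longrightarrow> y \<in> V \<Longrightarrow> E x y \<longleftrightarrow> F (f x) (f y)"
    using assms(1) unfolding rel_iso_def by blast
  obtain g where g: "bij_betw g W U" "\<And>x y. x \<in> W \<Longrightarrow> y \<in> W \<Longrightarrow> F x y \<longleftrightarrow> K (g x) (g y)"
    using assms(2) unfolding rel_iso_def by blast
  show ?thesis
    by (rule rel_isoI[OF bij_betw_trans[OF f(1) g(1)]]) (use f g in \<open>auto simp: bij_betw_def\<close>)
qed

abbreviation gadj :: "'a pair_pre_digraph \<Rightarrow> 'a \<Rightarrow> 'a \<Rightarrow> bool" where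
  "gadj G x y \<equiv> (x, y) \<in> parcs G"

lemma graph_iso_iff_rel_iso:
  assumes "pair_wf_digraph G" "pair_wf_digraph H"
  shows "graph_iso G H \<longleftrightarrow> rel_iso (pverts G) (gadj G) (pverts H) (gadj H)"
  unfolding graph_iso_iff[OF assms] rel_iso_def ..

text \<open>\<open>path\<close> expresses in one condition that the graph is neither edgeless nor a
  disjoint union of complete graphs; it also makes \<open>m\<close> positive. \<open>E_V\<close>
  allows neighbourhoods to be written as \<open>{w. E x w}\<close> without mentioning
  \<open>V\<close>.\<close>

locale sr_graph =
  fixes V :: "'a set" and E :: "'a \<Rightarrow> 'a \<Rightarrow> bool" and k l m :: nat
  assumes finite_V: "finite V"
    and E_V: "E x y \<Longrightarrow> x \<in> V \<and> y \<in> V"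
    and E_sym: "E x y \<Longrightarrow> E y x"
    and E_irrefl: "\<not> E x x"
    and card_nbrs: "x \<in> V \<Longrightarrow> card {w. E x w} = k"
    and card_adj: "E x y \<Longrightarrow> card {w. E x w \<and> E y w} = l"
    and card_nonadj: "x \<in> V \<Longrightarrow> y \<in> V \<Longrightarrow> x \<noteq> y \<Longrightarrow> \<not> E x y \<Longrightarrow> card {w. E x w \<and> E y w} = m"
    and path: "\<exists>x y z. E x y \<and> E y z \<and> x \<noteq> z \<and> \<not> E x z"

text \<open>\<open>rel_iso\<close> leaves \<open>F\<close> free outside \<open>W\<close>, whereas
  the neighbourhoods in \<open>sr_graph\<close> are taken in the whole type; hence the third
  hypothesis.\<close>

lemma sr_graph_rel_iso:
  assumes "sr_graph V E k l m" "rel_iso V E W F" "\<And>x y. F x y \<Longrightarrow> x \<in> W \<and> y \<in> W"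
  shows "sr_graph W F k l m"
proof -
  interpret sr_graph V E k l m by fact
  obtain f where f: "bij_betw f V W" "\<And>x y. x \<in> V \<Longrightarrow> y \<in> V \<Longrightarrow> E x y \<longleftrightarrow> F (f x) (f y)"
    using assms(2) unfolding rel_iso_def by blast
  have inj: "inj_on f V" and W: "W = f ` V" using f(1) by (auto simp: bij_betw_def)
  have im: "card {w. F (f x) w \<and> P w} = card {w. E x w \<and> P (f w)}" if "x \<in> V" for x P
  proof -
    have "{w. F (f x) w \<and> P w} = f ` {w. E x w \<and> P (f w)}"
    proof (rule Set.set_eqI, rule iffI)
      fix w assume w: "w \<in> {w. F (f x) w \<and> P w}"
      then obtain y where "y \<in> V" "w = f y" using assms(3)[of "f x" w] W by auto
      with w show "w \<in> f ` {w. E x w \<and> P (f w)}" using f(2)[OF that] by auto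
    next
      fix w assume "w \<in> f ` {w. E x w \<and> P (f w)}"
      then show "w \<in> {w. F (f x) w \<and> P w}" using f(2)[OF that] E_V by auto
    qed
    moreover have "inj_on f {w. E x w \<and> P (f w)}"
      by (rule inj_on_subset[OF inj]) (use E_V in auto)
    ultimately show ?thesis by (simp add: card_image)
  qed
  show ?thesis
  proof
    show "finite W" using W finite_V by simp
    show "F x y \<Longrightarrow> x \<in> W \<and> y \<in> W" for x y by (rule assms(3))
    show "F y x" if Fxy: "F x y" for x y
    proof -
      obtain a b where ab: "a \<in> V" "b \<in> V" "x = f a" "y = f b" using assms(3)[OF Fxy] W by auto
      then show ?thesis using Fxy f(2)[of a b] f(2)[of b a] E_sym by blast
    qed
    show "\<not> F x x" for x
    proof
      assume F: "F x x"
      then obtain a where "a \<in> V" "x = f a" using assms(3)[OF F] W by auto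
      then show False using F f(2)[of a a] E_irrefl by blast
    qed
    show "card {w. F x w} = k" if "x \<in> W" for x
      using that W im[of _ "\<lambda>_. True"] card_nbrs by auto
    show "card {w. F x w \<and> F y w} = l" if xy: "F x y" for x y
    proof -
      obtain a b where ab: "a \<in> V" "b \<in> V" "x = f a" "y = f b" using assms(3)[OF xy] W by auto
      have "card {w. F x w \<and> F y w} = card {w. E a w \<and> F (f b) (f w)}"
        using im[of a "F y"] ab by simp
      also have "{w. E a w \<and> F (f b) (f w)} = {w. E a w \<and> E b w}" using f(2) ab E_V by blast
      finally show ?thesis using card_adj[of a b] f(2)[of a b] xy ab by simp
    qed
    show "card {w. F x w \<and> F y w} = m" if xy: "x \<in> W" "y \<in> W" "x \<noteq> y" "\<not> F x y" for x y
    proof -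
      obtain a b where ab: "a \<in> V" "b \<in> V" "x = f a" "y = f b" using xy W by auto
      have "card {w. F x w \<and> F y w} = card {w. E a w \<and> F (f b) (f w)}"
        using im[of a "F y"] ab by simp
      also have "{w. E a w \<and> F (f b) (f w)} = {w. E a w \<and> E b w}" using f(2) ab E_V by blast
      finally show ?thesis using card_nonadj[of a b] f(2)[of a b] xy ab by auto
    qed
    obtain x y z where p: "E x y" "E y z" "x \<noteq> z" "\<not> E x z" using path by blast
    then have "x \<in> V" "y \<in> V" "z \<in> V" using E_V by blast+
    note v = this
    have "F (f x) (f y)" "F (f y) (f z)" "\<not> F (f x) (f z)" using p f(2) v by auto
    moreover have "f x \<noteq> f z" using p(3) inj_onD[OF inj _ v(1,3)] by blast
    ultimately show "\<exists>x y z. F x y \<and> F y z \<and> x \<noteq> z \<and> \<not> F x z" by blast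
  qed
qed

lemma srg_iff_sr_graph:
  assumes "pair_graph G"
  shows "srg G v k l m \<longleftrightarrow> card (pverts G) = v \<and> sr_graph (pverts G) (gadj G) k l m"
proof -
  interpret pair_graph G by fact
  have symG: "gadj G x y \<Longrightarrow> gadj G y x" for x y using arcs_symmetric by auto
  have irr: "\<not> gadj G x x" for x using no_loops[of "(x, x)"] by auto
  have path_iff: "(\<not> disjoint_union_of_complete_graphs G \<and> parcs G \<noteq> {}) \<longleftrightarrow>
      (\<exists>x y z. gadj G x y \<and> gadj G y z \<and> x \<noteq> z \<and> \<not> gadj G x z)" (is "_ \<longleftrightarrow> ?path")
  proof
    assume *: "\<not> disjoint_union_of_complete_graphs G \<and> parcs G \<noteq> {}"
    show ?path
    proof (rule ccontr)
      assume np: "\<not> ?path"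
      \<comment> \<open>Without an induced path of length two, being equal or adjacent is
        transitive; its classes are the complete components.\<close>
      define R where "R = {(x, y). x \<in> pverts G \<and> y \<in> pverts G \<and> (x = y \<or> gadj G x y)}"
      have "equiv (pverts G) R"
      proof (rule equivI)
        show "R \<subseteq> pverts G \<times> pverts G" "refl_on (pverts G) R" by (auto simp: R_def refl_on_def)
        show "sym R" using symG by (auto simp: R_def intro!: symI)
        show "trans R"
        proof (rule transI)
          fix x y z assume "(x, y) \<in> R" "(y, z) \<in> R"
          then show "(x, z) \<in> R" using np by (cases "x = y"; cases "y = z"; cases "x = z") (auto simp: R_def)
        qed
      qed
      then have P: "partition_on (pverts G) (pverts G // R)" by (rule partition_on_quotient)
      have "gadj G u w \<longleftrightarrow> u \<noteq> w \<and> (\<exists>B\<in>pverts G // R. u \<in> B \<and> w \<in> B)" for u w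
      proof
        assume a: "gadj G u w"
        then have "u \<in> pverts G" "w \<in> pverts G" using in_arcsD1 in_arcsD2 by blast+
        then show "u \<noteq> w \<and> (\<exists>B\<in>pverts G // R. u \<in> B \<and> w \<in> B)"
          using a irr by (auto simp: quotient_def R_def intro!: bexI[of _ u])
      next
        assume uw: "u \<noteq> w \<and> (\<exists>B\<in>pverts G // R. u \<in> B \<and> w \<in> B)"
        then obtain x where "(x, u) \<in> R" "(x, w) \<in> R" by (auto simp: quotient_def)
        then have "x = u \<or> gadj G u x" "x = w \<or> gadj G x w" using symG by (auto simp: R_def)
        then show "gadj G u w" using np uw symG by blast
      qed
      then have "parcs G = {(u, w). u \<noteq> w \<and> (\<exists>B\<in>pverts G // R. u \<in> B \<and> w \<in> B)}" by auto
      with P * show False unfolding disjoint_union_of_complete_graphs_def by blast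
    qed
  next
    assume ?path
    then obtain x y z where p: "gadj G x y" "gadj G y z" "x \<noteq> z" "\<not> gadj G x z" by blast
    have False if du: "disjoint_union_of_complete_graphs G"
    proof -
      obtain P where P: "partition_on (pverts G) P"
        "parcs G = {(u, w). u \<noteq> w \<and> (\<exists>B\<in>P. u \<in> B \<and> w \<in> B)}"
        using du unfolding disjoint_union_of_complete_graphs_def by blast
      obtain B C where BC: "B \<in> P" "x \<in> B" "y \<in> B" "C \<in> P" "y \<in> C" "z \<in> C"
        using p(1,2) unfolding P(2) by blast
      with P(1) have "B = C" by (metis disjointD disjoint_iff partition_onD2)
      then have "gadj G x z" unfolding P(2) using BC p(3) by blast
      then show False using p(4) by blast
    qed
    with p show "\<not> disjoint_union_of_complete_graphs G \<and> parcs G \<noteq> {}" by blast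
  qed
  have "srg G v k l m \<longleftrightarrow> card (pverts G) = v \<and>
    (\<forall>u\<in>pverts G. card {w. gadj G u w} = k) \<and>
    (\<forall>u\<in>pverts G. \<forall>w\<in>pverts G. gadj G u w \<longrightarrow> card {x. gadj G u x \<and> gadj G w x} = l) \<and>
    (\<forall>u\<in>pverts G. \<forall>w\<in>pverts G. u \<noteq> w \<and> \<not> gadj G u w \<longrightarrow> card {x. gadj G u x \<and> gadj G w x} = m) \<and>
    (\<exists>x y z. gadj G x y \<and> gadj G y z \<and> x \<noteq> z \<and> \<not> gadj G x z)"
    unfolding srg_def path_iff nbrs_def using assms by (simp add: Int_def)
  also have "\<dots> \<longleftrightarrow> card (pverts G) = v \<and> sr_graph (pverts G) (gadj G) k l m" (is "?lhs \<longleftrightarrow> ?rhs")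
  proof -
    have V: "gadj G u w \<Longrightarrow> u \<in> pverts G \<and> w \<in> pverts G" for u w using in_arcsD1 in_arcsD2 by blast
    show ?thesis
    proof
      assume ?lhs
      then have *: "card (pverts G) = v" "\<And>u. u\<in>pverts G \<Longrightarrow> card {w. gadj G u w} = k"
        "\<And>u w. gadj G u w \<Longrightarrow> card {x. gadj G u x \<and> gadj G w x} = l"
        "\<And>u w. u\<in>pverts G \<Longrightarrow> w\<in>pverts G \<Longrightarrow> u \<noteq> w \<Longrightarrow> \<not> gadj G u w \<Longrightarrow>
          card {x. gadj G u x \<and> gadj G w x} = m"
        "\<exists>x y z. gadj G x y \<and> gadj G y z \<and> x \<noteq> z \<and> \<not> gadj G x z"
        by (simp_all add: V)
      have "sr_graph (pverts G) (gadj G) k l m"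
        by (unfold_locales; (rule pair_finite_verts V symG irr *; assumption?)?)
      with *(1) show ?rhs by blast
    next
      assume rhs: ?rhs
      interpret S: sr_graph "pverts G" "gadj G" k l m by (rule conjunct2[OF rhs])
      show ?lhs using conjunct1[OF rhs] S.card_nbrs S.card_adj S.card_nonadj S.path by simp
    qed
  qed
  finally show ?thesis .
qed

context sr_graph
begin

lemma finite_nbrs [simp]: "finite {w. E x w}"
  by (rule finite_subset[OF _ finite_V]) (use E_V in blast)

lemma finite_nbrs2 [simp]: "finite {w. E x w \<and> P w}"
  by (rule finite_subset[OF _ finite_V]) (use E_V in blast)

lemma E_sym_iff: "E x y \<longleftrightarrow> E y x" using E_sym by blast

lemma m_pos: "m > 0"
proof -
  obtain x y z where p: "E x y" "E y z" "x \<noteq> z" "\<not> E x z" using path by blast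
  then have "card {w. E x w \<and> E z w} = m" using E_V card_nonadj by blast
  moreover have "y \<in> {w. E x w \<and> E z w}" using p E_sym by auto
  ultimately show ?thesis by (metis card_gt_0_iff empty_iff finite_nbrs2)
qed

lemma m_le_k: "m \<le> k"
proof -
  obtain x y z where p: "E x y" "E y z" "x \<noteq> z" "\<not> E x z" using path by blast
  then have "card {w. E x w \<and> E z w} = m" "card {w. E x w} = k" using E_V card_nonadj card_nbrs by blast+
  moreover have "card {w. E x w \<and> E z w} \<le> card {w. E x w}" by (rule card_mono) auto
  ultimately show ?thesis by simp
qed

lemma l_less: "l + 2 \<le> k"
proof -
  obtain x y z where p: "E x y" "E y z" "x \<noteq> z" "\<not> E x z" using path by blast
  have "card {w. E x w \<and> E y w} = l" "card {w. E y w} = k" using p E_V card_adj card_nbrs by blast+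
  moreover have "card ({w. E x w \<and> E y w} \<union> {x, z}) \<le> card {w. E y w}"
    by (rule card_mono) (use p E_sym in auto)
  moreover have "card ({w. E x w \<and> E y w} \<union> {x, z}) = card {w. E x w \<and> E y w} + 2"
    using p E_irrefl by (subst card_Un_disjoint) auto
  ultimately show ?thesis by simp
qed

lemma V_nonempty: "V \<noteq> {}" using path E_V by blast

lemma k_less: "k + 2 \<le> card V"
proof -
  obtain x y z where p: "E x y" "E y z" "x \<noteq> z" "\<not> E x z" using path by blast
  then have "card {w. E x w} = k" using E_V card_nbrs by blast
  moreover have "card ({w. E x w} \<union> {x, z}) \<le> card V"
    using finite_V by (rule card_mono) (use p E_V in auto)
  moreover have "card ({w. E x w} \<union> {x, z}) = card {w. E x w} + 2"
    using p E_irrefl by (subst card_Un_disjoint) auto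
  ultimately show ?thesis by simp
qed

lemma card_nonnbrs: "u \<in> V \<Longrightarrow> card {w \<in> V. w \<noteq> u \<and> \<not> E u w} = card V - 1 - k"
proof -
  assume u: "u \<in> V"
  have "{w \<in> V. w \<noteq> u \<and> \<not> E u w} = V - insert u {w. E u w}" by auto
  moreover have "card (V - insert u {w. E u w}) = card V - card (insert u {w. E u w})"
    by (rule card_Diff_subset) (use u E_V in auto)
  ultimately show ?thesis using card_nbrs[OF u] E_irrefl by simp
qed

lemma card_nbr_diff: "E u x \<Longrightarrow> card {w. E x w \<and> w \<noteq> u \<and> \<not> E u w} = k - 1 - l"
proof -
  assume u: "E u x"
  have "{w. E x w \<and> w \<noteq> u \<and> \<not> E u w} = {w. E x w} - insert u {w. E u w \<and> E x w}" by auto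
  moreover have "card ({w. E x w} - insert u {w. E u w \<and> E x w}) =
      card {w. E x w} - card (insert u {w. E u w \<and> E x w})"
    by (rule card_Diff_subset) (use u E_sym in auto)
  ultimately show ?thesis using card_nbrs[of x] card_adj[OF u] E_V[OF u] E_irrefl by simp
qed

text \<open>Double count of the edges between the neighbours and the non-neighbours of one vertex
  \<open>u\<close>: each neighbour sends \<open>k - 1 - l\<close>, each non-neighbour receives
  \<open>m\<close>.\<close>

lemma parameter_identity: "k * (k - 1 - l) = m * (card V - 1 - k)"
proof -
  obtain u where u: "u \<in> V" using V_nonempty by blast
  define W where "W = {w \<in> V. w \<noteq> u \<and> \<not> E u w}"
  have "(\<Sum>x\<in>{w. E u w}. card {w \<in> W. E x w}) = (\<Sum>w\<in>W. card {x \<in> {w. E u w}. E x w})"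
    by (rule double_count) (use finite_V in \<open>auto simp: W_def\<close>)
  moreover have "(\<Sum>x\<in>{w. E u w}. card {w \<in> W. E x w}) = (\<Sum>x\<in>{w. E u w}. k - 1 - l)"
  proof (rule sum.cong[OF refl])
    fix x assume "x \<in> {w. E u w}"
    then have "card {w. E x w \<and> w \<noteq> u \<and> \<not> E u w} = k - 1 - l" by (simp add: card_nbr_diff)
    moreover have "{w \<in> W. E x w} = {w. E x w \<and> w \<noteq> u \<and> \<not> E u w}" using E_V by (auto simp: W_def)
    ultimately show "card {w \<in> W. E x w} = k - 1 - l" by simp
  qed
  moreover have "(\<Sum>w\<in>W. card {x \<in> {w. E u w}. E x w}) = (\<Sum>w\<in>W. m)"
  proof (rule sum.cong[OF refl])
    fix w assume w: "w \<in> W"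
    have "{x \<in> {w. E u w}. E x w} = {x. E u x \<and> E w x}" using E_sym by blast
    then show "card {x \<in> {w. E u w}. E x w} = m" using card_nonadj[of u w] w u by (auto simp: W_def)
  qed
  moreover have "card W = card V - 1 - k" unfolding W_def by (rule card_nonnbrs[OF u])
  ultimately show ?thesis using card_nbrs[OF u] by simp
qed

lemma card_common:
  assumes "x \<in> V" "y \<in> V"
  shows "card {w. E x w \<and> E y w} = (if x = y then k else if E x y then l else m)"
  using assms card_nbrs card_adj card_nonadj by auto

end

section \<open>Eigenvalues\<close>

context sr_graph
begin

text \<open>Entries of 0-1 matrices: \<open>ind (E x y)\<close> is the adjacency matrix
  \<open>A\<close>, \<open>ind (x = y)\<close> the identity \<open>I\<close>.\<close>

definition ind :: "bool \<Rightarrow> 'b::comm_ring_1" where "ind P = (if P then 1 else 0)"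

lemma sum_nbrs_eq: "(\<Sum>w | E u w. f w) = (\<Sum>w\<in>V. ind (E u w) * (f w :: 'b :: comm_ring_1))"
proof -
  have "(\<Sum>w\<in>V. ind (E u w) * f w) = (\<Sum>w\<in>V. if E u w then f w else 0)"
    by (intro sum.cong refl) (simp add: ind_def)
  also have "\<dots> = (\<Sum>w\<in>{w\<in>V. E u w}. f w)"
    using finite_V by (simp add: sum.If_cases Int_def)
  also have "{w\<in>V. E u w} = {w. E u w}" using E_V by blast
  finally show ?thesis by simp
qed

text \<open>Entrywise form of \<open>A^2 = (k - m) I + (l - m) A + m J\<close>, the source of the
  spectral facts below.\<close>

lemma sum_common:
  assumes "x \<in> V" "y \<in> V"
  shows "(\<Sum>w\<in>V. ind (E x w) * ind (E w y)) =
    (of_nat k - of_nat m) * ind (x = y) + (of_nat l - of_nat m) * ind (E x y) + (of_nat m :: 'b :: comm_ring_1)"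
proof -
  have "(\<Sum>w\<in>V. ind (E x w) * ind (E w y)) = (\<Sum>w\<in>V. if E x w \<and> E y w then 1 else 0 :: 'b)"
    by (intro sum.cong refl) (auto simp: ind_def E_sym_iff)
  also have "\<dots> = of_nat (card {w\<in>V. E x w \<and> E y w})"
    using finite_V by (simp add: sum.If_cases Int_def)
  also have "{w\<in>V. E x w \<and> E y w} = {w. E x w \<and> E y w}" using E_V by blast
  finally show ?thesis using card_common[OF assms] E_irrefl by (auto simp: ind_def)
qed

lemma sum_deg: "x \<in> V \<Longrightarrow> (\<Sum>w\<in>V. ind (E x w)) = (of_nat k :: 'b :: comm_ring_1)"
proof -
  assume x: "x \<in> V"
  have "(\<Sum>w\<in>V. ind (E x w)) = (\<Sum>w | E x w. 1 :: 'b)" unfolding sum_nbrs_eq by simp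
  then show ?thesis using card_nbrs[OF x] by simp
qed

lemma sum_delta: "x \<in> V \<Longrightarrow> (\<Sum>w\<in>V. ind (x = w) * f w) = (f x :: 'b :: comm_ring_1)"
  "x \<in> V \<Longrightarrow> (\<Sum>w\<in>V. ind (w = x) * f w) = f x"
  "x \<in> V \<Longrightarrow> (\<Sum>w\<in>V. f w * ind (x = w)) = f x"
  "x \<in> V \<Longrightarrow> (\<Sum>w\<in>V. f w * ind (w = x)) = f x"
proof -
  assume x: "x \<in> V"
  have *: "(\<Sum>w\<in>V. if x = w then f w else 0) = f x" using x finite_V by simp
  have "(\<Sum>w\<in>V. ind (x = w) * f w) = (\<Sum>w\<in>V. if x = w then f w else 0)"
    by (intro sum.cong refl) (simp add: ind_def)
  with * show "(\<Sum>w\<in>V. ind (x = w) * f w) = f x" by simp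
  then show "(\<Sum>w\<in>V. ind (w = x) * f w) = f x" "(\<Sum>w\<in>V. f w * ind (x = w)) = f x"
    "(\<Sum>w\<in>V. f w * ind (w = x)) = f x" by (simp_all add: mult.commute eq_commute[of _ x])
qed

abbreviation "rk \<equiv> real k" abbreviation "rl \<equiv> real l" abbreviation "rm \<equiv> real m"

text \<open>The right-hand side is the polynomial \<open>x^2 - (l - m) x - (k - m)\<close> at
  \<open>x = k\<close>, so \<open>m v = (k - r) (k - s)\<close> for its roots \<open>r\<close>,
  \<open>s\<close>.\<close>

lemma parameter_identity_real: "rm * real (card V) = rk * rk - (rl - rm) * rk - (rk - rm)"
proof -
  have "rk * real (k - 1 - l) = rm * real (card V - 1 - k)" using parameter_identity by (metis of_nat_mult)
  moreover have "real (k - 1 - l) = rk - 1 - rl" "real (card V - 1 - k) = real (card V) - 1 - rk"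
    using l_less k_less by (simp_all add: of_nat_diff)
  ultimately have "rk * (rk - 1 - rl) = rm * (real (card V) - 1 - rk)" by metis
  then show ?thesis by (simp add: algebra_simps)
qed

text \<open>An eigenvector for \<open>\<theta> \<noteq> k\<close> sums to zero, because all column
  sums of the matrix are \<open>k\<close>; then the \<open>J\<close> term of \<open>A^2\<close>
  vanishes on it and the quadratic equation remains.\<close>

lemma eigenvalue_root:
  assumes f: "u \<in> V" "f u \<noteq> 0" "\<And>x. x \<in> V \<Longrightarrow> (\<Sum>w | E x w. f w) = \<theta> * f x"
  shows "\<theta> = rk \<or> \<theta> * \<theta> - (rl - rm) * \<theta> - (rk - rm) = 0"
proof (cases "\<theta> = rk")
  case False
  have "\<theta> * (\<Sum>x\<in>V. f x) = (\<Sum>x\<in>V. \<Sum>w\<in>V. ind (E x w) * f w)"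
    unfolding sum_distrib_left using f(3) by (intro sum.cong refl) (simp add: sum_nbrs_eq)
  also have "\<dots> = (\<Sum>w\<in>V. \<Sum>x\<in>V. ind (E x w) * f w)" by (rule sum.swap)
  also have "\<dots> = (\<Sum>w\<in>V. rk * f w)"
  proof (intro sum.cong refl)
    fix w assume "w \<in> V"
    then show "(\<Sum>x\<in>V. ind (E x w) * f w) = rk * f w"
      using sum_deg[of w, where 'b = real] E_sym_iff by (simp flip: sum_distrib_right)
  qed
  finally have "\<theta> * (\<Sum>x\<in>V. f x) = rk * (\<Sum>x\<in>V. f x)" by (simp add: sum_distrib_left)
  then have S: "(\<Sum>x\<in>V. f x) = 0" using False by simp
  have "\<theta> * (\<theta> * f u) = \<theta> * (\<Sum>w\<in>V. ind (E u w) * f w)" using f(3)[OF f(1)] by (simp add: sum_nbrs_eq)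
  also have "\<dots> = (\<Sum>w\<in>V. ind (E u w) * (\<theta> * f w))" by (simp add: sum_distrib_left mult.left_commute)
  also have "\<dots> = (\<Sum>w\<in>V. ind (E u w) * (\<Sum>x\<in>V. ind (E w x) * f x))"
    using f(3) by (intro sum.cong refl) (simp add: sum_nbrs_eq)
  also have "\<dots> = (\<Sum>w\<in>V. \<Sum>x\<in>V. ind (E u w) * ind (E w x) * f x)"
    by (simp add: sum_distrib_left mult.assoc)
  also have "\<dots> = (\<Sum>x\<in>V. (\<Sum>w\<in>V. ind (E u w) * ind (E w x)) * f x)"
    by (subst sum.swap) (simp add: sum_distrib_right)
  also have "\<dots> = (\<Sum>x\<in>V. (rk - rm) * (ind (u = x) * f x) + (rl - rm) * (ind (E u x) * f x) + rm * f x)"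
    by (intro sum.cong refl) (simp add: sum_common[OF f(1)] distrib_right mult.assoc)
  also have "\<dots> = (rk - rm) * f u + (rl - rm) * (\<theta> * f u)"
    using f(3)[OF f(1)] S by (simp add: sum.distrib sum_nbrs_eq f(1) sum_delta flip: sum_distrib_left)
  finally have "f u * (\<theta> * \<theta> - (rl - rm) * \<theta> - (rk - rm)) = 0" by (simp add: algebra_simps)
  with f(2) show ?thesis by simp
qed simp

text \<open>\<open>(A - s I) (A - r I) = m J\<close> annihilates \<open>e_u - e_w\<close>, so
  \<open>f = (A - r I) (e_u - e_w)\<close> belongs to the eigenvalue \<open>s\<close>. For adjacent
  \<open>u\<close>, \<open>w\<close> its value at \<open>u\<close> is \<open>-1 - r\<close>, which
  is nonzero as \<open>r \<ge> 0\<close>.\<close>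

lemma smaller_root_is_eigenvalue:
  assumes "r + s = rl - rm" "r * s = - (rk - rm)" "r \<ge> 0"
  shows "\<exists>f. (\<exists>u\<in>V. f u \<noteq> 0) \<and> (\<forall>u\<in>V. (\<Sum>w | E u w. f w) = s * f u)"
proof -
  obtain u w where uw: "E u w" using path by blast
  then have V: "u \<in> V" "w \<in> V" "u \<noteq> w" using E_V E_irrefl by blast+
  define f :: "'a \<Rightarrow> real" where
    "f x = ind (E x u) - ind (E x w) - r * (ind (x = u) - ind (x = w))" for x
  have "f u \<noteq> 0" using assms(3) V uw E_irrefl by (simp add: f_def ind_def)
  moreover have "(\<Sum>x | E y x. f x) = s * f y" if y: "y \<in> V" for y
  proof -
    have "(\<Sum>x | E y x. f x) = (\<Sum>x\<in>V. ind (E y x) * ind (E x u)) - (\<Sum>x\<in>V. ind (E y x) * ind (E x w))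
       - r * ((\<Sum>x\<in>V. ind (E y x) * ind (x = u)) - (\<Sum>x\<in>V. ind (E y x) * ind (x = w)))"
      unfolding sum_nbrs_eq f_def
      by (simp add: right_diff_distrib sum_subtractf sum_distrib_left mult.left_commute)
    also have "\<dots> = (rk - rm) * (ind (y = u) - ind (y = w)) + (rl - rm - r) * (ind (E y u) - ind (E y w))"
      unfolding sum_common[OF y V(1)] sum_common[OF y V(2)] sum_delta(4)[OF V(1)] sum_delta(4)[OF V(2)]
      by (simp add: algebra_simps)
    also have "\<dots> = s * f y"
    proof -
      have "rl - rm - r = s" "rk - rm = - (r * s)" using assms by simp_all
      note eq = this
      show ?thesis unfolding f_def eq by (simp add: algebra_simps)
    qed
    finally show ?thesis .
  qed
  ultimately show ?thesis using V by blast
qed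

end

text \<open>The trace is a similarity invariant, so it can be read off a triangular form; the
  diagonal entries there are eigenvalues, and those of an idempotent are 0 or 1.\<close>

lemma idempotent_trace_nat:
  fixes e :: "'a \<Rightarrow> 'a \<Rightarrow> complex"
  assumes "finite V" "\<And>x y. x \<in> V \<Longrightarrow> y \<in> V \<Longrightarrow> (\<Sum>w\<in>V. e x w * e w y) = e x y"
  shows "\<exists>f::nat. (\<Sum>x\<in>V. e x x) = of_nat f"
proof -
  obtain h where h: "bij_betw h {0..<card V} V" using ex_bij_betw_nat_finite[OF assms(1)] by blast
  define n where "n = card V"
  have h: "bij_betw h {0..<n} V" using h by (simp add: n_def)
  have hV: "i < n \<Longrightarrow> h i \<in> V" for i using h by (auto simp: bij_betw_def)
  define A where "A = mat n n (\<lambda>(i, j). e (h i) (h j))"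
  have A: "A \<in> carrier_mat n n" by (simp add: A_def)
  have idem: "A * A = A"
  proof (rule eq_matI)
    fix i j assume ij: "i < dim_row A" "j < dim_col A"
    then have "(A * A) $$ (i, j) = (\<Sum>w = 0..<n. e (h i) (h w) * e (h w) (h j))"
      by (auto simp: A_def scalar_prod_def intro!: sum.cong)
    also have "\<dots> = (\<Sum>w\<in>V. e (h i) w * e w (h j))" by (rule sum.reindex_bij_betw[OF h])
    finally show "(A * A) $$ (i, j) = A $$ (i, j)" using ij assms(2) hV by (simp add: A_def)
  qed (simp_all add: A_def)
  obtain es where es: "char_poly A = (\<Prod>a\<leftarrow>es. [:- a, 1:])" using char_poly_factorized[OF A] by blast
  obtain B P Q where "schur_decomposition A es = (B, P, Q)" by (metis prod_cases3)
  from schur_decomposition[OF A es this]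
  have wit: "similar_mat_wit A B P Q" and diag: "diag_mat B = es" by auto
  note w = similar_mat_witD2[OF A wit]
  have tr: "(\<Sum>i = 0..<n. (M * Y) $$ (i, i)) = (\<Sum>i = 0..<n. (Y * M) $$ (i, i))"
    if "M \<in> carrier_mat n n" "Y \<in> carrier_mat n n" for M Y :: "complex mat"
  proof -
    have "(\<Sum>i = 0..<n. (M * Y) $$ (i, i)) = (\<Sum>i = 0..<n. \<Sum>j = 0..<n. M $$ (i, j) * Y $$ (j, i))"
      using that by (auto simp: scalar_prod_def intro!: sum.cong)
    also have "\<dots> = (\<Sum>j = 0..<n. \<Sum>i = 0..<n. Y $$ (j, i) * M $$ (i, j))"
      by (subst sum.swap) (simp add: mult.commute)
    also have "\<dots> = (\<Sum>i = 0..<n. (Y * M) $$ (i, i))"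
      using that by (auto simp: scalar_prod_def intro!: sum.cong)
    finally show ?thesis .
  qed
  have "(\<Sum>i = 0..<n. A $$ (i, i)) = (\<Sum>i = 0..<n. ((P * B) * Q) $$ (i, i))" using w(3) by simp
  also have "\<dots> = (\<Sum>i = 0..<n. (Q * (P * B)) $$ (i, i))" using w by (intro tr) auto
  also have "Q * (P * B) = B" using w by (simp flip: assoc_mult_mat[of Q n n P n B n])
  also have "(\<Sum>i = 0..<n. B $$ (i, i)) = sum_list es"
    using w(5) unfolding diag[symmetric] diag_mat_def by (simp add: interv_sum_list_conv_sum_set_nat)
  finally have trA: "(\<Sum>i = 0..<n. A $$ (i, i)) = sum_list es" .
  have es01: "a = 0 \<or> a = 1" if "a \<in> set es" for a
  proof -
    have "poly (char_poly A) a = 0" using that unfolding es by (simp add: poly_prod_list_zero_iff) 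
    then have "eigenvalue A a" using eigenvalue_root_char_poly[OF A] by simp
    then obtain v where v: "v \<in> carrier_vec n" "v \<noteq> 0\<^sub>v n" "A *\<^sub>v v = a \<cdot>\<^sub>v v"
      using A by (auto simp: eigenvalue_def eigenvector_def)
    have "a \<cdot>\<^sub>v v = (A * A) *\<^sub>v v" using v idem by simp
    also have "\<dots> = A *\<^sub>v (a \<cdot>\<^sub>v v)" using v A by (simp add: assoc_mult_mat_vec[of A n n A n])
    also have "\<dots> = a \<cdot>\<^sub>v (a \<cdot>\<^sub>v v)" using v A by (simp add: mult_mat_vec[of A n n])
    finally have eq: "a \<cdot>\<^sub>v v = a \<cdot>\<^sub>v (a \<cdot>\<^sub>v v)" .
    obtain i where i: "i < n" "v $ i \<noteq> 0" using v by (metis carrier_vecD eq_vecI index_zero_vec(1) index_zero_vec(2))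
    have "(a \<cdot>\<^sub>v v) $ i = (a \<cdot>\<^sub>v (a \<cdot>\<^sub>v v)) $ i" using eq by simp
    then have "a * v $ i = a * (a * v $ i)" using i v(1) by simp
    then show ?thesis using i(2) by auto
  qed
  have "\<exists>f::nat. sum_list es = of_nat f"
    using es01
  proof (induction es)
    case (Cons a es)
    then obtain f where "sum_list es = of_nat f" by auto
    moreover have "a = 0 \<or> a = 1" using Cons.prems by simp
    ultimately show ?case by (auto intro: exI[of _ f] exI[of _ "Suc f"])
  qed (auto intro: exI[of _ 0])
  moreover have "(\<Sum>i = 0..<n. A $$ (i, i)) = (\<Sum>i = 0..<n. e (h i) (h i))" by (simp add: A_def)
  moreover have "\<dots> = (\<Sum>x\<in>V. e x x)" by (rule sum.reindex_bij_betw[OF h])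
  ultimately show ?thesis using trA by simp
qed

text \<open>\<open>(A - s I - c J) / (r - s)\<close> is the projection onto the eigenspace of
  \<open>r\<close>, so its trace, the multiplicity \<open>f\<close>, is a natural number. The roots
  may be irrational, as they are for the pentagon.\<close>

lemma (in sr_graph) multiplicity_integral:
  assumes "r + s = rl - rm" "r * s = - (rk - rm)" "r \<noteq> s"
  shows "\<exists>f::nat. real f * (r - s) = - s * (real (card V) - 1) - rk"
proof -
  define v where "v = real (card V)"
  have vpos: "v \<noteq> 0" using V_nonempty finite_V by (simp add: v_def)
  \<comment> \<open>Chosen so that \<open>A - s I - c J\<close> kills the constant vector, on which
    \<open>A\<close> acts as \<open>k\<close> and \<open>J\<close> as \<open>v\<close>.\<close>
  define c where "c = (rk - s) / v"
  define g where "g x y = ind (E x y) - s * ind (x = y) - c" for x y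
  have par: "rm * v = (rk - s) * (rk - r)"
  proof -
    have "(rk - s) * (rk - r) = rk * rk - (r + s) * rk + r * s" by (simp add: algebra_simps)
    then show ?thesis using parameter_identity_real assms(1,2) by (simp add: v_def)
  qed
  have gg: "(\<Sum>w\<in>V. g x w * g w y) = (r - s) * g x y" if V: "x \<in> V" "y \<in> V" for x y
  proof -
    have "(\<Sum>w\<in>V. g x w * g w y) = (\<Sum>w\<in>V. ind (E x w) * ind (E w y) - s * (ind (E x w) * ind (w = y))
      - s * (ind (x = w) * ind (E w y)) - c * ind (E x w) - c * ind (E w y)
      + s * s * (ind (x = w) * ind (w = y)) + s * c * ind (x = w) + s * c * ind (w = y) + c * c)"
      unfolding g_def by (intro sum.cong refl) (simp add: algebra_simps)
    also have "\<dots> =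
      (\<Sum>w\<in>V. ind (E x w) * ind (E w y)) - s * (\<Sum>w\<in>V. ind (E x w) * ind (w = y))
      - s * (\<Sum>w\<in>V. ind (x = w) * ind (E w y)) - c * (\<Sum>w\<in>V. ind (E x w)) - c * (\<Sum>w\<in>V. ind (E w y))
      + s * s * (\<Sum>w\<in>V. ind (x = w) * ind (w = y))
      + s * c * (\<Sum>w\<in>V. ind (x = w)) + s * c * (\<Sum>w\<in>V. ind (w = y)) + v * (c * c)"
      unfolding v_def by (simp add: sum.distrib sum_subtractf sum_distrib_left)
    also have "(\<Sum>w\<in>V. ind (x = w)) = (1::real)" using sum_delta(1)[OF V(1), of "\<lambda>_. 1::real"] by simp
    also have "(\<Sum>w\<in>V. ind (w = y)) = (1::real)" using sum_delta(2)[OF V(2), of "\<lambda>_. 1::real"] by simp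
    also have "(\<Sum>w\<in>V. ind (E w y)) = rk" using sum_deg[OF V(2), where 'b = real] E_sym_iff by simp
    also have "(\<Sum>w\<in>V. ind (E x w)) = rk" using sum_deg[OF V(1), where 'b = real] .
    also have "v * (c * c) = c * (rk - s)" using vpos by (simp add: c_def)
    finally have "(\<Sum>w\<in>V. g x w * g w y) =
      (rk - rm) * ind (x = y) + (rl - rm) * ind (E x y) + rm - s * ind (E x y) - s * ind (E x y)
      - c * rk - c * rk + s * s * ind (x = y) + s * c * 1 + s * c * 1 + c * (rk - s)"
      using V by (simp add: sum_common sum_delta)
    moreover have "rm = c * (rk - r)" using par vpos by (simp add: c_def field_simps)
    moreover have "rk - rm = - (r * s)" "rl - rm = r + s" using assms by simp_all
    ultimately have "(\<Sum>w\<in>V. g x w * g w y) =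
      - (r * s) * ind (x = y) + (r + s) * ind (E x y) + c * (rk - r) - s * ind (E x y) - s * ind (E x y)
      - c * rk - c * rk + s * s * ind (x = y) + s * c * 1 + s * c * 1 + c * (rk - s)" by simp
    then show ?thesis by (simp add: g_def algebra_simps)
  qed
  define e where "e x y = complex_of_real (g x y / (r - s))" for x y
  have "(\<Sum>w\<in>V. e x w * e w y) = e x y" if V: "x \<in> V" "y \<in> V" for x y
  proof -
    have "(\<Sum>w\<in>V. e x w * e w y) = complex_of_real ((\<Sum>w\<in>V. g x w * g w y) / ((r - s) * (r - s)))"
      by (simp add: e_def sum_divide_distrib)
    then show ?thesis using gg[OF V] assms(3) by (simp add: e_def)
  qed
  then obtain f :: nat where "(\<Sum>x\<in>V. e x x) = of_nat f" using idempotent_trace_nat[OF finite_V] by metis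
  moreover have "(\<Sum>x\<in>V. e x x) = complex_of_real (\<Sum>x\<in>V. g x x / (r - s))" by (simp add: e_def)
  ultimately have "complex_of_real (\<Sum>x\<in>V. g x x / (r - s)) = complex_of_real (real f)" by simp
  then have "(\<Sum>x\<in>V. g x x / (r - s)) = real f" by (rule of_real_eq_iff[THEN iffD1])
  moreover have "(\<Sum>x\<in>V. g x x / (r - s)) = (\<Sum>x\<in>V. (- s - c) / (r - s))"
    by (intro sum.cong refl) (simp add: g_def ind_def E_irrefl)
  ultimately have "v * (- s - c) / (r - s) = real f" by (simp add: v_def)
  then have "real f * (r - s) = v * (- s - c)" using assms(3) by (simp add: field_simps)
  also have "\<dots> = - s * v - (rk - s)" using vpos by (simp add: c_def field_simps)
  finally show ?thesis by (auto simp: v_def algebra_simps)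
qed

section \<open>Local structure for least eigenvalue -2\<close>

lemma ex1_eq: "\<exists>!x. Q x \<Longrightarrow> Q a \<Longrightarrow> Q b \<Longrightarrow> a = b" by blast

context sr_graph
begin

text \<open>Adjacency in the complement of the local graph at \<open>u\<close>.\<close>

definition local_nonadj :: "'a \<Rightarrow> 'a \<Rightarrow> 'a \<Rightarrow> bool" where
  "local_nonadj u x y \<longleftrightarrow> E u x \<and> E u y \<and> x \<noteq> y \<and> \<not> E x y"

definition outer_common :: "'a \<Rightarrow> 'a \<Rightarrow> 'a \<Rightarrow> 'a set" where
  "outer_common u a b = {w. E a w \<and> E b w \<and> w \<noteq> u \<and> \<not> E u w}"

text \<open>For non-adjacent neighbours \<open>a\<close>, \<open>b\<close> of \<open>u\<close>,
  these vertices complete them to an induced claw with centre \<open>u\<close>.\<close>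

definition claw_tips :: "'a \<Rightarrow> 'a \<Rightarrow> 'a \<Rightarrow> 'a set" where
  "claw_tips u a b = {c. local_nonadj u a c \<and> local_nonadj u b c}"

lemma local_nonadj_sym: "local_nonadj u x y \<Longrightarrow> local_nonadj u y x"
  using E_sym by (auto simp: local_nonadj_def)

lemma finite_local_nonadj [simp]: "finite {y. local_nonadj u x y}"
  by (rule finite_subset[OF _ finite_nbrs[of u]]) (auto simp: local_nonadj_def)

lemma card_local_nonadj: "E u x \<Longrightarrow> card {y. local_nonadj u x y} = k - 1 - l"
proof -
  assume ux: "E u x"
  have "{y. local_nonadj u x y} = {w. E u w \<and> w \<noteq> x \<and> \<not> E x w}" using ux by (auto simp: local_nonadj_def)
  then show ?thesis using card_nbr_diff[OF E_sym[OF ux]] by simp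
qed

text \<open>The \<open>m\<close> common neighbours of \<open>a\<close> and \<open>b\<close> are
  \<open>u\<close>, those inside the neighbourhood of \<open>u\<close>, and the outer ones.
  Inclusion-exclusion for the local non-neighbours of \<open>a\<close> and of \<open>b\<close>,
  \<open>k - 1 - l\<close> each, supplies a second equation; eliminating the inner common neighbours
  gives the first claim.\<close>

lemma local_count:
  assumes ab: "local_nonadj u a b"
  shows "2 * l + 3 + card (claw_tips u a b) + card (outer_common u a b) = k + m"
    and "card {c. E u c \<and> E a c \<and> E b c} + 1 + card (outer_common u a b) = m"
proof -
  let ?F = "{c. E u c \<and> E a c \<and> E b c}" and ?O = "outer_common u a b"
  let ?A = "{y. local_nonadj u a y}" and ?B = "{y. local_nonadj u b y}"
  have uab: "E u a" "E u b" "a \<noteq> b" "\<not> E a b" using ab by (auto simp: local_nonadj_def)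
  have u: "E a u" "E b u" using uab E_sym by auto
  have finO: "finite ?O" unfolding outer_common_def by simp
  have finA: "finite ?A" "finite ?B" by simp_all
  have "card {w. E a w \<and> E b w} = m" using card_nonadj[of a b] uab E_V by blast
  moreover have "{w. E a w \<and> E b w} = insert u (?F \<union> ?O)" using u by (auto simp: outer_common_def)
  moreover have "card (insert u (?F \<union> ?O)) = Suc (card (?F \<union> ?O))"
    using finO E_irrefl by (subst card_insert_disjoint) (auto simp: outer_common_def)
  moreover have "card (?F \<union> ?O) = card ?F + card ?O"
    by (rule card_Un_disjoint) (use finO in \<open>auto simp: outer_common_def\<close>)
  ultimately show m: "card ?F + 1 + card ?O = m" by simp
  have "{w. E u w} = (?A \<union> ?B) \<union> ?F"
    using uab E_sym by (auto simp: local_nonadj_def)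
  moreover have "card ((?A \<union> ?B) \<union> ?F) = card (?A \<union> ?B) + card ?F"
    by (rule card_Un_disjoint) (use finA in \<open>auto simp: local_nonadj_def\<close>)
  moreover have "?A \<inter> ?B = claw_tips u a b" by (auto simp: claw_tips_def)
  then have "card ?A + card ?B = card (?A \<union> ?B) + card (claw_tips u a b)"
    using card_Un_Int[OF finA] by simp
  moreover have "card {w. E u w} = k" using card_nbrs uab(1) E_V by blast
  moreover have "card ?A = k - 1 - l" "card ?B = k - 1 - l" using card_local_nonadj uab by auto
  ultimately have "k + card (claw_tips u a b) = 2 * (k - 1 - l) + card ?F" by simp
  then show "2 * l + 3 + card (claw_tips u a b) + card ?O = k + m" using m l_less by linarith
qed

lemma exists_local_nonadj: "\<exists>u a b. local_nonadj u a b"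
proof -
  obtain x y z where p: "E x y" "E y z" "x \<noteq> z" "\<not> E x z" using path by blast
  then have "local_nonadj y x z" using E_sym by (auto simp: local_nonadj_def)
  then show ?thesis by blast
qed

lemma local_nonadj_ex: "E u x \<Longrightarrow> \<exists>y. local_nonadj u x y"
proof -
  assume "E u x"
  then have "card {y. local_nonadj u x y} > 0" using card_local_nonadj l_less by simp
  then show ?thesis by (metis (no_types, lifting) Collect_empty_eq card.empty less_numeral_extra(3))
qed

end

text \<open>The eigenvalues other than \<open>k\<close> are \<open>r\<close> and \<open>-2\<close>:
  the two equations are \<open>r (-2) = -(k - m)\<close> and \<open>r + (-2) = l - m\<close>,
  written without subtraction.\<close>

locale sr_minus2 = sr_graph V E k l m for V :: "'a set" and E k l m +
  fixes r :: nat
  assumes r_pos: "r \<ge> 1" and k_eq: "k = m + 2 * r" and l_eq: "l + 2 = m + r"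
begin

lemma card_local_nonadj_r: "E u x \<Longrightarrow> card {y. local_nonadj u x y} = r + 1"
  using card_local_nonadj k_eq l_eq r_pos by simp

text \<open>Here \<open>k + m\<close> exceeds the lower bound \<open>2 l + 3\<close> of
  \<open>local_count\<close> by exactly one, and this one unit is either a claw or an outer common
  neighbour.\<close>

lemma claw_or_quadrangle:
  "local_nonadj u a b \<Longrightarrow> card (claw_tips u a b) + card (outer_common u a b) = 1"
  using local_count(1)[of u a b] k_eq l_eq by simp

lemma outer_common_unique:
  assumes "local_nonadj u a b" "w \<in> outer_common u a b" "w' \<in> outer_common u a b"
  shows "w = w'"
proof -
  have "finite (outer_common u a b)" by (simp add: outer_common_def)
  moreover have "card (outer_common u a b) \<le> Suc 0" using claw_or_quadrangle[OF assms(1)] by simp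
  ultimately show ?thesis using assms(2,3) card_le_Suc0_iff_eq by metis
qed

lemma finite_claw_tips: "finite (claw_tips u a b)"
  by (rule finite_subset[OF _ finite_local_nonadj[of u a]]) (auto simp: claw_tips_def)

lemma claw_tips_unique:
  assumes "local_nonadj u a b" "w \<in> claw_tips u a b" "w' \<in> claw_tips u a b"
  shows "w = w'"
proof -
  have "card (claw_tips u a b) \<le> Suc 0" using claw_or_quadrangle[OF assms(1)] by simp
  then show ?thesis using assms(2,3) card_le_Suc0_iff_eq[OF finite_claw_tips] by metis
qed

text \<open>Seen from \<open>z\<close>, both \<open>x\<close> and \<open>y\<close> are outer common
  neighbours of the non-adjacent pair \<open>a\<close>, \<open>b\<close>.\<close>

lemma far_nonadj_unique:
  assumes "local_nonadj u a b" "E u z" "E a z" "E b z" "E a x" "E b x" "E a y" "E b y"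
    "x \<noteq> z" "\<not> E z x" "y \<noteq> z" "\<not> E z y"
  shows "x = y"
proof (rule outer_common_unique)
  show "local_nonadj z a b" using assms E_sym by (auto simp: local_nonadj_def)
  show "x \<in> outer_common z a b" "y \<in> outer_common z a b" using assms by (auto simp: outer_common_def)
qed

definition claw_free :: bool where
  "claw_free \<longleftrightarrow> (\<forall>u a b. local_nonadj u a b \<longrightarrow> claw_tips u a b = {})"

text \<open>The partner of \<open>z\<close> is the outer common neighbour \<open>w\<close> of
  \<open>a\<close>, \<open>b\<close> as seen from \<open>z\<close>; absence of claws guarantees that
  it exists.\<close>

lemma claw_free_far_match:
  assumes cf: claw_free and ab: "local_nonadj u a b" and z: "E u z" "E a z" "E b z"
  shows "\<exists>!z'. E u z' \<and> E a z' \<and> E b z' \<and> local_nonadj u z z'"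
proof -
  have ab': "E u a" "E u b" "a \<noteq> b" "\<not> E a b" using ab by (auto simp: local_nonadj_def)
  have O1: "card (outer_common w a b) = 1" if "E w a" "E w b" for w
  proof -
    have "local_nonadj w a b" using that ab' by (simp add: local_nonadj_def)
    then show ?thesis using claw_or_quadrangle[of w a b] cf by (simp add: claw_free_def)
  qed
  have za: "E z a" "E z b" using z E_sym by auto
  obtain w where w: "outer_common z a b = {w}" using O1[OF za] card_1_singletonE by blast
  then have w': "E a w" "E b w" "w \<noteq> z" "\<not> E z w" by (auto simp: outer_common_def)
  \<comment> \<open>Otherwise \<open>u\<close> and \<open>z\<close> would be two outer common
    neighbours of \<open>a\<close>, \<open>b\<close> as seen from \<open>w\<close>.\<close>
  have uw: "E u w"
  proof (rule ccontr)
    assume n: "\<not> E u w"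
    have wa: "E w a" "E w b" using w' E_sym by auto
    obtain x where x: "outer_common w a b = {x}" using O1[OF wa] card_1_singletonE by blast
    have "w \<noteq> u" using w' z E_sym by blast
    then have "u \<in> outer_common w a b" "z \<in> outer_common w a b"
      using n w' z ab' E_sym by (auto simp: outer_common_def)
    then have "u = z" unfolding x by simp
    then show False using z E_irrefl by blast
  qed
  show ?thesis
  proof (rule ex1I[of _ w])
    show "E u w \<and> E a w \<and> E b w \<and> local_nonadj u z w" using uw w' z by (auto simp: local_nonadj_def)
    fix y assume "E u y \<and> E a y \<and> E b y \<and> local_nonadj u z y"
    then have "y \<in> outer_common z a b" by (auto simp: outer_common_def local_nonadj_def)
    then show "y = w" unfolding w by simp
  qed
qed

end

text \<open>Abstracts the complement of the local graph at a vertex of a claw-free graph: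
  \<open>P\<close> is the neighbourhood, \<open>D\<close> non-adjacency inside it. Triangles of
  \<open>D\<close> would be claws; \<open>far_ex1\<close> says that the vertices joined by
  \<open>D\<close> to neither end of an edge are perfectly matched by \<open>D\<close>.\<close>

locale far_matching =
  fixes P :: "'a set" and D :: "'a \<Rightarrow> 'a \<Rightarrow> bool" and r :: nat
  assumes finite_P: "finite P"
    and D_P: "D x y \<Longrightarrow> x \<in> P \<and> y \<in> P"
    and D_sym: "D x y \<Longrightarrow> D y x"
    and D_irrefl: "\<not> D x x"
    and triangle_free: "D x y \<Longrightarrow> D y z \<Longrightarrow> \<not> D x z"
    and degree: "x \<in> P \<Longrightarrow> card {y. D x y} = r + 1"
    and r_pos: "r \<ge> 1"
    and far_ex1: "D a b \<Longrightarrow> z \<in> P \<Longrightarrow> \<not> D a z \<Longrightarrow> \<not> D b z \<Longrightarrow>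
      \<exists>!z'. z' \<in> P \<and> \<not> D a z' \<and> \<not> D b z' \<and> D z z'"
begin

lemma finite_D [simp]: "finite {y. D x y \<and> Q y}" "finite {y. D x y}"
  by (rule finite_subset[OF _ finite_P], use D_P in blast)+

definition far :: "'a \<Rightarrow> 'a \<Rightarrow> 'a set" where "far a b = {z \<in> P. \<not> D a z \<and> \<not> D b z}"

lemma far_sym: "far a b = far b a" by (auto simp: far_def)

lemma finite_far [simp]: "finite (far a b)" using finite_P by (simp add: far_def)

lemma card_split: "finite {y. Q y} \<Longrightarrow> card {y. Q y} = card {y. Q y \<and> R y} + card {y. Q y \<and> \<not> R y}"
proof -
  assume f: "finite {y. Q y}"
  have "{y. Q y} = {y. Q y \<and> R y} \<union> {y. Q y \<and> \<not> R y}" by auto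
  then have "card {y. Q y} = card ({y. Q y \<and> R y} \<union> {y. Q y \<and> \<not> R y})" by (rule arg_cong)
  also have "card ({y. Q y \<and> R y} \<union> {y. Q y \<and> \<not> R y}) = card {y. Q y \<and> R y} + card {y. Q y \<and> \<not> R y}"
  proof (rule card_Un_disjoint)
    show "finite {y. Q y \<and> R y}" "finite {y. Q y \<and> \<not> R y}" by (rule finite_subset[OF _ f], blast)+
  qed blast
  finally show ?thesis .
qed

lemma card_other: "D a b \<Longrightarrow> card {y. D a y \<and> y \<noteq> b} = r"
proof -
  assume ab: "D a b"
  have "{y. D a y \<and> y \<noteq> b} = {y. D a y} - {b}" by auto
  then show ?thesis using ab degree[of a] D_P[OF ab] by simp
qed

lemma card_far: "D a b \<Longrightarrow> card P = 2 * (r + 1) + card (far a b)"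
proof -
  assume ab: "D a b"
  have 1: "P = ({y. D a y} \<union> {y. D b y}) \<union> far a b" using D_P by (auto simp: far_def)
  have "card (({y. D a y} \<union> {y. D b y}) \<union> far a b) = card ({y. D a y} \<union> {y. D b y}) + card (far a b)"
    by (rule card_Un_disjoint) (use finite_P in \<open>auto simp: far_def\<close>)
  moreover have "card ({y. D a y} \<union> {y. D b y}) = card {y. D a y} + card {y. D b y}"
    by (rule card_Un_disjoint) (use triangle_free[OF ab] in auto)
  ultimately have "card P = card {y. D a y} + card {y. D b y} + card (far a b)" using 1 by simp
  then show ?thesis using degree D_P[OF ab] by simp
qed

text \<open>A far vertex and its mate have disjoint neighbourhoods which together exhaust the
  \<open>2 r\<close> vertices at distance one from the edge.\<close>

lemma far_mate:
  assumes ab: "D a b" and z: "z \<in> far a b" "w \<in> far a b" "D z w" and x: "D b x" "x \<noteq> a"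
  shows "D x z \<longleftrightarrow> \<not> D x w"
proof -
  let ?S = "{y. D a y \<and> y \<noteq> b} \<union> {y. D b y \<and> y \<noteq> a}"
  have "card ?S = card {y. D a y \<and> y \<noteq> b} + card {y. D b y \<and> y \<noteq> a}"
    by (rule card_Un_disjoint) (use triangle_free[OF ab] in auto)
  then have S: "card ?S = 2 * r" using card_other[OF ab] card_other[OF D_sym[OF ab]] by simp
  have sub: "{y. D z' y \<and> y \<noteq> w'} \<subseteq> ?S" if "z' \<in> far a b" "w' \<in> far a b" "D z' w'" for z' w'
  proof
    fix y assume y: "y \<in> {y. D z' y \<and> y \<noteq> w'}"
    show "y \<in> ?S"
    proof (rule ccontr)
      assume n: "y \<notin> ?S"
      have "y \<noteq> a" "y \<noteq> b" using y that(1) D_sym by (auto simp: far_def)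
      then have "y \<in> P" "\<not> D a y" "\<not> D b y" using y D_P n by auto
      moreover have "\<exists>!y. y \<in> P \<and> \<not> D a y \<and> \<not> D b y \<and> D z' y"
        using far_ex1[OF ab, of z'] that by (auto simp: far_def)
      ultimately show False using y that by (auto simp: far_def)
    qed
  qed
  have disj: "{y. D z y \<and> y \<noteq> w} \<inter> {y. D w y \<and> y \<noteq> z} = {}"
    using triangle_free[OF z(3)] by auto
  have "card ({y. D z y \<and> y \<noteq> w} \<union> {y. D w y \<and> y \<noteq> z}) =
      card {y. D z y \<and> y \<noteq> w} + card {y. D w y \<and> y \<noteq> z}"
    by (rule card_Un_disjoint[OF _ _ disj]) auto
  then have "card ({y. D z y \<and> y \<noteq> w} \<union> {y. D w y \<and> y \<noteq> z}) = 2 * r"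
    using card_other[OF z(3)] card_other[OF D_sym[OF z(3)]] by simp
  moreover have "{y. D z y \<and> y \<noteq> w} \<union> {y. D w y \<and> y \<noteq> z} \<subseteq> ?S"
    using sub[OF z] sub[OF z(2,1) D_sym[OF z(3)]] by blast
  ultimately have eq: "{y. D z y \<and> y \<noteq> w} \<union> {y. D w y \<and> y \<noteq> z} = ?S"
    using S by (intro card_subset_eq) auto
  have "x \<in> ?S" using x by blast
  then have "D z x \<or> D w x" using eq by blast
  then show ?thesis using triangle_free[OF z(3)] D_sym by blast
qed

lemma mate_ex1: "D a b \<Longrightarrow> z \<in> far a b \<Longrightarrow> \<exists>!w. w \<in> far a b \<and> D z w"
  using far_ex1[of a b z] unfolding far_def by simp

text \<open>Mates disagree about \<open>x\<close> by \<open>far_mate\<close>, so taking mates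
  exchanges the far neighbours of \<open>x\<close> with the other far vertices.\<close>

lemma card_far_nbrs:
  assumes ab: "D a b" and x: "D b x" "x \<noteq> a"
  shows "card (far a b) = 2 * card {z \<in> far a b. D x z}"
proof -
  define mt where "mt z = (THE w. w \<in> far a b \<and> D z w)" for z
  have mt: "mt z \<in> far a b" "D z (mt z)" if "z \<in> far a b" for z
    using theI'[OF mate_ex1[OF ab that]] by (auto simp: mt_def)
  have mtmt: "mt (mt z) = z" if "z \<in> far a b" for z
    using mate_ex1[OF ab mt(1)[OF that]] mt[OF mt(1)[OF that]] mt(2)[OF that] that D_sym by blast
  have "bij_betw mt {z \<in> far a b. D x z} {z \<in> far a b. \<not> D x z}"
  proof (rule bij_betw_byWitness[where f' = mt])
    show "\<forall>z\<in>{z \<in> far a b. D x z}. mt (mt z) = z" "\<forall>z\<in>{z \<in> far a b. \<not> D x z}. mt (mt z) = z"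
      using mtmt by auto
    show "mt ` {z \<in> far a b. D x z} \<subseteq> {z \<in> far a b. \<not> D x z}"
      using mt far_mate[OF ab _ _ _ x] by auto
    show "mt ` {z \<in> far a b. \<not> D x z} \<subseteq> {z \<in> far a b. D x z}"
      using mt far_mate[OF ab _ _ _ x] by auto
  qed
  then have "card {z \<in> far a b. D x z} = card {z \<in> far a b. \<not> D x z}" by (rule bij_betw_same_card)
  moreover have "card (far a b) = card {z \<in> far a b. D x z} + card {z \<in> far a b. \<not> D x z}"
    using card_split[of "\<lambda>z. z \<in> far a b" "\<lambda>z. D x z"] by simp
  ultimately show ?thesis by simp
qed

lemma card_side_nbrs:
  assumes ab: "D a b" and x: "D b x" "x \<noteq> a"
  shows "card {z \<in> far a b. D x z} + card {y. D a y \<and> y \<noteq> b \<and> D x y} = r"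
proof -
  have "{y. D x y \<and> y \<noteq> b} = {z \<in> far a b. D x z} \<union> {y. D a y \<and> y \<noteq> b \<and> D x y}"
  proof (intro equalityI subsetI)
    fix y assume y: "y \<in> {y. D x y \<and> y \<noteq> b}"
    then have "\<not> D b y" using triangle_free[OF x(1)] by blast
    then show "y \<in> {z \<in> far a b. D x z} \<union> {y. D a y \<and> y \<noteq> b \<and> D x y}"
      using y D_P by (auto simp: far_def)
  next
    fix y assume "y \<in> {z \<in> far a b. D x z} \<union> {y. D a y \<and> y \<noteq> b \<and> D x y}"
    then show "y \<in> {y. D x y \<and> y \<noteq> b}" using ab by (auto simp: far_def)
  qed
  moreover have "card ({z \<in> far a b. D x z} \<union> {y. D a y \<and> y \<noteq> b \<and> D x y}) =
      card {z \<in> far a b. D x z} + card {y. D a y \<and> y \<noteq> b \<and> D x y}"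
    by (rule card_Un_disjoint) (use finite_P in \<open>auto simp: far_def\<close>)
  ultimately show ?thesis using card_other[OF D_sym[OF x(1)]] by simp
qed

text \<open>\<open>far_ex1\<close> is applied to the edge \<open>x z\<close> and the vertex
  \<open>a\<close>: exactly one neighbour of \<open>a\<close> is joined to neither \<open>x\<close>
  nor \<open>z\<close>, and the remaining \<open>r - 1\<close> besides \<open>b\<close> are divided
  between \<open>x\<close> and \<open>z\<close>.\<close>

lemma card_far_side:
  assumes ab: "D a b" and x: "D b x" "x \<noteq> a" and z: "z \<in> far a b" "D x z"
    and mm: "card (far a b) = 2 * mm"
  shows "card {y. D a y \<and> y \<noteq> b \<and> D z y} + 1 = mm"
proof -
  have cx: "card {z \<in> far a b. D x z} = mm" using card_far_nbrs[OF ab x] mm by simp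
  have "\<not> D x a" using triangle_free[OF D_sym[OF x(1)] D_sym[OF ab]] .
  moreover have "\<not> D z a" using z D_sym by (auto simp: far_def)
  ultimately have "\<exists>!y. y \<in> P \<and> \<not> D x y \<and> \<not> D z y \<and> D a y"
    using far_ex1[OF z(2), of a] D_P[OF ab] by blast
  note ex1 = this
  then obtain y where y: "y \<in> P \<and> \<not> D x y \<and> \<not> D z y \<and> D a y" by blast
  have uy: "y' = y" if "y' \<in> P \<and> \<not> D x y' \<and> \<not> D z y' \<and> D a y'" for y'
    by (rule ex1_eq[OF ex1 that y])
  have yb: "y \<noteq> b" using y x D_sym by blast
  have "{y. D a y \<and> y \<noteq> b} = insert y ({y. D a y \<and> y \<noteq> b \<and> D x y} \<union> {y. D a y \<and> y \<noteq> b \<and> D z y})"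
    using y yb uy D_P by blast
  moreover have "card (insert y ({y. D a y \<and> y \<noteq> b \<and> D x y} \<union> {y. D a y \<and> y \<noteq> b \<and> D z y})) =
      Suc (card ({y. D a y \<and> y \<noteq> b \<and> D x y} \<union> {y. D a y \<and> y \<noteq> b \<and> D z y}))"
    by (rule card_insert_disjoint) (use y in auto)
  moreover have "card ({y. D a y \<and> y \<noteq> b \<and> D x y} \<union> {y. D a y \<and> y \<noteq> b \<and> D z y}) =
      card {y. D a y \<and> y \<noteq> b \<and> D x y} + card {y. D a y \<and> y \<noteq> b \<and> D z y}"
    by (rule card_Un_disjoint) (use triangle_free[OF z(2)] in auto)
  ultimately have "card {y. D a y \<and> y \<noteq> b \<and> D x y} + card {y. D a y \<and> y \<noteq> b \<and> D z y} + 1 = r"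
    using card_other[OF ab] by simp
  then show ?thesis using card_side_nbrs[OF ab x] cx by simp
qed

text \<open>The only far neighbour of \<open>z\<close> is its mate, so its other \<open>r\<close>
  neighbours lie beside \<open>a\<close> or beside \<open>b\<close>.\<close>

lemma card_far_sides:
  assumes ab: "D a b" and z: "z \<in> far a b"
  shows "card {y. D a y \<and> y \<noteq> b \<and> D z y} + card {x. D b x \<and> x \<noteq> a \<and> D z x} = r"
proof -
  obtain w where w: "w \<in> far a b" "D z w" using mate_ex1[OF ab z] by blast
  have "{y. D z y \<and> y \<noteq> w} = {y. D a y \<and> y \<noteq> b \<and> D z y} \<union> {x. D b x \<and> x \<noteq> a \<and> D z x}"
  proof (intro equalityI subsetI)
    fix y assume y: "y \<in> {y. D z y \<and> y \<noteq> w}"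
    have "\<not> (y \<in> far a b)" using y w mate_ex1[OF ab z] by blast
    moreover have "y \<noteq> a" "y \<noteq> b" using y z D_sym by (auto simp: far_def)
    ultimately show "y \<in> {y. D a y \<and> y \<noteq> b \<and> D z y} \<union> {x. D b x \<and> x \<noteq> a \<and> D z x}"
      using y D_P by (auto simp: far_def)
  next
    fix y assume "y \<in> {y. D a y \<and> y \<noteq> b \<and> D z y} \<union> {x. D b x \<and> x \<noteq> a \<and> D z x}"
    then show "y \<in> {y. D z y \<and> y \<noteq> w}" using w by (auto simp: far_def)
  qed
  moreover have "card ({y. D a y \<and> y \<noteq> b \<and> D z y} \<union> {x. D b x \<and> x \<noteq> a \<and> D z x}) =
     card {y. D a y \<and> y \<noteq> b \<and> D z y} + card {x. D b x \<and> x \<noteq> a \<and> D z x}"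
    by (rule card_Un_disjoint) (use triangle_free[OF ab] in auto)
  ultimately show ?thesis using card_other[OF w(2)] by simp
qed

lemma exists_other: "D a b \<Longrightarrow> \<exists>x. D b x \<and> x \<noteq> a"
proof -
  assume "D a b"
  then have "card {y. D b y \<and> y \<noteq> a} = r" using card_other D_sym by blast
  then have "{y. D b y \<and> y \<noteq> a} \<noteq> {}" using r_pos by (metis card.empty not_one_le_zero)
  then show ?thesis by blast
qed

text \<open>A far vertex that has neighbours on both sides has \<open>mm - 1\<close> on each, so
  \<open>r + 2 = 2 mm\<close>. With \<open>r \<le> mm + 1\<close> this leaves
  \<open>mm \<le> 3\<close>; the two solutions belong to the Clebsch and the Schlaefli
  graph.\<close>

lemma mm_ge_2:
  assumes ab: "D a b" and mm: "card (far a b) = 2 * mm" "mm \<ge> 2"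
  shows "(mm = 2 \<and> r = 2) \<or> (mm = 3 \<and> r = 4)"
proof -
  have ba: "D b a" using ab D_sym by blast
  have mm': "card (far b a) = 2 * mm" using mm far_sym by simp
  obtain x where x: "D b x" "x \<noteq> a" using exists_other[OF ab] by blast
  have Fx: "card {z \<in> far a b. D x z} = mm" if "D b x" "x \<noteq> a" for x
    using card_far_nbrs[OF ab that] mm by simp
  have Fy: "card {z \<in> far a b. D y z} = mm" if "D a y" "y \<noteq> b" for y
    using card_far_nbrs[OF ba that] mm far_sym by simp
  have Bx: "card {y. D a y \<and> y \<noteq> b \<and> D x y} + mm = r" if "D b x" "x \<noteq> a" for x
    using card_side_nbrs[OF ab that] Fx[OF that] by simp
  have Ay: "card {x. D b x \<and> x \<noteq> a \<and> D y x} + mm = r" if "D a y" "y \<noteq> b" for y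
    using card_side_nbrs[OF ba that] Fy[OF that] far_sym[of a b] by simp
  have "{z \<in> far a b. D x z} \<noteq> {}" using Fx[OF x] mm by (metis card.empty not_numeral_le_zero)
  then obtain z where z: "z \<in> far a b" "D x z" by blast
  have c1: "card {y. D a y \<and> y \<noteq> b \<and> D z y} + 1 = mm" by (rule card_far_side[OF ab x z mm(1)])
  then have "{y. D a y \<and> y \<noteq> b \<and> D z y} \<noteq> {}" using mm
    by (metis add_0 card.empty not_less_eq_eq numeral_2_eq_2 One_nat_def order_refl)
  then obtain y where y: "D a y" "y \<noteq> b" "D y z" using D_sym by blast
  have c2: "card {x. D b x \<and> x \<noteq> a \<and> D z x} + 1 = mm"
    using card_far_side[OF ba y(1,2) _ y(3) mm'] z far_sym by blast
  have r2: "r + 2 = 2 * mm" using c1 c2 card_far_sides[OF ab z(1)] by simp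
  \<comment> \<open>Otherwise all \<open>mm \<ge> 2\<close> far neighbours of \<open>y\<close> would
    be joined to neither end of the edge \<open>b x\<close>, where \<open>y\<close> has only one
    mate.\<close>
  have shared: "\<exists>z. z \<in> far a b \<and> D x z \<and> D y z" if xy: "D b x" "x \<noteq> a" "D a y" "y \<noteq> b" "\<not> D x y" for x y
  proof -
    have nby: "\<not> D b y" using triangle_free[OF ba xy(3)] .
    have ex1: "\<exists>!w. w \<in> P \<and> \<not> D b w \<and> \<not> D x w \<and> D y w"
      using far_ex1[OF xy(1), of y] nby xy(5) D_P[OF xy(3)] by blast
    then obtain w where w: "w \<in> P \<and> \<not> D b w \<and> \<not> D x w \<and> D y w" by blast
    have uw: "w' = w" if "w' \<in> P \<and> \<not> D b w' \<and> \<not> D x w' \<and> D y w'" for w'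
      by (rule ex1_eq[OF ex1 that w])
    show ?thesis
    proof (rule ccontr)
      assume n: "\<not> (\<exists>z. z \<in> far a b \<and> D x z \<and> D y z)"
      have "{z \<in> far a b. D y z} \<subseteq> {w}"
      proof
        fix z assume z: "z \<in> {z \<in> far a b. D y z}"
        then have "z \<in> P \<and> \<not> D b z \<and> \<not> D x z \<and> D y z" using n by (auto simp: far_def)
        then show "z \<in> {w}" using uw by blast
      qed
      then have "card {z \<in> far a b. D y z} \<le> card {w}" by (intro card_mono) auto
      then show False using Fy[OF xy(3,4)] mm by simp
    qed
  qed
  \<comment> \<open>The far neighbourhoods are disjoint, as there are no triangles, and each is one
    half of the far vertices.\<close>
  have compl: "{z \<in> far a b. D x z} = far a b - {z \<in> far a b. D y z}"
    if "D b x" "x \<noteq> a" "D a y" "y \<noteq> b" "D x y" for x y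
  proof -
    have "{z \<in> far a b. D x z} \<subseteq> far a b - {z \<in> far a b. D y z}"
      using triangle_free[OF that(5)] by auto
    moreover have "card (far a b - {z \<in> far a b. D y z}) = mm"
      using mm(1) Fy[OF that(3,4)] by (subst card_Diff_subset) auto
    ultimately show ?thesis using Fx[OF that(1,2)] by (intro card_subset_eq) auto
  qed
  \<comment> \<open>Otherwise \<open>x\<close> has a neighbour \<open>y\<close> beside
    \<open>a\<close>, and \<open>y\<close> a non-neighbour \<open>x'\<close> beside
    \<open>b\<close>. A neighbour \<open>y'\<close> of \<open>x'\<close> beside \<open>a\<close>
    cannot be joined to \<open>x\<close>: then \<open>x\<close> and \<open>x'\<close> would have the
    same far neighbours, by \<open>compl\<close>, and one shared by \<open>x'\<close> and
    \<open>y\<close> would close a triangle on \<open>x y\<close>. So every such \<open>y'\<close>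
    is the mate of \<open>x'\<close> off the edge \<open>x y\<close>, although there are
    \<open>r - mm > 1\<close> of them.\<close>
  have "r \<le> mm + 1"
  proof (rule ccontr)
    assume "\<not> r \<le> mm + 1"
    then have "card {y. D a y \<and> y \<noteq> b \<and> D x y} \<noteq> 0" using Bx[OF x] by linarith
    then have "{y. D a y \<and> y \<noteq> b \<and> D x y} \<noteq> {}" by (metis card.empty)
    then obtain y where y: "D a y" "y \<noteq> b" "D x y" by blast
    have "card {x. D b x \<and> x \<noteq> a} \<noteq> card {x. D b x \<and> x \<noteq> a \<and> D y x}"
      using Ay[OF y(1,2)] card_other[OF ba] mm(2) by linarith
    then have "{x. D b x \<and> x \<noteq> a} \<noteq> {x. D b x \<and> x \<noteq> a \<and> D y x}" by metis
    then obtain x' where x': "D b x'" "x' \<noteq> a" "\<not> D y x'" by blast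
    have nxx': "\<not> D x x'" using triangle_free[OF D_sym[OF x(1)] x'(1)] .
    have ex1: "\<exists>!w. w \<in> P \<and> \<not> D x w \<and> \<not> D y w \<and> D x' w"
      using far_ex1[OF y(3), of x'] nxx' x'(3) D_P[OF x'(1)] by blast
    then obtain w where w: "w \<in> P \<and> \<not> D x w \<and> \<not> D y w \<and> D x' w" by blast
    have uw: "w' = w" if "w' \<in> P \<and> \<not> D x w' \<and> \<not> D y w' \<and> D x' w'" for w'
      by (rule ex1_eq[OF ex1 that w])
    have "{y'. D a y' \<and> y' \<noteq> b \<and> D x' y'} \<subseteq> {w}"
    proof
      fix y' assume "y' \<in> {y'. D a y' \<and> y' \<noteq> b \<and> D x' y'}"
      then have y': "D a y'" "y' \<noteq> b" "D x' y'" by auto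
      have "\<not> D y y'" using triangle_free[OF D_sym[OF y(1)] y'(1)] .
      moreover have "\<not> D x y'"
      proof
        assume "D x y'"
        then have eq: "{z \<in> far a b. D x z} = {z \<in> far a b. D x' z}"
          using compl[OF x y'(1,2)] compl[OF x'(1,2) y'] by simp
        obtain z where "z \<in> far a b" "D x' z" "D y z"
          using shared[OF x'(1,2) y(1,2)] x'(3) D_sym by blast
        then have "D x z" using eq by blast
        then show False using triangle_free[OF y(3) \<open>D y z\<close>] by blast
      qed
      ultimately show "y' \<in> {w}" using uw D_P[OF y'(3)] y'(3) by blast
    qed
    then have "card {y'. D a y' \<and> y' \<noteq> b \<and> D x' y'} \<le> 1" using card_mono[of "{w}"] by fastforce
    then show False using Bx[OF x'(1,2)] \<open>\<not> r \<le> mm + 1\<close> by linarith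
  qed
  then show ?thesis using r2 mm(2) by presburger
qed

text \<open>Without far vertices \<open>D\<close> is the complete bipartite graph between the
  neighbours of \<open>a\<close> and those of \<open>b\<close>: a neighbourhood of the original
  graph is then two cliques with no edges between them.\<close>

lemma mm_eq_0:
  assumes ab: "D a b" and mm: "far a b = {}"
  shows "\<exists>L R. P = L \<union> R \<and> L \<inter> R = {} \<and> card L = r + 1 \<and> card R = r + 1 \<and>
    (\<forall>x\<in>L. \<forall>y\<in>L. \<not> D x y) \<and> (\<forall>x\<in>R. \<forall>y\<in>R. \<not> D x y) \<and> (\<forall>x\<in>L. \<forall>y\<in>R. D x y)"
proof (intro exI conjI)
  let ?L = "{y. D b y}" and ?R = "{y. D a y}"
  have ba: "D b a" using ab D_sym by blast
  show "P = ?L \<union> ?R" using mm D_P by (auto simp: far_def)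
  show "?L \<inter> ?R = {}" using triangle_free[OF ab] by auto
  show "card ?L = r + 1" "card ?R = r + 1" using degree D_P[OF ab] by auto
  show "\<forall>x\<in>?L. \<forall>y\<in>?L. \<not> D x y" using triangle_free D_sym by blast
  show "\<forall>x\<in>?R. \<forall>y\<in>?R. \<not> D x y" using triangle_free D_sym by blast
  show "\<forall>x\<in>?L. \<forall>y\<in>?R. D x y"
  proof (intro ballI)
    fix x y assume "x \<in> ?L" "y \<in> ?R"
    then have xy: "D b x" "D a y" by auto
    show "D x y"
    proof (cases "x = a \<or> y = b")
      case True
      then show ?thesis using xy D_sym by blast
    next
      case False
      then have "card {y. D a y \<and> y \<noteq> b \<and> D x y} = r" using card_side_nbrs[OF ab xy(1)] mm by simp
      moreover have "card {y. D a y \<and> y \<noteq> b} = r" by (rule card_other[OF ab])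
      ultimately have "{y. D a y \<and> y \<noteq> b \<and> D x y} = {y. D a y \<and> y \<noteq> b}"
        by (intro card_subset_eq) auto
      then show ?thesis using xy False by blast
    qed
  qed
qed

text \<open>The two far vertices join opposite sides. Since all degrees are \<open>r + 1\<close>,
  \<open>D\<close> is complete bipartite with parts of size \<open>r + 2\<close>, minus a perfect
  matching.\<close>

lemma mm_eq_1:
  assumes ab: "D a b" and mm: "card (far a b) = 2"
  shows "\<exists>L R. P = L \<union> R \<and> L \<inter> R = {} \<and> card L = r + 2 \<and> card R = r + 2 \<and>
    (\<forall>x\<in>L. \<forall>y\<in>L. \<not> D x y) \<and> (\<forall>x\<in>R. \<forall>y\<in>R. \<not> D x y)"
proof -
  \<comment> \<open>Of the two far vertices, \<open>c\<close> denotes the one that the chosen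
    \<open>x\<close> sees. By \<open>card_far_side\<close> it has no neighbour beside
    \<open>a\<close>, so it is joined to everything beside \<open>b\<close>.\<close>
  have *: ?thesis if ab: "D a b" and far: "far a b = {c, d}" "c \<noteq> d" and x: "D b x" "x \<noteq> a" "D x c" for a b c d x
  proof (intro exI conjI)
    have mm: "card (far a b) = 2 * 1" using far by simp
    have fc: "c \<in> far a b" "d \<in> far a b" using far by auto
    have cd: "D c d"
      using mate_ex1[OF ab fc(1)] D_irrefl unfolding far(1) by blast
    have c0: "card {y. D a y \<and> y \<noteq> b \<and> D c y} = 0"
      using card_far_side[OF ab x(1,2) fc(1) x(3) mm] by simp
    then have "card {x. D b x \<and> x \<noteq> a \<and> D c x} = r" using card_far_sides[OF ab fc(1)] by linarith
    then have cA: "{x. D b x \<and> x \<noteq> a \<and> D c x} = {x. D b x \<and> x \<noteq> a}"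
      using card_other[OF D_sym[OF ab]] by (intro card_subset_eq) auto
    have cB: "{y. D a y \<and> y \<noteq> b \<and> D c y} = {}" using c0 by simp
    have dA: "\<not> D d x" if "D b x" "x \<noteq> a" for x
    proof -
      have "D c x" using cA that by blast
      then show ?thesis using triangle_free[OF D_sym[OF cd]] by blast
    qed
    let ?L = "insert d {y. D b y}" and ?R = "insert c {y. D a y}"
    have P: "P = ({y. D a y} \<union> {y. D b y}) \<union> far a b" using D_P by (auto simp: far_def)
    have nd: "\<not> D a c" "\<not> D b c" "\<not> D a d" "\<not> D b d" using fc by (auto simp: far_def)
    have e: "({y. D a y} \<union> {y. D b y}) \<union> {c, d} = ?L \<union> ?R" by auto
    show "P = ?L \<union> ?R" by (rule trans[OF P[unfolded far(1)] e])
    show "?L \<inter> ?R = {}" using triangle_free[OF ab] nd far by auto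
    have "card {y. D b y} = r + 1" "card {y. D a y} = r + 1" using degree D_P[OF ab] by blast+
    then show "card ?L = r + 2" "card ?R = r + 2" using nd by simp_all
    have A: "\<not> D x y" if "D b x" "D b y" for x y using triangle_free[OF D_sym[OF that(1)] that(2)] .
    have B: "\<not> D x y" if "D a x" "D a y" for x y using triangle_free[OF D_sym[OF that(1)] that(2)] .
    have dA': "\<not> D d y" if "D b y" for y using dA[OF that] nd D_sym by blast
    have cB': "\<not> D c y" if "D a y" for y using cB that nd D_sym by blast
    show "\<forall>x\<in>?L. \<forall>y\<in>?L. \<not> D x y" using A dA' D_sym D_irrefl by blast
    show "\<forall>x\<in>?R. \<forall>y\<in>?R. \<not> D x y" using B cB' D_sym D_irrefl by blast
  qed
  obtain x where x: "D b x" "x \<noteq> a" using exists_other[OF ab] by blast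
  have "card {z \<in> far a b. D x z} = 1" using card_far_nbrs[OF ab x] mm by simp
  then obtain c where c: "c \<in> far a b" "D x c" by (metis (no_types, lifting) One_nat_def card_eq_SucD insertI1 mem_Collect_eq)
  obtain p q where pq: "far a b = {p, q}" "p \<noteq> q" using mm unfolding card_2_iff by blast
  then have "c = p \<or> c = q" using c(1) by simp
  then show ?thesis
  proof
    assume "c = p"
    then show ?thesis using *[OF ab pq x] c(2) by simp
  next
    assume "c = q"
    then show ?thesis using *[OF ab _ _ x c(2), of p] pq by (simp add: insert_commute)
  qed
qed

end

context sr_minus2
begin

text \<open>The far vertices of an edge \<open>a b\<close> of \<open>local_nonadj u\<close> are the
  common neighbours of \<open>u\<close>, \<open>a\<close> and \<open>b\<close>, so
  \<open>far_ex1\<close> is \<open>claw_free_far_match\<close>.\<close>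

lemma claw_free_far_matching:
  assumes cf: claw_free and u: "u \<in> V"
  shows "far_matching {x. E u x} (local_nonadj u) r"
proof
  show "finite {x. E u x}" by simp
  show "local_nonadj u x y \<Longrightarrow> x \<in> {x. E u x} \<and> y \<in> {x. E u x}" for x y by (auto simp: local_nonadj_def)
  show "local_nonadj u x y \<Longrightarrow> local_nonadj u y x" for x y by (rule local_nonadj_sym)
  show "\<not> local_nonadj u x x" for x by (auto simp: local_nonadj_def)
  show "\<not> local_nonadj u x z" if "local_nonadj u x y" "local_nonadj u y z" for x y z
  proof
    assume "local_nonadj u x z"
    then have "z \<in> claw_tips u x y" using that by (simp add: claw_tips_def)
    then show False using cf that(1) by (simp add: claw_free_def)
  qed
  show "card {y. local_nonadj u x y} = r + 1" if "x \<in> {x. E u x}" for x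
    using that card_local_nonadj_r by simp
  show "r \<ge> 1" by (rule r_pos)
  show "\<exists>!z'. z' \<in> {x. E u x} \<and> \<not> local_nonadj u a z' \<and> \<not> local_nonadj u b z' \<and> local_nonadj u z z'"
    if ab: "local_nonadj u a b" and z: "z \<in> {x. E u x}" "\<not> local_nonadj u a z" "\<not> local_nonadj u b z" for a b z
  proof -
    have ab': "E u a" "E u b" "a \<noteq> b" "\<not> E a b" "\<not> E b a" using ab E_sym by (auto simp: local_nonadj_def)
    have far: "z \<in> {x. E u x} \<and> \<not> local_nonadj u a z \<and> \<not> local_nonadj u b z \<longleftrightarrow> E u z \<and> E a z \<and> E b z" for z
      using ab' E_irrefl by (auto simp: local_nonadj_def)
    have "E u z" "E a z" "E b z" using far[of z] z by auto
    from claw_free_far_match[OF cf ab this]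
    have "\<exists>!z'. (E u z' \<and> E a z' \<and> E b z') \<and> local_nonadj u z z'" by (simp add: conj_assoc)
    then show ?thesis unfolding far[symmetric] by (simp add: conj_assoc)
  qed
qed

end

section \<open>Recognising triangular and lattice graphs\<close>

definition meet :: "'b set \<Rightarrow> 'b set \<Rightarrow> bool" where "meet A B \<longleftrightarrow> A \<noteq> B \<and> A \<inter> B \<noteq> {}"

definition rook :: "'b \<times> 'c \<Rightarrow> 'b \<times> 'c \<Rightarrow> bool" where
  "rook p q \<longleftrightarrow> p \<noteq> q \<and> (fst p = fst q \<or> snd p = snd q)"

lemma triangular_graph_eq:
  "pverts (triangular_graph n) = {A. A \<subseteq> {..<n} \<and> card A = 2}"
  "gadj (triangular_graph n) A B \<longleftrightarrow> A \<in> pverts (triangular_graph n) \<and> B \<in> pverts (triangular_graph n) \<and> meet A B"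
proof -
  have "{{u, w} |u w. (u, w) \<in> parcs (complete_graph n)} = {A. A \<subseteq> {..<n} \<and> card A = 2}"
  proof (intro equalityI subsetI)
    fix A assume "A \<in> {{u, w} |u w. (u, w) \<in> parcs (complete_graph n)}"
    then obtain u w where "A = {u, w}" "u < n" "w < n" "u \<noteq> w" by (auto simp: complete_graph_def)
    then show "A \<in> {A. A \<subseteq> {..<n} \<and> card A = 2}" by auto
  next
    fix A assume "A \<in> {A. A \<subseteq> {..<n} \<and> card A = 2}"
    then obtain u w where "A = {u, w}" "u \<noteq> w" "A \<subseteq> {..<n}" by (auto simp: card_2_iff)
    then have "A = {u, w}" "(u, w) \<in> parcs (complete_graph n)" by (auto simp: complete_graph_def)
    then show "A \<in> {{u, w} |u w. (u, w) \<in> parcs (complete_graph n)}" by blast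
  qed
  then show V: "pverts (triangular_graph n) = {A. A \<subseteq> {..<n} \<and> card A = 2}"
    by (simp add: triangular_graph_def line_graph_def Let_def)
  show "gadj (triangular_graph n) A B \<longleftrightarrow> A \<in> pverts (triangular_graph n) \<and> B \<in> pverts (triangular_graph n) \<and> meet A B"
    by (simp add: triangular_graph_def line_graph_def Let_def meet_def)
qed

lemma triangular_rel_iso:
  assumes "finite S" "card S = n"
  shows "rel_iso {A. A \<subseteq> S \<and> card A = 2} meet (pverts (triangular_graph n)) (gadj (triangular_graph n))"
proof -
  obtain h where h: "bij_betw h S {0..<n}" using ex_bij_betw_finite_nat[OF assms(1)] assms(2) by blast
  have inj: "inj_on h S" and im: "h ` S = {..<n}" using h by (auto simp: bij_betw_def)
  have "bij_betw (image h) {A. A \<subseteq> S \<and> card A = 2} {A. A \<subseteq> {..<n} \<and> card A = 2}"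
  proof (rule bij_betw_imageI)
    show "inj_on (image h) {A. A \<subseteq> S \<and> card A = 2}"
      by (rule inj_on_subset[OF inj_on_image_Pow[OF inj]]) auto
    show "image h ` {A. A \<subseteq> S \<and> card A = 2} = {A. A \<subseteq> {..<n} \<and> card A = 2}"
    proof (intro equalityI subsetI)
      fix B assume "B \<in> image h ` {A. A \<subseteq> S \<and> card A = 2}"
      then obtain A where A: "B = h ` A" "A \<subseteq> S" "card A = 2" by auto
      have "card B = 2" using A card_image[OF inj_on_subset[OF inj A(2)]] by simp
      then show "B \<in> {A. A \<subseteq> {..<n} \<and> card A = 2}" using A im by blast
    next
      fix B assume "B \<in> {A. A \<subseteq> {..<n} \<and> card A = 2}"
      then have "B \<subseteq> h ` S" "card B = 2" using im by auto
      then obtain A where A: "A \<subseteq> S" "B = h ` A" by (auto simp: subset_image_iff)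
      then have "card A = 2" using \<open>card B = 2\<close> card_image[OF inj_on_subset[OF inj A(1)]] by simp
      then show "B \<in> image h ` {A. A \<subseteq> S \<and> card A = 2}" using A by blast
    qed
  qed
  then have bij: "bij_betw (image h) {A. A \<subseteq> S \<and> card A = 2} (pverts (triangular_graph n))"
    by (simp add: triangular_graph_eq)
  show ?thesis
  proof (rule rel_isoI[OF bij])
    fix A B assume AB: "A \<in> {A. A \<subseteq> S \<and> card A = 2}" "B \<in> {A. A \<subseteq> S \<and> card A = 2}"
    have "h ` A = h ` B \<longleftrightarrow> A = B" using AB inj_on_image_eq_iff[OF inj] by blast
    moreover have "h ` A \<inter> h ` B = h ` (A \<inter> B)" using AB inj_on_image_Int[OF inj] by blast
    moreover have "h ` A \<in> pverts (triangular_graph n)" "h ` B \<in> pverts (triangular_graph n)"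
      using bij AB by (auto simp: bij_betw_def)
    ultimately show "meet A B \<longleftrightarrow> gadj (triangular_graph n) (h ` A) (h ` B)"
      by (simp add: triangular_graph_eq(2) meet_def)
  qed
qed

lemma lattice_graph_rel_iso:
  "rel_iso ({..<n} \<times> {..<n}) rook (pverts (lattice_graph n)) (gadj (lattice_graph n))"
proof -
  define h where "h = (\<lambda>(i, j). {(0 :: nat, i :: nat), (1, j :: nat)})"
  have V: "pverts (lattice_graph n) = h ` ({..<n} \<times> {..<n})"
  proof (intro equalityI subsetI)
    fix e assume "e \<in> pverts (lattice_graph n)"
    then obtain x y where e: "e = {x, y}" and xy: "x \<in> {..<2} \<times> {..<n}" "y \<in> {..<2} \<times> {..<n}" "fst x \<noteq> fst y"
      by (auto simp: lattice_graph_def line_graph_def Let_def complete_multipartite_graph_def)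
    have "(fst x = 0 \<and> fst y = 1) \<or> (fst x = 1 \<and> fst y = 0)" using xy by auto
    then show "e \<in> h ` ({..<n} \<times> {..<n})"
    proof
      assume "fst x = 0 \<and> fst y = 1"
      then have "e = h (snd x, snd y)" using e by (cases x; cases y) (simp add: h_def)
      then show ?thesis using xy by (auto simp: mem_Times_iff)
    next
      assume "fst x = 1 \<and> fst y = 0"
      then have "e = h (snd y, snd x)" using e by (cases x; cases y) (simp add: h_def insert_commute)
      then show ?thesis using xy by (auto simp: mem_Times_iff)
    qed
  next
    fix e assume "e \<in> h ` ({..<n} \<times> {..<n})"
    then obtain i j where e: "e = {(0, i), (1, j)}" "i < n" "j < n" by (auto simp: h_def)
    then have "((0, i), (1, j)) \<in> parcs (complete_multipartite_graph 2 n)" by (simp add: complete_multipartite_graph_def)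
    then show "e \<in> pverts (lattice_graph n)" unfolding e lattice_graph_def line_graph_def Let_def by auto
  qed
  have inj: "inj_on h ({..<n} \<times> {..<n})"
    by (auto simp: inj_on_def h_def doubleton_eq_iff)
  have bij: "bij_betw h ({..<n} \<times> {..<n}) (pverts (lattice_graph n))" using V inj by (simp add: bij_betw_def)
  show ?thesis
  proof (rule rel_isoI[OF bij])
    fix p q assume pq: "p \<in> {..<n} \<times> {..<n}" "q \<in> {..<n} \<times> {..<n}"
    then have "h p \<in> pverts (lattice_graph n)" "h q \<in> pverts (lattice_graph n)" using V by auto
    then have "gadj (lattice_graph n) (h p) (h q) \<longleftrightarrow> h p \<noteq> h q \<and> h p \<inter> h q \<noteq> {}"
      by (simp add: lattice_graph_def line_graph_def Let_def)
    moreover have "h p \<noteq> h q \<longleftrightarrow> p \<noteq> q" using inj pq by (auto dest: inj_onD)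
    moreover have "h p \<inter> h q \<noteq> {} \<longleftrightarrow> fst p = fst q \<or> snd p = snd q" by (cases p; cases q) (auto simp: h_def)
    ultimately show "rook p q \<longleftrightarrow> gadj (lattice_graph n) (h p) (h q)" by (simp add: rook_def)
  qed
qed

lemma rook_rel_iso:
  assumes "finite R" "finite C" "card R = n" "card C = n'"
  shows "rel_iso (R \<times> C) rook ({..<n} \<times> {..<n'}) rook"
proof -
  obtain f where f: "bij_betw f R {0..<n}" using ex_bij_betw_finite_nat[OF assms(1)] assms(3) by blast
  obtain g where g: "bij_betw g C {0..<n'}" using ex_bij_betw_finite_nat[OF assms(2)] assms(4) by blast
  have "bij_betw (map_prod f g) (R \<times> C) ({..<n} \<times> {..<n'})"
    using bij_betw_map_prod[OF f g] by (simp add: atLeast0LessThan)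
  moreover have "rook p q \<longleftrightarrow> rook (map_prod f g p) (map_prod f g q)" if "p \<in> R \<times> C" "q \<in> R \<times> C" for p q
  proof -
    have "f (fst p) = f (fst q) \<longleftrightarrow> fst p = fst q" "g (snd p) = g (snd q) \<longleftrightarrow> snd p = snd q"
      using that f g by (auto simp: bij_betw_def inj_on_eq_iff mem_Times_iff)
    then show ?thesis by (auto simp: rook_def prod_eq_iff)
  qed
  ultimately show ?thesis by (rule rel_isoI)
qed

section \<open>Graphs whose neighbourhoods split into two cliques\<close>

context sr_graph
begin

definition clique :: "'a set \<Rightarrow> bool" where "clique K \<longleftrightarrow> (\<forall>x\<in>K. \<forall>y\<in>K. x \<noteq> y \<longrightarrow> E x y)"

text \<open>The last clause makes \<open>A\<close> and \<open>B\<close> the only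
  \<open>s\<close>-cliques in the neighbourhood, so that the lines through \<open>u\<close> can be
  recovered as the cliques of size \<open>s + 1\<close> containing \<open>u\<close>.\<close>

definition two_cliques :: "nat \<Rightarrow> bool" where
  "two_cliques s \<longleftrightarrow> (\<forall>u\<in>V. \<exists>A B. {w. E u w} = A \<union> B \<and> A \<inter> B = {} \<and> card A = s \<and> card B = s \<and>
    clique A \<and> clique B \<and> (\<forall>K. K \<subseteq> {w. E u w} \<longrightarrow> card K = s \<longrightarrow> clique K \<longrightarrow> K = A \<or> K = B))"

definition grid_lines :: "nat \<Rightarrow> 'a set set" where
  "grid_lines s = {K. K \<subseteq> V \<and> card K = s + 1 \<and> clique K}"

end

text \<open>Krausz's criterion: a graph is a line graph when its edges can be partitioned into
  cliques with at most two of them through any vertex. Here the cliques are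
  \<open>grid_lines s\<close>; a vertex \<open>u\<close> is represented by \<open>through u\<close>,
  its pair of lines.\<close>

locale krausz = sr_graph V E k l m for V :: "'a set" and E k l m +
  fixes s :: nat
  assumes s_pos: "s \<ge> 1" and tc: "two_cliques s"
begin

abbreviation "LS \<equiv> grid_lines s"

lemma finite_LS: "finite LS"
  by (rule finite_subset[of _ "Pow V"]) (use finite_V in \<open>auto simp: grid_lines_def\<close>)

lemma two_lines:
  assumes u: "u \<in> V"
  obtains K L where "K \<in> LS" "L \<in> LS" "K \<noteq> L" "K \<inter> L = {u}" "{M \<in> LS. u \<in> M} = {K, L}"
    "{w. E u w} = K \<union> L - {u}"
proof -
  obtain A B where AB: "{w. E u w} = A \<union> B" "A \<inter> B = {}" "card A = s" "card B = s" "clique A" "clique B"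
    and max: "\<And>K. K \<subseteq> {w. E u w} \<Longrightarrow> card K = s \<Longrightarrow> clique K \<Longrightarrow> K = A \<or> K = B"
    using tc u unfolding two_cliques_def by (elim ballE[of _ _ u] exE conjE) auto
  have fin: "finite A" "finite B" using AB(1) finite_nbrs[of u] by auto
  have uA: "u \<notin> A" "u \<notin> B" using AB(1) E_irrefl by blast+
  have Eu: "E u x" if "x \<in> A \<union> B" for x using AB(1) that by blast
  have cl: "clique (insert u A)" "clique (insert u B)"
    using AB(5,6) Eu E_sym unfolding clique_def by blast+
  have sub: "A \<subseteq> V" "B \<subseteq> V" using Eu E_V by blast+
  have KL: "insert u A \<in> LS" "insert u B \<in> LS"
    using cl sub u AB(3,4) fin uA by (auto simp: grid_lines_def)
  have ne: "insert u A \<noteq> insert u B"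
  proof
    assume "insert u A = insert u B"
    then have "A = B" using uA by (simp add: insert_ident)
    then show False using AB(2,3) s_pos by simp
  qed
  have "{M \<in> LS. u \<in> M} = {insert u A, insert u B}"
  proof (intro equalityI subsetI)
    fix M assume "M \<in> {M \<in> LS. u \<in> M}"
    then have M: "M \<subseteq> V" "card M = s + 1" "clique M" "u \<in> M" by (auto simp: grid_lines_def)
    have "M - {u} \<subseteq> {w. E u w}" using M(3,4) by (auto simp: clique_def)
    moreover have "card (M - {u}) = s" using M by simp
    moreover have "clique (M - {u})" using M(3) by (auto simp: clique_def)
    ultimately have "M - {u} = A \<or> M - {u} = B" by (rule max)
    then show "M \<in> {insert u A, insert u B}" using M(4) insert_Diff[of u M] by auto
  qed (use KL in auto)
  moreover have "insert u A \<inter> insert u B = {u}" using AB(2) by auto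
  moreover have "{w. E u w} = insert u A \<union> insert u B - {u}" unfolding AB(1) using uA by auto
  ultimately show ?thesis using that[OF KL ne] by simp
qed

definition through :: "'a \<Rightarrow> 'a set set" where "through u = {M \<in> LS. u \<in> M}"

lemma card_through: assumes u: "u \<in> V" shows "card (through u) = 2"
proof -
  obtain K L where KL: "K \<noteq> L" "{M \<in> LS. u \<in> M} = {K, L}" by (rule two_lines[OF u])
  show ?thesis unfolding through_def KL(2) using KL(1) by simp
qed

lemma through_Int:
  assumes u: "u \<in> V" and M: "M \<in> through u" "M' \<in> through u" "M \<noteq> M'" shows "M \<inter> M' = {u}"
proof -
  obtain K L where KL: "K \<inter> L = {u}" "{M \<in> LS. u \<in> M} = {K, L}" by (rule two_lines[OF u])
  have "M \<in> {K, L}" "M' \<in> {K, L}" using M unfolding through_def KL(2) by simp_all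
  then show ?thesis using KL(1) M(3) by (auto simp: Int_commute)
qed

lemma lines_meet_once:
  assumes "K \<in> LS" "L \<in> LS" "K \<noteq> L" "x \<in> K" "x \<in> L" "y \<in> K" "y \<in> L" shows "x = y"
proof -
  have "x \<in> V" using assms by (auto simp: grid_lines_def)
  then have "K \<inter> L = {x}" by (rule through_Int) (use assms in \<open>auto simp: through_def\<close>)
  moreover have "y \<in> K \<inter> L" using assms by simp
  ultimately show ?thesis by simp
qed

lemma inj_through: "inj_on through V"
proof (rule inj_onI)
  fix u w assume uw: "u \<in> V" "w \<in> V" "through u = through w"
  obtain K L where KL: "K \<in> LS" "L \<in> LS" "K \<noteq> L" "{M \<in> LS. u \<in> M} = {K, L}" by (rule two_lines[OF uw(1)])
  then have "K \<in> through u" "L \<in> through u" by (auto simp: through_def)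
  then have "u \<in> K" "u \<in> L" "w \<in> K" "w \<in> L" using uw(3) by (auto simp: through_def)
  then show "u = w" by (rule lines_meet_once[OF KL(1-3)])
qed

lemma adj_through: "u \<in> V \<Longrightarrow> w \<in> V \<Longrightarrow> E u w \<longleftrightarrow> u \<noteq> w \<and> through u \<inter> through w \<noteq> {}"
proof -
  assume uw: "u \<in> V" "w \<in> V"
  obtain K L where KL: "K \<in> LS" "L \<in> LS" "K \<inter> L = {u}" "{w. E u w} = K \<union> L - {u}" by (rule two_lines[OF uw(1)])
  show ?thesis
  proof
    assume E: "E u w"
    then have "w \<in> K \<union> L - {u}" unfolding KL(4)[symmetric] by simp
    then have "w \<noteq> u" "K \<in> through u \<inter> through w \<or> L \<in> through u \<inter> through w"
      using KL(1-3) by (auto simp: through_def)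
    then show "u \<noteq> w \<and> through u \<inter> through w \<noteq> {}" by blast
  next
    assume "u \<noteq> w \<and> through u \<inter> through w \<noteq> {}"
    then obtain M where "u \<noteq> w" "M \<in> LS" "u \<in> M" "w \<in> M" by (auto simp: through_def)
    then show "E u w" by (auto simp: grid_lines_def clique_def)
  qed
qed

lemma card_lines: "(s + 1) * card LS = 2 * card V"
proof -
  have "(\<Sum>K\<in>LS. card {u \<in> V. u \<in> K}) = (\<Sum>u\<in>V. card {K \<in> LS. u \<in> K})"
    by (rule double_count[OF finite_LS finite_V])
  moreover have "card {u \<in> V. u \<in> K} = s + 1" if "K \<in> LS" for K
  proof -
    have "{u \<in> V. u \<in> K} = K" using that by (auto simp: grid_lines_def)
    then show ?thesis using that by (simp add: grid_lines_def)
  qed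
  ultimately show ?thesis using card_through by (simp add: through_def mult.commute)
qed

text \<open>\<open>through\<close> is injective and \<open>n choose 2\<close> equals the number of
  vertices, so every pair of lines occurs: any two lines meet.\<close>

lemma through_image:
  assumes "card LS = n" "2 * card V = n * (n - 1)"
  shows "through ` V = {A. A \<subseteq> LS \<and> card A = 2}"
proof -
  let ?Q = "{A. A \<subseteq> LS \<and> card A = 2}"
  have sub: "through ` V \<subseteq> ?Q" using card_through by (auto simp: through_def)
  have finQ: "finite ?Q" by (rule finite_subset[of _ "Pow LS"]) (use finite_LS in auto)
  have "card ?Q = n choose 2" using n_subsets[OF finite_LS, of 2] assms(1) by simp
  also have "\<dots> = card V" using assms(2) by (simp add: choose_two)
  also have "\<dots> = card (through ` V)" by (rule card_image[OF inj_through, symmetric])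
  finally show "through ` V = ?Q" using card_subset_eq[OF finQ sub] by simp
qed

lemma triangular:
  assumes "card LS = n" "2 * card V = n * (n - 1)"
  shows "rel_iso V E (pverts (triangular_graph n)) (gadj (triangular_graph n))"
proof -
  let ?Q = "{A. A \<subseteq> LS \<and> card A = 2}"
  have "through ` V = ?Q" by (rule through_image[OF assms])
  then have bij: "bij_betw through V ?Q" using inj_through by (simp add: bij_betw_def)
  have "rel_iso V E ?Q meet"
  proof (rule rel_isoI[OF bij])
    fix u w assume uw: "u \<in> V" "w \<in> V"
    have "through u = through w \<longleftrightarrow> u = w" using uw inj_through by (auto dest: inj_onD)
    then show "E u w \<longleftrightarrow> meet (through u) (through w)" using adj_through[OF uw] by (simp add: meet_def)
  qed
  then show ?thesis using triangular_rel_iso[OF finite_LS assms(1)] by (rule rel_iso_trans)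
qed

text \<open>Fix one line \<open>L0\<close>. Each vertex off \<open>L0\<close> has exactly one
  neighbour on it, hence lies on exactly one line meeting \<open>L0\<close>; these lines are the
  columns, and all others, \<open>L0\<close> included, are the rows.\<close>

lemma lattice:
  assumes n: "n = s + 1" "card V = n * n" and k: "k = 2 * s" and l: "l + 1 = s"
  shows "rel_iso V E (pverts (lattice_graph n)) (gadj (lattice_graph n))"
proof -
  have "n * card LS = n * (2 * n)" using card_lines n by simp
  then have cLS: "card LS = 2 * n" unfolding mult_cancel1 using n(1) by simp
  have "V \<noteq> {}" by (rule V_nonempty)
  then obtain u0 where "u0 \<in> V" by blast
  then obtain L0 where L0: "L0 \<in> LS" by (rule two_lines)
  have L0V: "L0 \<subseteq> V" "card L0 = n" "clique L0" using L0 n by (auto simp: grid_lines_def)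
  have finL0: "finite L0" using L0V(1) finite_V finite_subset by blast
  \<comment> \<open>Two vertices of \<open>L0\<close> have all their \<open>l = n - 2\<close> common
    neighbours on \<open>L0\<close> itself.\<close>
  have le1: "x = y" if xy: "x \<in> L0" "y \<in> L0" "E w x" "E w y" and w: "w \<notin> L0" for x y w
  proof (rule ccontr)
    assume "x \<noteq> y"
    then have Exy: "E x y" using xy L0V(3) by (simp add: clique_def)
    have sub: "L0 - {x, y} \<subseteq> {z. E x z \<and> E y z}" using xy L0V(3) by (auto simp: clique_def)
    have "card (L0 - {x, y}) = card L0 - card {x, y}" by (rule card_Diff_subset) (use xy in auto)
    then have "card (L0 - {x, y}) = l" using L0V(2) n l \<open>x \<noteq> y\<close> by simp
    then have "L0 - {x, y} = {z. E x z \<and> E y z}"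
      using card_subset_eq[OF _ sub] card_adj[OF Exy] by simp
    moreover have "w \<in> {z. E x z \<and> E y z}" using xy E_sym by blast
    ultimately show False using w by blast
  qed
  \<comment> \<open>The \<open>n\<close> vertices of \<open>L0\<close> send \<open>n s\<close> edges
    to the \<open>n^2 - n = n s\<close> vertices outside, none of which receives two; so each
    receives one.\<close>
  have one: "\<exists>x. x \<in> L0 \<and> E w x" if w: "w \<in> V" "w \<notin> L0" for w
  proof (rule ccontr)
    assume no: "\<not> (\<exists>x. x \<in> L0 \<and> E w x)"
    have "(\<Sum>x\<in>L0. card {w \<in> V - L0. E x w}) = (\<Sum>w\<in>V - L0. card {x \<in> L0. E x w})"
      by (rule double_count) (use finL0 finite_V in auto)
    moreover have "card {w \<in> V - L0. E x w} = s" if x: "x \<in> L0" for x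
    proof -
      have "{w \<in> V - L0. E x w} = {w. E x w} - (L0 - {x})" using E_V E_irrefl by auto
      moreover have "card ({w. E x w} - (L0 - {x})) = card {w. E x w} - card (L0 - {x})"
        by (rule card_Diff_subset) (use x L0V(3) finL0 in \<open>auto simp: clique_def\<close>)
      moreover have "card {w. E x w} = k" using card_nbrs x L0V(1) by blast
      ultimately show ?thesis using x L0V(2) n k by simp
    qed
    moreover have "(\<Sum>w\<in>V - L0. card {x \<in> L0. E x w}) < (\<Sum>w\<in>V - L0. 1)"
    proof (rule sum_strict_mono_ex1)
      show "finite (V - L0)" using finite_V by simp
      show "\<forall>w\<in>V - L0. card {x \<in> L0. E x w} \<le> 1"
      proof
        fix w assume "w \<in> V - L0"
        then have "\<forall>x\<in>{x \<in> L0. E x w}. \<forall>y\<in>{x \<in> L0. E x w}. x = y"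
          by (auto intro!: le1[of _ _ w] dest: E_sym)
        then show "card {x \<in> L0. E x w} \<le> 1" using card_le_Suc0_iff_eq[of "{x \<in> L0. E x w}"] finL0 by simp
      qed
      have "{x \<in> L0. E x w} = {}" using no E_sym by blast
      then show "\<exists>w\<in>V - L0. card {x \<in> L0. E x w} < 1" using w by (intro bexI[of _ w]) (simp_all only: card.empty, auto)
    qed
    moreover have "card (V - L0) = n * n - n" using card_Diff_subset[OF finL0 L0V(1)] L0V(2) n(2) by simp
    ultimately have "n * s < n * n - n" using L0V(2) by simp
    then show False using n(1) by simp
  qed
  define C where "C = {M \<in> LS. M \<noteq> L0 \<and> M \<inter> L0 \<noteq> {}}"
  define R where "R = LS - C"
  have col_row: "\<exists>c r. c \<in> C \<and> r \<in> R \<and> through u = {c, r}" if u: "u \<in> V" for u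
  proof -
    obtain K L where KL: "K \<in> LS" "L \<in> LS" "K \<noteq> L" "K \<inter> L = {u}" "{M \<in> LS. u \<in> M} = {K, L}"
      "{w. E u w} = K \<union> L - {u}" by (rule two_lines[OF u])
    have th: "through u = {K, L}" using KL(5) by (simp add: through_def)
    have uKL: "u \<in> K" "u \<in> L" using KL(4) by auto
    show ?thesis
    proof (cases "u \<in> L0")
      case True
      then have "L0 \<in> {K, L}" unfolding KL(5)[symmetric] using L0 by simp
      moreover have "L0 \<in> R" by (simp add: R_def C_def L0)
      moreover have "M \<in> C" if "M \<in> LS" "u \<in> M" "M \<noteq> L0" for M using that True by (auto simp: C_def)
      ultimately show ?thesis using th KL(1-3) uKL by (auto simp: insert_commute)
    next
      case False
      then obtain x where x: "x \<in> L0" "E u x" using one u by blast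
      have xu: "x \<noteq> u" using x E_irrefl by blast
      have *: "\<exists>c r. c \<in> C \<and> r \<in> R \<and> {K, L} = {c, r}"
        if KL: "K \<in> LS" "L \<in> LS" "K \<inter> L = {u}" "x \<in> K" for K L
      proof -
        have uKL: "u \<in> K" "u \<in> L" using KL(3) by auto
        have "K \<in> C" using KL x(1) uKL False by (auto simp: C_def)
        moreover have "L \<in> R"
        proof (rule ccontr)
          assume "L \<notin> R"
          then obtain y where y: "y \<in> L" "y \<in> L0" using KL(2) by (auto simp: R_def C_def)
          then have "y \<noteq> u" using False by blast
          then have "E u y" using y uKL KL(2) by (auto simp: grid_lines_def clique_def)
          then have "y = x" by (intro le1[OF y(2) x(1) _ x(2) False])
          then have "x \<in> K \<inter> L" using y KL(4) by simp
          then show False unfolding KL(3) using xu by simp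
        qed
        ultimately show ?thesis by blast
      qed
      have "x \<in> K \<union> L - {u}" using x(2) unfolding KL(6)[symmetric] by simp
      then have "x \<in> K \<or> x \<in> L" by simp
      then show ?thesis unfolding th
      proof
        assume "x \<in> L"
        then show "\<exists>c r. c \<in> C \<and> r \<in> R \<and> {K, L} = {c, r}"
          using *[of L K] KL(1,2,4) by (simp add: Int_commute insert_commute)
      qed (rule *[OF KL(1,2,4)])
    qed
  qed
  define c where "c u = (SOME M. M \<in> C \<and> M \<in> through u)" for u
  define w where "w u = (SOME M. M \<in> R \<and> M \<in> through u)" for u
  have cw: "c u \<in> C" "w u \<in> R" "through u = {c u, w u}" if u: "u \<in> V" for u
  proof -
    obtain c' r' where cr: "c' \<in> C" "r' \<in> R" "through u = {c', r'}" using col_row[OF u] by blast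
    have "c u \<in> C \<and> c u \<in> through u" unfolding c_def by (rule someI[of _ c']) (use cr in auto)
    moreover have "w u \<in> R \<and> w u \<in> through u" unfolding w_def by (rule someI[of _ r']) (use cr in auto)
    moreover have "C \<inter> R = {}" by (auto simp: R_def)
    ultimately have "c u = c'" "w u = r'" using cr by auto
    then show "c u \<in> C" "w u \<in> R" "through u = {c u, w u}" using cr by auto
  qed
  have disj: "C \<inter> R = {}" by (auto simp: R_def)
  have finC: "finite C" "finite R" using finite_LS by (auto simp: C_def R_def)
  have "bij_betw c L0 C"
  proof (rule bij_betw_imageI)
    show "inj_on c L0"
    proof (rule inj_onI)
      fix x y assume xy: "x \<in> L0" "y \<in> L0" "c x = c y"
      then have "x \<in> V" "y \<in> V" using L0V(1) by blast+
      then have "x \<in> c x" "y \<in> c x" "c x \<in> C" using cw[of x] cw[of y] xy(3) by (auto simp: through_def)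
      then show "x = y" using lines_meet_once[of "c x" L0 x y] L0 xy by (auto simp: C_def)
    qed
    show "c ` L0 = C"
    proof (intro equalityI subsetI)
      fix M assume M: "M \<in> C"
      then obtain x where x: "x \<in> M" "x \<in> L0" by (auto simp: C_def)
      then have xV: "x \<in> V" using L0V(1) by blast
      have "M \<in> through x" using M x by (auto simp: through_def C_def)
      then have "M = c x" using cw[OF xV] M disj by auto
      then show "M \<in> c ` L0" using x by blast
    qed (use cw L0V(1) in auto)
  qed
  then have cardC: "card C = n" using L0V(2) bij_betw_same_card by metis
  have "card R = card LS - card C" unfolding R_def
    by (rule card_Diff_subset) (use finC in \<open>auto simp: C_def\<close>)
  then have cardR: "card R = n" using cardC cLS by simp
  have inj: "inj_on (\<lambda>u. (c u, w u)) V"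
  proof (rule inj_onI)
    fix x y assume xy: "x \<in> V" "y \<in> V" "(c x, w x) = (c y, w y)"
    then have "through x = through y" using cw by simp
    then show "x = y" using inj_through xy by (auto dest: inj_onD)
  qed
  have "(\<lambda>u. (c u, w u)) ` V \<subseteq> C \<times> R" using cw by auto
  moreover have "card ((\<lambda>u. (c u, w u)) ` V) = card (C \<times> R)"
    using card_image[OF inj] n(2) cardC cardR by (simp add: card_cartesian_product)
  ultimately have "(\<lambda>u. (c u, w u)) ` V = C \<times> R" using finC by (intro card_subset_eq) auto
  then have bij: "bij_betw (\<lambda>u. (c u, w u)) V (C \<times> R)" using inj by (simp add: bij_betw_def)
  have "rel_iso V E (C \<times> R) rook"
  proof (rule rel_isoI[OF bij])
    fix x y assume xy: "x \<in> V" "y \<in> V"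
    have "through x \<inter> through y \<noteq> {} \<longleftrightarrow> c x = c y \<or> w x = w y"
    proof -
      have "c x \<noteq> w y" "w x \<noteq> c y"
        using cw(1,2)[OF xy(1)] cw(1,2)[OF xy(2)] disj by (metis IntI empty_iff)+
      then show ?thesis unfolding cw(3)[OF xy(1)] cw(3)[OF xy(2)] by auto
    qed
    moreover have "x = y \<longleftrightarrow> (c x, w x) = (c y, w y)" using inj xy by (auto dest: inj_onD)
    ultimately show "E x y \<longleftrightarrow> rook (c x, w x) (c y, w y)"
      unfolding adj_through[OF xy] rook_def by simp
  qed
  then have "rel_iso V E ({..<n} \<times> {..<n}) rook" using rook_rel_iso[OF finC cardC cardR] by (rule rel_iso_trans)
  then show ?thesis using lattice_graph_rel_iso by (rule rel_iso_trans)
qed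

end

section \<open>The claw-free graphs\<close>

context sr_minus2
begin

text \<open>The number \<open>2 mm\<close> of far vertices is read off the parameters, as
  \<open>m = 2 + 2 mm\<close>. It is therefore the same at every vertex and for every non-adjacent
  pair, and the three cases of \<open>mm\<close> can be treated uniformly over the graph.\<close>

lemma claw_free_cases:
  assumes cf: claw_free
  obtains "m = 2" "two_cliques (r + 1)" | "m = 4" "two_cliques (r + 2)"
    | "m = 6" "r = 2" | "m = 8" "r = 4"
proof -
  obtain u0 a0 b0 where n0: "local_nonadj u0 a0 b0" using exists_local_nonadj by blast
  then have u0: "u0 \<in> V" using E_V by (auto simp: local_nonadj_def)
  have cl: "clique K" if "K \<subseteq> {w. E u w}" "\<forall>x\<in>K. \<forall>y\<in>K. \<not> local_nonadj u x y" for u K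
    using that unfolding clique_def local_nonadj_def by blast
  have card_eq: "m + 2 * r = 2 * (r + 1) + card (far_matching.far {x. E u x} (local_nonadj u) a b)"
    if u: "u \<in> V" and ab: "local_nonadj u a b" for u a b
  proof -
    interpret far_matching "{x. E u x}" "local_nonadj u" r by (rule claw_free_far_matching[OF cf u])
    show ?thesis using card_far[OF ab] card_nbrs[OF u] k_eq by simp
  qed
  have ex: "\<exists>a b. local_nonadj u a b" if u: "u \<in> V" for u
  proof -
    have "card {w. E u w} \<noteq> 0" using card_nbrs[OF u] k_eq r_pos by linarith
    then have "{w. E u w} \<noteq> {}" by (metis card.empty)
    then obtain a where "E u a" by blast
    then show ?thesis using local_nonadj_ex by blast
  qed
  interpret F0: far_matching "{x. E u0 x}" "local_nonadj u0" r by (rule claw_free_far_matching[OF cf u0])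
  obtain x0 where x0: "local_nonadj u0 b0 x0" "x0 \<noteq> a0" using F0.exists_other[OF n0] by blast
  obtain mm where mm: "card (F0.far a0 b0) = 2 * mm" using F0.card_far_nbrs[OF n0 x0] by blast
  then have m: "m = 2 + 2 * mm" using card_eq[OF u0 n0] by simp
  consider "mm = 0" | "mm = 1" | "mm \<ge> 2" by linarith
  then show ?thesis
  proof cases
    case 1
    have "two_cliques (r + 1)" unfolding two_cliques_def
    proof
      fix u assume u: "u \<in> V"
      interpret far_matching "{x. E u x}" "local_nonadj u" r by (rule claw_free_far_matching[OF cf u])
      obtain a b where ab: "local_nonadj u a b" using ex[OF u] by blast
      have "card (far a b) = 0" using card_eq[OF u ab] m 1 by simp
      then have "far a b = {}" using finite_far[of a b] by (metis card_0_eq)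
      from mm_eq_0[OF ab this] obtain L R where LR: "{x. E u x} = L \<union> R" "L \<inter> R = {}" "card L = r + 1"
        "card R = r + 1" "\<forall>x\<in>L. \<forall>y\<in>L. \<not> local_nonadj u x y" "\<forall>x\<in>R. \<forall>y\<in>R. \<not> local_nonadj u x y"
        "\<forall>x\<in>L. \<forall>y\<in>R. local_nonadj u x y" by (elim exE conjE)
      have fin: "finite L" "finite R" using LR(1) finite_nbrs[of u] by auto
      have "K = L \<or> K = R" if K: "K \<subseteq> {w. E u w}" "card K = r + 1" "clique K" for K
      proof -
        have "K \<subseteq> L \<or> K \<subseteq> R"
        proof (rule ccontr)
          assume "\<not> (K \<subseteq> L \<or> K \<subseteq> R)"
          then obtain p q where pq: "p \<in> K" "p \<notin> L" "q \<in> K" "q \<notin> R" by blast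
          then have "p \<in> R" "q \<in> L" using K(1) LR(1) by blast+
          then have "local_nonadj u q p" using LR(7) by blast
          then show False using K(3) pq by (auto simp: clique_def local_nonadj_def)
        qed
        then show ?thesis using card_subset_eq[OF fin(1)] card_subset_eq[OF fin(2)] K(2) LR(3,4) by metis
      qed
      moreover have "clique L" "clique R" by (rule cl[of _ u]; use LR in blast)+
      ultimately show "\<exists>A B. {w. E u w} = A \<union> B \<and> A \<inter> B = {} \<and> card A = r + 1 \<and> card B = r + 1 \<and>
        clique A \<and> clique B \<and> (\<forall>K. K \<subseteq> {w. E u w} \<longrightarrow> card K = r + 1 \<longrightarrow> clique K \<longrightarrow> K = A \<or> K = B)"
        using LR by (intro exI[of _ L] exI[of _ R]) auto
    qed
    then show ?thesis using that(1) m 1 by simp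
  next
    case 2
    have "two_cliques (r + 2)" unfolding two_cliques_def
    proof
      fix u assume u: "u \<in> V"
      interpret far_matching "{x. E u x}" "local_nonadj u" r by (rule claw_free_far_matching[OF cf u])
      obtain a b where ab: "local_nonadj u a b" using ex[OF u] by blast
      have "card (far a b) = 2" using card_eq[OF u ab] m 2 by simp
      from mm_eq_1[OF ab this] obtain L R where LR: "{x. E u x} = L \<union> R" "L \<inter> R = {}" "card L = r + 2"
        "card R = r + 2" "\<forall>x\<in>L. \<forall>y\<in>L. \<not> local_nonadj u x y" "\<forall>x\<in>R. \<forall>y\<in>R. \<not> local_nonadj u x y" by (elim exE conjE)
      \<comment> \<open>Among the \<open>r + 2\<close> vertices of \<open>R\<close> all but one are
        non-neighbours of \<open>x\<close>; a clique of size at least three can therefore not meet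
        both sides.\<close>
      have uniq: "y = z" if R: "{x. E u x} = L \<union> R" "L \<inter> R = {}" "card R = r + 2" "\<forall>x\<in>L. \<forall>y\<in>L. \<not> local_nonadj u x y"
        and x: "x \<in> L" and yz: "y \<in> R" "z \<in> R" "E x y" "E x z" for L R x y z
      proof (rule ccontr)
        assume yz': "y \<noteq> z"
        have fin: "finite R" using R(1) finite_nbrs[of u] by auto
        have "E u x" using x R(1) by blast
        then have "card {w. local_nonadj u x w} = r + 1" by (rule card_local_nonadj_r)
        moreover have "{w. local_nonadj u x w} \<subseteq> R - {y, z}"
        proof
          fix w assume "w \<in> {w. local_nonadj u x w}"
          then have w: "local_nonadj u x w" by simp
          then have "w \<in> L \<union> R" using R(1) by (auto simp: local_nonadj_def)
          moreover have "w \<notin> L" using w R(4) x by blast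
          moreover have "w \<noteq> y" "w \<noteq> z" using w yz by (auto simp: local_nonadj_def)
          ultimately show "w \<in> R - {y, z}" by blast
        qed
        then have "card {w. local_nonadj u x w} \<le> card (R - {y, z})" using fin by (intro card_mono) auto
        moreover have "card (R - {y, z}) = card R - card {y, z}" by (rule card_Diff_subset) (use yz in auto)
        ultimately show False using R(3) yz' by simp
      qed
      have fin: "finite L" "finite R" using LR(1) finite_nbrs[of u] by auto
      have "K = L \<or> K = R" if K: "K \<subseteq> {w. E u w}" "card K = r + 2" "clique K" for K
      proof -
        have "K \<subseteq> L \<or> K \<subseteq> R"
        proof (rule ccontr)
          assume "\<not> (K \<subseteq> L \<or> K \<subseteq> R)"
          then obtain p q where pq: "p \<in> K" "p \<notin> L" "q \<in> K" "q \<notin> R" by blast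
          then have pR: "p \<in> R" "q \<in> L" using K(1) LR(1) by blast+
          have "\<not> K \<subseteq> {p, q}"
          proof
            assume "K \<subseteq> {p, q}"
            then have "card K \<le> card {p, q}" by (intro card_mono) auto
            also have "\<dots> \<le> 2" by (simp add: card_insert_if)
            finally show False using K(2) r_pos by simp
          qed
          then obtain z where z: "z \<in> K" "z \<noteq> p" "z \<noteq> q" by blast
          have pq': "p \<noteq> q" using pR LR(2) by blast
          have EE: "E q p" "E q z" "E p q" "E p z" using K(3) pq z pq' by (auto simp: clique_def)
          have "z \<in> L \<or> z \<in> R" using z K(1) LR(1) by blast
          then show False
          proof
            assume "z \<in> R"
            then show False using uniq[OF LR(1,2,4,5) pR(2,1) _ EE(1,2)] z by blast
          next
            assume zL: "z \<in> L"
            have "{x. E u x} = R \<union> L" "R \<inter> L = {}" using LR(1,2) by auto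
            from uniq[OF this LR(3,6) pR(1,2) zL EE(3,4)] show False using z by blast
          qed
        qed
        then show ?thesis using card_subset_eq[OF fin(1)] card_subset_eq[OF fin(2)] K(2) LR(3,4) by metis
      qed
      moreover have "clique L" "clique R" by (rule cl[of _ u]; use LR in blast)+
      ultimately show "\<exists>A B. {w. E u w} = A \<union> B \<and> A \<inter> B = {} \<and> card A = r + 2 \<and> card B = r + 2 \<and>
        clique A \<and> clique B \<and> (\<forall>K. K \<subseteq> {w. E u w} \<longrightarrow> card K = r + 2 \<longrightarrow> clique K \<longrightarrow> K = A \<or> K = B)"
        using LR by (intro exI[of _ L] exI[of _ R]) auto
    qed
    then show ?thesis using that(2) m 2 by simp
  next
    case 3
    then show ?thesis using F0.mm_ge_2[OF n0 mm] that m by auto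
  qed
qed

text \<open>\<open>parameter_identity\<close> with \<open>k\<close> and \<open>l\<close> eliminated,
  in a form free of subtraction.\<close>

lemma param_v: "(m + 2 * r) * (r + 1) + m * (1 + m + 2 * r) = m * card V"
proof -
  have 1: "k - 1 - l = r + 1" using k_eq l_eq r_pos by simp
  define d where "d = card V - 1 - k"
  have d: "card V = 1 + k + d" using k_less by (simp add: d_def)
  have "k * (r + 1) = m * d" using parameter_identity 1 d by simp
  then have "k * (r + 1) + m * (1 + k) = m * card V" using d by (simp add: algebra_simps)
  then show ?thesis unfolding k_eq by (simp add: add.assoc)
qed

text \<open>For the triangular graphs the incidence properties of their lines are returned as well,
  because the group-theoretic part works with the lines rather than with the isomorphism. There
  \<open>n = r + 4\<close> and a line has \<open>n - 1\<close> vertices, whence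
  \<open>grid_lines (n - 2)\<close>.\<close>

lemma claw_free_classification:
  assumes cf: claw_free
  shows "(\<exists>n\<ge>2. rel_iso V E (pverts (lattice_graph n)) (gadj (lattice_graph n))) \<or>
    (\<exists>n\<ge>5. rel_iso V E (pverts (triangular_graph n)) (gadj (triangular_graph n)) \<and> card (grid_lines (n - 2)) = n \<and>
      (\<forall>u\<in>V. card {K \<in> grid_lines (n - 2). u \<in> K} = 2) \<and>
      (\<forall>K\<in>grid_lines (n - 2). \<forall>L\<in>grid_lines (n - 2). K \<noteq> L \<longrightarrow> (\<exists>x. K \<inter> L = {x}))) \<or>
    (card V = 16 \<and> k = 10 \<and> l = 6 \<and> m = 6) \<or> (card V = 27 \<and> k = 16 \<and> l = 10 \<and> m = 8)"
  using cf
proof (cases rule: claw_free_cases)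
  case 1
  interpret krausz V E k l m "r + 1" by unfold_locales (use 1 in auto)
  have "2 * card V = 2 * ((r + 2) * (r + 2))" using param_v 1(1) by (simp add: algebra_simps)
  then have "card V = (r + 2) * (r + 2)" by linarith
  then have "rel_iso V E (pverts (lattice_graph (r + 2))) (gadj (lattice_graph (r + 2)))"
    by (intro lattice) (use 1 k_eq l_eq in auto)
  then show ?thesis by (intro disjI1 exI[of _ "r + 2"]) simp
next
  case 2
  interpret krausz V E k l m "r + 2" by unfold_locales (use 2 in auto)
  have "4 * card V = 2 * ((r + 4) * (r + 3))" using param_v 2(1) by (simp add: algebra_simps)
  then have v: "2 * card V = (r + 4) * (r + 3)" by linarith
  then have "(r + 3) * card LS = (r + 3) * (r + 4)" using card_lines by (simp add: algebra_simps)
  then have "card LS = r + 4" by (metis add_eq_0_iff_both_eq_0 mult_cancel1 zero_neq_numeral)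
  note n = this
  have v': "2 * card V = (r + 4) * (r + 4 - 1)" using v by simp
  have "rel_iso V E (pverts (triangular_graph (r + 4))) (gadj (triangular_graph (r + 4)))" by (rule triangular[OF n v'])
  moreover have "\<forall>u\<in>V. card {K \<in> LS. u \<in> K} = 2" using card_through unfolding through_def by blast
  moreover have "\<forall>K\<in>LS. \<forall>L\<in>LS. K \<noteq> L \<longrightarrow> (\<exists>x. K \<inter> L = {x})"
  proof (intro ballI impI)
    fix K L assume KL: "K \<in> LS" "L \<in> LS" "K \<noteq> L"
    have "{K, L} \<in> {A. A \<subseteq> LS \<and> card A = 2}" using KL by simp
    then have "{K, L} \<in> through ` V" unfolding through_image[OF n v'] .
    then obtain u where u: "u \<in> V" "{K, L} = through u" by auto
    then have "K \<in> through u" "L \<in> through u" by auto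
    then have "K \<inter> L = {u}" using through_Int[OF u(1)] KL(3) by blast
    then show "\<exists>x. K \<inter> L = {x}" by blast
  qed
  ultimately show ?thesis using r_pos n by (intro disjI2 disjI1 exI[of _ "r + 4"]) simp
next
  case 3
  have "6 * card V = 96" using param_v unfolding 3 by simp
  then show ?thesis using k_eq l_eq 3 by linarith
next
  case 4
  have "8 * card V = 216" using param_v unfolding 4 by simp
  then show ?thesis using k_eq l_eq 4 by linarith
qed

end

section \<open>Claws\<close>

definition ip :: "'a set \<Rightarrow> ('a \<Rightarrow> real) \<Rightarrow> ('a \<Rightarrow> real) \<Rightarrow> real" where
  "ip V f g = (\<Sum>z\<in>V. f z * g z)"

lemma ip_simps:
  "ip V (\<lambda>z. f z + g z) h = ip V f h + ip V g h" "ip V h (\<lambda>z. f z + g z) = ip V h f + ip V h g"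
  "ip V (\<lambda>z. f z - g z) h = ip V f h - ip V g h" "ip V h (\<lambda>z. f z - g z) = ip V h f - ip V h g"
  "ip V (\<lambda>z. f z / 2) h = ip V f h / 2" "ip V h (\<lambda>z. f z / 2) = ip V h f / 2"
  by (simp_all add: ip_def algebra_simps sum.distrib sum_subtractf sum_divide_distrib)

text \<open>Bessel's inequality: the projection of the unit vector \<open>y\<close> on the span of
  the \<open>w i\<close> has squared length \<open>card W / 4\<close>.\<close>

lemma bessel_half:
  assumes fin: "finite W" and ww: "\<And>i j. i \<in> W \<Longrightarrow> j \<in> W \<Longrightarrow> ip V (w i) (w j) = (if i = j then 1 else 0)"
    and yw: "\<And>i. i \<in> W \<Longrightarrow> (ip V y (w i))\<^sup>2 = 1 / 4" and yy: "ip V y y = 1"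
  shows "card W \<le> 4"
proof -
  define c where "c i = ip V y (w i)" for i
  define g where "g z = (\<Sum>i\<in>W. c i * w i z)" for z
  have ipg: "ip V h g = (\<Sum>i\<in>W. c i * ip V h (w i))" for h
    unfolding ip_def g_def sum_distrib_left by (subst sum.swap) (simp add: mult.left_commute)
  have yg: "ip V y g = (\<Sum>i\<in>W. c i * c i)" by (simp add: ipg c_def)
  have wg: "ip V (w i) g = c i" if "i \<in> W" for i
  proof -
    have "ip V (w i) g = (\<Sum>j\<in>W. if i = j then c j else 0)"
      unfolding ipg using ww[OF that] by (intro sum.cong) auto
    then show ?thesis using fin that by simp
  qed
  have sym: "ip V f h = ip V h f" for f h by (simp add: ip_def mult.commute)
  have gg: "ip V g g = (\<Sum>i\<in>W. c i * c i)"
    unfolding ipg[of g] by (intro sum.cong refl) (simp add: sym[of g] wg)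
  have "0 \<le> ip V (\<lambda>z. y z - g z) (\<lambda>z. y z - g z)" by (simp add: ip_def sum_nonneg)
  also have "\<dots> = 1 - (\<Sum>i\<in>W. c i * c i)" by (simp add: ip_simps yy yg gg sym[of g y])
  also have "(\<Sum>i\<in>W. c i * c i) = (\<Sum>i\<in>W. 1 / 4)"
    using yw by (intro sum.cong refl) (simp add: c_def power2_eq_square)
  finally show ?thesis by simp
qed

section \<open>Vectors whose Gram matrix is A + 2 I\<close>

context sr_minus2
begin

definition gram :: "'a \<Rightarrow> 'a \<Rightarrow> real" where
  "gram x y = (if x = y then 2 else if E x y then 1 else 0)"

text \<open>\<open>f\<close> is the multiplicity of the eigenvalue \<open>r\<close>: this is
  \<open>multiplicity_integral\<close> with \<open>s = -2\<close>, stated over the natural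
  numbers.\<close>

lemma multiplicity: "\<exists>f. f * (r + 2) + k + 2 = 2 * card V"
proof -
  have "real l + 2 = real m + real r" using l_eq by (metis of_nat_add of_nat_numeral)
  then have "real r + (- 2) = rl - rm" by simp
  moreover have "real r * (- 2) = - (rk - rm)" using k_eq by simp
  moreover have "real r \<noteq> - 2" by simp
  ultimately obtain f :: nat where "real f * (real r - (- 2)) = - (- 2) * (real (card V) - 1) - rk"
    using multiplicity_integral by blast
  then have "real (f * (r + 2) + k + 2) = real (2 * card V)" by (simp add: algebra_simps)
  then show ?thesis using of_nat_eq_iff by blast
qed

text \<open>With \<open>M = A + 2 I\<close> one has \<open>M^2 = (r + 2) M + m J\<close>, so
  \<open>(M - c J)^2 = (r + 2) M\<close> for a suitable \<open>c\<close>. The columns of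
  \<open>M - c J\<close>, divided by the square root of \<open>r + 2\<close>, are the required
  vectors.\<close>

lemma gram_representation: "\<exists>\<Phi>. \<forall>x\<in>V. \<forall>y\<in>V. ip V (\<Phi> x) (\<Phi> y) = gram x y"
proof -
  define v where "v = real (card V)"
  have vpos: "v > 0" using V_nonempty finite_V by (simp add: v_def card_gt_0_iff)
  have R: "real l + 2 = real m + real r" using l_eq by (metis of_nat_add of_nat_numeral)
  have K: "rk = rm + 2 * real r" using k_eq by simp
  have mv: "rm * v = (rk + 2) * (rk + 2) - (real r + 2) * (rk + 2)"
  proof -
    have "rm * v = rk * rk - (rl - rm) * rk - (rk - rm)" using parameter_identity_real by (simp add: v_def)
    moreover have "rl - rm = real r - 2" "rk - rm = 2 * real r" using R K by simp_all
    ultimately show ?thesis by (simp add: algebra_simps)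
  qed
  \<comment> \<open>The condition on \<open>c\<close> is \<open>v c^2 - 2 (k + 2) c + m = 0\<close>;
    by \<open>mv\<close> its discriminant is \<open>4 (r + 2) (k + 2)\<close>.\<close>
  define d where "d = sqrt ((real r + 2) * (rk + 2))"
  have dd: "d * d = (real r + 2) * (rk + 2)" by (simp add: d_def)
  define c where "c = ((rk + 2) - d) / v"
  have c: "v * c = (rk + 2) - d" using vpos by (simp add: c_def)
  have cc: "rm - 2 * c * (rk + 2) + v * c * c = 0"
  proof -
    have "v * (rm - 2 * c * (rk + 2) + v * c * c) = rm * v - 2 * (v * c) * (rk + 2) + (v * c) * (v * c)"
      by (simp add: algebra_simps)
    also have "\<dots> = 0" unfolding c mv using dd by (simp add: algebra_simps)
    finally show ?thesis using vpos by simp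
  qed
  define G where "G z x = 2 * ind (z = x) + (ind (E z x) :: real)" for z x
  have GG: "(\<Sum>z\<in>V. (G z x - c) * (G z y - c)) = (real r + 2) * gram x y" if V: "x \<in> V" "y \<in> V" for x y
  proof -
    have G1: "(\<Sum>z\<in>V. G z x) = rk + 2" if "x \<in> V" for x
    proof -
      have "(\<Sum>z\<in>V. ind (z = x)) = (1 :: real)" using sum_delta(2)[OF that, of "\<lambda>_. 1 :: real"] by simp
      moreover have "(\<Sum>z\<in>V. ind (E z x)) = rk" using sum_deg[OF that, where 'b = real] E_sym_iff by simp
      ultimately show ?thesis by (simp add: G_def sum.distrib flip: sum_distrib_left)
    qed
    have "(\<Sum>z\<in>V. G z x * G z y) = (\<Sum>z\<in>V. 4 * (ind (x = z) * ind (z = y)) + 2 * (ind (x = z) * ind (E z y))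
        + 2 * (ind (E x z) * ind (z = y)) + ind (E x z) * ind (E z y))"
      unfolding G_def by (intro sum.cong refl) (simp add: algebra_simps E_sym_iff[of _ x] eq_commute[of _ x])
    also have "\<dots> = 4 * ind (x = y) + 2 * ind (E x y) + 2 * ind (E x y) + (\<Sum>z\<in>V. ind (E x z) * ind (E z y))"
      by (simp add: sum.distrib sum_delta V flip: sum_distrib_left)
    also have "\<dots> = (4 + (rk - rm)) * ind (x = y) + (4 + (rl - rm)) * ind (E x y) + rm"
      unfolding sum_common[OF V] by (simp add: algebra_simps)
    also have "\<dots> = (real r + 2) * gram x y + rm"
    proof -
      have "rk - rm = 2 * real r" "rl - rm = real r - 2" using R K by simp_all
      then show ?thesis using E_irrefl by (auto simp: gram_def ind_def)
    qed
    finally have G2: "(\<Sum>z\<in>V. G z x * G z y) = (real r + 2) * gram x y + rm" .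
    have "(\<Sum>z\<in>V. (G z x - c) * (G z y - c)) =
        (\<Sum>z\<in>V. G z x * G z y) - c * (\<Sum>z\<in>V. G z x) - c * (\<Sum>z\<in>V. G z y) + v * c * c"
      by (simp add: algebra_simps sum.distrib sum_subtractf v_def flip: sum_distrib_left)
    then show ?thesis using G1[OF V(1)] G1[OF V(2)] G2 cc by (simp add: algebra_simps)
  qed
  define \<Phi> where "\<Phi> x z = (G z x - c) / sqrt (real r + 2)" for x z
  have "ip V (\<Phi> x) (\<Phi> y) = gram x y" if V: "x \<in> V" "y \<in> V" for x y
  proof -
    have "ip V (\<Phi> x) (\<Phi> y) = (\<Sum>z\<in>V. (G z x - c) * (G z y - c) / (real r + 2))"
      unfolding ip_def \<Phi>_def by (intro sum.cong refl) simp
    also have "\<dots> = (\<Sum>z\<in>V. (G z x - c) * (G z y - c)) / (real r + 2)" by (simp add: sum_divide_distrib)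
    finally show ?thesis using GG[OF V] by simp
  qed
  then show ?thesis by blast
qed

section \<open>Parameters of a graph with a claw\<close>

lemma clawD:
  assumes "c \<in> claw_tips u a b" "local_nonadj u a b"
  shows "E u a" "E u b" "E u c" "a \<noteq> b" "a \<noteq> c" "b \<noteq> c" "\<not> E a b" "\<not> E a c" "\<not> E b c"
  using assms by (auto simp: claw_tips_def local_nonadj_def)

lemma claw_tips_singleton:
  assumes "local_nonadj u a b" "c \<in> claw_tips u a b" shows "claw_tips u a b = {c}"
proof (intro equalityI subsetI)
  fix x assume "x \<in> claw_tips u a b"
  then have "x = c" by (rule claw_tips_unique[OF assms(1) _ assms(2)])
  then show "x \<in> {c}" by simp
qed (use assms in simp)

lemma claw_sym:
  assumes "local_nonadj u a b" "c \<in> claw_tips u a b"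
  shows "local_nonadj u a c" "local_nonadj u b c" "b \<in> claw_tips u a c" "a \<in> claw_tips u b c"
  using assms local_nonadj_sym by (auto simp: claw_tips_def)

text \<open>A neighbour of \<open>u\<close> missing both \<open>a\<close> and \<open>b\<close> would
  be a second vertex completing them to a claw.\<close>

lemma claw_two_adj:
  assumes ab: "local_nonadj u a b" and c: "c \<in> claw_tips u a b" and x: "E u x" "x \<noteq> a" "x \<noteq> b" "x \<noteq> c"
  shows "E a x \<or> E b x"
proof (rule ccontr)
  assume "\<not> (E a x \<or> E b x)"
  then have "x \<in> claw_tips u a b" using ab x by (auto simp: claw_tips_def local_nonadj_def)
  then show False using claw_tips_unique[OF ab _ c] x(4) by blast
qed

text \<open>Two tips of a claw have used up the single unit in \<open>claw_or_quadrangle\<close>, so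
  they have no outer common neighbour.\<close>

lemma claw_outer_empty:
  assumes ab: "local_nonadj u a b" and c: "c \<in> claw_tips u a b" and w: "E a w" "\<not> E u w" "w \<noteq> u"
  shows "\<not> E b w"
proof
  assume "E b w"
  then have "w \<in> outer_common u a b" using w by (simp add: outer_common_def)
  then have "card (outer_common u a b) > 0" by (metis card_gt_0_iff empty_iff finite_nbrs2 outer_common_def)
  moreover have "card (claw_tips u a b) > 0" using c finite_claw_tips by (metis card_gt_0_iff empty_iff)
  ultimately show False using claw_or_quadrangle[OF ab] by linarith
qed

text \<open>\<open>Z\<close> collects the neighbours of \<open>u\<close> adjacent to all three tips;
  every other neighbour of \<open>u\<close> besides the tips misses exactly one tip. Counting gives
  \<open>m = r + card Z\<close>, and \<open>Z\<close> must be shown to be empty.\<close>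

lemma claw_m_eq_r:
  assumes ab: "local_nonadj u a b" and c: "c \<in> claw_tips u a b"
  shows "m = r"
proof -
  let ?N = "\<lambda>x. {y. local_nonadj u x y}"
  note cl = clawD[OF c ab] and cs = claw_sym[OF ab c]
  define Z where "Z = {z. E u z \<and> E a z \<and> E b z \<and> E c z}"
  have finZ: "finite Z" by (simp add: Z_def)
  have card_N: "card (?N a) = r + 1" "card (?N b) = r + 1" "card (?N c) = r + 1"
    using card_local_nonadj_r cl by auto
  have int: "?N a \<inter> ?N b = {c}" "(?N a \<union> ?N b) \<inter> ?N c = {a, b}"
  proof -
    have "?N a \<inter> ?N b = claw_tips u a b" by (auto simp: claw_tips_def)
    moreover have "claw_tips u a b = {c}" by (rule claw_tips_singleton[OF ab c])
    ultimately show "?N a \<inter> ?N b = {c}" by simp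
    have "?N a \<inter> ?N c = claw_tips u a c" "?N b \<inter> ?N c = claw_tips u b c" by (auto simp: claw_tips_def)
    moreover have "claw_tips u a c = {b}" by (rule claw_tips_singleton[OF cs(1,3)])
    moreover have "claw_tips u b c = {a}" by (rule claw_tips_singleton[OF cs(2,4)])
    ultimately show "(?N a \<union> ?N b) \<inter> ?N c = {a, b}" unfolding Int_Un_distrib2 by auto
  qed
  have fin: "finite (?N a)" "finite (?N b)" "finite (?N c)" by simp_all
  have "card (?N a \<union> ?N b) + 1 = 2 * (r + 1)"
    using card_Un_Int[OF fin(1,2)] card_N int(1) by simp
  moreover have "card (?N a \<union> ?N b) + card (?N c) = card (?N a \<union> ?N b \<union> ?N c) + 2"
    using card_Un_Int[of "?N a \<union> ?N b" "?N c"] fin int(2) cl(4) by simp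
  ultimately have cU: "card (?N a \<union> ?N b \<union> ?N c) = 3 * r" using card_N by simp
  have split: "{w. E u w} = (?N a \<union> ?N b \<union> ?N c) \<union> Z"
    using cl E_sym by (auto simp: local_nonadj_def Z_def)
  have "card ((?N a \<union> ?N b \<union> ?N c) \<union> Z) = card (?N a \<union> ?N b \<union> ?N c) + card Z"
    by (rule card_Un_disjoint) (use fin finZ in \<open>auto simp: local_nonadj_def Z_def\<close>)
  moreover have "card {w. E u w} = k" using card_nbrs cl(1) E_V by blast
  ultimately have mZ: "m = r + card Z" using split cU k_eq by simp
  define A where "A = ?N a - {b, c}"
  define B where "B = ?N b - {a, c}"
  define C where "C = ?N c - {a, b}"
  have cA: "card A = r - 1" unfolding A_def
    by (subst card_Diff_subset) (use cl ab cs card_N in auto)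
  have cB: "card B = r - 1" unfolding B_def
    by (subst card_Diff_subset) (use cl local_nonadj_sym[OF ab] cs card_N in auto)
  have cC: "card C = r - 1" unfolding C_def
    by (subst card_Diff_subset) (use cl local_nonadj_sym[OF cs(1)] local_nonadj_sym[OF cs(2)] card_N in auto)
  have finABC: "finite A" "finite B" "finite C" by (auto simp: A_def B_def C_def)
  \<comment> \<open>The \<open>r + 1\<close> local non-neighbours of \<open>z\<close> each miss
    exactly one tip, and by \<open>far_nonadj_unique\<close> at most one of them misses a given tip;
    so \<open>r + 1 \<le> 3\<close>. On the other hand they fit into \<open>A\<close>,
    \<open>B\<close>, \<open>C\<close> of size \<open>r - 1\<close> each, so
    \<open>r \<ge> 2\<close>. For \<open>r = 2\<close> all bounds are attained, and \<open>A\<close>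
    lies inside \<open>?N z\<close>.\<close>
  have main: "r = 2 \<and> A \<subseteq> ?N z \<and> (\<forall>x\<in>A. E b x \<and> E c x)" if z: "z \<in> Z" for z
  proof -
    have zE: "E u z" "E a z" "E b z" "E c z" using z by (auto simp: Z_def)
    have cz: "card (?N z) = r + 1" using card_local_nonadj_r zE by blast
    have nz: "x \<noteq> z" "\<not> E z x" "E u x" "x \<noteq> a" "x \<noteq> b" "x \<noteq> c" if "x \<in> ?N z" for x
      using that zE E_sym by (auto simp: local_nonadj_def)
    have Fab: "x = y" if "x \<in> ?N z" "y \<in> ?N z" "E a x" "E b x" "E a y" "E b y" for x y
      using far_nonadj_unique[OF ab zE(1,2,3), of x y] that nz by blast
    have Fac: "x = y" if "x \<in> ?N z" "y \<in> ?N z" "E a x" "E c x" "E a y" "E c y" for x y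
      using far_nonadj_unique[OF cs(1) zE(1,2,4), of x y] that nz by blast
    have Fbc: "x = y" if "x \<in> ?N z" "y \<in> ?N z" "E b x" "E c x" "E b y" "E c y" for x y
      using far_nonadj_unique[OF cs(2) zE(1,3,4), of x y] that nz by blast
    have two: "E a x \<or> E b x" "E a x \<or> E c x" "E b x \<or> E c x" if "x \<in> ?N z" for x
      using claw_two_adj[OF ab c] claw_two_adj[OF cs(1,3)] claw_two_adj[OF cs(2,4)] nz[OF that] by blast+
    \<comment> \<open>Every local non-neighbour of \<open>z\<close> is adjacent to two of the tips,
      so by \<open>far_nonadj_unique\<close> it would coincide with one that is adjacent to all
      three; but there are at least two of them.\<close>
    have no_all: "\<not> (E a x \<and> E b x \<and> E c x)" if x: "x \<in> ?N z" for x
    proof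
      assume all: "E a x \<and> E b x \<and> E c x"
      have "?N z \<subseteq> {x}"
      proof
        fix y assume y: "y \<in> ?N z"
        have "x = y" using two[OF y] Fab[OF x y] Fac[OF x y] Fbc[OF x y] all by blast
        then show "y \<in> {x}" by simp
      qed
      then have "card (?N z) \<le> card {x}" by (intro card_mono) auto
      then show False using cz r_pos by simp
    qed
    have sub: "?N z \<subseteq> A \<union> B \<union> C"
    proof
      fix x assume x: "x \<in> ?N z"
      have "\<not> E a x \<or> \<not> E b x \<or> \<not> E c x" using no_all[OF x] by blast
      then show "x \<in> A \<union> B \<union> C"
        using nz[OF x] cl by (auto simp: A_def B_def C_def local_nonadj_def)
    qed
    have "card (?N z) \<le> card (A \<union> B \<union> C)" by (rule card_mono[OF _ sub]) (use finABC in simp)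
    also have "\<dots> \<le> card A + card B + card C"
      using card_Un_le[of "A \<union> B" C] card_Un_le[of A B] by linarith
    finally have r2: "r \<ge> 2" using cz cA cB cC by linarith
    have one: "card (?N z \<inter> A) \<le> 1" "card (?N z \<inter> B) \<le> 1" "card (?N z \<inter> C) \<le> 1"
    proof -
      have A': "\<not> E a x" if "x \<in> A" for x using that by (auto simp: A_def local_nonadj_def)
      have B': "\<not> E b x" if "x \<in> B" for x using that by (auto simp: B_def local_nonadj_def)
      have C': "\<not> E c x" if "x \<in> C" for x using that by (auto simp: C_def local_nonadj_def)
      have "\<forall>x\<in>?N z \<inter> A. \<forall>y\<in>?N z \<inter> A. x = y"
      proof (intro ballI)
        fix x y assume xy: "x \<in> ?N z \<inter> A" "y \<in> ?N z \<inter> A"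
        then show "x = y" using Fbc[of x y] two[of x] two[of y] A' by blast
      qed
      then show "card (?N z \<inter> A) \<le> 1" using card_le_Suc0_iff_eq[of "?N z \<inter> A"] by simp
      have "\<forall>x\<in>?N z \<inter> B. \<forall>y\<in>?N z \<inter> B. x = y"
      proof (intro ballI)
        fix x y assume xy: "x \<in> ?N z \<inter> B" "y \<in> ?N z \<inter> B"
        then show "x = y" using Fac[of x y] two[of x] two[of y] B' by blast
      qed
      then show "card (?N z \<inter> B) \<le> 1" using card_le_Suc0_iff_eq[of "?N z \<inter> B"] by simp
      have "\<forall>x\<in>?N z \<inter> C. \<forall>y\<in>?N z \<inter> C. x = y"
      proof (intro ballI)
        fix x y assume xy: "x \<in> ?N z \<inter> C" "y \<in> ?N z \<inter> C"
        then show "x = y" using Fab[of x y] two[of x] two[of y] C' by blast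
      qed
      then show "card (?N z \<inter> C) \<le> 1" using card_le_Suc0_iff_eq[of "?N z \<inter> C"] by simp
    qed
    have "?N z = (?N z \<inter> A) \<union> (?N z \<inter> B) \<union> (?N z \<inter> C)" using sub by blast
    then have "card (?N z) = card ((?N z \<inter> A) \<union> (?N z \<inter> B) \<union> (?N z \<inter> C))" by (rule arg_cong)
    also have "\<dots> \<le> card (?N z \<inter> A) + card (?N z \<inter> B) + card (?N z \<inter> C)"
      using card_Un_le[of "(?N z \<inter> A) \<union> (?N z \<inter> B)" "?N z \<inter> C"] card_Un_le[of "?N z \<inter> A" "?N z \<inter> B"] by linarith
    finally have le: "card (?N z) \<le> card (?N z \<inter> A) + card (?N z \<inter> B) + card (?N z \<inter> C)" .
    then have r: "r = 2" using cz one r2 by linarith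
    then have "card (?N z \<inter> A) = 1" using le one cz by linarith
    then have zA: "?N z \<inter> A = A" using cA r card_subset_eq[OF finABC(1), of "?N z \<inter> A"] by auto
    have "E b x \<and> E c x" if x: "x \<in> A" for x
    proof -
      have "x \<in> ?N z" using x zA by auto
      moreover have "\<not> E a x" using x by (auto simp: A_def local_nonadj_def)
      ultimately show ?thesis using two[of x] by blast
    qed
    then show ?thesis using r zA by auto
  qed
  \<comment> \<open>A nonempty \<open>Z\<close> would be a single vertex, giving
    \<open>m = 3\<close>, \<open>k = 7\<close> and 15 vertices; the multiplicity equation becomes
    \<open>4 f = 21\<close>.\<close>
  have "Z = {}"
  proof (rule ccontr)
    assume "Z \<noteq> {}"
    then obtain z where z: "z \<in> Z" by blast
    have r: "r = 2" using main[OF z] by simp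
    then have "card A = 1" using cA by simp
    then obtain a' where a': "A = {a'}" using card_1_singletonE by blast
    have "Z \<subseteq> {z}"
    proof
      fix z' assume z': "z' \<in> Z"
      have 1: "local_nonadj u z a'" "local_nonadj u z' a'" "E b a'" "E c a'" using main[OF z] main[OF z'] a' by auto
      have "z = z'"
        by (rule far_nonadj_unique[OF cs(2), of a'])
          (use 1 z z' E_sym in \<open>auto simp: local_nonadj_def Z_def\<close>)
      then show "z' \<in> {z}" by simp
    qed
    then have "Z = {z}" using z by auto
    then have m: "m = 3" using mZ r by simp
    have "3 * card V = 45" using param_v unfolding m r by simp
    then have v: "card V = 15" by simp
    obtain f where "f * (r + 2) + k + 2 = 2 * card V" using multiplicity by blast
    then have "f * 4 = 21" using k_eq unfolding v r m by simp
    then show False by presburger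
  qed
  then show ?thesis using mZ by simp
qed

text \<open>Greedy choice: keeping \<open>x\<close> costs at most two vertices, \<open>x\<close>
  itself and its single non-neighbour.\<close>

lemma clique_of_near_clique:
  assumes "finite S" "card S \<ge> 2 * n"
    and "\<And>x y z. x \<in> S \<Longrightarrow> y \<in> S \<Longrightarrow> z \<in> S \<Longrightarrow> y \<noteq> x \<Longrightarrow> z \<noteq> x \<Longrightarrow> \<not> E x y \<Longrightarrow> \<not> E x z \<Longrightarrow> y = z"
  shows "\<exists>W\<subseteq>S. card W = n \<and> clique W"
  using assms
proof (induction n arbitrary: S)
  case 0
  show ?case by (rule exI[of _ "{}"]) (simp add: clique_def)
next
  case (Suc n)
  have "S \<noteq> {}" using Suc.prems(2) by auto
  then obtain x where x: "x \<in> S" by blast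
  define T where "T = {y \<in> S. y \<noteq> x \<and> \<not> E x y}"
  have "\<forall>y\<in>T. \<forall>z\<in>T. y = z" using Suc.prems(3)[OF x] by (auto simp: T_def)
  moreover have finT: "finite T" using Suc.prems(1) by (simp add: T_def)
  ultimately have "card T \<le> 1" using card_le_Suc0_iff_eq[of T] by simp
  moreover have "card (insert x T) \<le> Suc (card T)" by (rule card_insert_le_m1) auto
  ultimately have c2: "card (insert x T) \<le> 2" by simp
  have "insert x T \<subseteq> S" using x by (auto simp: T_def)
  then have "card (S - insert x T) = card S - card (insert x T)" using finT by (intro card_Diff_subset) auto
  then have "card (S - insert x T) \<ge> 2 * n" using c2 Suc.prems(2) by simp
  moreover have "finite (S - insert x T)" using Suc.prems(1) by simp
  ultimately have "\<exists>W\<subseteq>S - insert x T. card W = n \<and> clique W"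
    by (intro Suc.IH) (use Suc.prems(3) in auto)
  then obtain W where W: "W \<subseteq> S - insert x T" "card W = n" "clique W" by (elim exE conjE)
  have finW: "finite W" using W(1) Suc.prems(1) finite_subset by blast
  have Ex: "E x y" if "y \<in> W" for y using W(1) that by (auto simp: T_def)
  have "clique (insert x W)" using W(3) Ex E_sym by (auto simp: clique_def)
  moreover have "card (insert x W) = Suc n" using W finW by (subst card_insert_disjoint) auto
  moreover have "insert x W \<subseteq> S" using W(1) x by auto
  ultimately show ?case by (intro exI[of _ "insert x W"] conjI)
qed

text \<open>The local non-neighbours \<open>S\<close> of \<open>u\<close> at \<open>a\<close> number
  \<open>r + 1 \<ge> 10\<close>. Each \<open>x\<close> in \<open>S\<close> has at most one
  non-neighbour in \<open>S\<close>, since two would complete \<open>u\<close>, \<open>x\<close> to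
  two claws at \<open>a\<close>. Hence \<open>S\<close> contains a clique \<open>W\<close> of five
  vertices, one more than \<open>bessel_half\<close> allows.\<close>

lemma claw_r_bound:
  assumes ab: "local_nonadj u a b" and c: "c \<in> claw_tips u a b"
  shows "r < 9"
proof (rule ccontr)
  assume "\<not> r < 9"
  then have r: "r \<ge> 9" by simp
  note cl = clawD[OF c ab] and cs = claw_sym[OF ab c]
  have au: "E a u" using cl E_sym by blast
  have Vs: "u \<in> V" "a \<in> V" "b \<in> V" "c \<in> V" using cl E_V by blast+
  obtain \<Phi> where \<Phi>: "\<And>x y. x \<in> V \<Longrightarrow> y \<in> V \<Longrightarrow> ip V (\<Phi> x) (\<Phi> y) = gram x y"
    using gram_representation by metis
  define S where "S = {w. local_nonadj a u w}"
  have Sw: "E a w" "\<not> E u w" "w \<noteq> u" "w \<in> V" if "w \<in> S" for w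
    using that E_V by (auto simp: S_def local_nonadj_def)
  have Sb: "\<not> E b w" if "w \<in> S" for w by (rule claw_outer_empty[OF ab c Sw(1,2,3)[OF that]])
  have Sc: "\<not> E c w" if "w \<in> S" for w by (rule claw_outer_empty[OF cs(1,3) Sw(1,2,3)[OF that]])
  have "\<exists>W\<subseteq>S. card W = 5 \<and> clique W"
  proof (rule clique_of_near_clique)
    show "finite S" by (simp add: S_def)
    show "card S \<ge> 2 * 5" using card_local_nonadj_r[OF au] r by (simp add: S_def)
    fix x y z assume h: "x \<in> S" "y \<in> S" "z \<in> S" "y \<noteq> x" "z \<noteq> x" "\<not> E x y" "\<not> E x z"
    show "y = z"
      by (rule claw_tips_unique[of a u x]) (use h in \<open>auto simp: S_def claw_tips_def local_nonadj_def\<close>)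
  qed
  then obtain W where W: "W \<subseteq> S" "card W = 5" "clique W" by (elim exE conjE)
  have "card ({y. local_nonadj u b y} - {a, c}) = card {y. local_nonadj u b y} - card {a, c}"
    by (rule card_Diff_subset) (use local_nonadj_sym[OF ab] cs in auto)
  then have "card ({y. local_nonadj u b y} - {a, c}) \<noteq> 0"
    using card_local_nonadj_r[OF cl(2)] r cl(5) by simp
  then have "{y. local_nonadj u b y} - {a, c} \<noteq> {}" by (metis card.empty)
  then obtain y where y: "local_nonadj u b y" "y \<noteq> a" "y \<noteq> c" by auto
  have yE: "E u y" "\<not> E b y" "y \<noteq> b" "y \<in> V" using y E_V by (auto simp: local_nonadj_def)
  have ya: "E a y" using claw_two_adj[OF ab c yE(1) y(2) yE(3) y(3)] yE(2) by blast
  have yc: "E c y" using claw_two_adj[OF cs(2,4) yE(1) yE(3) y(3) y(2)] yE(2) by blast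
  have g0: "gram x x = 2" for x by (simp add: gram_def)
  have g1: "gram x z = 1" "gram z x = 1" if "E x z" for x z using that E_irrefl E_sym by (auto simp: gram_def)
  have g2: "gram x z = 0" "gram z x = 0" if "\<not> E x z" "x \<noteq> z" for x z using that E_sym by (auto simp: gram_def)
  \<comment> \<open>The correction by \<open>u\<close>, \<open>a\<close>, \<open>b\<close>,
    \<open>c\<close> lowers every inner product between vectors of \<open>W\<close> by one, from 2
    and 1 to 1 and 0, so the \<open>w' w\<close> are orthonormal. Likewise \<open>y'\<close> is a
    unit vector, and its inner product with \<open>w' w\<close> is
    \<open>gram y w - 1/2\<close>.\<close>
  define w' where "w' w = (\<lambda>z. \<Phi> w z + \<Phi> u z - \<Phi> a z - (\<Phi> b z + \<Phi> c z) / 2)" for w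
  define y' where "y' = (\<lambda>z. \<Phi> y z - (\<Phi> a z + \<Phi> c z) / 2)"
  note gv = g0 g1[OF cl(1)] g1[OF cl(2)] g1[OF cl(3)] g2[OF cl(7) cl(4)] g2[OF cl(8) cl(5)] g2[OF cl(9) cl(6)]
    g1[OF yE(1)] g2[OF yE(2) yE(3)[symmetric]] g1[OF ya] g1[OF yc]
  have Wg: "gram a w = 1" "gram w a = 1" "gram u w = 0" "gram w u = 0" "gram b w = 0" "gram w b = 0"
    "gram c w = 0" "gram w c = 0" "w \<in> V" if "w \<in> W" for w
  proof -
    have w: "w \<in> S" using W(1) that by auto
    have "b \<noteq> w" "c \<noteq> w" using Sw(2)[OF w] cl by auto
    then show "gram a w = 1" "gram w a = 1" "gram u w = 0" "gram w u = 0" "gram b w = 0" "gram w b = 0"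
      "gram c w = 0" "gram w c = 0" "w \<in> V"
      using g1[OF Sw(1)[OF w]] g2[OF Sw(2)[OF w]] Sw(3)[OF w] g2[OF Sb[OF w]] g2[OF Sc[OF w]] Sw(4)[OF w] by auto
  qed
  have "card W \<le> 4"
  proof (rule bessel_half[where y = y' and w = w' and V = V])
    show "finite W" using W(2) card.infinite by fastforce
    show "ip V (w' i) (w' j) = (if i = j then 1 else 0)" if ij: "i \<in> W" "j \<in> W" for i j
    proof -
      have "gram i j = (if i = j then 2 else 1)" using ij W(3) by (auto simp: gram_def clique_def)
      then show ?thesis unfolding w'_def
        by (simp add: ip_simps \<Phi> Vs Wg[OF ij(1)] Wg[OF ij(2)] gv)
    qed
    show "(ip V y' (w' i))\<^sup>2 = 1 / 4" if i: "i \<in> W" for i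
    proof -
      have "y \<noteq> i" using Sw(2)[of i] W(1) i yE(1) by auto
      then have t: "gram y i = 0 \<or> gram y i = 1" by (simp add: gram_def)
      have "ip V y' (w' i) = gram y i - 1 / 2" unfolding w'_def y'_def
        by (simp add: ip_simps \<Phi> Vs Wg[OF i] gv yE(4))
      then show ?thesis using t by (auto simp: power2_eq_square)
    qed
    show "ip V y' y' = 1" unfolding y'_def by (simp add: ip_simps \<Phi> Vs gv yE(4))
  qed
  then show False using W(2) by simp
qed

text \<open>The multiplicity equation reads \<open>f (r + 2) = 9 r + 6 = 9 (r + 2) - 12\<close>, so
  \<open>r + 2\<close> divides 12 and \<open>r\<close> is 1, 2, 4 or 10; \<open>claw_r_bound\<close>
  removes 10.\<close>

lemma claw_parameters:
  assumes ab: "local_nonadj u a b" and c: "c \<in> claw_tips u a b"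
  shows "m = r" "k = 3 * r" "l + 2 = 2 * r" "card V = 6 * r + 4" "r = 1 \<or> r = 2 \<or> r = 4"
proof -
  show m: "m = r" by (rule claw_m_eq_r[OF ab c])
  show "k = 3 * r" "l + 2 = 2 * r" using k_eq l_eq m by simp_all
  have "r * (6 * r + 4) = r * card V" using param_v unfolding m by (simp add: algebra_simps)
  then have v: "card V = 6 * r + 4" unfolding mult_cancel1 using r_pos by simp
  then show "card V = 6 * r + 4" .
  obtain f where "f * (r + 2) + k + 2 = 2 * card V" using multiplicity by blast
  then have f: "f * (r + 2) = 9 * r + 6" using \<open>k = 3 * r\<close> v by simp
  have "r < 9" by (rule claw_r_bound[OF ab c])
  then have "r \<in> {1, 2, 3, 4, 5, 6, 7, 8}" using r_pos by auto
  moreover have "f * 5 \<noteq> 33" "f * 7 \<noteq> 51" "f * 8 \<noteq> 60" "f * 9 \<noteq> 69" "f * 10 \<noteq> 78" by presburger+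
  ultimately show "r = 1 \<or> r = 2 \<or> r = 4" using f by auto
qed

end

section \<open>Uniqueness of the pentagon and the Clebsch graph\<close>

text \<open>A bijective homomorphism between finite graphs of the same valency is an isomorphism, so
  only edges have to be checked, never non-edges.\<close>

lemma (in sr_graph) rel_iso_of_hom:
  assumes bij: "bij_betw f W V" and deg: "\<And>x. x \<in> W \<Longrightarrow> card {y \<in> W. F x y} = k"
    and hom: "\<And>x y. x \<in> W \<Longrightarrow> y \<in> W \<Longrightarrow> F x y \<Longrightarrow> E (f x) (f y)"
  shows "rel_iso V E W F"
proof (rule rel_iso_sym, rule rel_isoI[OF bij])
  have inj: "inj_on f W" and im: "f ` W = V" using bij by (auto simp: bij_betw_def)
  fix x y assume xy: "x \<in> W" "y \<in> W"
  have fx: "f x \<in> V" using xy im by auto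
  have "f ` {y \<in> W. F x y} = {w. E (f x) w}"
  proof (rule card_subset_eq)
    show "finite {w. E (f x) w}" by simp
    show "f ` {y \<in> W. F x y} \<subseteq> {w. E (f x) w}" using hom xy by auto
    have "card (f ` {y \<in> W. F x y}) = card {y \<in> W. F x y}"
      by (rule card_image) (rule inj_on_subset[OF inj], auto)
    then show "card (f ` {y \<in> W. F x y}) = card {w. E (f x) w}" using deg[OF xy(1)] card_nbrs[OF fx] by simp
  qed
  note eq = this
  show "F x y \<longleftrightarrow> E (f x) (f y)"
  proof
    assume "E (f x) (f y)"
    then have "f y \<in> f ` {y \<in> W. F x y}" unfolding eq by simp
    then obtain y' where "y' \<in> W" "F x y'" "f y = f y'" by auto
    then show "F x y" using inj_onD[OF inj, of y y'] xy by simp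
  qed (rule hom[OF xy])
qed

text \<open>The hypothesis says that the last parameter of the complement is positive: two adjacent
  vertices have a common non-neighbour, which provides \<open>path\<close>.\<close>

lemma (in sr_graph) sr_graph_complement:
  assumes "card V + l > 2 * k"
  shows "sr_graph V (\<lambda>x y. x \<in> V \<and> y \<in> V \<and> x \<noteq> y \<and> \<not> E x y) (card V - 1 - k)
    (card V + m - 2 - 2 * k) (card V + l - 2 * k)"
proof -
  let ?E = "\<lambda>x y. x \<in> V \<and> y \<in> V \<and> x \<noteq> y \<and> \<not> E x y"
  have uni: "card ({w. E x w} \<union> {w. E y w}) + card {w. E x w \<and> E y w} = 2 * k" if "x \<in> V" "y \<in> V" for x y
    using card_Un_Int[of "{w. E x w}" "{w. E y w}"] card_nbrs that by (simp add: Int_def)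
  have adj: "card {w. ?E x w \<and> ?E y w} = card V + l - 2 * k" if xy: "E x y" for x y
  proof -
    have V: "x \<in> V" "y \<in> V" using E_V[OF xy] by auto
    have "{w. ?E x w \<and> ?E y w} = V - ({w. E x w} \<union> {w. E y w})" using V xy E_sym by auto
    moreover have "card (V - ({w. E x w} \<union> {w. E y w})) = card V - card ({w. E x w} \<union> {w. E y w})"
      by (rule card_Diff_subset) (use E_V in auto)
    ultimately show ?thesis using uni[OF V] card_adj[OF xy] by simp
  qed
  show ?thesis
  proof
    show "finite V" by (rule finite_V)
    show "?E x y \<Longrightarrow> x \<in> V \<and> y \<in> V" for x y by simp
    show "?E x y \<Longrightarrow> ?E y x" for x y using E_sym by auto
    show "\<not> ?E x x" for x by simp
    show "card {w. ?E x w} = card V - 1 - k" if x: "x \<in> V" for x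
    proof -
      have "{w. ?E x w} = {w \<in> V. w \<noteq> x \<and> \<not> E x w}" using x by auto
      then show ?thesis using card_nonnbrs[OF x] by simp
    qed
    show "card {w. ?E x w \<and> ?E y w} = card V + m - 2 - 2 * k" if xy: "?E x y" for x y
    proof -
      have "{w. ?E x w \<and> ?E y w} = V - (({w. E x w} \<union> {w. E y w}) \<union> {x, y})" using xy by auto
      moreover have "card (V - (({w. E x w} \<union> {w. E y w}) \<union> {x, y})) = card V - card (({w. E x w} \<union> {w. E y w}) \<union> {x, y})"
        by (rule card_Diff_subset) (use E_V xy in auto)
      moreover have "card (({w. E x w} \<union> {w. E y w}) \<union> {x, y}) = card ({w. E x w} \<union> {w. E y w}) + card {x, y}"
        by (rule card_Un_disjoint) (use xy E_irrefl E_sym in auto)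
      ultimately show ?thesis using uni[of x y] card_nonadj[of x y] xy by simp
    qed
    show "card {w. ?E x w \<and> ?E y w} = card V + l - 2 * k" if "x \<in> V" "y \<in> V" "x \<noteq> y" "\<not> ?E x y" for x y
      using adj[of x y] that by simp
    obtain x y where xy: "E x y" using path by blast
    have V: "x \<in> V" "y \<in> V" "x \<noteq> y" using E_V[OF xy] xy E_irrefl by auto
    have "card {w. ?E x w \<and> ?E y w} \<noteq> 0" using adj[OF xy] assms by linarith
    then have "{w. ?E x w \<and> ?E y w} \<noteq> {}" by (metis card.empty)
    then obtain w where "?E x w" "?E y w" by auto
    then show "\<exists>x y z. ?E x y \<and> ?E y z \<and> x \<noteq> z \<and> \<not> ?E x z"
      using xy V E_sym by (intro exI[of _ x] exI[of _ w] exI[of _ y]) auto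
  qed
qed

lemma (in sr_graph) rel_iso_complement:
  assumes "rel_iso V (\<lambda>x y. x \<in> V \<and> y \<in> V \<and> x \<noteq> y \<and> \<not> E x y) W F"
  shows "rel_iso V E W (\<lambda>x y. x \<noteq> y \<and> \<not> F x y)"
proof -
  obtain f where f: "bij_betw f V W" and iff: "\<And>x y. x \<in> V \<Longrightarrow> y \<in> V \<Longrightarrow> (x \<noteq> y \<and> \<not> E x y) \<longleftrightarrow> F (f x) (f y)"
    using assms unfolding rel_iso_def by auto
  show ?thesis
  proof (rule rel_isoI[OF f])
    fix x y assume xy: "x \<in> V" "y \<in> V"
    have "f x = f y \<longleftrightarrow> x = y" using f xy by (auto simp: bij_betw_def dest: inj_onD)
    then show "E x y \<longleftrightarrow> f x \<noteq> f y \<and> \<not> F (f x) (f y)" using iff[OF xy] E_irrefl by auto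
  qed
qed

text \<open>The neighbours \<open>x\<close>, \<open>y\<close> of \<open>u\<close> and their further
  neighbours \<open>p\<close>, \<open>q\<close> are distinct for want of triangles and quadrangles,
  so they account for all five vertices; the neighbour of \<open>p\<close> besides \<open>x\<close>
  can then only be \<open>q\<close>.\<close>

lemma pentagon_unique:
  assumes "sr_graph V E 2 0 1" "card V = 5"
  shows "rel_iso V E (pverts (cycle_graph 5)) (gadj (cycle_graph 5))"
proof -
  interpret sr_graph V E 2 0 1 by fact
  obtain u where u: "u \<in> V" using V_nonempty by blast
  have two: "\<exists>b. {w. E x w} = {a, b} \<and> a \<noteq> b" if "E x a" for x a
  proof -
    have "card {w. E x w} = 2" using card_nbrs E_V[OF that] by blast
    then obtain p q where pq: "{w. E x w} = {p, q}" "p \<noteq> q" unfolding card_2_iff by blast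
    have "a \<in> {p, q}" unfolding pq(1)[symmetric] using that by simp
    then have "a = p \<or> a = q" by simp
    then show ?thesis
    proof
      assume "a = p" then show ?thesis using pq by (intro exI[of _ q]) simp
    next
      assume "a = q" then show ?thesis using pq by (intro exI[of _ p]) (simp add: insert_commute)
    qed
  qed
  have tri: "\<not> E y w" if "E x y" "E x w" for x y w
  proof -
    have "card {w. E x w \<and> E y w} = 0" by (rule card_adj[OF that(1)])
    then have "{w. E x w \<and> E y w} = {}" using finite_nbrs2[of x "E y"] by (metis card_0_eq)
    then show ?thesis using that by auto
  qed
  have quad: "w = w'" if "E x w" "E y w" "E x w'" "E y w'" "x \<noteq> y" for x y w w'
  proof -
    have "\<not> E x y" using tri[of w x y] that E_sym by auto
    then have "card {w. E x w \<and> E y w} = 1" using card_nonadj that E_V by metis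
    then obtain z where z: "{w. E x w \<and> E y w} = {z}" using card_1_singletonE by blast
    have "w \<in> {z}" "w' \<in> {z}" unfolding z[symmetric] using that by auto
    then show ?thesis by simp
  qed
  have "card {w. E u w} \<noteq> 0" using card_nbrs[OF u] by simp
  then have "{w. E u w} \<noteq> {}" by (metis card.empty)
  then obtain x where ux: "E u x" by auto
  obtain y where y: "{w. E u w} = {x, y}" "x \<noteq> y" using two[OF ux] by blast
  have uy: "E u y" using y(1) by auto
  obtain p where p: "{w. E x w} = {u, p}" "u \<noteq> p" using two[OF E_sym[OF ux]] by blast
  obtain q where q: "{w. E y w} = {u, q}" "u \<noteq> q" using two[OF E_sym[OF uy]] by blast
  have xp: "E x p" and yq: "E y q" using p(1) q(1) by auto
  have xy: "\<not> E x y" using tri[OF ux uy] .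
  have pq: "p \<noteq> q" using quad[OF E_sym[OF ux] E_sym[OF uy], of p] xp yq y(2) p(2) by auto
  have ne: "p \<noteq> x" "p \<noteq> y" "q \<noteq> x" "q \<noteq> y" "u \<noteq> x" "u \<noteq> y" using xp yq ux uy E_irrefl xy E_sym by auto
  have up: "\<not> E u p" "\<not> E u q" using tri[OF E_sym[OF ux] xp] tri[OF E_sym[OF uy] yq] by auto
  have "card {u, x, p, q, y} = 5" using ne y(2) p(2) q(2) pq by simp
  moreover have sub: "{u, x, p, q, y} \<subseteq> V" using u E_V[OF ux] E_V[OF uy] E_V[OF xp] E_V[OF yq] by simp
  ultimately have V: "{u, x, p, q, y} = V" using card_subset_eq[OF finite_V sub] assms(2) by simp
  obtain z where z: "{w. E p w} = {x, z}" "x \<noteq> z" using two[OF E_sym[OF xp]] by blast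
  have pz: "E p z" using z(1) by auto
  have "z \<in> {u, x, p, q, y}" unfolding V using E_V[OF pz] by simp
  moreover have "z \<noteq> u" using pz up E_sym by auto
  moreover have "z \<noteq> p" using pz E_irrefl by auto
  moreover have "z \<noteq> y"
  proof
    assume "z = y"
    then have "p \<in> {w. E y w}" using pz E_sym by auto
    then show False unfolding q(1) using p(2) pq by auto
  qed
  ultimately have "z = q" using z(2) by auto
  then have pq': "E p q" using pz by simp
  define f where "f i = [u, x, p, q, y] ! i" for i
  have n5: "{..<5::nat} = {0, 1, 2, 3, 4}" by auto
  have f: "f 0 = u" "f 1 = x" "f (Suc 0) = x" "f 2 = p" "f 3 = q" "f 4 = y" by (simp_all add: f_def)
  have "bij_betw f (pverts (cycle_graph 5)) V"
    unfolding bij_betw_def cycle_graph_def using V ne y(2) p(2) q(2) pq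
    by (simp add: n5 f inj_on_def)
  moreover have "card {b \<in> pverts (cycle_graph 5). gadj (cycle_graph 5) a b} = 2" if "a \<in> pverts (cycle_graph 5)" for a
  proof -
    have "a \<in> {0, 1, 2, 3, 4}" using that by (auto simp: cycle_graph_def)
    moreover have "{b \<in> pverts (cycle_graph 5). gadj (cycle_graph 5) 0 b} = {1, 4}"
      "{b \<in> pverts (cycle_graph 5). gadj (cycle_graph 5) 1 b} = {0, 2}"
      "{b \<in> pverts (cycle_graph 5). gadj (cycle_graph 5) 2 b} = {1, 3}"
      "{b \<in> pverts (cycle_graph 5). gadj (cycle_graph 5) 3 b} = {2, 4}"
      "{b \<in> pverts (cycle_graph 5). gadj (cycle_graph 5) 4 b} = {0, 3}"
      unfolding cycle_graph_def pair_pre_digraph.simps n5 by auto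
    ultimately show ?thesis by auto
  qed
  moreover have "E (f a) (f b)" if "gadj (cycle_graph 5) a b" for a b
  proof -
    have "(a = 0 \<and> b = 1) \<or> (a = 1 \<and> b = 0) \<or> (a = 1 \<and> b = 2) \<or> (a = 2 \<and> b = 1) \<or> (a = 2 \<and> b = 3) \<or>
      (a = 3 \<and> b = 2) \<or> (a = 3 \<and> b = 4) \<or> (a = 4 \<and> b = 3) \<or> (a = 4 \<and> b = 0) \<or> (a = 0 \<and> b = 4)"
    proof -
      have "a \<in> {0, 1, 2, 3, 4}" "b \<in> {0, 1, 2, 3, 4}" "b = (a + 1) mod 5 \<or> a = (b + 1) mod 5"
        using that by (auto simp: cycle_graph_def)
      then show ?thesis by (elim insertE emptyE; simp)
    qed
    then show ?thesis
      using ux uy xp yq pq' E_sym[OF ux] E_sym[OF uy] E_sym[OF xp] E_sym[OF yq] E_sym[OF pq'] by (auto simp: f)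
  qed
  ultimately show ?thesis by (rule rel_iso_of_hom)
qed

definition sd :: "'b set \<Rightarrow> 'b set \<Rightarrow> 'b set" where "sd A B = (A - B) \<union> (B - A)"

lemma card_split_set: "finite A \<Longrightarrow> card A = card (A - B) + card (A \<inter> B)"
proof -
  assume f: "finite A"
  have "(A - B) \<union> (A \<inter> B) = A" by auto
  moreover have "card ((A - B) \<union> (A \<inter> B)) = card (A - B) + card (A \<inter> B)"
    by (rule card_Un_disjoint) (use f in auto)
  ultimately show ?thesis by simp
qed

lemma card_sd: "finite A \<Longrightarrow> finite B \<Longrightarrow> card (sd A B) + 2 * card (A \<inter> B) = card A + card B"
proof -
  assume f: "finite A" "finite B"
  have "card (sd A B) = card (A - B) + card (B - A)" unfolding sd_def by (rule card_Un_disjoint) (use f in auto)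
  moreover have "card A = card (A - B) + card (A \<inter> B)"
    using card_split_set[OF f(1)] .
  moreover have "card B = card (B - A) + card (A \<inter> B)"
    using card_split_set[OF f(2), of A] by (simp add: Int_commute)
  ultimately show ?thesis by simp
qed

text \<open>Adjacency in the folded 5-cube in terms of representatives: a symmetric difference of
  size 4 becomes one of size 1 after complementing one of the sets.\<close>

definition sd14 :: "'b set \<Rightarrow> 'b set \<Rightarrow> bool" where "sd14 A B \<longleftrightarrow> card (sd A B) = 1 \<or> card (sd A B) = 4"

lemma rel_iso_image_sd:
  assumes h: "bij_betw h T T'"
  shows "rel_iso {A. A \<subseteq> T \<and> card A \<le> 2} sd14 {A. A \<subseteq> T' \<and> card A \<le> 2} sd14"
proof -
  have inj: "inj_on h T" and im: "h ` T = T'" using h by (auto simp: bij_betw_def)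
  have "bij_betw (image h) {A. A \<subseteq> T \<and> card A \<le> 2} {A. A \<subseteq> T' \<and> card A \<le> 2}"
  proof (rule bij_betw_imageI)
    show "inj_on (image h) {A. A \<subseteq> T \<and> card A \<le> 2}"
      by (rule inj_on_subset[OF inj_on_image_Pow[OF inj]]) auto
    show "image h ` {A. A \<subseteq> T \<and> card A \<le> 2} = {A. A \<subseteq> T' \<and> card A \<le> 2}"
    proof (intro equalityI subsetI)
      fix B assume "B \<in> image h ` {A. A \<subseteq> T \<and> card A \<le> 2}"
      then obtain A where A: "B = h ` A" "A \<subseteq> T" "card A \<le> 2" by auto
      then show "B \<in> {A. A \<subseteq> T' \<and> card A \<le> 2}" using im card_image[OF inj_on_subset[OF inj A(2)]] by auto
    next
      fix B assume "B \<in> {A. A \<subseteq> T' \<and> card A \<le> 2}"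
      then have "B \<subseteq> h ` T" "card B \<le> 2" using im by auto
      then obtain A where A: "A \<subseteq> T" "B = h ` A" by (auto simp: subset_image_iff)
      then have "card A \<le> 2" using \<open>card B \<le> 2\<close> card_image[OF inj_on_subset[OF inj A(1)]] by simp
      then show "B \<in> image h ` {A. A \<subseteq> T \<and> card A \<le> 2}" using A by auto
    qed
  qed
  moreover have "sd14 A B \<longleftrightarrow> sd14 (h ` A) (h ` B)"
    if "A \<in> {A. A \<subseteq> T \<and> card A \<le> 2}" "B \<in> {A. A \<subseteq> T \<and> card A \<le> 2}" for A B
  proof -
    have "sd (h ` A) (h ` B) = h ` sd A B"
      using that inj_on_image_set_diff[OF inj, of A B] inj_on_image_set_diff[OF inj, of B A] by (auto simp: sd_def image_Un)
    moreover have "card (h ` sd A B) = card (sd A B)"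
      by (rule card_image, rule inj_on_subset[OF inj]) (use that in \<open>auto simp: sd_def\<close>)
    ultimately show ?thesis by (simp add: sd14_def)
  qed
  ultimately show ?thesis by (rule rel_isoI)
qed

text \<open>The neighbours of \<open>u\<close> become singletons, and a vertex at distance two
  becomes the pair of its common neighbours with \<open>u\<close>. Distinct vertices get distinct
  pairs because two neighbours of \<open>u\<close> have only one common neighbour besides
  \<open>u\<close>.\<close>

lemma folded_5_cube_unique:
  assumes "sr_graph V E 5 0 2"
  shows "rel_iso V E {A. A \<subseteq> {..<5::nat} \<and> card A \<le> 2} sd14"
proof -
  interpret sr_graph V E 5 0 2 by fact
  obtain u where u: "u \<in> V" using V_nonempty by blast
  define T where "T = {w. E u w}"
  have T: "card T = 5" "finite T" using card_nbrs[OF u] by (auto simp: T_def)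
  have tri: "\<not> E y w" if "E x y" "E x w" for x y w
  proof -
    have "card {w. E x w \<and> E y w} = 0" by (rule card_adj[OF that(1)])
    then have "{w. E x w \<and> E y w} = {}" using finite_nbrs2[of x "E y"] by (metis card_0_eq)
    then show ?thesis using that by auto
  qed
  define lab where "lab x = {t. E u t \<and> E x t}" for x
  have finlab: "finite (lab x)" for x by (simp add: lab_def)
  have lab: "card (lab x) = 2" "lab x \<subseteq> T" if "x \<in> V" "x \<noteq> u" "\<not> E u x" for x
    using card_nonadj[of u x] that u by (auto simp: lab_def T_def)
  have labinj: "x = y" if x: "x \<in> V" "x \<noteq> u" "\<not> E u x" and y: "y \<in> V" "y \<noteq> u" "\<not> E u y" and eq: "lab x = lab y" for x y
  proof (rule ccontr)
    assume ne: "x \<noteq> y"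
    obtain s t where st: "lab x = {s, t}" "s \<noteq> t" using lab(1)[OF x] unfolding card_2_iff by blast
    then have "s \<in> lab x" "t \<in> lab x" "s \<in> lab y" "t \<in> lab y" using eq by auto
    then have E: "E u s" "E u t" "E x s" "E x t" "E y s" "E y t" by (auto simp: lab_def)
    have "card {w. E s w \<and> E t w} = 2" using card_nonadj[of s t] tri[OF E(1,2)] st(2) E_V E by blast
    moreover have "{u, x, y} \<subseteq> {w. E s w \<and> E t w}" using E E_sym by auto
    then have "card {u, x, y} \<le> card {w. E s w \<and> E t w}" by (intro card_mono) auto
    ultimately show False using x y ne by simp
  qed
  define g where "g x = (if x = u then {} else if E u x then {x} else lab x)" for x
  have gT: "g x \<subseteq> T" "finite (g x)" for x using finlab by (auto simp: g_def T_def lab_def)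
  have gc: "card (g x) = (if x = u then 0 else if E u x then 1 else 2)" if "x \<in> V" for x
    using lab(1)[OF that] by (auto simp: g_def)
  have inj: "inj_on g V"
  proof (rule inj_onI)
    fix x y assume xy: "x \<in> V" "y \<in> V" "g x = g y"
    then have "card (g x) = card (g y)" by simp
    then have "(if x = u then 0 else if E u x then 1 else 2 :: nat) = (if y = u then 0 else if E u y then 1 else 2)"
      unfolding gc[OF xy(1)] gc[OF xy(2)] .
    then have c: "(x = u \<longleftrightarrow> y = u) \<and> (E u x \<longleftrightarrow> E u y)"
      using E_irrefl[of u] by (cases "x = u"; cases "y = u"; cases "E u x"; cases "E u y") simp_all
    show "x = y"
    proof (cases "x = u \<or> E u x")
      case True
      then show ?thesis
      proof
        assume "x = u"
        moreover have "y = u" using c \<open>x = u\<close> by blast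
        ultimately show "x = y" by simp
      next
        assume ux: "E u x"
        then have uy: "E u y" "x \<noteq> u" "y \<noteq> u" using c E_irrefl[of u] by auto
        have gx: "g x = {x}" using ux uy by (simp add: g_def)
        have gy: "g y = {y}" using uy by (simp add: g_def)
        have "{x} = {y}" using xy(3) unfolding gx gy .
        then show "x = y" by (rule singleton_inject)
      qed
    next
      case False
      then have h: "x \<noteq> u" "\<not> E u x" "y \<noteq> u" "\<not> E u y" using c by auto
      then have "lab x = lab y" using xy(3) by (simp add: g_def)
      then show ?thesis by (rule labinj[OF xy(1) h(1,2) xy(2) h(3,4)])
    qed
  qed
  have im: "g ` V = {A. A \<subseteq> T \<and> card A \<le> 2}"
  proof (intro equalityI subsetI)
    fix A assume "A \<in> g ` V"
    then obtain x where "x \<in> V" "A = g x" by auto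
    then show "A \<in> {A. A \<subseteq> T \<and> card A \<le> 2}" using gT[of x] gc[of x] by auto
  next
    fix A assume "A \<in> {A. A \<subseteq> T \<and> card A \<le> 2}"
    then have A: "A \<subseteq> T" "card A \<le> 2" by auto
    have finA: "finite A" using A(1) T(2) finite_subset by blast
    consider "card A = 0" | "card A = 1" | "card A = 2" using A(2) by linarith
    then show "A \<in> g ` V"
    proof cases
      case 1
      then have "A = g u" using finA by (simp add: g_def)
      then show ?thesis using u by auto
    next
      case 2
      then obtain t where t: "A = {t}" using card_1_singletonE by blast
      then have "E u t" using A(1) by (auto simp: T_def)
      then have "A = g t" "t \<in> V" using t E_irrefl E_V by (auto simp: g_def)
      then show ?thesis by auto
    next
      case 3
      then obtain s t where st: "A = {s, t}" "s \<noteq> t" unfolding card_2_iff by blast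
      have E: "E u s" "E u t" using A(1) st by (auto simp: T_def)
      have "card {w. E s w \<and> E t w} = 2" using card_nonadj[of s t] tri[OF E] st(2) E_V E by blast
      then have "card ({w. E s w \<and> E t w} - {u}) = 1" using E E_sym by simp
      then obtain x where "{w. E s w \<and> E t w} - {u} = {x}" using card_1_singletonE by blast
      then have "x \<in> {w. E s w \<and> E t w} - {u}" by simp
      then have x: "E s x" "E t x" "x \<noteq> u" by auto
      have nx: "\<not> E u x" using tri[OF E_sym[OF E(1)] x(1)] .
      have xV: "x \<in> V" using E_V x by blast
      have "A \<subseteq> lab x" using st E x E_sym by (auto simp: lab_def)
      then have "A = lab x" using card_subset_eq[OF finlab] lab(1)[OF xV x(3) nx] 3 by simp
      then have "A = g x" using x nx by (simp add: g_def)
      then show ?thesis using xV by auto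
    qed
  qed
  have bij: "bij_betw g V {A. A \<subseteq> T \<and> card A \<le> 2}" using inj im by (simp add: bij_betw_def)
  \<comment> \<open>The three outer neighbours of \<open>x\<close> have distinct labels inside the
    3-set \<open>T - lab x\<close>, so they realise all three pairs there, \<open>lab y\<close>
    among them.\<close>
  have disj_adj: "E x y" if x: "x \<in> V" "x \<noteq> u" "\<not> E u x" and y: "y \<in> V" "y \<noteq> u" "\<not> E u y" and dj: "lab x \<inter> lab y = {}" for x y
  proof -
    define Y where "Y = {y. E x y \<and> \<not> E u y}"
    have "{w. E x w} = lab x \<union> Y" by (auto simp: lab_def Y_def)
    moreover have "card (lab x \<union> Y) = card (lab x) + card Y"
      by (rule card_Un_disjoint) (use finlab in \<open>auto simp: lab_def Y_def\<close>)
    ultimately have cY: "card Y = 3" using card_nbrs[OF x(1)] lab(1)[OF x] by simp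
    have Yp: "y' \<in> V" "y' \<noteq> u" "\<not> E u y'" "E x y'" if "y' \<in> Y" for y'
      using that x(3) E_V E_sym by (auto simp: Y_def)
    have injY: "inj_on lab Y" by (rule inj_onI) (use labinj Yp in auto)
    have sub: "lab ` Y \<subseteq> {B. B \<subseteq> T - lab x \<and> card B = 2}"
    proof
      fix B assume "B \<in> lab ` Y"
      then obtain y' where y': "y' \<in> Y" "B = lab y'" by auto
      have "lab x \<inter> lab y' = {}" using tri[OF Yp(4)[OF y'(1)]] by (auto simp: lab_def)
      then show "B \<in> {B. B \<subseteq> T - lab x \<and> card B = 2}" using lab[OF Yp(1,2,3)[OF y'(1)]] y'(2) by auto
    qed
    have "card (T - lab x) = 3" using card_Diff_subset[OF finlab lab(2)[OF x]] lab(1)[OF x] T by simp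
    then have "card {B. B \<subseteq> T - lab x \<and> card B = 2} = 3" using n_subsets[of "T - lab x" 2] T(2) by (simp add: choose_two)
    then have "lab ` Y = {B. B \<subseteq> T - lab x \<and> card B = 2}"
      using cY card_image[OF injY] T(2) by (intro card_subset_eq[OF _ sub]) auto
    moreover have "lab y \<in> {B. B \<subseteq> T - lab x \<and> card B = 2}" using lab[OF y] dj by auto
    ultimately have "lab y \<in> lab ` Y" by simp
    then obtain y' where y': "y' \<in> Y" "lab y = lab y'" by auto
    then have "y = y'" using labinj[OF y Yp(1,2,3)[OF y'(1)]] by simp
    then show ?thesis using Yp(4)[OF y'(1)] by simp
  qed
  have "rel_iso V E {A. A \<subseteq> T \<and> card A \<le> 2} sd14"
  proof (rule rel_isoI[OF bij])
    fix x y assume xy: "x \<in> V" "y \<in> V"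
    have cs: "card (sd (g x) (g y)) + 2 * card (g x \<inter> g y) = card (g x) + card (g y)"
      by (rule card_sd) (use gT in auto)
    \<comment> \<open>The condition \<open>o\<close> orders the types base, neighbour, outer of
      \<open>x\<close> and \<open>y\<close>; the remaining combinations follow by symmetry.\<close>
    have main: "E x y \<longleftrightarrow> sd14 (g x) (g y)" if xy: "x \<in> V" "y \<in> V" and o: "x = u \<or> (E u x \<and> y \<noteq> u) \<or> (x \<noteq> u \<and> \<not> E u x \<and> y \<noteq> u \<and> \<not> E u y)" for x y
      using o
    proof (elim disjE conjE)
      assume "x = u"
      then show ?thesis using gc[OF xy(2)] E_irrefl by (auto simp: sd14_def sd_def g_def)
    next
      assume x: "E u x" "y \<noteq> u"
      have xu: "x \<noteq> u" using x E_irrefl by auto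
      have gx: "g x = {x}" using x xu by (simp add: g_def)
      have cs: "card (sd {x} (g y)) + 2 * card ({x} \<inter> g y) = 1 + card (g y)"
        using card_sd[of "{x}" "g y"] gT by simp
      show ?thesis
      proof (cases "E u y")
        case True
        then have gy: "g y = {y}" using x by (simp add: g_def)
        show ?thesis using tri[OF x(1) True] cs unfolding gx gy by (cases "x = y") (auto simp: sd14_def)
      next
        case False
        then have gy: "g y = lab y" using x by (simp add: g_def)
        have xl: "x \<in> lab y \<longleftrightarrow> E x y" using x E_sym by (auto simp: lab_def)
        show ?thesis using cs lab(1)[OF xy(2) x(2) False] xl unfolding gx gy by (cases "x \<in> lab y") (auto simp: sd14_def)
      qed
    next
      assume h: "x \<noteq> u" "\<not> E u x" "y \<noteq> u" "\<not> E u y"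
      have gx: "g x = lab x" "g y = lab y" using h by (auto simp: g_def)
      have cs: "card (sd (lab x) (lab y)) + 2 * card (lab x \<inter> lab y) = 4"
        using card_sd[of "lab x" "lab y"] finlab lab(1)[OF xy(1) h(1,2)] lab(1)[OF xy(2) h(3,4)] by simp
      show ?thesis
      proof (cases "lab x \<inter> lab y = {}")
        case True
        then show ?thesis using disj_adj[OF xy(1) h(1,2) xy(2) h(3,4)] cs unfolding gx by (simp add: sd14_def)
      next
        case False
        then have "card (lab x \<inter> lab y) \<noteq> 0" using finlab by (metis card_0_eq finite_Int)
        then have "\<not> sd14 (lab x) (lab y)" using cs unfolding sd14_def by presburger
        moreover have "\<not> E x y" using False tri[of _ x y] tri[of x y] by (auto simp: lab_def)
        ultimately show ?thesis unfolding gx by simp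
      qed
    qed
    have sym: "sd14 A B = sd14 B A" for A B :: "'a set" by (simp add: sd14_def sd_def Un_commute)
    show "E x y \<longleftrightarrow> sd14 (g x) (g y)"
      using main[OF xy] main[OF xy(2,1)] sym[of "g x" "g y"] E_sym by metis
  qed
  moreover obtain h where "bij_betw h T {0..<5::nat}" using ex_bij_betw_finite_nat[OF T(2)] T(1) by auto
  then have "bij_betw h T {..<5::nat}" by (simp add: atLeast0LessThan)
  ultimately show ?thesis using rel_iso_image_sd rel_iso_trans by blast
qed

text \<open>Each antipodal pair of vertices of the 5-cube has exactly one member with at most two
  elements.\<close>

lemma clebsch_rel_iso:
  "rel_iso {A. A \<subseteq> {..<5::nat} \<and> card A \<le> 2} (\<lambda>x y. x \<noteq> y \<and> \<not> sd14 x y) (pverts clebsch_graph) (gadj clebsch_graph)"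
proof -
  define S where "S = {A. A \<subseteq> {..<5::nat} \<and> card A \<le> 2}"
  define \<phi> where "\<phi> A = {A, {..<5} - A}" for A :: "nat set"
  have cc: "card ({..<5} - A) = 5 - card A" "card A \<le> 5" if "A \<subseteq> {..<5}" for A :: "nat set"
    using that card_Diff_subset[of A "{..<5}"] finite_subset[OF that] card_mono[OF _ that] by auto
  have W: "pverts clebsch_graph = {{A, {..<5} - A} | A. A \<subseteq> {..<5}}"
    by (simp add: clebsch_graph_def complement_graph_def folded_cube_graph_def Let_def)
  have bij: "bij_betw \<phi> S (pverts clebsch_graph)"
  proof (rule bij_betw_imageI)
    show "inj_on \<phi> S"
    proof (rule inj_onI)
      fix A B assume AB: "A \<in> S" "B \<in> S" "\<phi> A = \<phi> B"
      then have "A = B \<or> A = {..<5} - B" by (auto simp: \<phi>_def doubleton_eq_iff)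
      then show "A = B" using AB cc[of B] by (auto simp: S_def)
    qed
    show "\<phi> ` S = pverts clebsch_graph"
    proof (intro equalityI subsetI)
      fix P assume "P \<in> pverts clebsch_graph"
      then obtain A where A: "P = {A, {..<5} - A}" "A \<subseteq> {..<5}" unfolding W by auto
      show "P \<in> \<phi> ` S"
      proof (cases "card A \<le> 2")
        case True
        then show ?thesis using A by (auto simp: S_def \<phi>_def)
      next
        case False
        then have "{..<5} - A \<in> S" using cc[OF A(2)] by (auto simp: S_def)
        moreover have "P = \<phi> ({..<5} - A)" using A by (auto simp: \<phi>_def double_diff)
        ultimately show ?thesis by blast
      qed
    qed (auto simp: W \<phi>_def S_def)
  qed
  have "rel_iso S (\<lambda>x y. x \<noteq> y \<and> \<not> sd14 x y) (pverts clebsch_graph) (gadj clebsch_graph)"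
  proof (rule rel_isoI[OF bij])
    fix A B assume AB: "A \<in> S" "B \<in> S"
    have S: "A \<subseteq> {..<5}" "B \<subseteq> {..<5}" using AB by (auto simp: S_def)
    have eq: "\<phi> A = \<phi> B \<longleftrightarrow> A = B" using bij AB by (auto simp: bij_betw_def dest: inj_onD)
    have s1: "sd ({..<5} - A) ({..<5} - B) = sd A B" "sd A ({..<5} - B) = {..<5} - sd A B" "sd ({..<5} - A) B = {..<5} - sd A B"
      using S by (auto simp: sd_def)
    have sub: "sd A B \<subseteq> {..<5}" using S by (auto simp: sd_def)
    have "(\<exists>A'\<in>\<phi> A. \<exists>B'\<in>\<phi> B. (A', B') \<in> parcs (cube_graph 5)) \<longleftrightarrow>
      card (sd A B) = 1 \<or> card (sd A ({..<5} - B)) = 1 \<or> card (sd ({..<5} - A) B) = 1 \<or> card (sd ({..<5} - A) ({..<5} - B)) = 1"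
      using S by (auto simp: \<phi>_def cube_graph_def sd_def)
    also have "\<dots> \<longleftrightarrow> sd14 A B" unfolding s1 cc(1)[OF sub] sd14_def using cc(2)[OF sub] by auto
    finally have fc: "(\<exists>A'\<in>\<phi> A. \<exists>B'\<in>\<phi> B. (A', B') \<in> parcs (cube_graph 5)) \<longleftrightarrow> sd14 A B" .
    have mem: "\<phi> A \<in> {{A, {..<5} - A} | A. A \<subseteq> {..<5}}" "\<phi> B \<in> {{A, {..<5} - A} | A. A \<subseteq> {..<5}}"
      using S by (auto simp: \<phi>_def)
    have "gadj clebsch_graph (\<phi> A) (\<phi> B) \<longleftrightarrow> \<phi> A \<noteq> \<phi> B \<and> \<not> (\<exists>A'\<in>\<phi> A. \<exists>B'\<in>\<phi> B. (A', B') \<in> parcs (cube_graph 5))"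
    proof -
      define W0 where "W0 = {{A, {..<5} - A} | A. A \<subseteq> {..<5::nat}}"
      have G: "gadj clebsch_graph P Q \<longleftrightarrow> P \<in> W0 \<and> Q \<in> W0 \<and> P \<noteq> Q \<and>
          \<not> (P \<in> W0 \<and> Q \<in> W0 \<and> P \<noteq> Q \<and> (\<exists>A'\<in>P. \<exists>B'\<in>Q. (A', B') \<in> parcs (cube_graph 5)))" for P Q
        by (simp add: clebsch_graph_def complement_graph_def folded_cube_graph_def Let_def W0_def)
      have m: "\<phi> A \<in> W0" "\<phi> B \<in> W0" using mem by (simp_all only: W0_def)
      show ?thesis unfolding G by (simp only: m) blast
    qed
    then show "(A \<noteq> B \<and> \<not> sd14 A B) \<longleftrightarrow> gadj clebsch_graph (\<phi> A) (\<phi> B)" using eq fc by simp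
  qed
  then show ?thesis by (simp add: S_def)
qed

lemma clebsch_unique:
  assumes "sr_graph V E 10 6 6" "card V = 16"
  shows "rel_iso V E (pverts clebsch_graph) (gadj clebsch_graph)"
proof -
  interpret sr_graph V E 10 6 6 by fact
  have "sr_graph V (\<lambda>x y. x \<in> V \<and> y \<in> V \<and> x \<noteq> y \<and> \<not> E x y) 5 0 2"
    using sr_graph_complement assms(2) by simp
  then have "rel_iso V E {A. A \<subseteq> {..<5::nat} \<and> card A \<le> 2} (\<lambda>x y. x \<noteq> y \<and> \<not> sd14 x y)"
    by (intro rel_iso_complement folded_5_cube_unique)
  then show ?thesis using clebsch_rel_iso by (rule rel_iso_trans)
qed

section \<open>Uniqueness of the Schlaefli graph\<close>

text \<open>Coordinates for the complement of the Schlaefli graph, the collinearity graph of the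
  generalised quadrangle of order (2, 4): a point \<open>Base\<close>, the further points
  \<open>Pos i\<close>, \<open>Neg i\<close> of the five lines through it, and the points
  \<open>Spread A\<close> not collinear with it, collinear with \<open>Pos i\<close> for
  \<open>i\<close> in \<open>A\<close> and with \<open>Neg i\<close> for the other
  \<open>i\<close>.\<close>

datatype schlaefli_label = Base | Pos nat | Neg nat | Spread "nat set"

fun schlaefli_rel :: "schlaefli_label \<Rightarrow> schlaefli_label \<Rightarrow> bool" where
  "schlaefli_rel Base (Pos i) = True"
| "schlaefli_rel Base (Neg i) = True"
| "schlaefli_rel (Pos i) Base = True"
| "schlaefli_rel (Neg i) Base = True"
| "schlaefli_rel (Pos i) (Neg j) = (i = j)"
| "schlaefli_rel (Neg i) (Pos j) = (i = j)"
| "schlaefli_rel (Pos i) (Spread A) = (i \<in> A)"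
| "schlaefli_rel (Spread A) (Pos i) = (i \<in> A)"
| "schlaefli_rel (Neg i) (Spread A) = (i \<notin> A)"
| "schlaefli_rel (Spread A) (Neg i) = (i \<notin> A)"
| "schlaefli_rel (Spread A) (Spread B) = (card {i. i < 5 \<and> (i \<in> A \<longleftrightarrow> i \<in> B)} = 1)"
| "schlaefli_rel _ _ = False"

text \<open>Only subsets of odd size occur: moving along a line from one \<open>Spread\<close> point
  to another keeps the membership of one index and flips the other four. The parity is fixed by
  giving one such point the full set \<open>{..<5}\<close>.\<close>

definition schlaefli_labels :: "schlaefli_label set" where
  "schlaefli_labels = {Base} \<union> Pos ` {..<5} \<union> Neg ` {..<5} \<union> Spread ` {A. A \<subseteq> {..<5} \<and> odd (card A)}"

lemma card_odd_subsets: "card {A. A \<subseteq> {..<5::nat} \<and> odd (card A)} = 16"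
proof -
  let ?S = "\<lambda>j. {A. A \<subseteq> {..<5::nat} \<and> card A = j}"
  have fin: "finite (?S j)" for j by (rule finite_subset[of _ "Pow {..<5}"]) auto
  have "{A. A \<subseteq> {..<5::nat} \<and> odd (card A)} = ?S 1 \<union> ?S 3 \<union> ?S 5"
  proof (intro equalityI subsetI)
    fix A assume A: "A \<in> {A. A \<subseteq> {..<5::nat} \<and> odd (card A)}"
    then have "card A \<le> card {..<5::nat}" by (intro card_mono) auto
    then have "card A = 0 \<or> card A = 1 \<or> card A = 2 \<or> card A = 3 \<or> card A = 4 \<or> card A = 5" by auto
    then show "A \<in> ?S 1 \<union> ?S 3 \<union> ?S 5" using A by auto
  qed auto
  moreover have "card (?S 1 \<union> ?S 3 \<union> ?S 5) = card (?S 1 \<union> ?S 3) + card (?S 5)"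
    by (rule card_Un_disjoint) (use fin in auto)
  moreover have "card (?S 1 \<union> ?S 3) = card (?S 1) + card (?S 3)"
    by (rule card_Un_disjoint) (use fin in auto)
  moreover have "card (?S j) = 5 choose j" for j using n_subsets[of "{..<5::nat}" j] by simp
  ultimately show ?thesis by (simp add: numeral_eq_Suc)
qed

text \<open>Adjacent vertices have one common neighbour, so edges lie on lines of three points, and
  \<open>third x y\<close> is the third one. A vertex \<open>x\<close> not adjacent to
  \<open>u\<close> is coded by \<open>lab x\<close>, the five common neighbours it shares with
  \<open>u\<close>.\<close>

lemma gq24_unique:
  assumes "sr_graph V E 10 1 5" "card V = 27"
  shows "rel_iso V E schlaefli_labels schlaefli_rel"
proof -
  interpret sr_graph V E 10 1 5 by fact
  obtain u where u: "u \<in> V" using V_nonempty by blast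
  define Z where "Z = {x \<in> V. x \<noteq> u \<and> \<not> E u x}"
  have cardZ: "card Z = 16" unfolding Z_def using card_nonnbrs[OF u] assms(2) by simp
  have Zp: "x \<in> V" "x \<noteq> u" "\<not> E u x" "\<not> E x u" if "x \<in> Z" for x using that E_sym by (auto simp: Z_def)
  have one: "w = w'" if "E x y" "E x w" "E y w" "E x w'" "E y w'" for x y w w'
  proof -
    have "card {w. E x w \<and> E y w} \<le> Suc 0" using card_adj[OF that(1)] by simp
    then show ?thesis using card_le_Suc0_iff_eq[OF finite_nbrs2[of x "E y"]] that by auto
  qed
  have ex: "\<exists>w. E x w \<and> E y w" if "E x y" for x y
  proof -
    have "card {w. E x w \<and> E y w} \<noteq> 0" using card_adj[OF that] by simp
    then have "{w. E x w \<and> E y w} \<noteq> {}" by (metis card.empty)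
    then show ?thesis by auto
  qed
  define third where "third x y = (SOME w. E x w \<and> E y w)" for x y
  have th: "E x (third x y)" "E y (third x y)" if "E x y" for x y
    using someI_ex[OF ex[OF that]] by (auto simp: third_def)
  define mate where "mate t = third u t" for t
  have mt: "E u (mate t)" "E t (mate t)" if "E u t" for t using th[OF that] by (auto simp: mate_def)
  have mt_uniq: "s = mate t" if "E u t" "E u s" "E t s" for s t
    by (rule one[OF that(1)]) (use that mt in auto)
  have mtmt: "mate (mate t) = t" if "E u t" for t
    using mt_uniq[OF mt(1)[OF that] that E_sym[OF mt(2)[OF that]]] by simp
  have mt_ne: "mate t \<noteq> t" if "E u t" for t using mt(2)[OF that] E_irrefl by auto
  define lab where "lab x = {t. E u t \<and> E x t}" for x
  have finlab: "finite (lab x)" for x by (simp add: lab_def)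
  have clab: "card (lab x) = 5" if "x \<in> Z" for x
    using card_nonadj[OF u Zp(1)[OF that]] Zp[OF that] by (auto simp: lab_def)
  have trans1: "\<not> (t \<in> lab x \<and> mate t \<in> lab x)" if t: "E u t" and x: "x \<in> Z" for x t
  proof
    assume "t \<in> lab x \<and> mate t \<in> lab x"
    then have "E t x" "E (mate t) x" using E_sym by (auto simp: lab_def)
    then have "u = x" using one[OF mt(2)[OF t], of u x] t mt(1)[OF t] E_sym by auto
    then show False using Zp(2)[OF x] by simp
  qed
  have matelab: "inj_on mate (lab x)" for x
  proof (rule inj_onI)
    fix s t assume st: "s \<in> lab x" "t \<in> lab x" "mate s = mate t"
    have "E u s" "E u t" using st by (auto simp: lab_def)
    then show "s = t" by (metis mtmt st(3))
  qed
  \<comment> \<open>\<open>lab x\<close> has five points, no two on a line through \<open>u\<close>,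
    so it meets each of the five lines through \<open>u\<close> exactly once.\<close>
  have trans: "mate t \<in> lab x \<longleftrightarrow> t \<notin> lab x" if t: "E u t" and x: "x \<in> Z" for x t
  proof -
    have dj: "lab x \<inter> mate ` lab x = {}"
    proof (rule ccontr)
      assume "lab x \<inter> mate ` lab x \<noteq> {}"
      then obtain s where s: "s \<in> lab x" "mate s \<in> lab x" by auto
      then show False using trans1[OF _ x, of s] by (auto simp: lab_def)
    qed
    have "card (lab x \<union> mate ` lab x) = card (lab x) + card (mate ` lab x)"
      by (rule card_Un_disjoint) (use finlab dj in auto)
    then have "card (lab x \<union> mate ` lab x) = 10" using card_image[OF matelab[of x]] clab[OF x] by simp
    moreover have sub: "lab x \<union> mate ` lab x \<subseteq> {w. E u w}" using mt(1) by (auto simp: lab_def)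
    ultimately have "lab x \<union> mate ` lab x = {w. E u w}"
      using card_subset_eq[OF _ sub] card_nbrs[OF u] by simp
    then have "t \<in> lab x \<union> mate ` lab x" using t by simp
    then have "t \<in> lab x \<or> (\<exists>s\<in>lab x. t = mate s)" by auto
    then have "t \<in> lab x \<or> mate t \<in> lab x"
    proof
      assume "\<exists>s\<in>lab x. t = mate s"
      then obtain s where s: "s \<in> lab x" "t = mate s" by blast
      then have "E u s" by (simp add: lab_def)
      then have "mate t = s" using mtmt s(2) by simp
      then show ?thesis using s(1) by simp
    qed simp
    then show ?thesis using trans1[OF t x] by blast
  qed
  have third_Z: "third x t \<in> Z" "lab x \<inter> lab (third x t) = {t}" "E x (third x t)" if x: "x \<in> Z" and t: "t \<in> lab x" for x t
  proof -
    have t': "E u t" "E x t" using t by (auto simp: lab_def)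
    note y = th[OF t'(2)]
    have ny: "\<not> E u (third x t)"
    proof
      assume uy: "E u (third x t)"
      then have "third x t = mate t" using mt_uniq[OF t'(1) uy y(2)] by simp
      then have "mate t \<in> lab x" using uy y(1) by (simp add: lab_def)
      then show False using trans[OF t'(1) x] t by simp
    qed
    have "third x t \<noteq> u" using y(1) Zp(4)[OF x] by auto
    then show "third x t \<in> Z" using ny E_V[OF y(1)] by (auto simp: Z_def)
    show "lab x \<inter> lab (third x t) = {t}"
    proof (intro equalityI subsetI)
      fix s assume "s \<in> lab x \<inter> lab (third x t)"
      then have "E x s" "E (third x t) s" by (auto simp: lab_def)
      then have "s = t" using one[OF y(1), of s t] t'(2) y(2) E_sym by auto
      then show "s \<in> {t}" by simp
    qed (use t t' y E_sym in \<open>auto simp: lab_def\<close>)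
    show "E x (third x t)" by (rule y(1))
  qed
  \<comment> \<open>Five neighbours of \<open>x\<close> are in \<open>lab x\<close>, and each line
    from \<open>x\<close> through one of these supplies one more; that makes all ten.\<close>
  have nbrsZ: "\<exists>t\<in>lab x. y = third x t" if x: "x \<in> Z" and y: "y \<in> Z" "E x y" for x y
  proof -
    have inj: "inj_on (third x) (lab x)"
    proof (rule inj_onI)
      fix s t assume st: "s \<in> lab x" "t \<in> lab x" "third x s = third x t"
      have "{t} = {s}" using third_Z(2)[OF x st(1)] unfolding st(3) third_Z(2)[OF x st(2)] .
      then show "s = t" by simp
    qed
    have "card (lab x \<union> third x ` lab x) = card (lab x) + card (third x ` lab x)"
      by (rule card_Un_disjoint) (use finlab third_Z(1)[OF x] Zp(3) in \<open>auto simp: lab_def\<close>)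
    then have "card (lab x \<union> third x ` lab x) = 10" using card_image[OF inj] clab[OF x] by simp
    moreover have sub: "lab x \<union> third x ` lab x \<subseteq> {w. E x w}" using third_Z(3)[OF x] by (auto simp: lab_def)
    ultimately have "lab x \<union> third x ` lab x = {w. E x w}"
      using card_subset_eq[OF _ sub] card_nbrs[OF Zp(1)[OF x]] by simp
    then have "y \<in> lab x \<union> third x ` lab x" using y by simp
    moreover have "y \<notin> lab x" using Zp(3)[OF y(1)] by (auto simp: lab_def)
    ultimately show ?thesis by auto
  qed
  \<comment> \<open>If \<open>x\<close> and \<open>x'\<close> had the same label, take
    \<open>y\<close> on a line through \<open>x'\<close> and a suitable common neighbour
    \<open>z\<close> of \<open>x\<close> and \<open>y\<close> in \<open>Z\<close>. Then
    \<open>lab z\<close> and \<open>lab y\<close> each keep one point of the common label and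
    contain the mates of the rest, so they share at least three points although \<open>z\<close> and
    \<open>y\<close> are adjacent.\<close>
  have labinj: "x = x'" if x: "x \<in> Z" and x': "x' \<in> Z" and eq: "lab x = lab x'" for x x'
  proof (rule ccontr)
    assume ne: "x \<noteq> x'"
    have sub: "lab x \<subseteq> {w. E x w \<and> E x' w}" using eq by (auto simp: lab_def)
    have nE: "\<not> E x x'"
    proof
      assume "E x x'"
      then have "card {w. E x w \<and> E x' w} = 1" by (rule card_adj)
      moreover have "card (lab x) \<le> card {w. E x w \<and> E x' w}" by (rule card_mono[OF _ sub]) simp
      ultimately show False using clab[OF x] by simp
    qed
    have com: "lab x = {w. E x w \<and> E x' w}"
      using card_subset_eq[OF _ sub] clab[OF x] card_nonadj[OF Zp(1)[OF x] Zp(1)[OF x'] ne nE] by simp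
    have "lab x \<noteq> {}" using clab[OF x] by auto
    then obtain t where t: "t \<in> lab x" by blast
    define y where "y = third x' t"
    have t': "t \<in> lab x'" using t eq by simp
    note yZ = third_Z[OF x' t', folded y_def]
    have xy: "x \<noteq> y" "\<not> E x y"
    proof -
      show "x \<noteq> y" using yZ(3) nE E_sym by auto
      show "\<not> E x y"
      proof
        assume "E x y"
        then have "y \<in> lab x" unfolding com using yZ(3) by simp
        then show False using Zp(3)[OF yZ(1)] by (auto simp: lab_def)
      qed
    qed
    have c5: "card {w. E x w \<and> E y w} = 5" by (rule card_nonadj[OF Zp(1)[OF x] Zp(1)[OF yZ(1)] xy])
    have "\<not> {w. E x w \<and> E y w} \<subseteq> {t, third x t}"
    proof
      assume "{w. E x w \<and> E y w} \<subseteq> {t, third x t}"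
      then have "card {w. E x w \<and> E y w} \<le> card {t, third x t}" by (intro card_mono) auto
      also have "\<dots> \<le> 2" by (simp add: card_insert_if)
      finally show False using c5 by simp
    qed
    then obtain z where z: "E x z" "E y z" "z \<noteq> t" "z \<noteq> third x t" by auto
    have zu: "\<not> E u z"
    proof
      assume "E u z"
      then have "z \<in> lab x' \<inter> lab y" using z eq by (auto simp: lab_def)
      then show False unfolding yZ(2) using z(3) by simp
    qed
    have "z \<noteq> u" using z(1) Zp(4)[OF x] by auto
    then have zZ: "z \<in> Z" using zu E_V[OF z(1)] by (auto simp: Z_def)
    obtain s where s: "s \<in> lab x" "z = third x s" using nbrsZ[OF x zZ z(1)] by blast
    have st: "s \<noteq> t" using s(2) z(4) by auto
    have czy: "lab z \<inter> lab y \<subseteq> {w. E z w \<and> E y w}" by (auto simp: lab_def)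
    have "card (lab z \<inter> lab y) \<le> card {w. E z w \<and> E y w}" by (rule card_mono[OF _ czy]) simp
    then have le1: "card (lab z \<inter> lab y) \<le> 1" using card_adj[OF E_sym[OF z(2)]] by simp
    have sub2: "mate ` (lab x - {s, t}) \<subseteq> lab z \<inter> lab y"
    proof
      fix q assume "q \<in> mate ` (lab x - {s, t})"
      then obtain p where p: "q = mate p" "p \<in> lab x" "p \<noteq> s" "p \<noteq> t" by auto
      have up: "E u p" using p(2) by (simp add: lab_def)
      have "p \<notin> lab z"
      proof
        assume "p \<in> lab z"
        then have "p \<in> lab x \<inter> lab (third x s)" using p(2) s(2) by simp
        then show False unfolding third_Z(2)[OF x s(1)] using p(3) by simp
      qed
      moreover have "p \<notin> lab y"
      proof
        assume "p \<in> lab y"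
        then have "p \<in> lab x' \<inter> lab y" using p(2) eq by simp
        then show False unfolding yZ(2) using p(4) by simp
      qed
      ultimately show "q \<in> lab z \<inter> lab y" using trans[OF up zZ] trans[OF up yZ(1)] p(1) by simp
    qed
    have "card (mate ` (lab x - {s, t})) = card (lab x - {s, t})"
      by (rule card_image, rule inj_on_subset[OF matelab[of x]]) auto
    also have "\<dots> = card (lab x) - card {s, t}" by (rule card_Diff_subset) (use s t in auto)
    also have "\<dots> = 3" using clab[OF x] st by simp
    finally have "3 \<le> card (lab z \<inter> lab y)" using card_mono[OF _ sub2] finlab by simp
    then show False using le1 by simp
  qed
  \<comment> \<open>By \<open>trans\<close>, a label meeting \<open>lab x\<close> in
    \<open>t\<close> alone contains the mates of all other points of \<open>lab x\<close>; this is
    what makes a single shared point sufficient for adjacency.\<close>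
  have lab_eq: "lab y = insert t (mate ` (lab x - {t}))" if x: "x \<in> Z" and y: "y \<in> Z" and t: "lab x \<inter> lab y = {t}" for x y t
  proof -
    have tx: "t \<in> lab x" "t \<in> lab y" using t by auto
    have sub: "insert t (mate ` (lab x - {t})) \<subseteq> lab y"
    proof
      fix q assume "q \<in> insert t (mate ` (lab x - {t}))"
      then consider "q = t" | p where "q = mate p" "p \<in> lab x" "p \<noteq> t" by auto
      then show "q \<in> lab y"
      proof cases
        case 2
        have "p \<notin> lab y"
        proof
          assume "p \<in> lab y"
          then have "p \<in> {t}" unfolding t[symmetric] using 2 by simp
          then show False using 2 by simp
        qed
        then show ?thesis using trans[of p y] y 2 by (simp add: lab_def)
      qed (use tx in simp)
    qed
    have "t \<notin> mate ` (lab x - {t})"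
    proof
      assume "t \<in> mate ` (lab x - {t})"
      then obtain p where p: "t = mate p" "p \<in> lab x" by auto
      then show False using trans[of p x] x tx by (simp add: lab_def)
    qed
    then have "card (insert t (mate ` (lab x - {t}))) = Suc (card (mate ` (lab x - {t})))" using finlab by simp
    also have "card (mate ` (lab x - {t})) = card (lab x - {t})"
      by (rule card_image, rule inj_on_subset[OF matelab[of x]]) auto
    also have "card (lab x - {t}) = 4" using clab[OF x] tx by simp
    finally show ?thesis using card_subset_eq[OF finlab sub] clab[OF y] by simp
  qed
  have adjZ: "E x y \<longleftrightarrow> card (lab x \<inter> lab y) = 1" if x: "x \<in> Z" and y: "y \<in> Z" for x y
  proof
    assume "E x y"
    then obtain t where "t \<in> lab x" "y = third x t" using nbrsZ[OF x y] by blast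
    note t = this
    show "card (lab x \<inter> lab y) = 1" unfolding t(2) third_Z(2)[OF x t(1)] by simp
  next
    assume "card (lab x \<inter> lab y) = 1"
    then obtain t where t: "lab x \<inter> lab y = {t}" using card_1_singletonE by blast
    then have tx: "t \<in> lab x" by auto
    have "lab y = lab (third x t)" using lab_eq[OF x y t] lab_eq[OF x third_Z(1)[OF x tx] third_Z(2)[OF x tx]] by simp
    then have "y = third x t" by (rule labinj[OF y third_Z(1)[OF x tx]])
    then show "E x y" using third_Z(3)[OF x tx] by simp
  qed
  have "Z \<noteq> {}" using cardZ by auto
  then obtain x0 where x0: "x0 \<in> Z" by blast
  obtain e where e0: "bij_betw e {0..<5::nat} (lab x0)" using ex_bij_betw_nat_finite[OF finlab[of x0]] clab[OF x0] by auto
  have eim: "\<exists>i<5. t = e i" if "t \<in> lab x0" for t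
  proof -
    have "t \<in> e ` {0..<5}" using e0 that by (simp add: bij_betw_def)
    then show ?thesis by auto
  qed
  have e: "E u (e i)" "e i \<in> lab x0" if "i < 5" for i using e0 that by (auto simp: bij_betw_def lab_def)
  have einj: "i = j" if "i < 5" "j < 5" "e i = e j" for i j
    using e0 that by (auto simp: bij_betw_def dest: inj_onD)
  define A where "A x = {i. i < 5 \<and> e i \<in> lab x}" for x
  \<comment> \<open>\<open>pt x i\<close> is the point of \<open>lab x\<close> on the
    \<open>i\<close>-th line through \<open>u\<close>; the lines are numbered by the points of
    \<open>lab x0\<close>, so that \<open>x0\<close> receives the full set as its code.\<close>
  define pt where "pt x i = (if i \<in> A x then e i else mate (e i))" for x i
  have em: "e i \<noteq> mate (e j)" if "i < 5" "j < 5" for i j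
    using trans[OF e(1)[OF that(2)] x0] e(2)[OF that(1)] e(2)[OF that(2)] by auto
  have minj: "i = j" if ij: "i < 5" "j < 5" "mate (e i) = mate (e j)" for i j
  proof (rule einj[OF ij(1,2)])
    show "e i = e j" by (metis mtmt[OF e(1)[OF ij(1)]] mtmt[OF e(1)[OF ij(2)]] ij(3))
  qed
  have Tcases: "\<exists>i<5. t = e i \<or> t = mate (e i)" if t: "E u t" for t
  proof (cases "t \<in> lab x0")
    case True
    then show ?thesis using eim by blast
  next
    case False
    then have "mate t \<in> lab x0" using trans[OF t x0] by simp
    then obtain i where "i < 5" "mate t = e i" using eim by blast
    then have "t = mate (e i)" using mtmt[OF t] by simp
    then show ?thesis using \<open>i < 5\<close> by auto
  qed
  have ptlab: "pt x i \<in> lab y \<longleftrightarrow> (i \<in> A x \<longleftrightarrow> i \<in> A y)" if "i < 5" "y \<in> Z" for x y i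
    using trans[OF e(1)[OF that(1)] that(2)] that by (auto simp: pt_def A_def)
  have pt_inj: "inj_on (pt x) {..<5}" for x
    using einj em minj by (auto simp: inj_on_def pt_def split: if_splits) (metis em)+
  have lab_pt: "lab x = pt x ` {..<5}" if x: "x \<in> Z" for x
  proof (rule sym, rule card_subset_eq[OF finlab])
    show "pt x ` {..<5} \<subseteq> lab x" using ptlab[OF _ x] by auto
    show "card (pt x ` {..<5}) = card (lab x)" using card_image[OF pt_inj[of x]] clab[OF x] by simp
  qed
  have Aint: "card (lab x \<inter> lab y) = card {i. i < 5 \<and> (i \<in> A x \<longleftrightarrow> i \<in> A y)}" if x: "x \<in> Z" and y: "y \<in> Z" for x y
  proof -
    have eq: "lab x \<inter> lab y = pt x ` {i. i < 5 \<and> (i \<in> A x \<longleftrightarrow> i \<in> A y)}"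
    proof (intro equalityI subsetI)
      fix t assume t: "t \<in> lab x \<inter> lab y"
      then have "t \<in> pt x ` {..<5}" unfolding lab_pt[OF x, symmetric] by simp
      then obtain i where i: "i < 5" "t = pt x i" by auto
      then show "t \<in> pt x ` {i. i < 5 \<and> (i \<in> A x \<longleftrightarrow> i \<in> A y)}" using t ptlab[OF i(1) y, of x] by simp
    next
      fix t assume "t \<in> pt x ` {i. i < 5 \<and> (i \<in> A x \<longleftrightarrow> i \<in> A y)}"
      then obtain i where i: "i < 5" "i \<in> A x \<longleftrightarrow> i \<in> A y" "t = pt x i" by blast
      then show "t \<in> lab x \<inter> lab y" using ptlab[OF i(1) y, of x] ptlab[OF i(1) x, of x] by simp
    qed
    have inj: "inj_on (pt x) {i. i < 5 \<and> (i \<in> A x \<longleftrightarrow> i \<in> A y)}"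
      by (rule inj_on_subset[OF pt_inj[of x]]) auto
    show ?thesis unfolding eq by (rule card_image[OF inj])
  qed
  have Ainj: "inj_on A Z"
  proof (rule inj_onI)
    fix x y assume xy: "x \<in> Z" "y \<in> Z" "A x = A y"
    have "pt x i = pt y i" for i unfolding pt_def xy(3) by (rule refl)
    then have "pt x = pt y" by (rule ext)
    then have "pt x ` {..<5} = pt y ` {..<5}" by simp
    then have "lab x = lab y" unfolding lab_pt[OF xy(1)] lab_pt[OF xy(2)] .
    then show "x = y" by (rule labinj[OF xy(1,2)])
  qed
  \<comment> \<open>\<open>flip i\<close> keeps the membership of \<open>i\<close> and reverses that
    of every other index: the effect on \<open>A\<close> of moving from \<open>x\<close> to
    \<open>third x (pt x i)\<close>.\<close>
  define flip where "flip i B = {j. j < (5::nat) \<and> (j \<in> B \<longleftrightarrow> j = i)}" for i :: nat and B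
  have flipA: "\<exists>y\<in>Z. A y = flip i (A x)" if x: "x \<in> Z" and i: "i < 5" for x i
  proof -
    have t: "pt x i \<in> lab x" using ptlab[OF i x] by simp
    let ?y = "third x (pt x i)"
    have y: "?y \<in> Z" "lab x \<inter> lab ?y = {pt x i}" using third_Z[OF x t] by auto
    have "j \<in> A ?y \<longleftrightarrow> (j \<in> A x \<longleftrightarrow> j = i)" if j: "j < 5" for j
    proof -
      have "pt x j \<in> lab ?y \<longleftrightarrow> pt x j \<in> lab x \<inter> lab ?y" using ptlab[OF j x] by simp
      also have "\<dots> \<longleftrightarrow> j = i" unfolding y(2) using inj_onD[OF pt_inj[of x], of j i] i j by auto
      finally show ?thesis using ptlab[OF j y(1), of x] by auto
    qed
    then have "A ?y = flip i (A x)" by (auto simp: flip_def A_def)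
    then show ?thesis using y(1) by blast
  qed
  \<comment> \<open>Two flips, along \<open>i\<close> and along \<open>j\<close>, change the
    membership of \<open>i\<close> and \<open>j\<close> only.\<close>
  have toggle: "\<exists>y\<in>Z. A y = B" if x: "x \<in> Z" "A x = B \<union> {i, j}" and ij: "i < 5" "j < 5" "i \<noteq> j" "i \<notin> B" "j \<notin> B" "B \<subseteq> {..<5}" for x B i j
  proof -
    obtain z where z: "z \<in> Z" "A z = flip i (A x)" using flipA[OF x(1) ij(1)] by blast
    obtain y where y: "y \<in> Z" "A y = flip j (A z)" using flipA[OF z(1) ij(2)] by blast
    have "flip j (flip i (B \<union> {i, j})) = B" using ij by (auto simp: flip_def)
    then show ?thesis using y z x(2) by auto
  qed
  have reach: "\<exists>x\<in>Z. A x = B" if "B \<subseteq> {..<5}" "odd (card B)" for B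
    using that
  proof (induction "card ({..<5} - B)" arbitrary: B rule: less_induct)
    case less
    have finB: "finite B" using less.prems(1) finite_subset by blast
    have cB: "card ({..<5} - B) + card B = 5"
      using card_Diff_subset[OF finB less.prems(1)] card_mono[OF _ less.prems(1)] by simp
    show ?case
    proof (cases "{..<5} - B = {}")
      case True
      then have "B = {..<5}" using less.prems(1) by auto
      moreover have "A x0 = {..<5}" using e(2) by (auto simp: A_def)
      ultimately show ?thesis using x0 by blast
    next
      case False
      then obtain i where i: "i < 5" "i \<notin> B" by auto
      have "{..<5} - B \<noteq> {i}"
      proof
        assume eq: "{..<5} - B = {i}"
        have "card B = 4" using cB unfolding eq by simp
        then show False using less.prems(2) by simp
      qed
      then obtain j where j: "j < 5" "j \<notin> B" "j \<noteq> i" using i by blast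
      have sub: "B \<union> {i, j} \<subseteq> {..<5}" using i j less.prems(1) by auto
      have "card (B \<union> {i, j}) = card B + card {i, j}" by (rule card_Un_disjoint) (use i j finB in auto)
      then have "odd (card (B \<union> {i, j}))" using less.prems(2) j(3) by simp
      note od = this
      have lt: "card ({..<5} - (B \<union> {i, j})) < card ({..<5} - B)"
        by (rule psubset_card_mono) (use i in auto)
      obtain x where x: "x \<in> Z" "A x = B \<union> {i, j}" using less.hyps[OF lt sub od] by blast
      show ?thesis by (rule toggle[OF x i(1) j(1) j(3)[symmetric] i(2) j(2) less.prems(1)])
    qed
  qed
  \<comment> \<open>There are 16 odd sets and 16 vertices in \<open>Z\<close>, so once all odd sets
    are reached no other code can occur.\<close>
  have Aim: "A ` Z = {B. B \<subseteq> {..<5} \<and> odd (card B)}"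
  proof (rule sym, rule card_subset_eq)
    show "finite (A ` Z)" using finite_V by (simp add: Z_def)
    show "{B. B \<subseteq> {..<5} \<and> odd (card B)} \<subseteq> A ` Z" using reach by blast
    show "card {B. B \<subseteq> {..<5::nat} \<and> odd (card B)} = card (A ` Z)"
      using card_odd_subsets card_image[OF Ainj] cardZ by simp
  qed
  define g where "g x = (if x = u then Base else if E u x then
      (if x \<in> lab x0 then Pos (inv_into {..<5} e x) else Neg (inv_into {..<5} e (mate x))) else Spread (A x))" for x
  have einj': "inj_on e {..<5}" using einj by (auto simp: inj_on_def)
  have ge: "g (e i) = Pos i" "g (mate (e i)) = Neg i" if i: "i < 5" for i
  proof -
    have 1: "E u (e i)" "e i \<in> lab x0" "e i \<noteq> u" using e[OF i] E_irrefl by auto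
    then show "g (e i) = Pos i" using inv_into_f_f[OF einj', of i] i by (simp add: g_def)
    have "mate (e i) \<notin> lab x0" using trans[OF 1(1) x0] 1(2) by simp
    moreover have "E u (mate (e i))" "mate (e i) \<noteq> u" using mt(1)[OF 1(1)] E_irrefl by auto
    ultimately show "g (mate (e i)) = Neg i" using inv_into_f_f[OF einj', of i] i mtmt[OF 1(1)] by (simp add: g_def)
  qed
  have gZ: "g x = Spread (A x)" if "x \<in> Z" for x using Zp[OF that] by (simp add: g_def)
  have gu: "g u = Base" by (simp add: g_def)
  have Vcases: "x = u \<or> (\<exists>i<5. x = e i) \<or> (\<exists>i<5. x = mate (e i)) \<or> x \<in> Z" if "x \<in> V" for x
    using that Tcases[of x] by (auto simp: Z_def)
  have mV: "mate (e i) \<in> V" "e i \<in> V" if "i < 5" for i using e(1)[OF that] mt(1)[OF e(1)[OF that]] E_V by blast+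
  have ZV: "Z \<subseteq> V" by (auto simp: Z_def)
  have bij: "bij_betw g V schlaefli_labels"
  proof (rule bij_betw_imageI)
    define dec where "dec p = (case p of Base \<Rightarrow> u | Pos i \<Rightarrow> e i | Neg i \<Rightarrow> mate (e i) | Spread B \<Rightarrow> inv_into Z A B)" for p
    have "dec (g x) = x" if "x \<in> V" for x
      using Vcases[OF that]
    proof (elim disjE exE conjE)
      assume "x = u" then show ?thesis by (simp add: gu dec_def)
    next
      fix i assume i: "i < 5" "x = e i" show ?thesis unfolding i(2) ge(1)[OF i(1)] by (simp add: dec_def)
    next
      fix i assume i: "i < 5" "x = mate (e i)" show ?thesis unfolding i(2) ge(2)[OF i(1)] by (simp add: dec_def)
    next
      assume x: "x \<in> Z"
      show ?thesis unfolding gZ[OF x] using inv_into_f_f[OF Ainj x] by (simp add: dec_def)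
    qed
    then show "inj_on g V" by (rule inj_on_inverseI)
    show "g ` V = schlaefli_labels"
    proof (intro equalityI subsetI)
      fix p assume "p \<in> g ` V"
      then obtain x where x: "x \<in> V" "p = g x" by auto
      show "p \<in> schlaefli_labels" using Vcases[OF x(1)]
      proof (elim disjE exE conjE)
        assume "x = u" then show ?thesis using x(2) gu by (simp add: schlaefli_labels_def)
      next
        fix i assume i: "i < 5" "x = e i" show ?thesis unfolding x(2) i(2) ge(1)[OF i(1)] using i(1) by (simp add: schlaefli_labels_def)
      next
        fix i assume i: "i < 5" "x = mate (e i)" show ?thesis unfolding x(2) i(2) ge(2)[OF i(1)] using i(1) by (simp add: schlaefli_labels_def)
      next
        assume xZ: "x \<in> Z"
        then have "A x \<in> {B. B \<subseteq> {..<5} \<and> odd (card B)}" unfolding Aim[symmetric] by simp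
        then show ?thesis unfolding x(2) gZ[OF xZ] by (simp add: schlaefli_labels_def)
      qed
    next
      fix p assume "p \<in> schlaefli_labels"
      then consider "p = Base" | i where "p = Pos i" "i < 5" | i where "p = Neg i" "i < 5"
        | B where "p = Spread B" "B \<in> A ` Z" unfolding schlaefli_labels_def Aim by auto
      then show "p \<in> g ` V"
      proof cases
        case 1 then show ?thesis using gu u by (metis imageI)
      next
        case 2 then show ?thesis using ge(1) mV(2) by (metis imageI)
      next
        case 3 then show ?thesis using ge(2) mV(1) by (metis imageI)
      next
        case 4
        then obtain x where "x \<in> Z" "B = A x" by auto
        then show ?thesis using gZ[of x] ZV 4 by (metis imageI subsetD)
      qed
    qed
  qed
  have uE: "\<not> E u u" "E u (e i)" "E (e i) u" "E u (mate (e i))" "E (mate (e i)) u" if "i < 5" for i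
    by (rule E_irrefl e(1)[OF that] mt(1)[OF e(1)[OF that]] E_sym[OF e(1)[OF that]] E_sym[OF mt(1)[OF e(1)[OF that]]])+
  have TE: "\<not> E (e i) (e j)" "E (e i) (mate (e j)) \<longleftrightarrow> i = j" "E (mate (e j)) (e i) \<longleftrightarrow> j = i"
    "\<not> E (mate (e i)) (mate (e j))" if ij: "i < 5" "j < 5" for i j
  proof -
    have E: "E u (e i)" "E u (e j)" "E u (mate (e i))" "E u (mate (e j))"
      using uE(2,4)[OF ij(1)] uE(2,4)[OF ij(2)] by simp_all
    show "\<not> E (e i) (e j)" using mt_uniq[OF E(1,2)] em[OF ij(2,1)] by auto
    show 2: "E (e i) (mate (e j)) \<longleftrightarrow> i = j"
    proof
      assume "E (e i) (mate (e j))"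
      then have "mate (e j) = mate (e i)" by (rule mt_uniq[OF E(1,4)])
      then show "i = j" using minj[OF ij(2,1)] by simp
    qed (use mt(2)[OF E(1)] in simp)
    show "E (mate (e j)) (e i) \<longleftrightarrow> j = i" unfolding E_sym_iff[of "mate (e j)"] 2 by (rule eq_commute)
    show "\<not> E (mate (e i)) (mate (e j))"
    proof
      assume "E (mate (e i)) (mate (e j))"
      then have "mate (e j) = mate (mate (e i))" by (rule mt_uniq[OF E(3,4)])
      then show False using mtmt[OF E(1)] em[OF ij] by simp
    qed
  qed
  have ZE: "E (e i) x \<longleftrightarrow> i \<in> A x" "E x (e i) \<longleftrightarrow> i \<in> A x" "E (mate (e i)) x \<longleftrightarrow> i \<notin> A x" "E x (mate (e i)) \<longleftrightarrow> i \<notin> A x"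
    if i: "i < 5" and x: "x \<in> Z" for i x
  proof -
    have 1: "E x (e i) \<longleftrightarrow> i \<in> A x" using e(1)[OF i] i by (auto simp: A_def lab_def)
    have 2: "E x (mate (e i)) \<longleftrightarrow> i \<notin> A x"
      using trans[OF e(1)[OF i] x] mt(1)[OF e(1)[OF i]] i by (auto simp: A_def lab_def)
    show "E (e i) x \<longleftrightarrow> i \<in> A x" "E x (e i) \<longleftrightarrow> i \<in> A x" "E (mate (e i)) x \<longleftrightarrow> i \<notin> A x" "E x (mate (e i)) \<longleftrightarrow> i \<notin> A x"
      using 1 2 E_sym_iff by blast+
  qed
  have ZZ: "E x y \<longleftrightarrow> card {i. i < 5 \<and> (i \<in> A x \<longleftrightarrow> i \<in> A y)} = 1" if "x \<in> Z" "y \<in> Z" for x y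
    using adjZ[OF that] Aint[OF that] by simp
  have uZ: "\<not> E u x" "\<not> E x u" if "x \<in> Z" for x using Zp[OF that] by auto
  show ?thesis
  proof (rule rel_isoI[OF bij])
    fix x y assume xy: "x \<in> V" "y \<in> V"
    show "E x y \<longleftrightarrow> schlaefli_rel (g x) (g y)"
      using Vcases[OF xy(1)]
    proof (elim disjE exE conjE)
      assume x: "x = u"
      show ?thesis using Vcases[OF xy(2)]
        by (elim disjE exE conjE) (simp_all add: x ge gZ gu uE uZ E_irrefl)
    next
      fix i assume i: "i < 5" "x = e i"
      show ?thesis unfolding i(2) using Vcases[OF xy(2)]
        by (elim disjE exE conjE) (simp_all add: ge gZ gu uE TE ZE i(1))
    next
      fix i assume i: "i < 5" "x = mate (e i)"
      show ?thesis unfolding i(2) using Vcases[OF xy(2)]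
        by (elim disjE exE conjE) (simp_all add: ge gZ gu uE TE ZE i(1))
    next
      assume x: "x \<in> Z"
      show ?thesis using Vcases[OF xy(2)]
        by (elim disjE exE conjE) (simp_all add: ge gZ gu ZE ZZ uZ x)
    qed
  qed
qed

lemma schlaefli_unique:
  assumes "sr_graph V E 16 10 8" "card V = 27"
  shows "rel_iso V E schlaefli_labels (\<lambda>x y. x \<noteq> y \<and> \<not> schlaefli_rel x y)"
proof -
  interpret sr_graph V E 16 10 8 by fact
  have "sr_graph V (\<lambda>x y. x \<in> V \<and> y \<in> V \<and> x \<noteq> y \<and> \<not> E x y) 10 1 5"
    using sr_graph_complement assms(2) by simp
  then show ?thesis using assms(2) by (intro rel_iso_complement gq24_unique)
qed

section \<open>Uniqueness of the Shrikhande graph\<close>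

text \<open>Each edge in one direction, in coordinates about the base vertex \<open>(0, 0)\<close>:
  \<open>(1, i)\<close> runs through the hexagon of its neighbours, \<open>(2, i)\<close> is the
  second common neighbour of the consecutive hexagon vertices \<open>i\<close>,
  \<open>i + 1\<close>, and \<open>(3, i)\<close> that of the opposite ones \<open>i\<close>,
  \<open>i + 3\<close>.\<close>

fun shrikhande_rel0 :: "nat \<times> nat \<Rightarrow> nat \<times> nat \<Rightarrow> bool" where
  "shrikhande_rel0 (a, i) (b, j) \<longleftrightarrow> (a = 0 \<and> b = 1) \<or> (a = 1 \<and> b = 1 \<and> j = (i + 1) mod 6) \<or>
    (a = 2 \<and> b = 1 \<and> (j = i \<or> j = (i + 1) mod 6)) \<or> (a = 1 \<and> b = 3 \<and> j = i mod 3) \<or>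
    (a = 2 \<and> b = 3 \<and> (j = i mod 3 \<or> j = (i + 1) mod 3)) \<or> (a = 2 \<and> b = 2 \<and> j = (i + 2) mod 6)"

definition shrikhande_rel :: "nat \<times> nat \<Rightarrow> nat \<times> nat \<Rightarrow> bool" where
  "shrikhande_rel x y \<longleftrightarrow> shrikhande_rel0 x y \<or> shrikhande_rel0 y x"

definition shrikhande_labels :: "(nat \<times> nat) list" where
  "shrikhande_labels = (0, 0) # map (Pair 1) [0, 1, 2, 3, 4, 5] @ map (Pair 2) [0, 1, 2, 3, 4, 5] @ map (Pair 3) [0, 1, 2]"

lemma shrikhande_labels_degree: "\<forall>x\<in>set shrikhande_labels. length (filter (shrikhande_rel x) shrikhande_labels) = 6"
  by code_simp

lemma shrikhande_labels_distinct: "distinct shrikhande_labels"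
  by code_simp

section \<open>Reconstruction of the graph from a hexagonal neighbourhood\<close>

lemma periodic_mod:
  fixes f :: "nat \<Rightarrow> 'b"
  assumes "\<And>i. f (i + c) = f i" shows "f (n mod c) = f n"
proof -
  have "f (a + c * k) = f a" for a k
  proof (induction k)
    case (Suc k)
    have "f (a + c * Suc k) = f ((a + c * k) + c)" by (simp add: algebra_simps)
    then show ?case using assms Suc by simp
  qed simp
  from this[of "n mod c" "n div c"] show ?thesis by simp
qed

text \<open>Reduces equalities of shifted residues to numerals, which simplification decides; the
  index computations on the hexagon rest on this.\<close>

lemma mod6_iff:
  "(i + a) mod 6 = (i + b) mod 6 \<longleftrightarrow> a mod 6 = b mod (6::nat)"
  "i mod 6 = (i + b) mod 6 \<longleftrightarrow> b mod 6 = (0::nat)"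
  "(i + a) mod 6 = i mod 6 \<longleftrightarrow> a mod 6 = (0::nat)"
  using cong_add_lcancel_nat[of i a b 6] cong_add_lcancel_nat[of i 0 b 6] cong_add_lcancel_nat[of i a 0 6]
  by (auto simp: cong_def)

lemma mod6_shift: "(i + c) mod 6 = (i mod 6 + c) mod (6::nat)"
  by (rule mod_add_left_eq[symmetric])

lemma mod6_in: "i mod 6 \<in> set [0..<6::nat]" by simp

lemma mod6_cases: "i mod 6 = 0 \<or> i mod 6 = 1 \<or> i mod 6 = 2 \<or> i mod 6 = 3 \<or> i mod 6 = 4 \<or> i mod 6 = (5::nat)"
proof -
  have "\<forall>a\<in>set [0..<6::nat]. a = 0 \<or> a = 1 \<or> a = 2 \<or> a = 3 \<or> a = 4 \<or> a = 5" by code_simp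
  then show ?thesis using mod6_in by blast
qed

text \<open>\<open>h\<close> is indexed by all natural numbers with period 6, so that
  \<open>h (i + 5)\<close> can stand for the predecessor of \<open>h i\<close>.\<close>

locale hexagon = sr_graph V E 6 2 2 for V :: "'a set" and E +
  fixes u :: 'a and h :: "nat \<Rightarrow> 'a"
  assumes Euh: "E u (h i)" and h_eq: "h i = h j \<longleftrightarrow> i mod 6 = j mod 6" and h_adj: "E (h i) (h (i + 1))"
begin

lemma two_of_two:
  assumes "card S = 2" "a \<in> S" "b \<in> S" "a \<noteq> b" shows "S = {a, b}"
proof -
  have "finite S" using assms(1) card.infinite by fastforce
  then show ?thesis using card_subset_eq[of S "{a, b}"] assms by simp
qed

lemma h6: "h (i + 6) = h i" unfolding h_eq by simp

lemma u_V: "u \<in> V" using Euh[of 0] E_V by blast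

lemma u_nbr: "E u x \<Longrightarrow> \<exists>i<6. x = h i"
proof -
  assume x: "E u x"
  have "h ` {..<6} = {w. E u w}"
  proof (rule card_subset_eq)
    have "inj_on h {..<6}" by (auto simp: inj_on_def h_eq)
    then show "card (h ` {..<6}) = card {w. E u w}" using card_nbrs[OF u_V] by (simp add: card_image)
  qed (use Euh in auto)
  then have "x \<in> h ` {..<6}" using x by simp
  then show ?thesis by auto
qed

lemma h_adj': "E (h i) (h (i + 5))"
proof -
  have "E (h (i + 5)) (h (i + 5 + 1))" by (rule h_adj)
  moreover have "h (i + 5 + 1) = h i" unfolding h_eq by simp
  ultimately show ?thesis using E_sym by simp
qed

lemma h_adj_iff: "E (h i) (h j) \<longleftrightarrow> j mod 6 = (i + 1) mod 6 \<or> j mod 6 = (i + 5) mod 6"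
proof -
  have "{w. E u w \<and> E (h i) w} = {h (i + 1), h (i + 5)}"
  proof (rule two_of_two)
    show "card {w. E u w \<and> E (h i) w} = 2" by (rule card_adj[OF Euh])
    show "h (i + 1) \<noteq> h (i + 5)" unfolding h_eq by (simp only: mod6_iff) simp
  qed (use Euh h_adj h_adj' in auto)
  then have "h j \<in> {w. E u w \<and> E (h i) w} \<longleftrightarrow> h j \<in> {h (i + 1), h (i + 5)}" by simp
  then show ?thesis using Euh by (simp add: h_eq)
qed

text \<open>The common neighbours of consecutive hexagon vertices are \<open>u\<close> and
  \<open>p i\<close>, those of opposite ones \<open>u\<close> and \<open>q i\<close>; the choice
  operator thus has only one candidate.\<close>

definition p :: "nat \<Rightarrow> 'a" where "p i = (SOME w. E (h i) w \<and> E (h (i + 1)) w \<and> w \<noteq> u)"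
definition q :: "nat \<Rightarrow> 'a" where "q i = (SOME w. (E (h i) w \<and> E (h (i + 3)) w) \<and> w \<noteq> u)"

lemma ex_other: "card {w. E x w \<and> E y w} = 2 \<Longrightarrow> \<exists>w. E x w \<and> E y w \<and> w \<noteq> u"
proof (rule ccontr)
  assume c: "card {w. E x w \<and> E y w} = 2" and "\<not> (\<exists>w. E x w \<and> E y w \<and> w \<noteq> u)"
  then have "{w. E x w \<and> E y w} \<subseteq> {u}" by auto
  then have "card {w. E x w \<and> E y w} \<le> card {u}" by (intro card_mono) auto
  then show False using c by simp
qed

lemma p: "E (h i) (p i)" "E (h (i + 1)) (p i)" "p i \<noteq> u" "\<not> E u (p i)"
proof -
  have "\<exists>w. E (h i) w \<and> E (h (i + 1)) w \<and> w \<noteq> u" by (rule ex_other[OF card_adj[OF h_adj]])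
  from someI_ex[OF this] show 1: "E (h i) (p i)" "E (h (i + 1)) (p i)" "p i \<noteq> u" by (auto simp: p_def)
  show "\<not> E u (p i)"
  proof
    assume "E u (p i)"
    then obtain j where "p i = h j" using u_nbr by blast
    then have "E (h i) (h j)" "E (h (i + 1)) (h j)" using 1 by auto
    then show False unfolding h_adj_iff add.assoc by (elim disjE; simp only: mod6_iff; simp)
  qed
qed

lemma q: "E (h i) (q i)" "E (h (i + 3)) (q i)" "q i \<noteq> u" "\<not> E u (q i)"
proof -
  have "\<not> E (h i) (h (i + 3))" unfolding h_adj_iff by (simp only: mod6_iff) simp
  moreover have "h i \<noteq> h (i + 3)" unfolding h_eq by (simp only: mod6_iff) simp
  ultimately have "card {w. E (h i) w \<and> E (h (i + 3)) w} = 2" using card_nonadj Euh E_V by blast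
  then have "\<exists>w. (E (h i) w \<and> E (h (i + 3)) w) \<and> w \<noteq> u" using ex_other by blast
  from someI_ex[OF this] show 1: "E (h i) (q i)" "E (h (i + 3)) (q i)" "q i \<noteq> u" by (auto simp: q_def)
  show "\<not> E u (q i)"
  proof
    assume "E u (q i)"
    then obtain j where "q i = h j" using u_nbr by blast
    then have "E (h i) (h j)" "E (h (i + 3)) (h j)" using 1 by auto
    then show False unfolding h_adj_iff add.assoc by (elim disjE; simp only: mod6_iff; simp)
  qed
qed

lemma p6: "p (i + 6) = p i"
proof -
  have "h (i + 6 + 1) = h ((i + 1) + 6)" by (rule arg_cong[where f = h]) simp
  then have "h (i + 6 + 1) = h (i + 1)" unfolding h6 .
  then show ?thesis unfolding p_def h6 by simp
qed

lemma q3: "q (i + 3) = q i"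
proof -
  have "h (i + 3 + 3) = h (i + 6)" by (rule arg_cong[where f = h]) simp
  then have "h (i + 3 + 3) = h i" unfolding h6 .
  then show ?thesis unfolding q_def by (simp add: conj_commute)
qed

text \<open>A vertex at distance two from \<open>u\<close> has exactly two neighbours on the
  hexagon, the common neighbours counted by the last parameter 2.\<close>

lemma outer_h:
  assumes "x \<noteq> u" "\<not> E u x" "E (h i) x" "E (h j) x" "i mod 6 \<noteq> j mod 6"
  shows "E (h n) x \<longleftrightarrow> n mod 6 = i mod 6 \<or> n mod 6 = j mod 6"
proof -
  have xV: "x \<in> V" using assms(3) E_V by blast
  have "{w. E u w \<and> E x w} = {h i, h j}"
  proof (rule two_of_two)
    show "card {w. E u w \<and> E x w} = 2" using card_nonadj[OF u_V xV] assms by auto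
    show "h i \<noteq> h j" unfolding h_eq by (rule assms(5))
  qed (use Euh assms E_sym in auto)
  then have "h n \<in> {w. E u w \<and> E x w} \<longleftrightarrow> h n \<in> {h i, h j}" by simp
  then show ?thesis using Euh E_sym_iff[of x] by (simp add: h_eq)
qed

lemma hp: "E (h n) (p i) \<longleftrightarrow> n mod 6 = i mod 6 \<or> n mod 6 = (i + 1) mod 6"
  by (rule outer_h[OF p(3,4,1,2)]) (simp only: mod6_iff, simp)

lemma hq: "E (h n) (q i) \<longleftrightarrow> n mod 6 = i mod 6 \<or> n mod 6 = (i + 3) mod 6"
  by (rule outer_h[OF q(3,4,1,2)]) (simp only: mod6_iff, simp)

lemma p_eqD: "p i = p j \<Longrightarrow> i mod 6 = j mod 6"
proof -
  assume "p i = p j"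
  then have "(n mod 6 = i mod 6 \<or> n mod 6 = (i + 1) mod 6) \<longleftrightarrow> (n mod 6 = j mod 6 \<or> n mod 6 = (j + 1) mod 6)" for n
    using hp[of n i] hp[of n j] by simp
  then have "(i mod 6 = j mod 6 \<or> i mod 6 = (j mod 6 + 1) mod 6) \<and>
      ((i mod 6 + 1) mod 6 = j mod 6 \<or> (i mod 6 + 1) mod 6 = (j mod 6 + 1) mod 6)"
    unfolding mod6_shift[symmetric] by blast
  moreover have "\<forall>a\<in>set [0..<6::nat]. \<forall>b\<in>set [0..<6]. (a = b \<or> a = (b + 1) mod 6) \<and>
      ((a + 1) mod 6 = b \<or> (a + 1) mod 6 = (b + 1) mod 6) \<longrightarrow> a = b" by code_simp
  ultimately show ?thesis using mod6_in by blast
qed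

lemma q_eqD: "q i = q j \<Longrightarrow> i mod 3 = j mod 3"
proof -
  assume "q i = q j"
  then have "(n mod 6 = i mod 6 \<or> n mod 6 = (i + 3) mod 6) \<longleftrightarrow> (n mod 6 = j mod 6 \<or> n mod 6 = (j + 3) mod 6)" for n
    using hq[of n i] hq[of n j] by simp
  then have "i mod 6 = j mod 6 \<or> i mod 6 = (j mod 6 + 3) mod 6"
    unfolding mod6_shift[symmetric] by blast
  moreover have "\<forall>a\<in>set [0..<6::nat]. \<forall>b\<in>set [0..<6]. (a = b \<or> a = (b + 3) mod 6) \<longrightarrow> a mod 3 = b mod 3" by code_simp
  ultimately have "i mod 6 mod 3 = j mod 6 mod 3" using mod6_in by blast
  then show ?thesis by (simp add: mod_mod_cancel)
qed

lemma p_neq_q: "p i \<noteq> q j"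
proof
  assume "p i = q j"
  then have "(n mod 6 = i mod 6 \<or> n mod 6 = (i + 1) mod 6) \<longleftrightarrow> (n mod 6 = j mod 6 \<or> n mod 6 = (j + 3) mod 6)" for n
    using hp[of n i] hq[of n j] by simp
  then have "(i mod 6 = j mod 6 \<or> i mod 6 = (j mod 6 + 3) mod 6) \<and>
      ((i mod 6 + 1) mod 6 = j mod 6 \<or> (i mod 6 + 1) mod 6 = (j mod 6 + 3) mod 6)"
    unfolding mod6_shift[symmetric] by blast
  moreover have "\<forall>a\<in>set [0..<6::nat]. \<forall>b\<in>set [0..<6]. \<not> ((a = b \<or> a = (b + 3) mod 6) \<and>
      ((a + 1) mod 6 = b \<or> (a + 1) mod 6 = (b + 3) mod 6))" by code_simp
  ultimately show False using mod6_in by blast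
qed

lemma ph: "E (h i) (p (i + 5))" unfolding hp add.assoc by simp

lemma nbrs_h: "{w. E (h i) w} = {u, h (i + 1), h (i + 5), p i, p (i + 5), q i}"
proof (rule sym, rule card_subset_eq)
  have n: "h (i + 1) \<noteq> h (i + 5)" unfolding h_eq by (simp only: mod6_iff) simp
  have n1: "p i \<noteq> p (i + 5)"
  proof
    assume "p i = p (i + 5)"
    then have "i mod 6 = (i + 5) mod 6" by (rule p_eqD)
    then show False by (simp only: mod6_iff) simp
  qed
  have n2: "h j \<noteq> p n" "h j \<noteq> q n" for j n using Euh[of j] p(4)[of n] q(4)[of n] by metis+
  have n3: "u \<noteq> h j" for j using Euh[of j] E_irrefl by metis
  have "card {u, h (i + 1), h (i + 5), p i, p (i + 5), q i} = 6"
    using n n1 n2 n3 p(3) q(3) p_neq_q by (simp add: eq_commute[of u])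
  then show "card {u, h (i + 1), h (i + 5), p i, p (i + 5), q i} = card {w. E (h i) w}"
    using card_nbrs[of "h i"] E_V[OF Euh[of i]] by simp
  show "{u, h (i + 1), h (i + 5), p i, p (i + 5), q i} \<subseteq> {w. E (h i) w}"
    using E_sym[OF Euh[of i]] h_adj[of i] h_adj'[of i] p(1)[of i] ph[of i] q(1)[of i] by simp
qed simp

text \<open>\<open>h i\<close> and \<open>q i\<close> have two common neighbours; of the six
  neighbours of \<open>h i\<close> all but \<open>p i\<close> and \<open>p (i + 5)\<close> are ruled
  out.\<close>

lemma pq: "E (q i) (p i)" "E (q i) (p (i + 5))"
proof -
  have sub: "{w. E (h i) w \<and> E (q i) w} \<subseteq> {p i, p (i + 5)}"
  proof
    fix w assume "w \<in> {w. E (h i) w \<and> E (q i) w}"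
    then have w: "w \<in> {w. E (h i) w}" "E (q i) w" by auto
    have "w \<noteq> u" using w(2) q(4) E_sym by auto
    moreover have "w \<noteq> h (i + 1)"
    proof
      assume "w = h (i + 1)"
      then have "E (h (i + 1)) (q i)" using w(2) E_sym by simp
      then show False unfolding hq by (simp only: mod6_iff) simp
    qed
    moreover have "w \<noteq> h (i + 5)"
    proof
      assume "w = h (i + 5)"
      then have "E (h (i + 5)) (q i)" using w(2) E_sym by simp
      then show False unfolding hq by (simp only: mod6_iff) simp
    qed
    moreover have "w \<noteq> q i" using w(2) E_irrefl by auto
    ultimately show "w \<in> {p i, p (i + 5)}" using w(1) unfolding nbrs_h by simp
  qed
  have "p i \<noteq> p (i + 5)"
  proof
    assume "p i = p (i + 5)"
    then have "i mod 6 = (i + 5) mod 6" by (rule p_eqD)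
    then show False by (simp only: mod6_iff) simp
  qed
  then have "card {p i, p (i + 5)} = 2" by simp
  then have "{w. E (h i) w \<and> E (q i) w} = {p i, p (i + 5)}"
    using card_subset_eq[OF _ sub] card_adj[OF q(1)] by simp
  then have "p i \<in> {w. E (h i) w \<and> E (q i) w}" "p (i + 5) \<in> {w. E (h i) w \<and> E (q i) w}" by simp_all
  then show "E (q i) (p i)" "E (q i) (p (i + 5))" by simp_all
qed

text \<open>Otherwise \<open>h i\<close> and \<open>p i\<close> would have the three common
  neighbours \<open>h (i + 1)\<close>, \<open>q i\<close> and \<open>p (i + 5)\<close>.\<close>

lemma p_nonadj: "\<not> E (p i) (p (i + 5))"
proof
  assume a: "E (p i) (p (i + 5))"
  have "{h (i + 1), q i, p (i + 5)} \<subseteq> {w. E (h i) w \<and> E (p i) w}"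
    using h_adj[of i] E_sym[OF p(2)[of i]] q(1)[of i] E_sym[OF pq(1)[of i]] ph[of i] a by simp
  then have "card {h (i + 1), q i, p (i + 5)} \<le> card {w. E (h i) w \<and> E (p i) w}" by (intro card_mono) auto
  also have "\<dots> = 2" by (rule card_adj[OF p(1)])
  moreover have "h (i + 1) \<noteq> q i" "h (i + 1) \<noteq> p (i + 5)" using Euh[of "i + 1"] p(4)[of "i + 5"] q(4)[of i] by metis+
  ultimately show False using p_neq_q[of "i + 5" i] by (simp add: eq_commute[of "q i"])
qed

lemma q_nbrs: "E (q i) (p j) \<Longrightarrow> j mod 6 \<in> {i mod 6, (i + 5) mod 6, (i + 3) mod 6, (i + 2) mod 6}"
proof -
  assume qj: "E (q i) (p j)"
  have "p (i + 3 + 5) = p ((i + 2) + 6)" by (rule arg_cong[where f = p]) simp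
  then have e: "p (i + 3 + 5) = p (i + 2)" unfolding p6 .
  have "E (q i) (p (i + 3))" "E (q i) (p (i + 2))" using pq[of "i + 3"] unfolding q3 e .
  then have sub: "{h i, h (i + 3), p i, p (i + 5), p (i + 3), p (i + 2)} \<subseteq> {w. E (q i) w}"
    using pq[of i] E_sym[OF q(1)[of i]] E_sym[OF q(2)[of i]] by simp
  have ne: "p a \<noteq> p b" if "a mod 6 \<noteq> b mod 6" for a b using p_eqD that by blast
  have hn: "h a \<noteq> p b" for a b using Euh[of a] p(4)[of b] by metis
  have hh: "h i \<noteq> h (i + 3)" unfolding h_eq by (simp only: mod6_iff) simp
  have d: "i mod 6 \<noteq> (i + 5) mod 6" "i mod 6 \<noteq> (i + 3) mod 6" "i mod 6 \<noteq> (i + 2) mod 6" "(i + 5) mod 6 \<noteq> (i + 3) mod 6"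
    "(i + 5) mod 6 \<noteq> (i + 2) mod 6" "(i + 3) mod 6 \<noteq> (i + 2) mod 6" by (simp_all only: mod6_iff) simp_all
  have "card {h i, h (i + 3), p i, p (i + 5), p (i + 3), p (i + 2)} = 6"
    using hn hh ne[OF d(1)] ne[OF d(2)] ne[OF d(3)] ne[OF d(4)] ne[OF d(5)] ne[OF d(6)] by simp
  moreover have "card {w. E (q i) w} = 6" using card_nbrs E_V q(1) by blast
  ultimately have "{h i, h (i + 3), p i, p (i + 5), p (i + 3), p (i + 2)} = {w. E (q i) w}"
    by (intro card_subset_eq[OF _ sub]) auto
  then have "p j \<in> {h i, h (i + 3), p i, p (i + 5), p (i + 3), p (i + 2)}" using qj by simp
  then have "p j = p i \<or> p j = p (i + 5) \<or> p j = p (i + 3) \<or> p j = p (i + 2)"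
    using hn[of i j] hn[of "i + 3" j] unfolding insert_iff empty_iff by metis
  then show ?thesis using p_eqD by blast
qed

text \<open>\<open>h (i + 2)\<close> and \<open>p i\<close> have a second common neighbour besides
  \<open>h (i + 1)\<close>, and among the neighbours of \<open>h (i + 2)\<close> only
  \<open>p (i + 2)\<close> is left.\<close>

lemma pp: "E (p i) (p (i + 2))"
proof -
  have nhp: "\<not> E (h (i + 2)) (p i)" unfolding hp by (simp only: mod6_iff) simp
  have ne: "h (i + 2) \<noteq> p i" using Euh[of "i + 2"] p(4)[of i] by metis
  have V: "h (i + 2) \<in> V" "p i \<in> V" using E_V Euh p(1) by blast+
  have c: "card {w. E (h (i + 2)) w \<and> E (p i) w} = 2" by (rule card_nonadj[OF V ne nhp])
  have i7: "i + 2 + 5 = (i + 1) + 6" by simp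
  have e: "h (i + 2 + 5) = h (i + 1)" "p (i + 2 + 5) = p (i + 1)" unfolding i7 h6 p6 by simp_all
  show ?thesis
  proof (rule ccontr)
    assume n: "\<not> E (p i) (p (i + 2))"
    have "{w. E (h (i + 2)) w \<and> E (p i) w} \<subseteq> {h (i + 1)}"
    proof
      fix w assume "w \<in> {w. E (h (i + 2)) w \<and> E (p i) w}"
      then have w: "w \<in> {w. E (h (i + 2)) w}" "E (p i) w" by auto
      have "w \<noteq> u" using w(2) p(4) E_sym by auto
      moreover have "w \<noteq> h (i + 2 + 1)"
      proof
        assume "w = h (i + 2 + 1)"
        then have "E (h (i + 2 + 1)) (p i)" using w(2) E_sym by simp
        then show False unfolding hp add.assoc by (simp only: mod6_iff) simp
      qed
      moreover have "w \<noteq> p (i + 2)" using w(2) n by auto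
      moreover have "w \<noteq> p (i + 1)"
      proof
        assume "w = p (i + 1)"
        moreover have "i + 1 + 5 = i + 6" by simp
        then have "p (i + 1 + 5) = p i" by (simp only: p6)
        ultimately have "E (p (i + 1)) (p (i + 1 + 5))" using E_sym[OF w(2)] by simp
        then show False using p_nonadj by blast
      qed
      moreover have "w \<noteq> q (i + 2)"
      proof
        assume "w = q (i + 2)"
        then have "E (q (i + 2)) (p i)" using w(2) E_sym by simp
        from q_nbrs[OF this] show False unfolding insert_iff empty_iff add.assoc by (simp only: mod6_iff) simp
      qed
      ultimately show "w \<in> {h (i + 1)}" using w(1) unfolding nbrs_h e by simp
    qed
    then have "card {w. E (h (i + 2)) w \<and> E (p i) w} \<le> card {h (i + 1)}" by (intro card_mono) auto
    then show False using c by simp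
  qed
qed

lemma shrikhande:
  assumes "card V = 16"
  shows "rel_iso V E (set shrikhande_labels) shrikhande_rel"
proof -
  define f where "f x = (case x of (a, i) \<Rightarrow> if a = 0 then u else if a = 1 then h i else if a = (2::nat) then p i else q i)" for x
  have hm: "h (n mod 6) = h n" for n by (rule periodic_mod[where f = h, OF h6])
  have pm: "p (n mod 6) = p n" for n by (rule periodic_mod[where f = p, OF p6])
  have qm: "q (n mod 3) = q n" for n by (rule periodic_mod[where f = q, OF q3])
  have labs: "\<exists>a i. x = (a, i) \<and> ((a = 0 \<and> i = 0) \<or> (a = 1 \<and> i < 6) \<or> (a = 2 \<and> i < 6) \<or> (a = 3 \<and> i < 3))"
    if x: "x \<in> set shrikhande_labels" for x
  proof -
    have "\<forall>(a, i)\<in>set shrikhande_labels. (a = 0 \<and> i = 0) \<or> (a = 1 \<and> i < 6) \<or> (a = 2 \<and> i < 6) \<or> (a = 3 \<and> i < 3)"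
      by code_simp
    then show ?thesis using x by (cases x) fastforce
  qed
  have ne: "u \<noteq> h i" "u \<noteq> p i" "u \<noteq> q i" "h i \<noteq> p j" "h i \<noteq> q j" for i j
    using Euh[of i] E_irrefl p(3,4) q(3,4) by metis+
  have inj: "inj_on f (set shrikhande_labels)"
  proof (rule inj_onI)
    fix x y assume xy: "x \<in> set shrikhande_labels" "y \<in> set shrikhande_labels" "f x = f y"
    obtain a i where x: "x = (a, i)" "(a = 0 \<and> i = 0) \<or> (a = 1 \<and> i < 6) \<or> (a = 2 \<and> i < 6) \<or> (a = 3 \<and> i < 3)"
      using labs[OF xy(1)] by blast
    obtain b j where y: "y = (b, j)" "(b = 0 \<and> j = 0) \<or> (b = 1 \<and> j < 6) \<or> (b = 2 \<and> j < 6) \<or> (b = 3 \<and> j < 3)"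
      using labs[OF xy(2)] by blast
    have hi: "h i = h j \<Longrightarrow> i < 6 \<Longrightarrow> j < 6 \<Longrightarrow> i = j" by (simp add: h_eq)
    have pi: "p i = p j \<Longrightarrow> i < 6 \<Longrightarrow> j < 6 \<Longrightarrow> i = j" using p_eqD[of i j] by simp
    have qi: "q i = q j \<Longrightarrow> i < 3 \<Longrightarrow> j < 3 \<Longrightarrow> i = j" using q_eqD[of i j] by simp
    have fe: "f (0, i) = u" "f (1, i) = h i" "f (2, i) = p i" "f (3, i) = q i" for i by (simp_all add: f_def)
    have fs: "f (Suc 0, i) = h i" for i by (simp add: f_def)
    note n = fs ne ne[symmetric] p_neq_q p_neq_q[symmetric]
    have eq: "f (a, i) = f (b, j)" using xy(3) unfolding x(1) y(1) .
    have "a = b \<and> i = j" using x(2)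
    proof (elim disjE conjE)
      assume a: "a = 0" "i = 0"
      have "u = f (b, j)" using eq unfolding a(1) fe(1) .
      then show ?thesis using y(2) a by (elim disjE conjE) (simp_all add: fe n)
    next
      assume a: "a = 1" "i < 6"
      have e: "h i = f (b, j)" using eq unfolding a(1) fe(2) .
      show ?thesis using y(2)
      proof (elim disjE conjE)
        assume b: "b = 1" "j < 6"
        have "h i = h j" using e unfolding b(1) fe(2) .
        then show ?thesis using hi a b by blast
      qed (use e a in \<open>simp_all add: fe n\<close>)
    next
      assume a: "a = 2" "i < 6"
      have e: "p i = f (b, j)" using eq unfolding a(1) fe(3) .
      show ?thesis using y(2)
      proof (elim disjE conjE)
        assume b: "b = 2" "j < 6"
        have "p i = p j" using e unfolding b(1) fe(3) .
        then show ?thesis using pi a b by blast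
      qed (use e a in \<open>simp_all add: fe n\<close>)
    next
      assume a: "a = 3" "i < 3"
      have e: "q i = f (b, j)" using eq unfolding a(1) fe(4) .
      show ?thesis using y(2)
      proof (elim disjE conjE)
        assume b: "b = 3" "j < 3"
        have "q i = q j" using e unfolding b(1) fe(4) .
        then show ?thesis using qi a b by blast
      qed (use e a in \<open>simp_all add: fe n\<close>)
    qed
    then show "x = y" using x(1) y(1) by simp
  qed
  have "f ` set shrikhande_labels = V"
  proof (rule card_subset_eq[OF finite_V])
    show "f ` set shrikhande_labels \<subseteq> V"
    proof
      fix w assume "w \<in> f ` set shrikhande_labels"
      then obtain a i where "w = f (a, i)" by auto
      then show "w \<in> V" using u_V E_V[OF Euh[of i]] E_V[OF p(1)[of i]] E_V[OF q(1)[of i]] by (simp add: f_def)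
    qed
    have "card (set shrikhande_labels) = 16"
      using distinct_card[OF shrikhande_labels_distinct] by (simp add: shrikhande_labels_def)
    then show "card (f ` set shrikhande_labels) = card V" using card_image[OF inj] assms by simp
  qed
  then have bij: "bij_betw f (set shrikhande_labels) V" using inj by (simp add: bij_betw_def)
  have deg: "card {y \<in> set shrikhande_labels. shrikhande_rel x y} = 6" if x: "x \<in> set shrikhande_labels" for x
  proof -
    have "{y \<in> set shrikhande_labels. shrikhande_rel x y} = set (filter (shrikhande_rel x) shrikhande_labels)" by auto
    then show ?thesis
      using distinct_card[OF distinct_filter[OF shrikhande_labels_distinct, of "shrikhande_rel x"]]
        bspec[OF shrikhande_labels_degree x] by simp
  qed
  have pq': "E (p i) (q (i + 1))" for i
  proof -
    have "i + 1 + 5 = i + 6" by simp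
    then have "p (i + 1 + 5) = p i" by (simp only: p6)
    then show ?thesis using E_sym[OF pq(2)[of "i + 1"]] by simp
  qed
  have hom0: "E (f x) (f y)" if xy: "shrikhande_rel0 x y" for x y
  proof -
    obtain a i b j where x: "x = (a, i)" and y: "y = (b, j)" by (cases x; cases y) auto
    show ?thesis using xy Euh h_adj E_sym[OF p(1)] E_sym[OF p(2)] q(1) E_sym[OF pq(1)] pq' pp
      unfolding x y shrikhande_rel0.simps f_def
      by (elim disjE conjE) (simp_all add: hm pm qm)
  qed
  have hom: "E (f x) (f y)" if "shrikhande_rel x y" for x y
    using that hom0[of x y] hom0[of y x] E_sym unfolding shrikhande_rel_def by blast
  show ?thesis by (rule rel_iso_of_hom[OF bij deg hom])
qed

end

text \<open>For \<open>r = 2\<close> a tip has three local non-neighbours, the two other tips and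
  one more. These opposite vertices \<open>a'\<close>, \<open>b'\<close>, \<open>c'\<close> are
  adjacent to the tips they do not oppose, which closes the hexagon
  \<open>a, c', b, a', c, b'\<close>.\<close>

lemma (in sr_minus2) hexagon_of_claw:
  assumes ab: "local_nonadj u a b" and c: "c \<in> claw_tips u a b" and r: "r = 2"
  shows "\<exists>h. hexagon V E u h"
proof -
  note cl = clawD[OF c ab] and cs = claw_sym[OF ab c]
  have par: "k = 6" "l = 2" "m = 2" using claw_parameters[OF ab c] r by auto
  have opp: "\<exists>x. E u x \<and> x \<noteq> a \<and> x \<noteq> b \<and> x \<noteq> c \<and> \<not> E a x \<and> E b x \<and> E c x"
    if ab: "local_nonadj u a b" and c: "c \<in> claw_tips u a b" for a b c
  proof -
    note cl = clawD[OF c ab] and cs = claw_sym[OF ab c]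
    have "\<not> {y. local_nonadj u a y} \<subseteq> {b, c}"
    proof
      assume "{y. local_nonadj u a y} \<subseteq> {b, c}"
      then have "card {y. local_nonadj u a y} \<le> card {b, c}" by (intro card_mono) auto
      also have "\<dots> \<le> 2" by (simp add: card_insert_if)
      finally show False using card_local_nonadj_r[OF cl(1)] r by simp
    qed
    then obtain x where x: "local_nonadj u a x" "x \<noteq> b" "x \<noteq> c" by auto
    then have x': "E u x" "x \<noteq> a" "\<not> E a x" by (auto simp: local_nonadj_def)
    have "E b x" using claw_two_adj[OF ab c x'(1,2) x(2,3)] x'(3) by blast
    moreover have "E c x" using claw_two_adj[OF cs(1,3) x'(1,2) x(3,2)] x'(3) by blast
    ultimately show ?thesis using x x' by blast
  qed
  obtain a' where a': "E u a'" "a' \<noteq> a" "a' \<noteq> b" "a' \<noteq> c" "\<not> E a a'" "E b a'" "E c a'" using opp[OF ab c] by blast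
  have ba: "local_nonadj u b a" by (rule local_nonadj_sym[OF ab])
  have "c \<in> claw_tips u b a" using c by (auto simp: claw_tips_def)
  then obtain b' where b': "E u b'" "b' \<noteq> b" "b' \<noteq> a" "b' \<noteq> c" "\<not> E b b'" "E a b'" "E c b'" using opp[OF ba] by blast
  have ca: "local_nonadj u c a" by (rule local_nonadj_sym[OF cs(1)])
  have "b \<in> claw_tips u c a" using cs(3) by (auto simp: claw_tips_def)
  then obtain c' where c': "E u c'" "c' \<noteq> c" "c' \<noteq> a" "c' \<noteq> b" "\<not> E c c'" "E a c'" "E b c'" using opp[OF ca] by blast
  have ne: "a' \<noteq> b'" "a' \<noteq> c'" "b' \<noteq> c'" using a' b' c' by auto
  define h where "h i = [a, c', b, a', c, b'] ! (i mod 6)" for i :: nat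
  have Eu: "E u (h i)" for i
    using mod6_cases[of i] cl(1,2,3) a'(1) b'(1) c'(1) by (elim disjE) (simp_all add: h_def)
  have dist: "distinct [a, c', b, a', c, b']"
    using cl(4,5,6) a'(2,3,4) b'(2,3,4) c'(2,3,4) ne by (simp add: eq_commute)
  have heq: "h i = h j \<longleftrightarrow> i mod 6 = j mod 6" for i j
    unfolding h_def by (rule nth_eq_iff_index_eq[OF dist]) simp_all
  have hadj: "E (h i) (h (i + 1))" for i
  proof -
    have "(i + 1) mod 6 = (i mod 6 + 1) mod 6" by (rule mod6_shift)
    then show ?thesis
      using mod6_cases[of i] c'(6) E_sym[OF c'(7)] a'(6) E_sym[OF a'(7)] b'(7) E_sym[OF b'(6)]
      by (elim disjE) (simp_all add: h_def)
  qed
  have "sr_graph V E 6 2 2" using sr_graph_axioms unfolding par .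
  then have "hexagon V E u h" unfolding hexagon_def hexagon_axioms_def using Eu heq hadj by simp
  then show ?thesis by blast
qed

section \<open>Cayley graphs\<close>

definition cadj :: "('a, 'm) monoid_scheme \<Rightarrow> 'a set \<Rightarrow> 'a \<Rightarrow> 'a \<Rightarrow> bool" where
  "cadj G S a b \<longleftrightarrow> a \<in> carrier G \<and> b \<in> carrier G \<and> a \<otimes>\<^bsub>G\<^esub> inv\<^bsub>G\<^esub> b \<in> S"

lemma cayley_graph_simps: "pverts (cayley_graph G S) = carrier G" "gadj (cayley_graph G S) = cadj G S"
  by (auto simp: cayley_graph_def cadj_def fun_eq_iff)

lemma (in group) cadj_translate:
  assumes "g \<in> carrier G" "cadj G S a b" shows "cadj G S (a \<otimes> g) (b \<otimes> g)"
proof -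
  have ab: "a \<in> carrier G" "b \<in> carrier G" using assms(2) by (auto simp: cadj_def)
  have "(a \<otimes> g) \<otimes> inv (b \<otimes> g) = a \<otimes> (g \<otimes> inv g) \<otimes> inv b"
    using ab assms(1) by (simp only: inv_mult_group m_assoc m_closed inv_closed)
  then have "(a \<otimes> g) \<otimes> inv (b \<otimes> g) = a \<otimes> inv b" using ab assms(1) by simp
  then show ?thesis using assms ab by (simp add: cadj_def)
qed

lemma (in group) cadj_translate_iff:
  assumes "g \<in> carrier G" "a \<in> carrier G" "b \<in> carrier G"
  shows "cadj G S (a \<otimes> g) (b \<otimes> g) \<longleftrightarrow> cadj G S a b"
proof
  assume "cadj G S (a \<otimes> g) (b \<otimes> g)"
  from cadj_translate[OF inv_closed[OF assms(1)] this]
  have "cadj G S (a \<otimes> g \<otimes> inv g) (b \<otimes> g \<otimes> inv g)" .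
  moreover have "a \<otimes> g \<otimes> inv g = a" "b \<otimes> g \<otimes> inv g = b" using assms by (simp_all add: m_assoc)
  ultimately show "cadj G S a b" by simp
qed (rule cadj_translate[OF assms(1)])

text \<open>Cauchy's theorem, as the Sylow theorem with exponent 1.\<close>

lemma (in group) exists_prime_order_subgroup:
  assumes "Factorial_Ring.prime p" "p dvd order G" "finite (carrier G)"
  shows "\<exists>H. subgroup H G \<and> card H = p"
proof -
  obtain q where "order G = p ^ 1 * q" using assms(2) by auto
  from sylow_thm[OF assms(1) is_group this assms(3)] show ?thesis by simp
qed

section \<open>Regular groups on the vertices of a triangular graph\<close>

locale line_group = group G for G (structure) +
  fixes LS :: "'a set set" and n :: nat
  assumes finite_G: "finite (carrier G)" and n_ge: "n \<ge> 3" and card_LS: "card LS = n"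
    and LS_sub: "L \<in> LS \<Longrightarrow> L \<subseteq> carrier G"
    and LS_closed: "L \<in> LS \<Longrightarrow> g \<in> carrier G \<Longrightarrow> L #> g \<in> LS"
    and two: "x \<in> carrier G \<Longrightarrow> card {L \<in> LS. x \<in> L} = 2"
    and meet1: "K \<in> LS \<Longrightarrow> L \<in> LS \<Longrightarrow> K \<noteq> L \<Longrightarrow> \<exists>x. K \<inter> L = {x}"
begin

lemma finite_LS: "finite LS" using card_LS n_ge card.infinite by fastforce

text \<open>An element fixing two lines fixes the vertex where they meet, and right translation by a
  non-identity element fixes no vertex.\<close>

lemma fixes_two:
  assumes g: "g \<in> carrier G" and KL: "K \<in> LS" "L \<in> LS" "K \<noteq> L" "K #> g = K" "L #> g = L"
  shows "g = \<one>"
proof -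
  obtain x where x: "K \<inter> L = {x}" using meet1 KL by blast
  then have xKL: "x \<in> K" "x \<in> L" by auto
  have xG: "x \<in> carrier G" using LS_sub KL(1) xKL(1) by blast
  have "x \<otimes> g \<in> K #> g" "x \<otimes> g \<in> L #> g" using xKL by (auto simp: r_coset_def)
  then have "x \<otimes> g \<in> K \<inter> L" unfolding KL(4,5) by simp
  then have "x \<otimes> g = x" unfolding x by simp
  then show ?thesis using xG g by (metis l_cancel_one)
qed

text \<open>If an involution moved a line \<open>M\<close>, it would exchange \<open>M\<close> with
  its image and so fix their common vertex. Hence it fixes all lines, and \<open>fixes_two\<close>
  applies.\<close>

lemma no_involution:
  assumes t: "t \<in> carrier G" "t \<otimes> t = \<one>" shows "t = \<one>"
proof -
  have fix_all: "M #> t = M" if M: "M \<in> LS" and ne: "t \<noteq> \<one>" for M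
  proof (rule ccontr)
    assume n: "M #> t \<noteq> M"
    have Mt: "M #> t \<in> LS" by (rule LS_closed[OF M t(1)])
    obtain x where x: "(M #> t) \<inter> M = {x}" using meet1[OF Mt M n] by blast
    then have xM: "x \<in> M" "x \<in> M #> t" by auto
    have xG: "x \<in> carrier G" using LS_sub[OF M] xM by blast
    obtain y where y: "y \<in> M" "x = y \<otimes> t" using xM(2) by (auto simp: r_coset_def)
    have yG: "y \<in> carrier G" using LS_sub[OF M] y by blast
    have "x \<otimes> t = y" using y yG t by (simp add: m_assoc)
    then have "x \<otimes> t \<in> (M #> t) \<inter> M" using y(1) xM(1) by (auto simp: r_coset_def)
    then have "x \<otimes> t = x" unfolding x by simp
    then show False using ne xG t(1) by (metis l_cancel_one)
  qed
  have "\<exists>K L. K \<in> LS \<and> L \<in> LS \<and> K \<noteq> L"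
  proof (rule ccontr)
    assume "\<not> ?thesis"
    then have "\<forall>K\<in>LS. \<forall>L\<in>LS. K = L" by blast
    then have "card LS \<le> 1" using card_le_Suc0_iff_eq[OF finite_LS] by simp
    then show False using card_LS n_ge by simp
  qed
  then obtain K L where KL: "K \<in> LS" "L \<in> LS" "K \<noteq> L" by blast
  show ?thesis
  proof (rule ccontr)
    assume ne: "t \<noteq> \<one>"
    show False using fixes_two[OF t(1) KL fix_all[OF KL(1) ne] fix_all[OF KL(2) ne]] ne by simp
  qed
qed

lemma odd_order: "odd (order G)"
proof
  assume "even (order G)"
  then obtain H where H: "subgroup H G" "card H = 2" using exists_prime_order_subgroup[of 2] finite_G by auto
  interpret H: subgroup H G by (rule H(1))
  have "H \<noteq> {\<one>}" using H(2) by auto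
  then obtain t where t: "t \<in> H" "t \<noteq> \<one>" using H.one_closed by blast
  have "H = {\<one>, t}"
  proof (rule sym, rule card_subset_eq)
    show "finite H" using H(2) card.infinite by fastforce
    show "{\<one>, t} \<subseteq> H" using t H.one_closed by simp
    show "card {\<one>, t} = card H" using t(2) H(2) by simp
  qed
  moreover have "t \<otimes> t \<in> H" using t by simp
  ultimately have "t \<otimes> t = \<one> \<or> t \<otimes> t = t" by simp
  moreover have tG: "t \<in> carrier G" using t(1) H.subset by blast
  ultimately have "t \<otimes> t = \<one>" using t(2) by (metis l_cancel_one)
  then show False using no_involution[OF tG] t(2) by simp
qed

text \<open>The other \<open>n - 1\<close> lines meet \<open>L\<close> in distinct vertices, as
  three lines never share one, and every vertex of \<open>L\<close> lies on one of them.\<close>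

lemma card_line:
  assumes L: "L \<in> LS" shows "card L = n - 1"
proof -
  define pt where "pt M = the_elem (L \<inter> M)" for M
  have pt: "L \<inter> M = {pt M}" if M: "M \<in> LS - {L}" for M
  proof -
    obtain x where "L \<inter> M = {x}" using meet1[OF L, of M] M by blast
    then show ?thesis by (simp add: pt_def)
  qed
  have "bij_betw pt (LS - {L}) L"
  proof (rule bij_betw_imageI)
    show "inj_on pt (LS - {L})"
    proof (rule inj_onI)
      fix M M' assume M: "M \<in> LS - {L}" "M' \<in> LS - {L}" "pt M = pt M'"
      show "M = M'"
      proof (rule ccontr)
        assume ne: "M \<noteq> M'"
        have x: "pt M \<in> L" "pt M \<in> M" using pt[OF M(1)] by auto
        have x': "pt M \<in> M'" using pt[OF M(2)] M(3) by auto
        have "pt M \<in> carrier G" using x(1) LS_sub[OF L] by blast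
        then have "card {K \<in> LS. pt M \<in> K} = 2" by (rule two)
        moreover have "{L, M, M'} \<subseteq> {K \<in> LS. pt M \<in> K}" using L M(1,2) x x' by auto
        then have "card {L, M, M'} \<le> card {K \<in> LS. pt M \<in> K}" using finite_LS by (intro card_mono) auto
        moreover have "L \<noteq> M" "L \<noteq> M'" using M(1,2) by auto
        then have "card {L, M, M'} = 3" using ne by simp
        ultimately show False by simp
      qed
    qed
    show "pt ` (LS - {L}) = L"
    proof (intro equalityI subsetI)
      fix x assume "x \<in> pt ` (LS - {L})"
      then show "x \<in> L" using pt by auto
    next
      fix x assume x: "x \<in> L"
      have "x \<in> carrier G" using x LS_sub[OF L] by blast
      then have c: "card {K \<in> LS. x \<in> K} = 2" by (rule two)
      have "\<not> {K \<in> LS. x \<in> K} \<subseteq> {L}"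
      proof
        assume "{K \<in> LS. x \<in> K} \<subseteq> {L}"
        then have "card {K \<in> LS. x \<in> K} \<le> card {L}" by (intro card_mono) auto
        then show False using c by simp
      qed
      then obtain M where M: "M \<in> LS" "x \<in> M" "M \<noteq> L" by auto
      then have "x \<in> L \<inter> M" using x by simp
      moreover have "M \<in> LS - {L}" using M by simp
      ultimately have "x \<in> {pt M}" using pt by blast
      then have "x = pt M" by simp
      then show "x \<in> pt ` (LS - {L})" using M by auto
    qed
  qed
  then have "card (LS - {L}) = card L" by (rule bij_betw_same_card)
  then show ?thesis using L card_LS by simp
qed

lemma card_G: "2 * order G = n * (n - 1)"
proof -
  have "(\<Sum>L\<in>LS. card {x \<in> carrier G. x \<in> L}) = (\<Sum>x\<in>carrier G. card {L \<in> LS. x \<in> L})"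
    by (rule double_count[OF finite_LS finite_G])
  moreover have "card {x \<in> carrier G. x \<in> L} = n - 1" if "L \<in> LS" for L
  proof -
    have "{x \<in> carrier G. x \<in> L} = L" using LS_sub[OF that] by auto
    then show ?thesis using card_line[OF that] by simp
  qed
  ultimately show ?thesis using two card_LS by (simp add: order_def mult.commute)
qed

definition stab :: "'a set \<Rightarrow> 'a set" where "stab L = {g \<in> carrier G. L #> g = L}"

lemma stab_subgroup: "L \<in> LS \<Longrightarrow> subgroup (stab L) G"
proof
  assume L: "L \<in> LS"
  have sub: "L \<subseteq> carrier G" by (rule LS_sub[OF L])
  show "stab L \<subseteq> carrier G" by (auto simp: stab_def)
  show "x \<otimes> y \<in> stab L" if "x \<in> stab L" "y \<in> stab L" for x y
    using that coset_mult_assoc[OF sub, of x y] by (simp add: stab_def)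
  show "\<one> \<in> stab L" using coset_mult_one[OF sub] by (simp add: stab_def)
  show "inv x \<in> stab L" if x: "x \<in> stab L" for x
  proof -
    have xG: "x \<in> carrier G" "L #> x = L" using x by (auto simp: stab_def)
    have "(L #> x) #> inv x = L" using coset_mult_assoc[OF sub xG(1) inv_closed[OF xG(1)]] coset_mult_one[OF sub] xG(1) by simp
    then show ?thesis using xG by (simp add: stab_def)
  qed
qed

text \<open>Every line has a translate through the identity, where there are two lines
  \<open>A\<close> and \<open>B\<close>. Were \<open>B\<close> no translate of \<open>A\<close>,
  each of them would be mapped to itself by its own elements, and a translate of either that meets
  it would equal it. But a third line is a translate of one of them and meets both.\<close>

lemma transitive:
  assumes KL: "K \<in> LS" "L \<in> LS" shows "\<exists>g\<in>carrier G. L = K #> g"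
proof -
  have one_line: "\<exists>g\<in>carrier G. \<one> \<in> M #> g" if M: "M \<in> LS" for M
  proof -
    have "card M \<noteq> 0" using card_line[OF M] n_ge by simp
    then have "M \<noteq> {}" by auto
    then obtain x where x: "x \<in> M" by blast
    then have xG: "x \<in> carrier G" using LS_sub[OF M] by blast
    have "x \<otimes> inv x \<in> M #> inv x" using x by (auto simp: r_coset_def)
    then show ?thesis using xG by (intro bexI[of _ "inv x"]) auto
  qed
  have trans1: "B = A" if AB: "A \<in> LS" "B \<in> LS" "\<one> \<in> A" "\<one> \<in> B" and no: "\<forall>g\<in>carrier G. B \<noteq> A #> g" for A B
  proof (rule ccontr)
    assume ne: "B \<noteq> A"
    have sub: "A \<subseteq> carrier G" by (rule LS_sub[OF AB(1)])
    have AB2: "{L \<in> LS. \<one> \<in> L} = {A, B}"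
    proof (rule sym, rule card_subset_eq)
      show "card {A, B} = card {L \<in> LS. \<one> \<in> L}" using two[OF one_closed] ne by simp
    qed (use finite_LS AB in auto)
    have Ax: "A #> x = A" if x: "x \<in> A" for x
    proof -
      have xG: "x \<in> carrier G" using x sub by blast
      have "x \<otimes> inv x \<in> A #> inv x" using x by (auto simp: r_coset_def)
      then have "\<one> \<in> A #> inv x" using xG by simp
      then have "A #> inv x \<in> {L \<in> LS. \<one> \<in> L}" using LS_closed[OF AB(1)] xG by simp
      then have "A #> inv x = A" using no xG unfolding AB2 by auto
      then have "(A #> inv x) #> x = A #> x" by simp
      then show ?thesis using coset_mult_assoc[OF sub inv_closed[OF xG] xG] coset_mult_one[OF sub] xG by simp
    qed
    have "\<exists>M\<in>LS. M \<noteq> A \<and> M \<noteq> B"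
    proof (rule ccontr)
      assume "\<not> ?thesis"
      then have "LS \<subseteq> {A, B}" by auto
      then have "card LS \<le> card {A, B}" by (intro card_mono) auto
      also have "\<dots> \<le> 2" by (simp add: card_insert_if)
      finally show False using card_LS n_ge by simp
    qed
    then obtain M where M: "M \<in> LS" "M \<noteq> A" "M \<noteq> B" by blast
    \<comment> \<open>distinct translates of \<open>A\<close> are disjoint, so all lines but \<open>A\<close> are translates of \<open>B\<close>,
      and the translates of \<open>B\<close> are disjoint as well\<close>
    have disjA: "M = A" if M: "M \<in> LS" "M = A #> g" "g \<in> carrier G" for M g
    proof (rule ccontr)
      assume ne: "M \<noteq> A"
      obtain x where "M \<inter> A = {x}" using meet1[OF M(1) AB(1) ne] by blast
      then have x: "x \<in> M" "x \<in> A" by auto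
      obtain y where y: "y \<in> A" "x = y \<otimes> g" using x(1) M(2) by (auto simp: r_coset_def)
      have G: "x \<in> carrier G" "y \<in> carrier G" using x y sub by auto
      have "M = (A #> y) #> g" using Ax[OF y(1)] M(2) by simp
      also have "\<dots> = A #> x" using coset_mult_assoc[OF sub G(2) M(3)] y(2) by simp
      also have "\<dots> = A" by (rule Ax[OF x(2)])
      finally show False using ne by simp
    qed
    have subB: "B \<subseteq> carrier G" by (rule LS_sub[OF AB(2)])
    have Bx: "B #> x = B" if x: "x \<in> B" for x
    proof -
      have xG: "x \<in> carrier G" using x subB by blast
      have "x \<otimes> inv x \<in> B #> inv x" using x by (auto simp: r_coset_def)
      then have "\<one> \<in> B #> inv x" using xG by simp
      then have mem: "B #> inv x \<in> {L \<in> LS. \<one> \<in> L}" using LS_closed[OF AB(2)] xG by simp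
      have bk: "(B #> inv x) #> x = B" using coset_mult_assoc[OF subB inv_closed[OF xG] xG] coset_mult_one[OF subB] xG by simp
      have "B #> inv x \<noteq> A"
      proof
        assume "B #> inv x = A"
        then have "B = A #> x" using bk by simp
        then show False using no xG by blast
      qed
      then have "B #> inv x = B" using mem unfolding AB2 by auto
      then show ?thesis using bk by simp
    qed
    obtain g where g: "g \<in> carrier G" "\<one> \<in> M #> g" using one_line[OF M(1)] by blast
    have mem: "M #> g \<in> {A, B}" unfolding AB2[symmetric] using LS_closed[OF M(1) g(1)] g(2) by simp
    have subM: "M \<subseteq> carrier G" by (rule LS_sub[OF M(1)])
    have bk: "M = (M #> g) #> inv g"
      using coset_mult_assoc[OF subM g(1) inv_closed[OF g(1)]] coset_mult_one[OF subM] g(1) by simp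
    have "M #> g \<noteq> A"
    proof
      assume "M #> g = A"
      then have "M = A #> inv g" using bk by metis
      then show False using disjA[OF M(1) _ inv_closed[OF g(1)]] M(2) by blast
    qed
    then have "M #> g = B" using mem by blast
    then have MB: "M = B #> inv g" using bk by metis
    obtain x where "M \<inter> B = {x}" using meet1[OF M(1) AB(2) M(3)] by blast
    then have x: "x \<in> M" "x \<in> B" by auto
    obtain y where y: "y \<in> B" "x = y \<otimes> inv g" using x(1) MB by (auto simp: r_coset_def)
    have G: "x \<in> carrier G" "y \<in> carrier G" using x y subB by auto
    have "M = (B #> y) #> inv g" using Bx[OF y(1)] MB by simp
    also have "\<dots> = B #> x" using coset_mult_assoc[OF subB G(2) inv_closed[OF g(1)]] y(2) by simp
    also have "\<dots> = B" by (rule Bx[OF x(2)])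
    finally show False using M(3) by simp
  qed
  obtain g where g: "g \<in> carrier G" "\<one> \<in> K #> g" using one_line[OF KL(1)] by blast
  obtain h where h: "h \<in> carrier G" "\<one> \<in> L #> h" using one_line[OF KL(2)] by blast
  have sub: "K \<subseteq> carrier G" "L \<subseteq> carrier G" using LS_sub KL by auto
  have "\<exists>f\<in>carrier G. L #> h = (K #> g) #> f"
  proof (rule ccontr)
    assume n: "\<not> ?thesis"
    then have "L #> h = K #> g" using trans1[OF LS_closed[OF KL(1) g(1)] LS_closed[OF KL(2) h(1)] g(2) h(2)] by blast
    moreover have "(K #> g) #> \<one> = K #> g" by (rule coset_mult_one[OF LS_sub[OF LS_closed[OF KL(1) g(1)]]])
    ultimately have "L #> h = (K #> g) #> \<one>" by (rule trans[OF _ sym])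
    then show False using n one_closed by blast
  qed
  then obtain f where f: "f \<in> carrier G" "L #> h = (K #> g) #> f" by blast
  have "L = (L #> h) #> inv h"
    using coset_mult_assoc[OF sub(2) h(1) inv_closed[OF h(1)]] coset_mult_one[OF sub(2)] h(1) by simp
  also have "\<dots> = K #> (g \<otimes> f \<otimes> inv h)"
    unfolding f(2) using sub(1) g f h by (simp add: coset_mult_assoc m_assoc)
  finally show ?thesis using g f h by (intro bexI[of _ "g \<otimes> f \<otimes> inv h"]) auto
qed

text \<open>Orbit-stabiliser for the transitive action on the \<open>n\<close> lines.\<close>

lemma card_stab:
  assumes K: "K \<in> LS" shows "n * card (stab K) = order G"
proof -
  have sub: "K \<subseteq> carrier G" by (rule LS_sub[OF K])
  have fib: "card {g \<in> carrier G. K #> g = L} = card (stab K)" if L: "L \<in> LS" for L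
  proof -
    obtain h where h: "h \<in> carrier G" "L = K #> h" using transitive[OF K L] by blast
    have "bij_betw (\<lambda>g. g \<otimes> h) (stab K) {g \<in> carrier G. K #> g = L}"
    proof (rule bij_betw_byWitness[where f' = "\<lambda>g. g \<otimes> inv h"])
      show "\<forall>a\<in>stab K. a \<otimes> h \<otimes> inv h = a" using h by (auto simp: stab_def m_assoc)
      show "\<forall>a'\<in>{g \<in> carrier G. K #> g = L}. a' \<otimes> inv h \<otimes> h = a'" using h by (auto simp: m_assoc)
      show "(\<lambda>g. g \<otimes> h) ` stab K \<subseteq> {g \<in> carrier G. K #> g = L}"
      proof
        fix y assume "y \<in> (\<lambda>g. g \<otimes> h) ` stab K"
        then obtain g where g: "g \<in> carrier G" "K #> g = K" "y = g \<otimes> h" by (auto simp: stab_def)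
        then show "y \<in> {g \<in> carrier G. K #> g = L}" using coset_mult_assoc[OF sub g(1) h(1)] h by simp
      qed
      show "(\<lambda>g. g \<otimes> inv h) ` {g \<in> carrier G. K #> g = L} \<subseteq> stab K"
      proof
        fix y assume "y \<in> (\<lambda>g. g \<otimes> inv h) ` {g \<in> carrier G. K #> g = L}"
        then obtain g where g: "g \<in> carrier G" "K #> g = L" "y = g \<otimes> inv h" by auto
        have "K #> y = (K #> g) #> inv h" using coset_mult_assoc[OF sub g(1) inv_closed[OF h(1)]] g(3) by simp
        also have "\<dots> = (K #> h) #> inv h" unfolding g(2) h(2) ..
        also have "\<dots> = K" using coset_mult_assoc[OF sub h(1) inv_closed[OF h(1)]] coset_mult_one[OF sub] h(1) by simp
        finally show "y \<in> stab K" using g h by (simp add: stab_def)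
      qed
    qed
    then show ?thesis using bij_betw_same_card by fastforce
  qed
  have "(\<Sum>L\<in>LS. card {g \<in> carrier G. K #> g = L}) = (\<Sum>g\<in>carrier G. card {L \<in> LS. K #> g = L})"
    by (rule double_count[OF finite_LS finite_G])
  moreover have "card {L \<in> LS. K #> g = L} = 1" if "g \<in> carrier G" for g
  proof -
    have "{L \<in> LS. K #> g = L} = {K #> g}" using LS_closed[OF K that] by auto
    then show ?thesis by simp
  qed
  ultimately show ?thesis using fib card_LS by (simp add: order_def)
qed

text \<open>Comparing \<open>card_stab\<close> with \<open>card_G\<close> gives the order
  \<open>(n - 1) / 2\<close> of a stabiliser, and this order is odd because that of the group
  is.\<close>

lemma n_mod_4: "n mod 4 = 3" and card_stab_eq: "K \<in> LS \<Longrightarrow> 2 * card (stab K) = n - 1"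
proof -
  have st: "2 * card (stab K) = n - 1" if "K \<in> LS" for K
  proof -
    have "2 * (n * card (stab K)) = n * (n - 1)" unfolding card_stab[OF that] by (rule card_G)
    then have "n * (2 * card (stab K)) = n * (n - 1)" by (simp only: mult.left_commute)
    then have "2 * card (stab K) = n - 1 \<or> n = 0" by (simp only: mult_cancel1)
    then show ?thesis using n_ge by auto
  qed
  then show "K \<in> LS \<Longrightarrow> 2 * card (stab K) = n - 1" .
  have "LS \<noteq> {}" using card_LS n_ge by auto
  then obtain K where K: "K \<in> LS" by blast
  have "odd (n * card (stab K))" using odd_order card_stab[OF K] by simp
  then have o: "odd n" "odd (card (stab K))" by auto
  then obtain c where "card (stab K) = 2 * c + 1" by (elim oddE)
  then have "n = 4 * c + 3" using st[OF K] n_ge by simp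
  then show "n mod 4 = 3" by simp
qed

definition fpf :: "'a set" where "fpf = {g \<in> carrier G. \<forall>L\<in>LS. L #> g \<noteq> L}"

text \<open>By \<open>fixes_two\<close> a non-identity element fixes at most one line. With
  \<open>s\<close> the order of a stabiliser, \<open>n (s - 1)\<close> non-identity elements fix a
  line, out of \<open>n s - 1\<close>.\<close>

lemma card_fpf: "card fpf = n - 1"
proof -
  have "(\<Sum>L\<in>LS. card {g \<in> carrier G - {\<one>}. L #> g = L}) = (\<Sum>g\<in>carrier G - {\<one>}. card {L \<in> LS. L #> g = L})"
    by (rule double_count) (use finite_LS finite_G in auto)
  moreover have "card {g \<in> carrier G - {\<one>}. L #> g = L} = card (stab L) - 1" if L: "L \<in> LS" for L
  proof -
    have "{g \<in> carrier G - {\<one>}. L #> g = L} = stab L - {\<one>}" by (auto simp: stab_def)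
    moreover have "\<one> \<in> stab L" by (rule subgroup.one_closed[OF stab_subgroup[OF L]])
    ultimately show ?thesis by simp
  qed
  moreover have "card {L \<in> LS. L #> g = L} = (if g \<in> fpf then 0 else 1)" if g: "g \<in> carrier G - {\<one>}" for g
  proof (cases "g \<in> fpf")
    case True
    then have e: "{L \<in> LS. L #> g = L} = {}" by (auto simp: fpf_def)
    show ?thesis unfolding e using True by simp
  next
    case False
    then obtain L where L: "L \<in> LS" "L #> g = L" using g by (auto simp: fpf_def)
    have "{L \<in> LS. L #> g = L} = {L}"
    proof (intro equalityI subsetI)
      fix M assume M: "M \<in> {L \<in> LS. L #> g = L}"
      have "M = L"
      proof (rule ccontr)
        assume ne: "M \<noteq> L"
        have "g = \<one>" by (rule fixes_two[of g M L]) (use M L g ne in auto)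
        then show False using g by simp
      qed
      then show "M \<in> {L}" by simp
    qed (use L in simp)
    then show ?thesis using False by simp
  qed
  ultimately have "(\<Sum>L\<in>LS. card (stab L) - 1) = (\<Sum>g\<in>carrier G - {\<one>}. if g \<in> fpf then 0 else 1)" by simp
  also have "\<dots> = card (carrier G - {\<one>} - fpf)"
  proof -
    have "(\<Sum>g\<in>carrier G - {\<one>}. if g \<in> fpf then 0 else 1) = (\<Sum>g\<in>carrier G - {\<one>} - fpf. 1::nat)"
      using finite_G by (intro sum.mono_neutral_cong_right) auto
    then show ?thesis by simp
  qed
  finally have e1: "(\<Sum>L\<in>LS. card (stab L) - 1) = card (carrier G - {\<one>} - fpf)" .
  have "fpf \<subseteq> carrier G - {\<one>}"
  proof
    fix g assume g: "g \<in> fpf"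
    have "LS \<noteq> {}" using card_LS n_ge by auto
    then obtain L where L: "L \<in> LS" by blast
    have "L #> \<one> = L" by (rule coset_mult_one[OF LS_sub[OF L]])
    then show "g \<in> carrier G - {\<one>}" using g L by (auto simp: fpf_def)
  qed
  note fsub = this
  have "card (carrier G - {\<one>} - fpf) = card (carrier G - {\<one>}) - card fpf"
    by (rule card_Diff_subset[OF finite_subset[OF fsub] fsub]) (use finite_G in simp)
  moreover have le: "card fpf \<le> card (carrier G - {\<one>})" by (rule card_mono[OF _ fsub]) (use finite_G in simp)
  moreover have "card (carrier G - {\<one>}) = order G - 1" by (simp add: order_def)
  moreover obtain s where s: "\<And>L. L \<in> LS \<Longrightarrow> card (stab L) = s" "2 * s = n - 1"
  proof -
    have "card (stab L) = (n - 1) div 2" if "L \<in> LS" for L using card_stab_eq[OF that] by simp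
    moreover have "LS \<noteq> {}" using card_LS n_ge by auto
    then obtain L where "L \<in> LS" by blast
    ultimately show ?thesis using that[of "(n - 1) div 2"] card_stab_eq[of L] by simp
  qed
  ultimately have e2: "n * (s - 1) + card fpf = order G - 1" using e1 card_LS by simp
  have "LS \<noteq> {}" using card_LS n_ge by auto
  then obtain L where "L \<in> LS" by blast
  then have oG: "order G = n * s" using card_stab s(1) by simp
  have "s \<ge> 1" using s(2) n_ge by simp
  then have "n * s = n * (s - 1) + n" by (metis Suc_diff_1 add.commute less_eq_Suc_le One_nat_def mult_Suc_right)
  then show ?thesis using e2 oG by simp
qed

lemma fpf_conj:
  assumes x: "x \<in> fpf" and h: "h \<in> carrier G" shows "inv h \<otimes> x \<otimes> h \<in> fpf"
proof -
  have xG: "x \<in> carrier G" using x by (simp add: fpf_def)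
  have "L #> (inv h \<otimes> x \<otimes> h) \<noteq> L" if L: "L \<in> LS" for L
  proof
    assume eq: "L #> (inv h \<otimes> x \<otimes> h) = L"
    have sub: "L \<subseteq> carrier G" by (rule LS_sub[OF L])
    have sub': "L #> inv h \<subseteq> carrier G" using LS_sub[OF LS_closed[OF L]] h by simp
    have "(L #> inv h) #> x = ((L #> (inv h \<otimes> x \<otimes> h))) #> inv h"
      using sub h xG by (simp add: coset_mult_assoc m_assoc)
    also have "\<dots> = L #> inv h" unfolding eq ..
    finally show False using x LS_closed[OF L inv_closed[OF h]] by (simp add: fpf_def)
  qed
  then show ?thesis using xG h by (simp add: fpf_def)
qed

lemma fpf_inv: assumes x: "x \<in> fpf" shows "inv x \<in> fpf"
proof -
  have xG: "x \<in> carrier G" using x by (simp add: fpf_def)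
  have "L #> inv x \<noteq> L" if L: "L \<in> LS" for L
  proof
    assume "L #> inv x = L"
    then have "inv x \<in> stab L" using xG by (simp add: stab_def)
    then have "inv (inv x) \<in> stab L" by (rule subgroup.m_inv_closed[OF stab_subgroup[OF L]])
    then show False using x L xG by (auto simp: stab_def fpf_def)
  qed
  then show ?thesis using xG by (simp add: fpf_def)
qed

text \<open>An element that commutes with \<open>x\<close> and fixes \<open>L\<close> also fixes
  \<open>L #> x\<close>, which is a different line.\<close>

lemma fpf_centralizer:
  assumes x: "x \<in> fpf" and L: "L \<in> LS" and h: "h \<in> stab L" and comm: "h \<otimes> x = x \<otimes> h"
  shows "h = \<one>"
proof -
  have G: "x \<in> carrier G" "h \<in> carrier G" "L #> h = L" using x h by (auto simp: fpf_def stab_def)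
  have sub: "L \<subseteq> carrier G" by (rule LS_sub[OF L])
  have "(L #> x) #> h = L #> (x \<otimes> h)" by (rule coset_mult_assoc[OF sub G(1) G(2)])
  also have "\<dots> = L #> (h \<otimes> x)" unfolding comm ..
  also have "\<dots> = (L #> h) #> x" by (rule coset_mult_assoc[symmetric, OF sub G(2) G(1)])
  finally have "(L #> x) #> h = L #> x" using G(3) by simp
  then show ?thesis using fixes_two[OF G(2) L LS_closed[OF L G(1)] _ G(3)] x L by (auto simp: fpf_def)
qed

text \<open>By \<open>fpf_centralizer\<close> the stabiliser of \<open>L\<close> acts freely on
  \<open>fpf\<close> by conjugation, so the classes of \<open>x\<close> and of its inverse have
  \<open>(n - 1) / 2\<close> elements each; being disjoint they exhaust the \<open>n - 1\<close>
  elements of \<open>fpf\<close>.\<close>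

lemma fpf_class_cover:
  assumes x: "x \<in> fpf" and L: "L \<in> LS" and y: "y \<in> fpf"
  shows "\<exists>h\<in>stab L. y = inv h \<otimes> x \<otimes> h \<or> y = inv h \<otimes> inv x \<otimes> h"
proof -
  interpret H: subgroup "stab L" G by (rule stab_subgroup[OF L])
  have xG: "x \<in> carrier G" using x by (simp add: fpf_def)
  have hG: "h \<in> carrier G" if "h \<in> stab L" for h using that H.subset by blast
  define cl where "cl z = (\<lambda>h. inv h \<otimes> z \<otimes> h) ` stab L" for z
  have inj: "inj_on (\<lambda>h. inv h \<otimes> z \<otimes> h) (stab L)" if z: "z \<in> fpf" for z
  proof (rule inj_onI)
    fix g h assume gh: "g \<in> stab L" "h \<in> stab L" "inv g \<otimes> z \<otimes> g = inv h \<otimes> z \<otimes> h"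
    have zG: "z \<in> carrier G" using z by (simp add: fpf_def)
    have G: "g \<in> carrier G" "h \<in> carrier G" using hG gh by auto
    have "g \<otimes> inv h \<otimes> z = g \<otimes> (inv h \<otimes> z \<otimes> h) \<otimes> inv h" using G zG by (simp add: m_assoc)
    also have "\<dots> = g \<otimes> (inv g \<otimes> z \<otimes> g) \<otimes> inv h" using gh(3) by simp
    also have "\<dots> = (g \<otimes> inv g) \<otimes> z \<otimes> (g \<otimes> inv h)" using G zG by (simp only: m_assoc m_closed inv_closed)
    also have "\<dots> = z \<otimes> (g \<otimes> inv h)" using G zG by simp
    finally have "g \<otimes> inv h = \<one>" using gh by (intro fpf_centralizer[OF z L]) auto
    then show "g = h" using G by (metis inv_inv inv_equality inv_closed)
  qed
  have card_cl: "card (cl z) = card (stab L)" if "z \<in> fpf" for z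
    unfolding cl_def by (rule card_image[OF inj[OF that]])
  \<comment> \<open>If \<open>k\<close> in the stabiliser conjugates \<open>x\<close> to its
    inverse, then \<open>k^2\<close> commutes with \<open>x\<close>; so \<open>k^2 = 1\<close>, then
    \<open>k = 1\<close>, and \<open>x\<close> would equal its inverse, which
    \<open>no_involution\<close> forbids.\<close>
  have disj: "cl x \<inter> cl (inv x) = {}"
  proof (rule ccontr)
    assume "cl x \<inter> cl (inv x) \<noteq> {}"
    then obtain g h where gh: "g \<in> stab L" "h \<in> stab L" "inv g \<otimes> x \<otimes> g = inv h \<otimes> inv x \<otimes> h" by (auto simp: cl_def)
    have G: "g \<in> carrier G" "h \<in> carrier G" using hG gh by auto
    define k where "k = g \<otimes> inv h"
    have kL: "k \<in> stab L" using gh by (simp add: k_def)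
    have kG: "k \<in> carrier G" using kL hG by blast
    have "k \<otimes> inv x \<otimes> inv k = g \<otimes> (inv h \<otimes> inv x \<otimes> h) \<otimes> inv g"
      using G xG by (simp add: k_def inv_mult_group m_assoc)
    also have "\<dots> = g \<otimes> (inv g \<otimes> x \<otimes> g) \<otimes> inv g" using gh(3) by simp
    also have "\<dots> = (g \<otimes> inv g) \<otimes> x \<otimes> (g \<otimes> inv g)" using G xG by (simp only: m_assoc m_closed inv_closed)
    also have "\<dots> = x" using G xG by simp
    finally have k1: "k \<otimes> inv x \<otimes> inv k = x" .
    have "inv (k \<otimes> inv x \<otimes> inv k) = k \<otimes> x \<otimes> inv k" using kG xG by (simp add: inv_mult_group m_assoc)
    then have k2: "k \<otimes> x \<otimes> inv k = inv x" using k1 by simp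
    have "k \<otimes> k \<otimes> x = k \<otimes> (k \<otimes> x \<otimes> inv k) \<otimes> k" using kG xG by (simp add: m_assoc)
    also have "\<dots> = k \<otimes> inv x \<otimes> k" unfolding k2 ..
    also have "\<dots> = (k \<otimes> inv x \<otimes> inv k) \<otimes> (k \<otimes> k)"
    proof -
      have "inv k \<otimes> (k \<otimes> k) = k" using kG by (simp add: m_assoc[symmetric])
      then show ?thesis using kG xG by (simp add: m_assoc)
    qed
    also have "\<dots> = x \<otimes> (k \<otimes> k)" unfolding k1 ..
    finally have "k \<otimes> k = \<one>" using kL by (intro fpf_centralizer[OF x L]) auto
    then have "k = \<one>" by (rule no_involution[OF kG])
    then have "inv x = x" using k1 xG by simp
    then have "x \<otimes> x = \<one>" using xG by (metis r_inv)
    then have "x = \<one>" by (rule no_involution[OF xG])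
    moreover have "L #> \<one> = L" by (rule coset_mult_one[OF LS_sub[OF L]])
    ultimately show False using x L by (auto simp: fpf_def)
  qed
  have fin: "finite (stab L)" using finite_G H.subset finite_subset by blast
  have "cl x \<union> cl (inv x) = fpf"
  proof (rule card_subset_eq)
    show "finite fpf" using finite_G by (simp add: fpf_def)
    show "cl x \<union> cl (inv x) \<subseteq> fpf" using fpf_conj[OF x] fpf_conj[OF fpf_inv[OF x]] hG by (auto simp: cl_def)
    have "card (cl x \<union> cl (inv x)) = card (cl x) + card (cl (inv x))"
      by (rule card_Un_disjoint[OF _ _ disj]) (use fin in \<open>auto simp: cl_def\<close>)
    then show "card (cl x \<union> cl (inv x)) = card fpf"
      using card_cl[OF x] card_cl[OF fpf_inv[OF x]] card_stab_eq[OF L] card_fpf by simp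
  qed
  then have "y \<in> cl x \<union> cl (inv x)" using y by simp
  then show ?thesis by (auto simp: cl_def)
qed

lemma conj_pow:
  assumes "x \<in> carrier G" "h \<in> carrier G"
  shows "(inv h \<otimes> x \<otimes> h) [^] (q::nat) = inv h \<otimes> x [^] q \<otimes> h"
proof (induction q)
  case (Suc q)
  have "(inv h \<otimes> x \<otimes> h) [^] Suc q = (inv h \<otimes> x [^] q \<otimes> h) \<otimes> (inv h \<otimes> x \<otimes> h)" using Suc by simp
  also have "\<dots> = inv h \<otimes> x [^] q \<otimes> (h \<otimes> inv h) \<otimes> x \<otimes> h"
    using assms by (simp only: m_assoc m_closed inv_closed nat_pow_closed)
  also have "\<dots> = inv h \<otimes> x [^] Suc q \<otimes> h" using assms by (simp add: m_assoc)
  finally show ?case .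
qed (use assms in simp)

text \<open>An element of order \<open>q\<close> that fixes a line lies in a group of order
  \<open>(n - 1) / 2\<close>, which is prime to \<open>n\<close>.\<close>

lemma prime_dvd_fpf:
  assumes q: "Factorial_Ring.prime q" "q dvd n"
  shows "\<exists>x\<in>fpf. x [^] q = \<one>"
proof -
  have "LS \<noteq> {}" using card_LS n_ge by auto
  then obtain K where K: "K \<in> LS" by blast
  have "q dvd order G" using card_stab[OF K] q(2) by (metis dvd_mult2)
  then obtain H where H: "subgroup H G" "card H = q" using exists_prime_order_subgroup[OF q(1)] finite_G by blast
  interpret H: subgroup H G by (rule H(1))
  have q1: "q > 1" using q(1) by (rule prime_gt_1_nat)
  have "H \<noteq> {\<one>}" using H(2) q1 by auto
  then obtain x where x: "x \<in> H" "x \<noteq> \<one>" using H.one_closed by blast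
  have xG: "x \<in> carrier G" using x(1) H.subset by blast
  have pw: "x [^] q = \<one>"
  proof -
    interpret HG: group "G\<lparr>carrier := H\<rparr>" by (rule subgroup_imp_group[OF H(1)])
    have "x [^]\<^bsub>G\<lparr>carrier := H\<rparr>\<^esub> order (G\<lparr>carrier := H\<rparr>) = \<one>\<^bsub>G\<lparr>carrier := H\<rparr>\<^esub>"
      by (rule HG.pow_order_eq_1) (use x in simp)
    then show ?thesis using H(2) by (simp add: order_def nat_pow_consistent[symmetric])
  qed
  have "x \<in> fpf"
  proof (rule ccontr)
    assume "x \<notin> fpf"
    then obtain L where L: "L \<in> LS" "x \<in> stab L" using xG by (auto simp: fpf_def stab_def)
    interpret S: subgroup "stab L" G by (rule stab_subgroup[OF L(1)])
    have "x [^] card (stab L) = \<one>"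
    proof -
      interpret SG: group "G\<lparr>carrier := stab L\<rparr>" by (rule subgroup_imp_group[OF stab_subgroup[OF L(1)]])
      have "x [^]\<^bsub>G\<lparr>carrier := stab L\<rparr>\<^esub> order (G\<lparr>carrier := stab L\<rparr>) = \<one>\<^bsub>G\<lparr>carrier := stab L\<rparr>\<^esub>"
        by (rule SG.pow_order_eq_1) (use L in simp)
      then show ?thesis by (simp add: order_def nat_pow_consistent[symmetric])
    qed
    then have "ord x dvd card (stab L)" "ord x dvd q" using pw xG by (simp_all add: pow_eq_id)
    moreover have "ord x \<noteq> 1" using x(2) ord_eq_1[OF xG] by blast
    ultimately have "q dvd card (stab L)" using q(1) by (metis prime_nat_iff)
    then have "q dvd 2 * card (stab L)" by simp
    then have "q dvd n - 1" using card_stab_eq[OF L(1)] by simp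
    then have "q dvd n - (n - 1)" using q(2) by (rule dvd_diff_nat[rotated])
    then show False using n_ge q1 by simp
  qed
  then show ?thesis using pw by blast
qed

text \<open>By \<open>fpf_class_cover\<close> all elements of \<open>fpf\<close> have the same
  order, while every prime divisor of \<open>n\<close> is the order of one of them.\<close>

lemma primepow_n: "primepow n"
proof -
  have "n \<noteq> 1" using n_ge by simp
  then obtain p where p: "Factorial_Ring.prime p" "p dvd n" using prime_factor_nat by blast
  obtain x where x: "x \<in> fpf" "x [^] p = \<one>" using prime_dvd_fpf[OF p] by blast
  have xG: "x \<in> carrier G" using x(1) by (simp add: fpf_def)
  have "LS \<noteq> {}" using card_LS n_ge by auto
  then obtain L where L: "L \<in> LS" by blast
  have x1: "y \<noteq> \<one>" if "y \<in> fpf" for y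
    using that L coset_mult_one[OF LS_sub[OF L]] by (auto simp: fpf_def)
  have uniq: "q = p" if q: "Factorial_Ring.prime q" "q dvd n" for q
  proof -
    obtain y where y: "y \<in> fpf" "y [^] q = \<one>" using prime_dvd_fpf[OF q] by blast
    have yG: "y \<in> carrier G" using y(1) by (simp add: fpf_def)
    obtain h where h: "h \<in> stab L" "y = inv h \<otimes> x \<otimes> h \<or> y = inv h \<otimes> inv x \<otimes> h"
      using fpf_class_cover[OF x(1) L y(1)] by blast
    have hG: "h \<in> carrier G" using h(1) by (simp add: stab_def)
    have xi: "inv x [^] p = \<one>" using x(2) xG by (simp add: nat_pow_inv)
    have "y [^] p = \<one>" using h(2)
    proof
      assume "y = inv h \<otimes> x \<otimes> h"
      then show ?thesis using conj_pow[OF xG hG, of p] x(2) hG by simp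
    next
      assume "y = inv h \<otimes> inv x \<otimes> h"
      then show ?thesis using conj_pow[OF inv_closed[OF xG] hG, of p] xi hG by simp
    qed
    then have "ord y dvd p" "ord y dvd q" using y(2) yG by (simp_all add: pow_eq_id)
    moreover have "ord y \<noteq> 1" using x1[OF y(1)] ord_eq_1[OF yG] by blast
    ultimately show "q = p" using p(1) q(1) by (metis prime_nat_iff)
  qed
  have n0: "n \<noteq> 0" using n_ge by simp
  have "\<not> is_unit p" using p(1) not_prime_unit by blast
  then obtain e m where m: "n = p ^ e * m" "\<not> p dvd m"
    using multiplicity_decompose'[OF n0, of p] by blast
  have "m = 1"
  proof (rule ccontr)
    assume "m \<noteq> 1"
    then obtain q where q: "Factorial_Ring.prime q" "q dvd m" using prime_factor_nat by blast
    then have "q dvd n" using m(1) by (metis dvd_mult)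
    then have "q = p" using uniq[OF q(1)] by simp
    then show False using q(2) m(2) by simp
  qed
  then have ne: "n = p ^ e" using m(1) by simp
  moreover have "e > 0"
  proof (rule ccontr)
    assume "\<not> e > 0"
    then show False using ne n_ge by simp
  qed
  ultimately show ?thesis using p(1) unfolding primepow_def by blast
qed

end

subsection \<open>The Petersen graph\<close>

text \<open>A product of two generators is never a generator (\<open>L0\<close>), and every other
  non-identity element is such a product in exactly one way (\<open>U\<close>, \<open>T\<close>). An
  inverse-closed set of three generators contains an involution \<open>t\<close>; factoring the
  conjugate \<open>g = t x t\<close> of another generator leads to a contradiction.\<close>

lemma (in group) petersen_not_cayley:
  assumes conn: "connection_set G S" and sr: "sr_graph (carrier G) (cadj G S) 3 0 1"
  shows False
proof -
  interpret sr_graph "carrier G" "cadj G S" 3 0 1 by (rule sr)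
  have SG: "S \<subseteq> carrier G" "\<one> \<notin> S" "\<And>s. s \<in> S \<Longrightarrow> inv s \<in> S" using conn by (auto simp: connection_set_def)
  have sG: "s \<in> carrier G" if "s \<in> S" for s using SG(1) that by blast
  have one: "cadj G S \<one> w \<longleftrightarrow> w \<in> S" for w
  proof
    assume "cadj G S \<one> w"
    then have w: "w \<in> carrier G" "inv w \<in> S" by (auto simp: cadj_def)
    then show "w \<in> S" using SG(3)[OF w(2)] by simp
  next
    assume "w \<in> S"
    then show "cadj G S \<one> w" using SG(3) sG by (simp add: cadj_def)
  qed
  have gw: "cadj G S (s \<otimes> t) t" if "s \<in> S" "t \<in> S" for s t
    using that sG by (simp add: cadj_def m_assoc)
  have L0: "s \<otimes> t \<notin> S" if st: "s \<in> S" "t \<in> S" for s t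
  proof
    assume "s \<otimes> t \<in> S"
    then have "card {w. cadj G S \<one> w \<and> cadj G S (s \<otimes> t) w} = 0" using card_adj one by blast
    moreover have "t \<in> {w. cadj G S \<one> w \<and> cadj G S (s \<otimes> t) w}" using st one gw by simp
    ultimately show False using finite_nbrs2[of \<one> "cadj G S (s \<otimes> t)"] by (metis card_0_eq empty_iff)
  qed
  have U: "s = s' \<and> t = t'" if st: "s \<in> S" "t \<in> S" "s' \<in> S" "t' \<in> S" and eq: "s \<otimes> t = s' \<otimes> t'" and ne: "s \<otimes> t \<noteq> \<one>" for s t s' t'
  proof -
    have G: "s \<otimes> t \<in> carrier G" using st sG by simp
    have "card {w. cadj G S \<one> w \<and> cadj G S (s \<otimes> t) w} = 1"
      using card_nonadj[OF one_closed G] ne one L0[OF st(1,2)] by auto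
    then obtain w where w: "{w. cadj G S \<one> w \<and> cadj G S (s \<otimes> t) w} = {w}" using card_1_singletonE by blast
    have "t \<in> {w}" "t' \<in> {w}" unfolding w[symmetric] using st one gw[OF st(1,2)] gw[OF st(3,4)] eq by auto
    then have "t = t'" by simp
    then show ?thesis using eq st sG by simp
  qed
  have T: "\<exists>s\<in>S. \<exists>t\<in>S. g = s \<otimes> t" if g: "g \<in> carrier G" "g \<noteq> \<one>" "g \<notin> S" for g
  proof -
    have "card {w. cadj G S \<one> w \<and> cadj G S g w} = 1" using card_nonadj[OF one_closed g(1)] g one by auto
    then obtain w where "{w. cadj G S \<one> w \<and> cadj G S g w} = {w}" using card_1_singletonE by blast
    then have "w \<in> {w. cadj G S \<one> w \<and> cadj G S g w}" by simp
    then have w: "w \<in> S" "g \<otimes> inv w \<in> S" using one by (auto simp: cadj_def)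
    have "g = (g \<otimes> inv w) \<otimes> w" using g sG[OF w(1)] by (simp add: m_assoc)
    then show ?thesis using w by blast
  qed
  have "{w. cadj G S \<one> w} = S" using one by blast
  then have cS: "card S = 3" using card_nbrs[OF one_closed] by simp
  then obtain x y z where xyz: "S = {x, y, z}" "x \<noteq> y" "y \<noteq> z" "x \<noteq> z" unfolding card_3_iff by blast
  have mem: "x \<in> S" "y \<in> S" "z \<in> S" using xyz(1) by auto
  have ii: "inv (inv s) = s" if "s \<in> S" for s using sG[OF that] by simp
  have "\<exists>t\<in>S. inv t = t"
  proof (rule ccontr)
    assume n: "\<not> (\<exists>t\<in>S. inv t = t)"
    have "inv x \<in> {x, y, z}" "inv y \<in> {x, y, z}" "inv z \<in> {x, y, z}" using SG(3) mem unfolding xyz(1)[symmetric] by auto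
    then have "inv x = y \<or> inv x = z" "inv y = x \<or> inv y = z" "inv z = x \<or> inv z = y" using n mem by auto
    then show False using ii[OF mem(1)] ii[OF mem(2)] ii[OF mem(3)] xyz(2,3,4) by metis
  qed
  then obtain t where t: "t \<in> S" "inv t = t" by blast
  have tG: "t \<in> carrier G" by (rule sG[OF t(1)])
  have tt: "t \<otimes> t = \<one>" using t(2) tG by (metis r_inv)
  have "card (S - {t}) = 2" using cS t(1) by simp
  then obtain x y where xy: "S - {t} = {x, y}" "x \<noteq> y" unfolding card_2_iff by blast
  have m: "x \<in> S" "y \<in> S" "x \<noteq> t" "y \<noteq> t" using xy(1) by auto
  have S: "s = t \<or> s = x \<or> s = y" if "s \<in> S" for s using that xy(1) by auto
  have xG: "x \<in> carrier G" "y \<in> carrier G" using sG m by auto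
  define g where "g = t \<otimes> x \<otimes> t"
  have gG: "g \<in> carrier G" using tG xG by (simp add: g_def)
  have gt: "t \<otimes> g \<otimes> t = x"
  proof -
    have "t \<otimes> g \<otimes> t = (t \<otimes> t) \<otimes> x \<otimes> (t \<otimes> t)" unfolding g_def using tG xG by (simp only: m_assoc m_closed)
    then show ?thesis using tt xG by simp
  qed
  have gt2: "g \<otimes> t = t \<otimes> x" "t \<otimes> g = x \<otimes> t"
  proof -
    have "g \<otimes> t = t \<otimes> x \<otimes> (t \<otimes> t)" unfolding g_def using tG xG by (simp only: m_assoc m_closed)
    then show "g \<otimes> t = t \<otimes> x" using tt tG xG by simp
    have "t \<otimes> g = (t \<otimes> t) \<otimes> x \<otimes> t" unfolding g_def using tG xG by (simp only: m_assoc m_closed)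
    then show "t \<otimes> g = x \<otimes> t" using tt tG xG by simp
  qed
  have x1: "x \<noteq> \<one>" "t \<noteq> \<one>" using m t SG(2) by auto
  have g1: "g \<noteq> \<one>" using gt tt tG x1(1) by auto
  have tx1: "t \<otimes> x \<noteq> \<one>"
  proof
    assume "t \<otimes> x = \<one>"
    then have "t \<otimes> x = t \<otimes> t" using tt by simp
    then show False using m(3) tG xG by simp
  qed
  \<comment> \<open>From \<open>g t = t x\<close>, membership of \<open>g\<close> in
    \<open>S\<close> would give this product two factorisations.\<close>
  have gS: "g \<notin> S"
  proof
    assume gS: "g \<in> S"
    have "t = g \<and> x = t" by (rule U[OF t(1) m(1) gS t(1)]) (use gt2 tx1 in auto)
    then show False using m(3) by simp
  qed
  obtain s1 s2 where s: "s1 \<in> S" "s2 \<in> S" "g = s1 \<otimes> s2" using T[OF gG g1 gS] by blast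
  have s1t: "s1 \<noteq> t"
  proof
    assume "s1 = t"
    then have "t \<otimes> (x \<otimes> t) = t \<otimes> s2" using s(3) tG xG by (simp add: g_def m_assoc)
    then have "x \<otimes> t = s2" using tG xG sG[OF s(2)] by simp
    then show False using L0[OF m(1) t(1)] s(2) by simp
  qed
  have s2t: "s2 \<noteq> t"
  proof
    assume "s2 = t"
    then have "(t \<otimes> x) \<otimes> t = s1 \<otimes> t" using s(3) by (simp add: g_def)
    then have "t \<otimes> x = s1" using tG xG sG[OF s(1)] by (metis m_closed r_cancel)
    then show False using L0[OF t(1) m(1)] s(1) by simp
  qed
  have s12: "s1 = x \<or> s1 = y" "s2 = x \<or> s2 = y" using S[OF s(1)] S[OF s(2)] s1t s2t by auto
  have gg: "g \<otimes> g = t \<otimes> (x \<otimes> x) \<otimes> t"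
  proof -
    have "g \<otimes> g = t \<otimes> x \<otimes> (t \<otimes> t) \<otimes> x \<otimes> t" unfolding g_def using tG xG by (simp only: m_assoc m_closed)
    then show ?thesis using tt tG xG by (simp add: m_assoc)
  qed
  \<comment> \<open>A generator with \<open>s^4 = s\<close> has order three, so \<open>s s\<close>
    is its inverse and thus again a generator.\<close>
  have cube: False if "s \<in> S" "s \<otimes> s \<otimes> (s \<otimes> s) = s" for s
  proof -
    have G: "s \<in> carrier G" using sG that by blast
    have "s \<otimes> (s \<otimes> s \<otimes> s) = s \<otimes> \<one>" using that(2) G by (simp add: m_assoc)
    then have "s \<otimes> s \<otimes> s = \<one>" using G by (metis l_cancel m_closed one_closed)
    then have "s \<otimes> s = inv s" using G by (metis inv_equality m_closed inv_inv)
    then show False using L0[OF that(1,1)] SG(3)[OF that(1)] by simp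
  qed
  show False
  proof (cases "inv x = x")
    \<comment> \<open>All three generators are involutions; then \<open>g\<close>, also an
      involution, equals both \<open>s1 s2\<close> and \<open>s2 s1\<close>.\<close>
    case True
    have xx: "x \<otimes> x = \<one>" using True xG by (metis r_inv)
    have "inv y \<noteq> x" using True xG ii[OF m(2)] xy(2) by auto
    moreover have "inv y \<noteq> t"
    proof
      assume "inv y = t"
      then have "inv t = y" using ii[OF m(2)] by simp
      then show False using t(2) m(4) by simp
    qed
    ultimately have "inv y = y" using S[OF SG(3)[OF m(2)]] by auto
    then have yy: "y \<otimes> y = \<one>" using xG by (metis r_inv)
    have gg1: "g \<otimes> g = \<one>" unfolding gg using xx tt tG by simp
    have gi: "inv g = g" using gg1 gG by (metis inv_equality)
    have "(s1 = x \<and> s2 = y) \<or> (s1 = y \<and> s2 = x)" using s12 s(3) g1 xx yy by auto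
    then have "s1 \<noteq> s2" "inv s1 = s1" "inv s2 = s2" using xy(2) True \<open>inv y = y\<close> by auto
    have "inv g = inv s2 \<otimes> inv s1" unfolding s(3) using sG s by (simp add: inv_mult_group)
    also have "\<dots> = s2 \<otimes> s1" unfolding \<open>inv s1 = s1\<close> \<open>inv s2 = s2\<close> ..
    finally have e: "inv g = s2 \<otimes> s1" .
    have "s1 \<otimes> s2 = s2 \<otimes> s1" unfolding s(3)[symmetric] e[symmetric] gi ..
    moreover have "s1 \<otimes> s2 \<noteq> \<one>" using g1 unfolding s(3) .
    ultimately have "s1 = s2 \<and> s2 = s1" by (rule U[OF s(1,2,2,1)])
    then show False using \<open>s1 \<noteq> s2\<close> by simp
  next
    \<comment> \<open>Now \<open>y\<close> is the inverse of \<open>x\<close>, and \<open>g\<close>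
      can only be \<open>x^2\<close> or its inverse; squaring \<open>g = t x t\<close> yields
      \<open>x^4 = x\<close> in both cases.\<close>
    case False
    have "inv x \<noteq> t"
    proof
      assume "inv x = t"
      then have "inv t = x" using ii[OF m(1)] by simp
      then show False using t(2) m(3) by simp
    qed
    then have xi: "inv x = y" using S[OF SG(3)[OF m(1)]] False by auto
    then have yi: "inv y = x" using ii[OF m(1)] by simp
    have p1: "x \<otimes> y = \<one>" "y \<otimes> x = \<one>" using xi xG by (metis r_inv, metis l_inv)
    have "(s1 = x \<and> s2 = x) \<or> (s1 = y \<and> s2 = y)" using s12 s(3) g1 p1 by auto
    then show False
    proof
      assume "s1 = x \<and> s2 = x"
      then have gx: "g = x \<otimes> x" using s(3) by simp
      have "x \<otimes> x \<otimes> (x \<otimes> x) = t \<otimes> g \<otimes> t" using gg unfolding gx .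
      then show False using gt cube[OF m(1)] by metis
    next
      assume "s1 = y \<and> s2 = y"
      then have gy: "g = y \<otimes> y" using s(3) by simp
      have "inv g = x \<otimes> x" unfolding gy using xG yi by (simp add: inv_mult_group)
      then have "inv (g \<otimes> g) = x \<otimes> x \<otimes> (x \<otimes> x)" using gG by (simp add: inv_mult_group)
      moreover have "inv (g \<otimes> g) = t \<otimes> inv (x \<otimes> x) \<otimes> t"
        unfolding gg using tG xG t(2) by (simp add: inv_mult_group m_assoc)
      moreover have "inv (x \<otimes> x) = g" unfolding gy using xG xi by (simp add: inv_mult_group)
      ultimately have "x \<otimes> x \<otimes> (x \<otimes> x) = x" using gt by simp
      then show False by (rule cube[OF m(1)])
    qed
  qed
qed

subsection \<open>The Chang graphs\<close>

text \<open>The neighbourhood of \<open>x\<close> consists of the six other vertices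
  \<open>K'\<close> of the clique and six vertices \<open>Q\<close>. With \<open>l = 6\<close>, each
  vertex of \<open>K'\<close> has one neighbour in \<open>Q\<close>, and each of \<open>Q\<close> at
  least one in \<open>K'\<close>, hence exactly one. So \<open>Q\<close> is a clique as well, and
  two cliques cannot contain the three tips of a claw.\<close>

lemma (in sr_minus2) seven_clique_no_claw:
  assumes par: "m = 4" "r = 4" and K: "clique K" "card K = 7" "x \<in> K"
    and ab: "local_nonadj x a b" and c: "c \<in> claw_tips x a b"
  shows False
proof -
  have kl: "k = 12" "l = 6" using k_eq l_eq par by auto
  note cl = clawD[OF c ab]
  define K' where "K' = K - {x}"
  define Q where "Q = {w. E x w} - K'"
  have finK: "finite K" using K(2) card.infinite by fastforce
  have K': "card K' = 6" "finite K'" using K finK by (auto simp: K'_def)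
  have Ex: "E x y" if "y \<in> K'" for y using that K(1,3) by (auto simp: K'_def clique_def)
  have EK: "E y z" if "y \<in> K'" "z \<in> K'" "y \<noteq> z" for y z using that K(1) by (auto simp: K'_def clique_def)
  have sub: "K' \<subseteq> {w. E x w}" using Ex by auto
  have finQ: "finite Q" by (simp add: Q_def)
  have "card {w. E x w} = k" using card_nbrs cl(1) E_V by blast
  then have Q: "card Q = 6" unfolding Q_def using card_Diff_subset[OF K'(2) sub] K'(1) kl by simp
  have split: "{w. E x w} = K' \<union> Q" using sub by (auto simp: Q_def)
  have dj: "K' \<inter> Q = {}" by (auto simp: Q_def)
  have com: "card {y \<in> K'. E w y} + card {y \<in> Q. E w y} = 6" if w: "E x w" for w
  proof -
    have "{y. E x y \<and> E w y} = {y \<in> K'. E w y} \<union> {y \<in> Q. E w y}" using split by auto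
    moreover have "card ({y \<in> K'. E w y} \<union> {y \<in> Q. E w y}) = card {y \<in> K'. E w y} + card {y \<in> Q. E w y}"
      by (rule card_Un_disjoint) (use K'(2) finQ dj in auto)
    ultimately show ?thesis using card_adj[OF w] kl by simp
  qed
  have one: "card {q \<in> Q. E y q} = 1" if y: "y \<in> K'" for y
  proof -
    have "{z \<in> K'. E y z} = K' - {y}" using EK[OF y] E_irrefl by auto
    then have "card {z \<in> K'. E y z} = 5" using y K' by simp
    then show ?thesis using com[OF Ex[OF y]] by simp
  qed
  have "(\<Sum>y\<in>K'. card {q \<in> Q. E y q}) = (\<Sum>q\<in>Q. card {y \<in> K'. E y q})" by (rule double_count[OF K'(2) finQ])
  then have sum: "(\<Sum>q\<in>Q. card {y \<in> K'. E y q}) = 6" using one K'(1) by simp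
  have ge: "card {y \<in> K'. E y q} \<ge> 1 \<and> card {y \<in> K'. E y q} + card {y \<in> Q. E q y} = 6 \<and> {y \<in> Q. E q y} \<subseteq> Q - {q}"
    if q: "q \<in> Q" for q
  proof -
    have e: "{y \<in> K'. E y q} = {y \<in> K'. E q y}" using E_sym by auto
    have xq: "E x q" using q by (auto simp: Q_def)
    have s: "{y \<in> Q. E q y} \<subseteq> Q - {q}" using E_irrefl by auto
    have "card {y \<in> Q. E q y} \<le> card (Q - {q})" by (rule card_mono[OF _ s]) (use finQ in simp)
    then have "card {y \<in> Q. E q y} \<le> 5" using Q q by simp
    then show ?thesis using com[OF xq] e s by simp
  qed
  have eq1: "card {y \<in> K'. E y q} = 1" if q: "q \<in> Q" for q
  proof (rule ccontr)
    assume "card {y \<in> K'. E y q} \<noteq> 1"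
    then have "(\<Sum>q\<in>Q. 1) < (\<Sum>q\<in>Q. card {y \<in> K'. E y q})"
      using ge q by (intro sum_strict_mono_ex1[OF finQ]) (auto intro!: bexI[of _ q] simp: order.strict_iff_order)
    then show False using sum Q by simp
  qed
  have EQ: "E p q" if "p \<in> Q" "q \<in> Q" "p \<noteq> q" for p q
  proof -
    have "card {y \<in> Q. E p y} = 5" using ge[OF that(1)] eq1[OF that(1)] by simp
    moreover have "card (Q - {p}) = 5" using Q that(1) by simp
    ultimately have "{y \<in> Q. E p y} = Q - {p}" using ge[OF that(1)] finQ by (intro card_subset_eq) auto
    then have "q \<in> {y \<in> Q. E p y}" using that by simp
    then show ?thesis by simp
  qed
  have "a \<in> K' \<union> Q" "b \<in> K' \<union> Q" "c \<in> K' \<union> Q" unfolding split[symmetric] using cl by auto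
  then show False using EK EQ cl(4-9) by (metis Un_iff)
qed

lemma even_card_involution:
  assumes "finite A" "\<And>x. x \<in> A \<Longrightarrow> f x \<in> A \<and> f (f x) = x \<and> f x \<noteq> x"
  shows "even (card A)"
  using assms
proof (induction A rule: finite_psubset_induct)
  case (psubset A)
  show ?case
  proof (cases "A = {}")
    case False
    then obtain x where x: "x \<in> A" by blast
    have fx: "f x \<in> A" "f (f x) = x" "f x \<noteq> x" using psubset.prems[OF x] by auto
    have "even (card (A - {x, f x}))"
    proof (rule psubset.IH)
      show "A - {x, f x} \<subset> A" using x by auto
      fix y assume y: "y \<in> A - {x, f x}"
      have fy: "f y \<in> A" "f (f y) = y" "f y \<noteq> y" using psubset.prems[of y] y by auto
      have "f y \<noteq> x" using fy(2) y by auto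
      moreover have "f y \<noteq> f x"
      proof
        assume "f y = f x"
        then have "f (f y) = f (f x)" by simp
        then show False using fy(2) fx(2) y by simp
      qed
      ultimately show "f y \<in> A - {x, f x} \<and> f (f y) = y \<and> f y \<noteq> y" using fy by simp
    qed
    moreover have "card (A - {x, f x}) = card A - card {x, f x}" by (rule card_Diff_subset) (use x fx in auto)
    moreover have "card {x, f x} \<le> card A" by (rule card_mono[OF psubset.hyps]) (use x fx in auto)
    ultimately show ?thesis using fx(3) by simp
  qed simp
qed

text \<open>A row of the 4 by 4 quotient matrix in the proof for the Chang graphs, with diagonal
  entry \<open>b\<close>: its sum is the valency 12, and its sum of squares is the diagonal entry
  \<open>8 + 2 b + 28\<close> of the squared matrix.\<close>

lemma chang_row:
  assumes "even (b::nat)" "b \<le> 6" "b + x + y + z = 12" "b * b + x * x + y * y + z * z = 36 + 2 * b"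
  shows "b = 6 \<or> (b = 2 \<and> (x = 2 \<and> y = 4 \<and> z = 4 \<or> x = 4 \<and> y = 2 \<and> z = 4 \<or> x = 4 \<and> y = 4 \<and> z = 2))"
proof -
  have "\<forall>b\<in>set [0, 2, 4, 6]. \<forall>x\<in>set [0..<13]. \<forall>y\<in>set [0..<13]. b + x + y \<le> 12 \<longrightarrow>
    (let z = 12 - (b + x + y) in b * b + x * x + y * y + z * z = 36 + 2 * b \<longrightarrow>
     b = 6 \<or> (b = (2::nat) \<and> (x = 2 \<and> y = 4 \<and> z = 4 \<or> x = 4 \<and> y = 2 \<and> z = 4 \<or> x = 4 \<and> y = 4 \<and> z = 2)))"
    by code_simp
  moreover have "b \<in> set [0, 2, 4, 6]"
  proof -
    have "b = 0 \<or> b = 1 \<or> b = 2 \<or> b = 3 \<or> b = 4 \<or> b = 5 \<or> b = 6" using assms(2) by linarith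
    then show ?thesis using assms(1) by auto
  qed
  moreover have "x \<in> set [0..<13]" "y \<in> set [0..<13]" using assms(3) by auto
  moreover have "b + x + y \<le> 12" "z = 12 - (b + x + y)" using assms(3) by auto
  ultimately show ?thesis using assms(4) unfolding Let_def by metis
qed

text \<open>The cosets \<open>C x\<close> are the orbits of a subgroup \<open>H\<close> of order 7
  under right translation. Their quotient matrix \<open>B\<close> is symmetric and inherits
  \<open>B^2 = 8 I + 2 B + 28 J\<close>. Some diagonal entry must be 6, so one coset is a clique of
  seven vertices, and the claw, translated to one of these, contradicts
  \<open>seven_clique_no_claw\<close>.\<close>

lemma (in group) chang_not_cayley:
  assumes conn: "connection_set G S" and sr: "sr_minus2 (carrier G) (cadj G S) 12 6 4 4" and v: "card (carrier G) = 28"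
    and nonadj: "sr_graph.local_nonadj (cadj G S) u a b" and tip: "c \<in> sr_graph.claw_tips (cadj G S) u a b"
  shows False
proof -
  interpret sr_minus2 "carrier G" "cadj G S" 12 6 4 4 by (rule sr)
  have SG: "S \<subseteq> carrier G" "\<one> \<notin> S" "\<And>s. s \<in> S \<Longrightarrow> inv s \<in> S" using conn by (auto simp: connection_set_def)
  have p7: "Factorial_Ring.prime (7::nat)" by simp
  have "7 dvd order G" using v by (simp add: order_def)
  then obtain H where H: "subgroup H G" "card H = 7" using exists_prime_order_subgroup[OF p7] finite_V by blast
  interpret H: subgroup H G by (rule H(1))
  have HG: "h \<in> carrier G" if "h \<in> H" for h using that H.subset by blast
  have finH: "finite H" using H(2) card.infinite by fastforce
  \<comment> \<open>Left cosets, so that right translation by elements of \<open>H\<close>, an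
    automorphism, maps each to itself.\<close>
  define C where "C x = (\<lambda>h. x \<otimes> h) ` H" for x
  have C_sub: "C x \<subseteq> carrier G" if "x \<in> carrier G" for x using that HG by (auto simp: C_def)
  have C_self: "x \<in> C x" if "x \<in> carrier G" for x using that H.one_closed by (auto simp: C_def intro!: rev_image_eqI[of \<one>])
  have C_card: "card (C x) = 7" if x: "x \<in> carrier G" for x
  proof -
    have "inj_on (\<lambda>h. x \<otimes> h) H" using x HG by (auto intro!: inj_onI)
    then show ?thesis using H(2) by (simp add: C_def card_image)
  qed
  have C_mem: "C y = C x" if x: "x \<in> carrier G" and y: "y \<in> C x" for x y
  proof -
    obtain h where h: "h \<in> H" "y = x \<otimes> h" using y by (auto simp: C_def)
    show ?thesis
    proof (intro equalityI subsetI)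
      fix z assume "z \<in> C y"
      then obtain k where k: "k \<in> H" "z = y \<otimes> k" by (auto simp: C_def)
      then have "z = x \<otimes> (h \<otimes> k)" using h x HG by (simp add: m_assoc)
      then show "z \<in> C x" using h k by (auto simp: C_def)
    next
      fix z assume "z \<in> C x"
      then obtain k where k: "k \<in> H" "z = x \<otimes> k" by (auto simp: C_def)
      have G: "h \<in> carrier G" "k \<in> carrier G" using h k HG by auto
      have "y \<otimes> (inv h \<otimes> k) = x \<otimes> (h \<otimes> inv h) \<otimes> k"
        unfolding h(2) using x G by (simp only: m_assoc m_closed inv_closed)
      then have "z = y \<otimes> (inv h \<otimes> k)" using x G k(2) by simp
      then show "z \<in> C y" using h k by (auto simp: C_def)
    qed
  qed
  define CS where "CS = C ` carrier G"
  have finCS: "finite CS" using finite_V by (simp add: CS_def)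
  have CS_disj: "D \<inter> F = {}" if "D \<in> CS" "F \<in> CS" "D \<noteq> F" for D F
  proof (rule ccontr)
    assume "D \<inter> F \<noteq> {}"
    then obtain z where z: "z \<in> D" "z \<in> F" by blast
    then have "D = C z" "F = C z" using that(1,2) C_mem by (auto simp: CS_def)
    then show False using that(3) by simp
  qed
  have CS_mem: "C x = D" if "D \<in> CS" "x \<in> D" for x D using that C_mem by (auto simp: CS_def)
  have CS_card: "card D = 7" if "D \<in> CS" for D using that C_card by (auto simp: CS_def)
  have CS_sub: "D \<subseteq> carrier G" if "D \<in> CS" for D using that C_sub by (auto simp: CS_def)
  have CS_fin: "finite D" if "D \<in> CS" for D using finite_subset[OF CS_sub[OF that] finite_V] .
  have CS_Un: "\<Union>CS = carrier G" using C_sub C_self by (auto simp: CS_def)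
  have "7 * card CS = card (\<Union>CS)"
    by (rule card_partition[OF finCS]) (use CS_Un finite_V CS_card CS_disj in auto)
  then have card_CS: "card CS = 4" using CS_Un v by simp
  define nb where "nb w D = card {d \<in> D. cadj G S w d}" for w D
  have nbh: "nb w D \<le> nb (w \<otimes> h) D" if w: "w \<in> carrier G" and h: "h \<in> H" and D: "D \<in> CS" for w h D
  proof -
    have inj: "inj_on (\<lambda>d. d \<otimes> h) {d \<in> D. cadj G S w d}" by (rule inj_onI) (use CS_sub[OF D] HG[OF h] in \<open>simp add: subset_iff\<close>)
    have "(\<lambda>d. d \<otimes> h) ` {d \<in> D. cadj G S w d} \<subseteq> {d \<in> D. cadj G S (w \<otimes> h) d}"
    proof
      fix e assume "e \<in> (\<lambda>d. d \<otimes> h) ` {d \<in> D. cadj G S w d}"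
      then obtain d where d: "d \<in> D" "cadj G S w d" "e = d \<otimes> h" by auto
      have "e \<in> C d" using h d(3) by (auto simp: C_def)
      then have "e \<in> D" using CS_mem[OF D d(1)] by simp
      then show "e \<in> {d \<in> D. cadj G S (w \<otimes> h) d}" using cadj_translate[OF HG[OF h] d(2)] d(3) by simp
    qed
    from card_mono[OF _ this] show ?thesis using card_image[OF inj] CS_fin[OF D] by (simp add: nb_def)
  qed
  \<comment> \<open>Right translation by \<open>H\<close> is transitive on each coset and preserves
    all cosets, so the partition is equitable.\<close>
  have nb_const: "nb w D = nb w' D" if w: "w \<in> F" "w' \<in> F" and F: "F \<in> CS" and D: "D \<in> CS" for w w' F D
  proof -
    have G: "w \<in> carrier G" "w' \<in> carrier G" using w CS_sub[OF F] by auto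
    have "w' \<in> C w" "w \<in> C w'" using CS_mem[OF F w(1)] CS_mem[OF F w(2)] w by auto
    then obtain h h' where h: "h \<in> H" "w' = w \<otimes> h" "h' \<in> H" "w = w' \<otimes> h'" by (auto simp: C_def)
    have "nb w D \<le> nb w' D" using nbh[OF G(1) h(1) D] h(2) by simp
    moreover have "nb w' D \<le> nb w D" using nbh[OF G(2) h(3) D] h(4) by simp
    ultimately show ?thesis by simp
  qed
  define B where "B F D = nb (SOME w. w \<in> F) D" for F D
  have B: "nb w D = B F D" if w: "w \<in> F" and F: "F \<in> CS" and D: "D \<in> CS" for w F D
    unfolding B_def by (rule nb_const[OF w someI[of "\<lambda>w. w \<in> F", OF w] F D])
  have ne: "\<exists>w. w \<in> F" if "F \<in> CS" for F using CS_card[OF that] by (metis card.empty ex_in_conv zero_neq_numeral)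
  have B_sym: "B F D = B D F" if F: "F \<in> CS" and D: "D \<in> CS" for F D
  proof -
    have "(\<Sum>w\<in>F. card {d \<in> D. cadj G S w d}) = (\<Sum>d\<in>D. card {w \<in> F. cadj G S w d})"
      by (rule double_count[OF CS_fin[OF F] CS_fin[OF D]])
    moreover have "(\<Sum>w\<in>F. card {d \<in> D. cadj G S w d}) = (\<Sum>w\<in>F. B F D)"
      using B[OF _ F D] by (intro sum.cong refl) (simp add: nb_def)
    moreover have "(\<Sum>d\<in>D. card {w \<in> F. cadj G S w d}) = (\<Sum>d\<in>D. B D F)"
    proof (intro sum.cong refl)
      fix d assume "d \<in> D"
      moreover have "{w \<in> F. cadj G S w d} = {w \<in> F. cadj G S d w}" using E_sym by blast
      ultimately show "card {w \<in> F. cadj G S w d} = B D F" using B[OF _ D F, of d] by (simp add: nb_def)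
    qed
    ultimately show ?thesis using CS_card[OF F] CS_card[OF D] by simp
  qed
  have sumCS: "(\<Sum>w | cadj G S x w. f w) = (\<Sum>D\<in>CS. \<Sum>w\<in>{w \<in> D. cadj G S x w}. f w)" for x and f :: "'a \<Rightarrow> nat"
  proof -
    have "{w. cadj G S x w} = (\<Union>D\<in>CS. {w \<in> D. cadj G S x w})" using CS_Un E_V by blast
    moreover have "sum f (\<Union>D\<in>CS. {w \<in> D. cadj G S x w}) = (\<Sum>D\<in>CS. sum f {w \<in> D. cadj G S x w})"
      by (rule sum.UNION_disjoint[OF finCS]) (use CS_fin CS_disj in auto)
    ultimately show ?thesis by simp
  qed
  have row: "(\<Sum>D\<in>CS. B F D) = 12" if F: "F \<in> CS" for F
  proof -
    obtain x where x: "x \<in> F" using ne[OF F] by blast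
    have xG: "x \<in> carrier G" using x CS_sub[OF F] by blast
    have "12 = (\<Sum>w | cadj G S x w. 1::nat)" using card_nbrs[OF xG] by simp
    also have "\<dots> = (\<Sum>D\<in>CS. B F D)" unfolding sumCS using B[OF x F] by (intro sum.cong refl) (simp add: nb_def)
    finally show ?thesis by simp
  qed
  \<comment> \<open>Counts the paths of length two from \<open>x\<close> into the coset
    \<open>K\<close>, once by the coset of the middle vertex and once by
    \<open>card_common\<close>.\<close>
  have sq: "(\<Sum>D\<in>CS. B F D * B D K) = 28 + 2 * B F K + (if F = K then 8 else 0)" if F: "F \<in> CS" and K: "K \<in> CS" for F K
  proof -
    obtain x where x: "x \<in> F" using ne[OF F] by blast
    have xG: "x \<in> carrier G" using x CS_sub[OF F] by blast
    have "(\<Sum>D\<in>CS. B F D * B D K) = (\<Sum>D\<in>CS. \<Sum>w\<in>{w \<in> D. cadj G S x w}. nb w K)"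
    proof (intro sum.cong refl)
      fix D assume D: "D \<in> CS"
      have "(\<Sum>w\<in>{w \<in> D. cadj G S x w}. nb w K) = (\<Sum>w\<in>{w \<in> D. cadj G S x w}. B D K)"
        using B[OF _ D K] by (intro sum.cong) auto
      then show "B F D * B D K = (\<Sum>w\<in>{w \<in> D. cadj G S x w}. nb w K)" using B[OF x F D] by (simp add: nb_def)
    qed
    also have "\<dots> = (\<Sum>w | cadj G S x w. nb w K)" by (rule sumCS[symmetric])
    also have "\<dots> = (\<Sum>d\<in>K. card {w \<in> {w. cadj G S x w}. cadj G S w d})"
      unfolding nb_def by (rule double_count) (use CS_fin[OF K] in auto)
    also have "\<dots> = (\<Sum>d\<in>K. 4 + (if cadj G S x d then 2 else 0) + (if x = d then 8 else 0))"
    proof (intro sum.cong refl)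
      fix d assume "d \<in> K"
      then have dG: "d \<in> carrier G" using CS_sub[OF K] by blast
      have "{w \<in> {w. cadj G S x w}. cadj G S w d} = {w. cadj G S x w \<and> cadj G S d w}" using E_sym by blast
      then show "card {w \<in> {w. cadj G S x w}. cadj G S w d} = 4 + (if cadj G S x d then 2 else 0) + (if x = d then 8 else 0)"
        using card_common[OF xG dG] E_irrefl by auto
    qed
    also have "\<dots> = 4 * card K + 2 * card {d \<in> K. cadj G S x d} + (if x \<in> K then 8 else 0)"
    proof -
      have "(\<Sum>d\<in>K. if cadj G S x d then 2 else 0) = 2 * card {d \<in> K. cadj G S x d}"
        using CS_fin[OF K] by (simp add: sum.If_cases Int_def)
      moreover have "(\<Sum>d\<in>K. if x = d then 8 else 0) = (if x \<in> K then 8 else (0::nat))"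
        using CS_fin[OF K] by simp
      ultimately show ?thesis by (simp add: sum.distrib)
    qed
    also have "x \<in> K \<longleftrightarrow> F = K" using x CS_mem[OF F x] CS_mem[OF K, of x] by auto
    finally show ?thesis using CS_card[OF K] B[OF x F K] by (simp add: nb_def)
  qed
  \<comment> \<open>The neighbours of \<open>x\<close> in its own coset correspond to an
    inverse-closed set of non-identity elements of a group of order 7, which has no
    involutions.\<close>
  have B_even: "even (B F F) \<and> B F F \<le> 6 \<and> (B F F = 6 \<longrightarrow> clique F)" if F: "F \<in> CS" for F
  proof -
    obtain x where x: "x \<in> F" using ne[OF F] by blast
    have xG: "x \<in> carrier G" using x CS_sub[OF F] by blast
    define A where "A = {h \<in> H. x \<otimes> h \<otimes> inv x \<in> S}"
    have "bij_betw (\<lambda>h. x \<otimes> inv h) A {d \<in> F. cadj G S x d}"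
    proof (rule bij_betw_imageI)
      show "inj_on (\<lambda>h. x \<otimes> inv h) A" using xG HG by (auto intro!: inj_onI simp: A_def)
      show "(\<lambda>h. x \<otimes> inv h) ` A = {d \<in> F. cadj G S x d}"
      proof (intro equalityI subsetI)
        fix d assume "d \<in> (\<lambda>h. x \<otimes> inv h) ` A"
        then obtain h where h: "h \<in> H" "x \<otimes> h \<otimes> inv x \<in> S" "d = x \<otimes> inv h" by (auto simp: A_def)
        have "d \<in> C x" using h by (auto simp: C_def)
        then have "d \<in> F" using CS_mem[OF F x] by simp
        moreover have "x \<otimes> inv d = x \<otimes> h \<otimes> inv x" unfolding h(3) using xG HG[OF h(1)] by (simp add: inv_mult_group m_assoc)
        ultimately show "d \<in> {d \<in> F. cadj G S x d}" using h xG HG[OF h(1)] by (simp add: cadj_def)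
      next
        fix d assume d: "d \<in> {d \<in> F. cadj G S x d}"
        then have "d \<in> C x" using CS_mem[OF F x] by simp
        then obtain h where h: "h \<in> H" "d = x \<otimes> h" by (auto simp: C_def)
        have "x \<otimes> inv d = x \<otimes> inv h \<otimes> inv x" unfolding h(2) using xG HG[OF h(1)] by (simp add: inv_mult_group m_assoc)
        then have "inv h \<in> A" using d h by (simp add: A_def cadj_def)
        moreover have "d = x \<otimes> inv (inv h)" using h HG by simp
        ultimately show "d \<in> (\<lambda>h. x \<otimes> inv h) ` A" by blast
      qed
    qed
    then have cA: "card A = B F F" using bij_betw_same_card B[OF x F F] by (fastforce simp: nb_def)
    have "even (card A)"
    proof (rule even_card_involution[where f = "\<lambda>h. inv h"])
      show "finite A" using finH by (simp add: A_def)
      fix h assume "h \<in> A"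
      then have h: "h \<in> H" "x \<otimes> h \<otimes> inv x \<in> S" by (auto simp: A_def)
      have hG: "h \<in> carrier G" by (rule HG[OF h(1)])
      have "inv (x \<otimes> h \<otimes> inv x) = x \<otimes> inv h \<otimes> inv x" using xG hG by (simp add: inv_mult_group m_assoc)
      then have "inv h \<in> A" using SG(3)[OF h(2)] h(1) by (simp add: A_def)
      moreover have "inv h \<noteq> h"
      proof
        assume "inv h = h"
        then have hh: "h \<otimes> h = \<one>" using hG by (metis r_inv)
        interpret HH: group "G\<lparr>carrier := H\<rparr>" by (rule subgroup_imp_group[OF H(1)])
        have "h [^]\<^bsub>G\<lparr>carrier := H\<rparr>\<^esub> order (G\<lparr>carrier := H\<rparr>) = \<one>\<^bsub>G\<lparr>carrier := H\<rparr>\<^esub>"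
          by (rule HH.pow_order_eq_1) (use h in simp)
        then have "h [^] (7::nat) = \<one>" using H(2) by (simp add: order_def nat_pow_consistent[symmetric])
        moreover have "h [^] (7::nat) = h"
        proof -
          have "h [^] (7::nat) = h [^] (2::nat) \<otimes> h [^] (2::nat) \<otimes> h [^] (2::nat) \<otimes> h"
            using hG by (simp add: nat_pow_mult nat_pow_Suc[symmetric] del: nat_pow_Suc)
          moreover have "h [^] (2::nat) = \<one>" using hh hG by (simp add: numeral_2_eq_2)
          ultimately show ?thesis using hG by simp
        qed
        ultimately have "h = \<one>" by simp
        then show False using h(2) SG(2) xG by simp
      qed
      ultimately show "inv h \<in> A \<and> inv (inv h) = h \<and> inv h \<noteq> h" using hG by simp
    qed
    moreover have sub: "{d \<in> F. cadj G S y d} \<subseteq> F - {y}" for y using E_irrefl by auto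
    have "card {d \<in> F. cadj G S x d} \<le> card (F - {x})" by (rule card_mono[OF _ sub]) (use CS_fin[OF F] in simp)
    then have "B F F \<le> 6" using B[OF x F F] CS_card[OF F] x CS_fin[OF F] by (simp add: nb_def)
    moreover have "clique F" if b6: "B F F = 6"
      unfolding clique_def
    proof (intro ballI impI)
      fix y z assume yz: "y \<in> F" "z \<in> F" "y \<noteq> z"
      have "card {d \<in> F. cadj G S y d} = 6" using B[OF yz(1) F F] b6 by (simp add: nb_def)
      moreover have "card (F - {y}) = 6" using yz(1) CS_card[OF F] CS_fin[OF F] by simp
      ultimately have "{d \<in> F. cadj G S y d} = F - {y}" using CS_fin[OF F] by (intro card_subset_eq[OF _ sub]) auto
      then have "z \<in> {d \<in> F. cadj G S y d}" using yz by simp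
      then show "cadj G S y z" by simp
    qed
    ultimately show ?thesis using cA by simp
  qed
  \<comment> \<open>Otherwise, by \<open>chang_row\<close>, every row has 2 on the diagonal and 2,
    4, 4 off it. An off-diagonal entry \<open>B F D = 2\<close> would make the corresponding entry
    of the square 40 instead of 32, so all these entries are 4; but then the rows sum to 14.\<close>
  have six: "\<exists>F\<in>CS. B F F = 6"
  proof (rule ccontr)
    assume no: "\<not> (\<exists>F\<in>CS. B F F = 6)"
    have key: "B F D \<noteq> 2 \<and> B F F = 2 \<and> (B F D = 4)" if FD: "CS = {F, D, K, M}" "distinct [F, D, K, M]" for F D K M
    proof -
      have mem: "F \<in> CS" "D \<in> CS" "K \<in> CS" "M \<in> CS" using FD(1) by auto
      have rowF: "B F F + B F D + B F K + B F M = 12" using row[OF mem(1)] FD by (simp add: add.assoc)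
      have rowD: "B D D + B D F + B D K + B D M = 12" using row[OF mem(2)] FD by (simp add: add.assoc add.left_commute)
      have sqF: "B F F * B F F + B F D * B F D + B F K * B F K + B F M * B F M = 36 + 2 * B F F"
        using sq[OF mem(1,1)] FD B_sym[OF mem(2,1)] B_sym[OF mem(3,1)] B_sym[OF mem(4,1)] by (simp add: add.assoc)
      have sqD: "B D D * B D D + B D F * B D F + B D K * B D K + B D M * B D M = 36 + 2 * B D D"
        using sq[OF mem(2,2)] FD B_sym[OF mem(1,2)] B_sym[OF mem(3,2)] B_sym[OF mem(4,2)] by (simp add: add.assoc add.left_commute)
      have sqFD: "B F F * B F D + B F D * B D D + B F K * B D K + B F M * B D M = 28 + 2 * B F D"
        using sq[OF mem(1,2)] FD B_sym[OF mem(3,2)] B_sym[OF mem(4,2)] by (simp add: add.assoc)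
      have rF: "B F F = 2 \<and> (B F D = 2 \<and> B F K = 4 \<and> B F M = 4 \<or> B F D = 4 \<and> B F K = 2 \<and> B F M = 4 \<or> B F D = 4 \<and> B F K = 4 \<and> B F M = 2)"
        using chang_row[OF _ _ rowF sqF] B_even[OF mem(1)] no mem(1) by blast
      have rD: "B D D = 2 \<and> (B D F = 2 \<and> B D K = 4 \<and> B D M = 4 \<or> B D F = 4 \<and> B D K = 2 \<and> B D M = 4 \<or> B D F = 4 \<and> B D K = 4 \<and> B D M = 2)"
        using chang_row[OF _ _ rowD sqD] B_even[OF mem(2)] no mem(2) by blast
      have "B F D \<noteq> 2"
      proof
        assume two: "B F D = 2"
        then have "B F F = 2" "B F K = 4" "B F M = 4" "B D D = 2" using rF rD by auto
        moreover have "B D F = 2" using two B_sym[OF mem(1,2)] by simp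
        then have "B D K = 4" "B D M = 4" using rD by auto
        ultimately show False using sqFD two by simp
      qed
      then show ?thesis using rF by auto
    qed
    obtain F D K M where FD: "CS = {F, D, K, M}" "distinct [F, D, K, M]"
      using card_CS by (auto simp: card_Suc_eq numeral_eq_Suc)
    have mem: "F \<in> CS" using FD(1) by auto
    have rowF: "B F F + B F D + B F K + B F M = 12" using row[OF mem] FD by (simp add: add.assoc)
    have "B F F = 2" "B F D = 4" using key[OF FD] by auto
    moreover have "B F K = 4" using key[of F K D M] FD by (auto simp: insert_commute)
    moreover have "B F M = 4" using key[of F M K D] FD by (auto simp: insert_commute)
    ultimately show False using rowF by simp
  qed
  then obtain F where F: "F \<in> CS" "B F F = 6" by blast
  obtain x where x: "x \<in> F" using ne[OF F(1)] by blast
  have xG: "x \<in> carrier G" using x CS_sub[OF F(1)] by blast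
  note cl = clawD[OF tip nonadj]
  have uG: "u \<in> carrier G" "a \<in> carrier G" "b \<in> carrier G" "c \<in> carrier G" using cl E_V by blast+
  define g where "g = inv u \<otimes> x"
  have gG: "g \<in> carrier G" using uG xG by (simp add: g_def)
  have ug: "u \<otimes> g = x" unfolding g_def using uG xG by (simp add: m_assoc[symmetric])
  have tr: "local_nonadj x (p \<otimes> g) (q \<otimes> g)" if pq: "local_nonadj u p q" for p q
  proof -
    have h: "cadj G S u p" "cadj G S u q" "p \<noteq> q" "\<not> cadj G S p q" using pq by (auto simp: local_nonadj_def)
    have G: "p \<in> carrier G" "q \<in> carrier G" using h E_V by blast+
    show ?thesis unfolding local_nonadj_def ug[symmetric]
      using h cadj_translate_iff[OF gG uG(1) G(1)] cadj_translate_iff[OF gG uG(1) G(2)] cadj_translate_iff[OF gG G] G gG by simp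
  qed
  have "local_nonadj x (a \<otimes> g) (b \<otimes> g)" by (rule tr[OF nonadj])
  moreover have "c \<otimes> g \<in> claw_tips x (a \<otimes> g) (b \<otimes> g)"
    using tr claw_sym(1,2)[OF nonadj tip] by (simp add: claw_tips_def)
  moreover have "clique F" using B_even[OF F(1)] F(2) by simp
  ultimately show False using seven_clique_no_claw[OF _ _ _ CS_card[OF F(1)] x] by simp
qed

section \<open>Finite fields and triangular graphs\<close>

lemma rel_iso_cong:
  assumes "rel_iso V E W F" "\<And>x y. x \<in> W \<Longrightarrow> y \<in> W \<Longrightarrow> F x y \<longleftrightarrow> F' x y"
  shows "rel_iso V E W F'"
  by (rule rel_iso_trans[OF assms(1)], rule rel_isoI[OF bij_betw_id]) (simp add: assms(2))

lemma rel_iso_card: "rel_iso V E W F \<Longrightarrow> card V = card W"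
  unfolding rel_iso_def using bij_betw_same_card by blast

text \<open>The connection set is the neighbourhood of the identity; invariance moves every
  adjacency there.\<close>

lemma right_invariant_is_cayley:
  assumes \<Gamma>: "pair_graph \<Gamma>" and G: "group G" "finite (carrier G)"
    and iso: "rel_iso (pverts \<Gamma>) (gadj \<Gamma>) (carrier G) E"
    and inv: "\<And>a b g. a \<in> carrier G \<Longrightarrow> b \<in> carrier G \<Longrightarrow> g \<in> carrier G \<Longrightarrow> E a b \<Longrightarrow> E (a \<otimes>\<^bsub>G\<^esub> g) (b \<otimes>\<^bsub>G\<^esub> g)"
  shows "is_cayley_graph \<Gamma>"
proof -
  interpret group G by (rule G)
  interpret P: pair_graph \<Gamma> by (rule \<Gamma>)
  have sym\<Gamma>: "gadj \<Gamma> x y \<Longrightarrow> gadj \<Gamma> y x" for x y using P.arcs_symmetric by auto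
  have irr\<Gamma>: "\<not> gadj \<Gamma> x x" for x using P.no_loops[of "(x, x)"] by auto
  obtain f where f: "bij_betw f (pverts \<Gamma>) (carrier G)"
      "\<And>x y. x \<in> pverts \<Gamma> \<Longrightarrow> y \<in> pverts \<Gamma> \<Longrightarrow> gadj \<Gamma> x y \<longleftrightarrow> E (f x) (f y)"
    using iso unfolding rel_iso_def by blast
  have ex: "\<exists>x\<in>pverts \<Gamma>. f x = a" if "a \<in> carrier G" for a
  proof -
    have "a \<in> f ` pverts \<Gamma>" using f(1) that by (simp add: bij_betw_def)
    then show ?thesis by auto
  qed
  have irr: "\<not> E a a" if a: "a \<in> carrier G" for a
  proof -
    obtain x where "x \<in> pverts \<Gamma>" "f x = a" using ex[OF a] by blast
    then show ?thesis using f(2)[of x x] irr\<Gamma> by blast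
  qed
  have sym: "E b a" if ab: "a \<in> carrier G" "b \<in> carrier G" "E a b" for a b
  proof -
    obtain x y where "x \<in> pverts \<Gamma>" "f x = a" "y \<in> pverts \<Gamma>" "f y = b" using ex ab by metis
    then show ?thesis using f(2)[of x y] f(2)[of y x] sym\<Gamma> ab(3) by blast
  qed
  define S where "S = {s \<in> carrier G. E s \<one>\<^bsub>G\<^esub>}"
  have conn: "connection_set G S"
    unfolding connection_set_def
  proof (intro conjI ballI)
    show "S \<subseteq> carrier G - {\<one>\<^bsub>G\<^esub>}" using irr[OF one_closed] by (auto simp: S_def)
    fix s assume s: "s \<in> S"
    then have sG: "s \<in> carrier G" "E \<one>\<^bsub>G\<^esub> s" using sym by (auto simp: S_def)
    from inv[OF one_closed sG(1) inv_closed[OF sG(1)] sG(2)]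
    show "inv\<^bsub>G\<^esub> s \<in> S" using sG by (simp add: S_def)
  qed
  have adj: "E a b \<longleftrightarrow> cadj G S a b" if ab: "a \<in> carrier G" "b \<in> carrier G" for a b
  proof
    assume "E a b"
    from inv[OF ab inv_closed[OF ab(2)] this] show "cadj G S a b" using ab by (simp add: cadj_def S_def)
  next
    assume "cadj G S a b"
    then have "E (a \<otimes>\<^bsub>G\<^esub> inv\<^bsub>G\<^esub> b) \<one>\<^bsub>G\<^esub>" by (simp add: cadj_def S_def)
    from inv[OF _ one_closed ab(2) this] show "E a b" using ab by (simp add: m_assoc)
  qed
  have wf: "pair_wf_digraph \<Gamma>" by unfold_locales
  have "rel_iso (pverts \<Gamma>) (gadj \<Gamma>) (carrier G) (cadj G S)" by (rule rel_iso_cong[OF iso adj])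
  then have "graph_iso \<Gamma> (cayley_graph G S)"
    unfolding graph_iso_iff_rel_iso[OF wf pair_wf_digraph_cayley_graph] cayley_graph_simps .
  then show ?thesis by (rule is_cayley_graphI[OF wf G conn])
qed

section \<open>Finite fields inside an algebraically closed field of characteristic p\<close>

locale closed_char = algebraically_closed L for L (structure) +
  fixes p :: nat
  assumes p: "Factorial_Ring.prime p" and char: "add_pow L p \<one> = \<zero>"
begin

lemma exists_root:
  assumes "set P \<subseteq> carrier L" "hd P \<noteq> \<zero>" "length P > 1"
  shows "\<exists>x\<in>carrier L. eval P x = \<zero>"
proof -
  have P: "P \<in> carrier (poly_ring L)" unfolding sym[OF univ_poly_carrier] polynomial_def using assms by auto
  have "splitted P" by (rule roots_over_carrier[OF P])
  then have "size (roots P) = length P - 1" unfolding splitted_def .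
  then have "roots P \<noteq> {#}" using assms(3) by auto
  then obtain x where "x \<in># roots P" by (meson multiset_nonemptyE)
  then have "is_root P x" using roots_mem_iff_is_root[OF P] by blast
  then show ?thesis by (auto simp: is_root_def)
qed

text \<open>The polynomial \<open>X^n - a\<close> as a list of coefficients, highest degree
  first.\<close>

definition kummer :: "nat \<Rightarrow> 'a \<Rightarrow> 'a list" where
  "kummer n a = \<one> # replicate (n - 1) \<zero> @ [\<ominus> a]"

lemma eval_kummer:
  assumes "n > 0" "a \<in> carrier L" "x \<in> carrier L"
  shows "eval (kummer n a) x = x [^] n \<ominus> a"
proof -
  have "eval (replicate (n - 1) \<zero> @ [\<ominus> a]) x = eval [\<ominus> a] x" by (rule eval_replicate) (use assms in auto)
  also have "\<dots> = \<ominus> a" using assms by simp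
  finally show ?thesis unfolding kummer_def using assms by (simp add: a_minus_def)
qed

lemma exists_nth_root:
  fixes n :: nat
  assumes "n > 0" "a \<in> carrier L" shows "\<exists>y\<in>carrier L. y [^] n = a"
proof -
  have "set (kummer n a) \<subseteq> carrier L" "hd (kummer n a) \<noteq> \<zero>" "length (kummer n a) > 1"
    using assms by (auto simp: kummer_def)
  then obtain y where y: "y \<in> carrier L" "eval (kummer n a) y = \<zero>" using exists_root by blast
  then have "y [^] n \<ominus> a = \<zero>" using eval_kummer[OF assms y(1)] by simp
  then show ?thesis using y(1) assms by auto
qed

definition unity_roots :: "nat \<Rightarrow> 'a set" where
  "unity_roots n = {x \<in> carrier L. x [^] n = \<one>}"

lemma card_unity_roots_le:
  assumes "n > 0" shows "finite (unity_roots n)" "card (unity_roots n) \<le> n"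
proof -
  define P where "P = kummer n \<one>"
  have P: "P \<in> carrier (poly_ring L)" unfolding sym[OF univ_poly_carrier] polynomial_def P_def kummer_def by auto
  have sub: "unity_roots n \<subseteq> set_mset (roots P)"
  proof
    fix x assume x: "x \<in> unity_roots n"
    then have "eval P x = x [^] n \<ominus> \<one>" unfolding P_def unity_roots_def using eval_kummer[OF assms] by simp
    then have "eval P x = \<zero>" using x by (simp add: unity_roots_def)
    then have "is_root P x" using x unfolding is_root_def P_def kummer_def unity_roots_def by simp
    then show "x \<in> set_mset (roots P)" using roots_mem_iff_is_root[OF P] by blast
  qed
  then show "finite (unity_roots n)" by (rule finite_subset) simp
  have "card (set_mset M) \<le> size M" for M :: "'a multiset"
    by (induction M) (auto simp: card_insert_if)
  then have "card (unity_roots n) \<le> size (roots P)" using card_mono[OF _ sub] by (meson finite_set_mset le_trans)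
  also have "\<dots> \<le> length P - 1" by (rule size_roots_le_degree[OF P])
  also have "\<dots> = n" using assms by (simp add: P_def kummer_def)
  finally show "card (unity_roots n) \<le> n" .
qed

lemma add_pow_one_nonzero:
  assumes "coprime n p" shows "add_pow L n \<one> \<noteq> \<zero>"
proof
  assume n: "add_pow L n \<one> = \<zero>"
  have "\<not> is_unit p" using p not_prime_unit by blast
  then have "n \<noteq> 0" using assms by (metis coprime_0_left_iff)
  then obtain x y where xy: "n * x = p * y + gcd n p" using bezout_nat by blast
  then have xy: "n * x = p * y + 1" using assms by simp
  have z: "add_pow L (m * j) \<one> = \<zero>" if "add_pow L m \<one> = \<zero>" for m j :: nat
    using add.nat_pow_pow[of \<one> j m] that by simp
  have "add_pow L (p * y + 1) \<one> = add_pow L (p * y) \<one> \<oplus> \<one>" by simp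
  then show False using z[OF n, of x] z[OF char, of y] unfolding xy by simp
qed

text \<open>\<open>w\<close> is a root of \<open>1 + X + ... + X^(r-1)\<close>, whose value at 1 is
  \<open>r\<close>, nonzero in characteristic \<open>p\<close>.\<close>

lemma exists_unity_root:
  assumes r: "Factorial_Ring.prime r" "r \<noteq> p" shows "\<exists>w\<in>carrier L. w [^] r = \<one> \<and> w \<noteq> \<one>"
proof -
  have geo: "(x \<ominus> \<one>) \<otimes> eval (replicate n \<one>) x = x [^] n \<ominus> \<one>" if x: "x \<in> carrier L" for x n
  proof (induction n)
    case (Suc n)
    define e where "e = eval (replicate n \<one>) x"
    have eG: "e \<in> carrier L" unfolding e_def by (rule eval_in_carrier) (use x in auto)
    have "(x \<ominus> \<one>) \<otimes> eval (replicate (Suc n) \<one>) x = (x \<ominus> \<one>) \<otimes> (x [^] n) \<oplus> (x \<ominus> \<one>) \<otimes> e"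
      using x eG by (simp add: e_def r_distr)
    also have "\<dots> = (x \<ominus> \<one>) \<otimes> (x [^] n) \<oplus> (x [^] n \<ominus> \<one>)" using Suc by (simp add: e_def)
    also have "\<dots> = x [^] n \<otimes> x \<ominus> \<one>"
    proof -
      define y where "y = x [^] n"
      have "y \<in> carrier L" using x by (simp add: y_def)
      then have "(x \<ominus> \<one>) \<otimes> y \<oplus> (y \<ominus> \<one>) = y \<otimes> x \<ominus> \<one>" using x by algebra
      then show ?thesis by (simp add: y_def)
    qed
    finally show ?case by simp
  qed (use x in \<open>simp add: a_minus_def r_neg\<close>)
  have ev1: "eval (replicate n \<one>) \<one> = add_pow L n \<one>" for n
  proof (induction n)
    case (Suc n)
    then show ?case by (simp add: a_comm)
  qed simp
  have r1: "r > 1" using r(1) by (rule prime_gt_1_nat)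
  obtain w where w: "w \<in> carrier L" "eval (replicate r \<one>) w = \<zero>"
    using exists_root[of "replicate r \<one>"] r1 by (auto simp: hd_replicate)
  have "w [^] r \<ominus> \<one> = \<zero>" using geo[OF w(1), of r] w by simp
  then have "w [^] r = \<one>" using w(1) by simp
  moreover have "w \<noteq> \<one>"
  proof
    assume "w = \<one>"
    then have "add_pow L r \<one> = \<zero>" using ev1[of r] w(2) by simp
    moreover have "coprime r p" using primes_coprime[OF r(1) p r(2)] .
    ultimately show False using add_pow_one_nonzero by blast
  qed
  ultimately show ?thesis using w(1) by blast
qed

lemma pow_eq_one_nonzero: "x \<in> carrier L \<Longrightarrow> x [^] n = \<one> \<Longrightarrow> (n::nat) > 0 \<Longrightarrow> x \<noteq> \<zero>"
  using nat_pow_zero[of n] by auto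

text \<open>Induction over prime factors: for \<open>n = r m\<close>, each \<open>a\<close> with
  \<open>a^m = 1\<close> has the \<open>r\<close> distinct \<open>r\<close>-th roots
  \<open>y a w^i\<close>, where \<open>w\<close> is a primitive \<open>r\<close>-th root of
  unity.\<close>

lemma card_unity_roots_ge:
  assumes "n > 0" "\<not> p dvd n" shows "n \<le> card (unity_roots n)"
  using assms
proof (induction n rule: less_induct)
  case (less n)
  show ?case
  proof (cases "n = 1")
    case True
    have "\<one> \<in> unity_roots n" by (simp add: unity_roots_def)
    then show ?thesis using True card_unity_roots_le(1)[of n] by (simp add: Suc_le_eq card_gt_0_iff) blast
  next
    case False
    then obtain r where r: "Factorial_Ring.prime r" "r dvd n" using prime_factor_nat by blast
    then obtain m where m: "n = r * m" by (elim dvdE)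
    have r1: "r > 1" using r(1) by (rule prime_gt_1_nat)
    have rp: "r \<noteq> p" using r(2) less.prems(2) by blast
    have m0: "m > 0" "m < n" "\<not> p dvd m" using less.prems m r1 by auto
    have IH: "m \<le> card (unity_roots m)" by (rule less.IH[OF m0(2,1,3)])
    obtain w where w: "w \<in> carrier L" "w [^] r = \<one>" "w \<noteq> \<one>" using exists_unity_root[OF r(1) rp] by blast
    have w0: "w \<noteq> \<zero>" using pow_eq_one_nonzero[OF w(1,2)] r1 by simp
    have "\<exists>y. y \<in> carrier L \<and> y [^] r = a" if "a \<in> unity_roots m" for a
      using exists_nth_root[of r a] r1 that by (auto simp: unity_roots_def)
    then obtain y where y: "\<And>a. a \<in> unity_roots m \<Longrightarrow> y a \<in> carrier L \<and> y a [^] r = a" by metis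
    define g where "g = (\<lambda>(a, i). y a \<otimes> w [^] (i::nat))"
    have gr: "y a \<otimes> w [^] i \<in> carrier L" "(y a \<otimes> w [^] i) [^] r = a" if "a \<in> unity_roots m" for a and i :: nat
    proof -
      have yG: "y a \<in> carrier L" "y a [^] r = a" using y[OF that] by auto
      then show "y a \<otimes> w [^] i \<in> carrier L" using w by simp
      have "(w [^] i) [^] r = (w [^] r) [^] i" using w(1) by (simp add: nat_pow_pow mult.commute)
      then have "(w [^] i) [^] r = \<one>" using w by simp
      then show "(y a \<otimes> w [^] i) [^] r = a" using yG w that by (simp add: nat_pow_distrib unity_roots_def)
    qed
    have "inj_on g (unity_roots m \<times> {..<r})"
    proof (rule inj_onI)
      fix s t assume st: "s \<in> unity_roots m \<times> {..<r}" "t \<in> unity_roots m \<times> {..<r}" "g s = g t"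
      obtain a i b j where ab: "s = (a, i)" "t = (b, j)" by (metis surj_pair)
      have mem: "a \<in> unity_roots m" "b \<in> unity_roots m" "i < r" "j < r" using st ab by auto
      have eq: "y a \<otimes> w [^] i = y b \<otimes> w [^] j" using st(3) by (simp add: ab g_def)
      have "a = (y a \<otimes> w [^] i) [^] r" using gr(2)[OF mem(1), of i] by simp
      also have "\<dots> = b" unfolding eq by (rule gr(2)[OF mem(2)])
      finally have ab2: "a = b" .
      have aG: "a \<in> carrier L" "a [^] m = \<one>" using mem(1) by (auto simp: unity_roots_def)
      have a0: "a \<noteq> \<zero>" by (rule pow_eq_one_nonzero[OF aG m0(1)])
      have yG: "y a \<in> carrier L" "y a [^] r = a" using y[OF mem(1)] by auto
      have y0: "y a \<noteq> \<zero>"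
      proof
        assume "y a = \<zero>"
        then have "a = \<zero> [^] r" using yG(2) by simp
        then show False using a0 nat_pow_zero[of r] r1 by simp
      qed
      have wij: "w [^] i = w [^] j" using eq ab2 y0 yG w m_lcancel[of "y a" "w [^] i" "w [^] j"] by simp
      \<comment> \<open>The difference \<open>d\<close> of the exponents is prime to
        \<open>r\<close>, so Bezout turns \<open>w^d = 1\<close> and \<open>w^r = 1\<close> into
        \<open>w = 1\<close>.\<close>
      have main: False if ij: "i < j" "j < r" "w [^] i = w [^] j" for i j :: nat
      proof -
        define d where "d = j - i"
        have d: "d > 0" "d < r" "j = i + d" using ij by (auto simp: d_def)
        have wi0: "w [^] i \<noteq> \<zero>" by (induction i) (use w(1) w0 in \<open>auto simp: integral_iff\<close>)
        have "w [^] i \<otimes> w [^] d = w [^] (i + d)" by (rule nat_pow_mult[OF w(1)])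
        also have "\<dots> = w [^] i" using ij(3) unfolding d(3) by (rule sym)
        also have "\<dots> = w [^] i \<otimes> \<one>" using w(1) by simp
        finally have wd: "w [^] d = \<one>" using wi0 w(1) m_lcancel[of "w [^] i" "w [^] d" \<one>] by simp
        have "\<not> r dvd d" using d by (auto dest: dvd_imp_le)
        then have "coprime d r" using r(1) by (metis coprime_commute prime_imp_coprime)
        moreover obtain x z where "d * x = r * z + gcd d r" using bezout_nat[of d r] d(1) by auto
        ultimately have xz: "d * x = r * z + 1" by simp
        have "w [^] (d * x) = (w [^] d) [^] x" by (rule nat_pow_pow[OF w(1), symmetric])
        also have "\<dots> = \<one>" unfolding wd by simp
        finally have "w [^] (r * z + 1) = \<one>" unfolding xz .
        moreover have "w [^] (r * z) = (w [^] r) [^] z" by (rule nat_pow_pow[OF w(1), symmetric])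
        then have "w [^] (r * z) = \<one>" unfolding w(2) by simp
        then have "w [^] (r * z + 1) = w" using w(1) by simp
        ultimately show False using w(3) by simp
      qed
      have "i = j" using main[of i j] main[of j i] wij mem by (metis linorder_neqE_nat)
      then show "s = t" using ab ab2 by simp
    qed
    then have "card (g ` (unity_roots m \<times> {..<r})) = card (unity_roots m) * r"
      by (simp add: card_image card_cartesian_product)
    moreover have "g ` (unity_roots m \<times> {..<r}) \<subseteq> unity_roots n"
    proof
      fix z assume "z \<in> g ` (unity_roots m \<times> {..<r})"
      then obtain a i where a: "a \<in> unity_roots m" "z = y a \<otimes> w [^] (i::nat)" by (auto simp: g_def)
      have "z [^] n = (z [^] r) [^] m" unfolding m using gr(1)[OF a(1), of i] a(2) by (simp add: nat_pow_pow)
      also have "\<dots> = \<one>" using gr(2)[OF a(1), of i] a by (simp add: unity_roots_def)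
      finally show "z \<in> unity_roots n" using gr(1)[OF a(1), of i] a(2) by (simp add: unity_roots_def)
    qed
    ultimately have "card (unity_roots m) * r \<le> card (unity_roots n)"
      using card_mono[OF card_unity_roots_le(1)[OF less.prems(1)]] by metis
    moreover have "m * r \<le> card (unity_roots m) * r" using IH by (rule mult_le_mono1)
    ultimately have "m * r \<le> card (unity_roots n)" by linarith
    then show ?thesis using m by (metis mult.commute)
  qed
qed

lemma binomial:
  assumes xy: "x \<in> carrier L" "y \<in> carrier L"
  shows "(x \<oplus> y) [^] n = (\<Oplus>i\<in>{..n}. add_pow L (n choose i) (x [^] i \<otimes> y [^] (n - i)))"
proof (induction n)
  case 0
  then show ?case using xy by simp
next
  case (Suc n)
  define b where "b i = add_pow L (n choose i) (x [^] i \<otimes> y [^] (n - i))" for i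
  have bG: "b i \<in> carrier L" for i using xy by (simp add: b_def)
  define c where "c i = add_pow L (n choose i) (x [^] i \<otimes> y [^] (Suc n - i))" for i
  have cG: "c i \<in> carrier L" for i using xy by (simp add: c_def)
  have xb: "b i \<otimes> x = add_pow L (n choose i) (x [^] Suc i \<otimes> y [^] (n - i))" for i
  proof -
    have "b i \<otimes> x = add_pow L (n choose i) ((x [^] i \<otimes> y [^] (n - i)) \<otimes> x)"
      unfolding b_def by (rule add_pow_ldistr) (use xy in auto)
    also have "(x [^] i \<otimes> y [^] (n - i)) \<otimes> x = x [^] Suc i \<otimes> y [^] (n - i)" using xy by (simp add: m_ac)
    finally show ?thesis .
  qed
  have yb: "b i \<otimes> y = c i" if "i \<le> n" for i
    using xy that by (simp add: b_def c_def add_pow_ldistr m_assoc Suc_diff_le)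
  have cS: "c (Suc n) = \<zero>" using xy by (simp add: c_def binomial_eq_0)
  have "(\<Oplus>i\<in>{..n}. b i) \<otimes> y = (\<Oplus>i\<in>{..n}. b i \<otimes> y)" by (rule finsum_ldistr) (use xy bG in auto)
  also have "\<dots> = (\<Oplus>i\<in>{..n}. c i)" by (rule finsum_cong') (use yb cG in auto)
  also have "\<dots> = (\<Oplus>i\<in>{..Suc n}. c i)"
  proof -
    have "(\<Oplus>i\<in>{..Suc n}. c i) = c (Suc n) \<oplus> (\<Oplus>i\<in>{..n}. c i)" by (rule finsum_Suc) (use cG in auto)
    moreover have "(\<Oplus>i\<in>{..n}. c i) \<in> carrier L" by (rule finsum_closed) (use cG in auto)
    ultimately show ?thesis using cS by simp
  qed
  also have "\<dots> = (\<Oplus>i\<in>{..n}. c (Suc i)) \<oplus> c 0" by (rule finsum_Suc2) (use cG in auto)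
  finally have sy: "(\<Oplus>i\<in>{..n}. b i) \<otimes> y = (\<Oplus>i\<in>{..n}. c (Suc i)) \<oplus> c 0" .
  have sx: "(\<Oplus>i\<in>{..n}. b i) \<otimes> x = (\<Oplus>i\<in>{..n}. b i \<otimes> x)" by (rule finsum_ldistr) (use xy bG in auto)
  have sG: "(\<Oplus>i\<in>{..n}. b i) \<in> carrier L" "(\<Oplus>i\<in>{..n}. c (Suc i)) \<in> carrier L" "(\<Oplus>i\<in>{..n}. b i \<otimes> x) \<in> carrier L"
    using bG cG xy by (auto intro!: finsum_closed)
  define d where "d i = add_pow L (Suc n choose i) (x [^] i \<otimes> y [^] (Suc n - i))" for i
  have dG: "d i \<in> carrier L" for i using xy by (simp add: d_def)
  have dS: "d (Suc i) = b i \<otimes> x \<oplus> c (Suc i)" for i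
    unfolding xb d_def c_def using xy by (simp add: add.nat_pow_mult[symmetric])
  have d0: "d 0 = c 0" by (simp add: d_def c_def)
  have "(x \<oplus> y) [^] Suc n = (\<Oplus>i\<in>{..n}. b i) \<otimes> (x \<oplus> y)" using Suc by (simp add: b_def)
  also have "\<dots> = (\<Oplus>i\<in>{..n}. b i \<otimes> x) \<oplus> ((\<Oplus>i\<in>{..n}. c (Suc i)) \<oplus> c 0)"
    using r_distr[OF xy sG(1)] sx sy by simp
  also have "\<dots> = ((\<Oplus>i\<in>{..n}. b i \<otimes> x) \<oplus> (\<Oplus>i\<in>{..n}. c (Suc i))) \<oplus> c 0"
    using sG cG[of 0] by (simp add: a_assoc)
  also have "(\<Oplus>i\<in>{..n}. b i \<otimes> x) \<oplus> (\<Oplus>i\<in>{..n}. c (Suc i)) = (\<Oplus>i\<in>{..n}. b i \<otimes> x \<oplus> c (Suc i))"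
    by (rule finsum_addf[symmetric]) (use bG cG xy in auto)
  also have "\<dots> = (\<Oplus>i\<in>{..n}. d (Suc i))" unfolding dS ..
  also have "\<dots> \<oplus> c 0 = (\<Oplus>i\<in>{..Suc n}. d i)"
    unfolding d0[symmetric] by (rule finsum_Suc2[symmetric]) (use dG in auto)
  finally show ?case unfolding d_def .
qed

lemma frobenius_add:
  assumes xy: "x \<in> carrier L" "y \<in> carrier L"
  shows "(x \<oplus> y) [^] p = x [^] p \<oplus> y [^] p"
proof -
  have "p \<ge> 2" using p by (rule prime_ge_2_nat)
  then obtain n where n: "p = Suc (Suc n)" by (metis add_2_eq_Suc le_Suc_ex)
  define b where "b i = add_pow L (p choose i) (x [^] i \<otimes> y [^] (p - i))" for i
  have bG: "b i \<in> carrier L" for i using xy by (simp add: b_def)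
  have b0: "b i = \<zero>" if i: "0 < i" "i < p" for i
  proof -
    have "p dvd p choose i" using i p by (simp add: dvd_choose_prime)
    then obtain j where j: "p choose i = p * j" by (elim dvdE)
    define z where "z = x [^] i \<otimes> y [^] (p - i)"
    have zG: "z \<in> carrier L" using xy by (simp add: z_def)
    have "add_pow L p z = add_pow L p \<one> \<otimes> z" using zG add_pow_ldistr[of \<one> z p] by simp
    then have "add_pow L p z = \<zero>" using char zG by simp
    then show ?thesis unfolding b_def z_def[symmetric] j using add.nat_pow_pow[OF zG, of j p] by simp
  qed
  have "(x \<oplus> y) [^] p = (\<Oplus>i\<in>{..p}. b i)" unfolding b_def by (rule binomial[OF xy])
  also have "\<dots> = b p \<oplus> (\<Oplus>i\<in>{..Suc n}. b i)" unfolding n by (rule finsum_Suc) (use bG in auto)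
  also have "(\<Oplus>i\<in>{..Suc n}. b i) = (\<Oplus>i\<in>{..n}. b (Suc i)) \<oplus> b 0" by (rule finsum_Suc2) (use bG in auto)
  also have "(\<Oplus>i\<in>{..n}. b (Suc i)) = \<zero>" by (rule add.finprod_one_eqI) (use b0 n in auto)
  finally show ?thesis using xy bG[of 0] by (simp add: b_def)
qed

lemma frobenius_power_add:
  assumes xy: "x \<in> carrier L" "y \<in> carrier L"
  shows "(x \<oplus> y) [^] (p ^ k) = x [^] (p ^ k) \<oplus> y [^] (p ^ k)"
proof (induction k)
  case (Suc k)
  have "(x \<oplus> y) [^] (p ^ Suc k) = ((x \<oplus> y) [^] (p ^ k)) [^] p" using xy by (simp add: nat_pow_pow mult.commute)
  also have "\<dots> = (x [^] (p ^ k)) [^] p \<oplus> (y [^] (p ^ k)) [^] p"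
    unfolding Suc by (rule frobenius_add) (use xy in auto)
  also have "\<dots> = x [^] (p ^ Suc k) \<oplus> y [^] (p ^ Suc k)" using xy by (simp add: nat_pow_pow mult.commute)
  finally show ?case .
qed (use xy in simp)

lemma neg_pow_odd:
  assumes "x \<in> carrier L" "odd h" shows "(\<ominus> x) [^] h = \<ominus> (x [^] (h::nat))"
proof -
  obtain j where j: "h = 2 * j + 1" using assms(2) by (elim oddE)
  have e: "(\<ominus> x) [^] (2::nat) = x [^] (2::nat)"
    using assms(1) by (simp add: numeral_2_eq_2 l_minus r_minus)
  have "(\<ominus> x) [^] (2 * j) = x [^] (2 * j)"
    using nat_pow_pow[of "\<ominus> x" 2 j] nat_pow_pow[of x 2 j] assms(1) e by simp
  then show ?thesis unfolding j using assms(1) by (simp add: r_minus)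
qed

text \<open>For \<open>q\<close> a positive power of \<open>p\<close> this is the subfield with
  \<open>q\<close> elements.\<close>

definition fixed_field :: "nat \<Rightarrow> 'a set" where
  "fixed_field q = {x \<in> carrier L. x [^] q = x}"

lemma fixed_field_eq:
  assumes "q > 1" shows "fixed_field q = insert \<zero> (unity_roots (q - 1))"
proof -
  have q: "q = Suc (q - 1)" using assms by simp
  have "x [^] q = x \<longleftrightarrow> x = \<zero> \<or> x [^] (q - 1) = \<one>" if x: "x \<in> carrier L" for x
  proof (cases "x = \<zero>")
    case True
    then show ?thesis using assms nat_pow_zero[of q] by simp
  next
    case False
    have "x [^] q = x [^] (q - 1) \<otimes> x" using q by (metis nat_pow_Suc)
    moreover have "x = \<one> \<otimes> x" using x by simp
    ultimately have "x [^] q = x \<longleftrightarrow> x [^] (q - 1) \<otimes> x = \<one> \<otimes> x" by metis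
    also have "\<dots> \<longleftrightarrow> x [^] (q - 1) = \<one>" by (rule m_rcancel[OF False x]) (use x in auto)
    finally show ?thesis using False by simp
  qed
  then show ?thesis by (auto simp: fixed_field_def unity_roots_def)
qed

text \<open>The nonzero elements are the roots of unity for the exponent \<open>p^k - 1\<close>,
  which is prime to \<open>p\<close>.\<close>

lemma card_fixed_field:
  assumes "k > 0" shows "finite (fixed_field (p ^ k))" "card (fixed_field (p ^ k)) = p ^ k"
proof -
  have p1: "p > 1" using p by (rule prime_gt_1_nat)
  then have q1: "p ^ k > 1" by (rule one_less_power[OF _ assms])
  have q0: "p ^ k - 1 > 0" using q1 by simp
  have "\<not> p dvd p ^ k - 1"
  proof
    assume "p dvd p ^ k - 1"
    moreover have "p dvd p ^ k" using assms by simp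
    ultimately have "p dvd p ^ k - (p ^ k - 1)" by (rule dvd_diff_nat[rotated])
    then show False using q1 p1 by simp
  qed
  then have c: "card (unity_roots (p ^ k - 1)) = p ^ k - 1"
    using card_unity_roots_ge[OF q0] card_unity_roots_le(2)[OF q0] by simp
  have fin: "finite (unity_roots (p ^ k - 1))" by (rule card_unity_roots_le(1)[OF q0])
  have "\<zero> \<notin> unity_roots (p ^ k - 1)" using pow_eq_one_nonzero[of \<zero>, OF _ _ q0] by (auto simp: unity_roots_def)
  then show "card (fixed_field (p ^ k)) = p ^ k" unfolding fixed_field_eq[OF q1] using fin c q1 by simp
  show "finite (fixed_field (p ^ k))" unfolding fixed_field_eq[OF q1] using fin by simp
qed

end

text \<open>The group of the maps \<open>x \<mapsto> a x + b\<close> with \<open>a\<close> a nonzero square, written so that a map acts on the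
  image of a pair of points by right multiplication.\<close>

locale paley = closed_char +
  fixes k h :: nat
  assumes k: "k > 0" and q_eq: "p ^ k = 2 * h + 1" and odd_h: "odd h"
begin

abbreviation F where "F \<equiv> fixed_field (p ^ k)"
text \<open>The nonzero squares of \<open>F\<close>: by Euler's criterion they are the solutions of
  \<open>x^h = 1\<close>.\<close>

abbreviation Q where "Q \<equiv> unity_roots h"

lemma F_carrier: "x \<in> F \<Longrightarrow> x \<in> carrier L" by (simp add: fixed_field_def)

lemma Q_carrier: "x \<in> Q \<Longrightarrow> x \<in> carrier L" by (simp add: unity_roots_def)

lemma h_pos: "h > 0" using odd_h by (rule odd_pos)

lemma Q_nonzero: "x \<in> Q \<Longrightarrow> x \<noteq> \<zero>"
  using pow_eq_one_nonzero h_pos by (auto simp: unity_roots_def)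

lemma Q_F: assumes "x \<in> Q" shows "x \<in> F"
proof -
  have x: "x \<in> carrier L" "x [^] h = \<one>" using assms by (auto simp: unity_roots_def)
  have "x [^] (h * 2) = \<one>" using nat_pow_pow[of x h 2] x by simp
  then have "x [^] (2 * h + 1) = x" using x by (simp add: mult.commute)
  then show ?thesis using x by (simp add: fixed_field_def q_eq)
qed

lemma F_closed:
  assumes "x \<in> F" "y \<in> F" shows "x \<oplus> y \<in> F" "x \<otimes> y \<in> F" "\<ominus> x \<in> F"
proof -
  have x: "x \<in> carrier L" "x [^] (p ^ k) = x" "y \<in> carrier L" "y [^] (p ^ k) = y"
    using assms by (auto simp: fixed_field_def)
  show "x \<oplus> y \<in> F" using frobenius_power_add[OF x(1,3), of k] x by (simp add: fixed_field_def)
  show "x \<otimes> y \<in> F" using x by (simp add: fixed_field_def nat_pow_distrib)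
  have "odd (p ^ k)" unfolding q_eq by simp
  then show "\<ominus> x \<in> F" using neg_pow_odd[OF x(1)] x by (simp add: fixed_field_def)
qed

lemma zero_F: "\<zero> \<in> F" and one_Q: "\<one> \<in> Q"
  using q_eq nat_pow_zero[of "p ^ k"] by (auto simp: fixed_field_def unity_roots_def)

lemma Q_closed:
  assumes "x \<in> Q" "y \<in> Q" shows "x \<otimes> y \<in> Q"
  using assms by (simp add: unity_roots_def nat_pow_distrib)

text \<open>\<open>x^h\<close> is 1 or -1, and in the second case \<open>(-x)^h = 1\<close> because
  \<open>h\<close> is odd.\<close>

lemma Q_or_neg: assumes x: "x \<in> F" "x \<noteq> \<zero>" shows "x \<in> Q \<or> \<ominus> x \<in> Q"
proof -
  have xG: "x \<in> carrier L" by (rule F_carrier[OF x(1)])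
  have q1: "p ^ k > 1" using q_eq h_pos by simp
  have "x \<in> unity_roots (p ^ k - 1)" using x unfolding fixed_field_eq[OF q1] by simp
  then have "x [^] (h * 2) = \<one>" unfolding q_eq by (simp add: unity_roots_def mult.commute)
  define y where "y = x [^] h"
  have yG: "y \<in> carrier L" using xG by (simp add: y_def)
  have "y \<otimes> y = \<one>" using \<open>x [^] (h * 2) = \<one>\<close> xG nat_pow_mult[of x h h] by (simp add: y_def mult_2_right)
  moreover have "(y \<ominus> \<one>) \<otimes> (y \<oplus> \<one>) = y \<otimes> y \<ominus> \<one>" using yG by algebra
  ultimately have "(y \<ominus> \<one>) \<otimes> (y \<oplus> \<one>) = \<zero>" by simp
  then have "y \<ominus> \<one> = \<zero> \<or> y \<oplus> \<one> = \<zero>" using yG by (simp add: integral_iff)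
  then have "y = \<one> \<or> y = \<ominus> \<one>" using yG by (metis minus_equality one_closed r_right_minus_eq a_comm minus_minus)
  then show ?thesis
  proof
    assume "y = \<one>"
    then show ?thesis using xG by (simp add: unity_roots_def y_def)
  next
    assume "y = \<ominus> \<one>"
    then have "(\<ominus> x) [^] h = \<one>" using neg_pow_odd[OF xG odd_h] by (simp add: y_def)
    then show ?thesis using xG by (simp add: unity_roots_def)
  qed
qed

lemma neg_not_Q: assumes "x \<in> Q" shows "\<ominus> x \<notin> Q"
proof
  assume n: "\<ominus> x \<in> Q"
  have x: "x \<in> carrier L" "x [^] h = \<one>" using assms by (auto simp: unity_roots_def)
  have "\<ominus> \<one> = \<one>" using neg_pow_odd[OF x(1) odd_h] x(2) n by (simp add: unity_roots_def)
  then have "\<one> \<oplus> \<one> = \<zero>" by (metis one_closed r_neg)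
  then have "add_pow L (2::nat) \<one> = \<zero>" by (simp add: numeral_2_eq_2)
  moreover have "coprime 2 p"
  proof -
    have "odd (p ^ k)" unfolding q_eq by simp
    then have "odd p" using k by (simp add: even_power)
    then show ?thesis by simp
  qed
  ultimately show False using add_pow_one_nonzero by blast
qed

text \<open>\<open>(a, b)\<close> stands for the map taking \<open>t\<close> to
  \<open>a t + b\<close>; in a product the left factor is applied first.\<close>

definition aff :: "('a \<times> 'a) monoid" where
  "aff = \<lparr>carrier = Q \<times> F, mult = (\<lambda>x y. (fst y \<otimes> fst x, fst y \<otimes> snd x \<oplus> snd y)), one = (\<one>, \<zero>)\<rparr>"

lemma carrier_aff: "carrier aff = Q \<times> F" by (simp add: aff_def)

lemma group_aff: "group aff"
proof (rule groupI)
  show "\<one>\<^bsub>aff\<^esub> \<in> carrier aff" using one_Q zero_F by (simp add: aff_def)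
next
  fix x y assume "x \<in> carrier aff" "y \<in> carrier aff"
  then show "x \<otimes>\<^bsub>aff\<^esub> y \<in> carrier aff" using Q_closed F_closed Q_F by (auto simp: aff_def)
next
  fix x y z assume "x \<in> carrier aff" "y \<in> carrier aff" "z \<in> carrier aff"
  then show "x \<otimes>\<^bsub>aff\<^esub> y \<otimes>\<^bsub>aff\<^esub> z = x \<otimes>\<^bsub>aff\<^esub> (y \<otimes>\<^bsub>aff\<^esub> z)"
    using Q_carrier F_carrier by (auto simp: aff_def m_assoc r_distr a_assoc)
next
  fix x assume "x \<in> carrier aff"
  then show "\<one>\<^bsub>aff\<^esub> \<otimes>\<^bsub>aff\<^esub> x = x" using Q_carrier F_carrier by (auto simp: aff_def)
next
  fix x assume "x \<in> carrier aff"
  then obtain a b where ab: "x = (a, b)" "a \<in> Q" "b \<in> F" by (auto simp: aff_def)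
  have G: "a \<in> carrier L" "b \<in> carrier L" using ab Q_carrier F_carrier by auto
  define c where "c = a [^] (h - 1)"
  have cG: "c \<in> carrier L" using G by (simp add: c_def)
  have "a [^] h = c \<otimes> a" using h_pos by (metis Suc_diff_1 c_def nat_pow_Suc)
  then have ca: "a \<otimes> c = \<one>" using ab(2) G cG by (simp add: unity_roots_def m_comm)
  have "c [^] h = (a [^] h) [^] (h - 1)" using G by (simp add: c_def nat_pow_pow mult.commute)
  then have cQ: "c \<in> Q" using ab(2) cG by (simp add: unity_roots_def)
  have dF: "\<ominus> (c \<otimes> b) \<in> F" using F_closed(2,3) Q_F[OF cQ] ab(3) by blast
  have "a \<otimes> (\<ominus> (c \<otimes> b)) = \<ominus> (a \<otimes> c \<otimes> b)" using G cG by (simp add: r_minus m_assoc)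
  then have "a \<otimes> (\<ominus> (c \<otimes> b)) \<oplus> b = \<zero>" using ca G by (simp add: l_neg)
  then show "\<exists>y\<in>carrier aff. y \<otimes>\<^bsub>aff\<^esub> x = \<one>\<^bsub>aff\<^esub>"
    using cQ dF ca by (intro bexI[of _ "(c, \<ominus> (c \<otimes> b))"]) (auto simp: aff_def ab(1))
qed

text \<open>The image of the pair \<open>{0, 1}\<close> under the map coded by
  \<open>x\<close>.\<close>

definition pt :: "'a \<times> 'a \<Rightarrow> 'a set" where "pt x = {snd x, fst x \<oplus> snd x}"

text \<open>For distinct \<open>x\<close>, \<open>y\<close> in \<open>F\<close> exactly one of
  \<open>x - y\<close> and \<open>y - x\<close> is in \<open>Q\<close>, so an unordered pair has
  exactly one description \<open>{b, a + b}\<close> with \<open>a\<close> in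
  \<open>Q\<close>.\<close>

lemma bij_pt: "bij_betw pt (Q \<times> F) {A. A \<subseteq> F \<and> card A = 2}"
proof (rule bij_betw_imageI)
  show "inj_on pt (Q \<times> F)"
  proof (rule inj_onI)
    fix x y assume xy: "x \<in> Q \<times> F" "y \<in> Q \<times> F" "pt x = pt y"
    obtain a b c d where ab: "x = (a, b)" "y = (c, d)" by (metis surj_pair)
    have Q: "a \<in> Q" "c \<in> Q" using xy ab by auto
    have G: "a \<in> carrier L" "b \<in> carrier L" "c \<in> carrier L" "d \<in> carrier L"
      using xy ab Q_carrier F_carrier by auto
    have "{b, a \<oplus> b} = {d, c \<oplus> d}" using xy(3) by (simp add: pt_def ab)
    then have "(b = d \<and> a \<oplus> b = c \<oplus> d) \<or> (b = c \<oplus> d \<and> a \<oplus> b = d)" by (simp only: doubleton_eq_iff)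
    then show "x = y"
    proof
      assume "b = d \<and> a \<oplus> b = c \<oplus> d"
      then show ?thesis using G ab by auto
    next
      assume e: "b = c \<oplus> d \<and> a \<oplus> b = d"
      have "(a \<oplus> c) \<oplus> d = a \<oplus> (c \<oplus> d)" using G by (simp add: a_assoc)
      also have "\<dots> = a \<oplus> b" unfolding conjunct1[OF e] ..
      also have "\<dots> = \<zero> \<oplus> d" unfolding conjunct2[OF e] using G by simp
      finally have "a \<oplus> c = \<zero>" using G by (metis add.r_cancel add.m_closed zero_closed)
      then have "a = \<ominus> c" using G by (metis minus_equality)
      then show ?thesis using Q neg_not_Q by blast
    qed
  qed
  show "pt ` (Q \<times> F) = {A. A \<subseteq> F \<and> card A = 2}"
  proof (intro equalityI subsetI)
    fix A assume "A \<in> pt ` (Q \<times> F)"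
    then obtain a b where ab: "a \<in> Q" "b \<in> F" "A = {b, a \<oplus> b}" by (auto simp: pt_def)
    have G: "a \<in> carrier L" "b \<in> carrier L" using ab Q_carrier F_carrier by auto
    have "a \<oplus> b \<noteq> b"
    proof
      assume "a \<oplus> b = b"
      then have "a \<oplus> b = \<zero> \<oplus> b" using G by simp
      then have "a = \<zero>" using G by (metis add.r_cancel zero_closed)
      then show False using Q_nonzero[OF ab(1)] by blast
    qed
    then show "A \<in> {A. A \<subseteq> F \<and> card A = 2}" using ab F_closed(1)[OF Q_F[OF ab(1)] ab(2)] by auto
  next
    fix A assume "A \<in> {A. A \<subseteq> F \<and> card A = 2}"
    then obtain x y where xy: "A = {x, y}" "x \<noteq> y" "x \<in> F" "y \<in> F" by (auto simp: card_2_iff)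
    have main: "\<exists>z\<in>Q \<times> F. pt z = {x, y}" if "x \<ominus> y \<in> Q" "x \<in> F" "y \<in> F" for x y
    proof -
      have G: "x \<in> carrier L" "y \<in> carrier L" using that F_carrier by auto
      have "x \<ominus> y \<oplus> y = x" using G by algebra
      then show ?thesis using that by (intro bexI[of _ "(x \<ominus> y, y)"]) (auto simp: pt_def)
    qed
    have G: "x \<in> carrier L" "y \<in> carrier L" using xy F_carrier by auto
    have "x \<ominus> y \<in> F" unfolding a_minus_def using xy F_closed by blast
    moreover have "x \<ominus> y \<noteq> \<zero>" using xy G by simp
    ultimately have "x \<ominus> y \<in> Q \<or> \<ominus> (x \<ominus> y) \<in> Q" by (rule Q_or_neg)
    moreover have "\<ominus> (x \<ominus> y) = y \<ominus> x" using G by algebra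
    ultimately have "x \<ominus> y \<in> Q \<or> y \<ominus> x \<in> Q" by simp
    then have "\<exists>z\<in>Q \<times> F. pt z = A" using main[of x y] main[of y x] xy by (metis insert_commute)
    then show "A \<in> pt ` (Q \<times> F)" by blast
  qed
qed

lemma pt_mult:
  assumes "x \<in> Q \<times> F" "y \<in> Q \<times> F"
  shows "pt (x \<otimes>\<^bsub>aff\<^esub> y) = (\<lambda>t. fst y \<otimes> t \<oplus> snd y) ` pt x"
proof -
  obtain a b c d where ab: "x = (a, b)" "y = (c, d)" by (metis surj_pair)
  have G: "a \<in> carrier L" "b \<in> carrier L" "c \<in> carrier L" "d \<in> carrier L"
    using assms ab Q_carrier F_carrier by auto
  have "c \<otimes> a \<oplus> (c \<otimes> b \<oplus> d) = c \<otimes> (a \<oplus> b) \<oplus> d" using G by algebra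
  then show ?thesis by (simp add: pt_def aff_def ab)
qed

lemma meet_mult:
  assumes "x \<in> Q \<times> F" "y \<in> Q \<times> F" "g \<in> Q \<times> F" "meet (pt x) (pt y)"
  shows "meet (pt (x \<otimes>\<^bsub>aff\<^esub> g)) (pt (y \<otimes>\<^bsub>aff\<^esub> g))"
proof -
  have sub: "pt x \<subseteq> carrier L" "pt y \<subseteq> carrier L" using assms Q_carrier F_carrier by (auto simp: pt_def)
  have g: "fst g \<in> carrier L" "snd g \<in> carrier L" "fst g \<noteq> \<zero>" using assms Q_carrier F_carrier Q_nonzero by auto
  let ?f = "\<lambda>t. fst g \<otimes> t \<oplus> snd g"
  have inj: "inj_on ?f (carrier L)"
    using g by (auto intro!: inj_onI simp: m_lcancel)
  then have "?f ` pt x \<noteq> ?f ` pt y" using assms(4) inj_on_image_eq_iff[OF inj sub] by (simp add: meet_def)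
  then show ?thesis unfolding pt_mult[OF assms(1,3)] pt_mult[OF assms(2,3)] using assms(4) by (auto simp: meet_def)
qed

end

text \<open>The algebraic closure of the integers modulo \<open>p\<close>; \<open>h1\<close> carries
  the multiples of 1 over from the prime field.\<close>

lemma exists_closed_char:
  assumes p: "Factorial_Ring.prime p"
  shows "\<exists>L :: ((int list \<times> nat) multiset \<Rightarrow> int) ring. closed_char L p"
proof -
  interpret R: residues_prime p "residue_ring (int p)" by unfold_locales (use p in auto)
  define L where "L = R.alg_closure"
  note cl = R.alg_closureE[folded L_def]
  interpret A: algebraic_closure L "ring.indexed_const (residue_ring (int p)) ` carrier (residue_ring (int p))" by (rule cl(1))
  let ?h = "ring.indexed_const (residue_ring (int p))"
  have h1: "add_pow L n \<one>\<^bsub>L\<^esub> = ?h (int n mod int p)" for n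
  proof (induction n)
    case 0
    have "?h \<zero>\<^bsub>residue_ring (int p)\<^esub> = \<zero>\<^bsub>L\<^esub>" by (rule ring_hom_zero[OF cl(2) R.ring_axioms A.ring_axioms])
    then show ?case by (simp add: R.res_zero_eq)
  next
    case (Suc n)
    have "add_pow L (Suc n) \<one>\<^bsub>L\<^esub> = ?h (int n mod int p) \<oplus>\<^bsub>L\<^esub> \<one>\<^bsub>L\<^esub>" using Suc by simp
    also have "\<dots> = ?h (int n mod int p) \<oplus>\<^bsub>L\<^esub> ?h \<one>\<^bsub>residue_ring (int p)\<^esub>" unfolding ring_hom_one[OF cl(2)] ..
    also have "?h (int n mod int p) \<oplus>\<^bsub>L\<^esub> ?h \<one>\<^bsub>residue_ring (int p)\<^esub>
        = ?h (int n mod int p \<oplus>\<^bsub>residue_ring (int p)\<^esub> \<one>\<^bsub>residue_ring (int p)\<^esub>)"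
      by (rule ring_hom_add[OF cl(2), symmetric]) (use R.mod_in_carrier in auto)
    also have "int n mod int p \<oplus>\<^bsub>residue_ring (int p)\<^esub> \<one>\<^bsub>residue_ring (int p)\<^esub> = int (Suc n) mod int p"
      unfolding R.res_add_eq R.res_one_eq by (simp add: mod_simps add.commute)
    finally show ?case .
  qed
  have "add_pow L p \<one>\<^bsub>L\<^esub> = \<zero>\<^bsub>L\<^esub>" using h1[of p] h1[of 0] by simp
  then have "closed_char L p" by unfold_locales (use p in auto)
  then show ?thesis by blast
qed

lemma triangular_cayley:
  assumes q: "primepow q" "q mod 4 = 3" and \<Gamma>: "pair_graph \<Gamma>"
    and iso: "rel_iso (pverts \<Gamma>) (gadj \<Gamma>) (pverts (triangular_graph q)) (gadj (triangular_graph q))"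
  shows "is_cayley_graph \<Gamma>"
proof -
  obtain p k where pk: "Factorial_Ring.prime p" "k > 0" "q = p ^ k" using q(1) unfolding primepow_def by blast
  obtain L :: "((int list \<times> nat) multiset \<Rightarrow> int) ring" where L: "closed_char L p"
    using exists_closed_char[OF pk(1)] by blast
  interpret closed_char L p by (rule L)
  have "q = 4 * (q div 4) + 3" using q(2) by presburger
  then have "p ^ k = 2 * (2 * (q div 4) + 1) + 1" using pk(3) by simp
  moreover define h where "h = 2 * (q div 4) + 1"
  ultimately have h: "p ^ k = 2 * h + 1" "odd h" by (simp_all add: h_def)
  interpret paley L p k h by unfold_locales (use pk h in auto)
  have i1: "rel_iso (Q \<times> F) (\<lambda>x y. meet (pt x) (pt y)) {A. A \<subseteq> F \<and> card A = 2} meet"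
    by (rule rel_isoI[OF bij_pt]) simp
  have i2: "rel_iso {A. A \<subseteq> F \<and> card A = 2} meet (pverts (triangular_graph q)) (gadj (triangular_graph q))"
    by (rule triangular_rel_iso) (use card_fixed_field[OF pk(2)] pk(3) in auto)
  show ?thesis
  proof (rule right_invariant_is_cayley[OF \<Gamma> group_aff])
    show "finite (carrier aff)" unfolding carrier_aff
      using card_fixed_field(1)[OF pk(2)] card_unity_roots_le(1)[OF h_pos] by simp
    show "rel_iso (pverts \<Gamma>) (gadj \<Gamma>) (carrier aff) (\<lambda>x y. meet (pt x) (pt y))" unfolding carrier_aff
      by (rule rel_iso_trans[OF iso rel_iso_sym[OF rel_iso_trans[OF i1 i2]]])
    show "meet (pt (a \<otimes>\<^bsub>aff\<^esub> g)) (pt (b \<otimes>\<^bsub>aff\<^esub> g))"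
      if "a \<in> carrier aff" "b \<in> carrier aff" "g \<in> carrier aff" "meet (pt a) (pt b)" for a b g
      using meet_mult that unfolding carrier_aff by blast
  qed
qed

section \<open>The graphs of the classification\<close>

lemma sr_graph_cocktail_party:
  assumes n: "n \<ge> 2"
  shows "sr_graph (pverts (cocktail_party_graph n)) (gadj (cocktail_party_graph n)) (2 * n - 2) (2 * n - 4) (2 * n - 2)"
proof -
  let ?V = "{..<n} \<times> {..<2::nat}" and ?E = "gadj (cocktail_party_graph n)"
  have V: "pverts (cocktail_party_graph n) = ?V"
    and E: "\<And>x y. ?E x y \<longleftrightarrow> x \<in> ?V \<and> y \<in> ?V \<and> fst x \<noteq> fst y"
    by (auto simp: cocktail_party_graph_def complete_multipartite_graph_def)
  show ?thesis
    unfolding V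
  proof
    show "card {w. ?E x w} = 2 * n - 2" if "x \<in> ?V" for x
    proof -
      have e: "{w. ?E x w} = ({..<n} - {fst x}) \<times> {..<2}" using that by (auto simp: E)
      have "card ({..<n} - {fst x}) = n - 1" using that by (simp add: mem_Times_iff)
      then show ?thesis unfolding e card_cartesian_product by simp
    qed
    show "card {w. ?E x w \<and> ?E y w} = 2 * n - 4" if "?E x y" for x y
    proof -
      have xy: "fst x < n" "fst y < n" "fst x \<noteq> fst y" using that unfolding E by auto
      have e: "{w. ?E x w \<and> ?E y w} = ({..<n} - {fst x, fst y}) \<times> {..<2}" using that by (auto simp: E)
      have "card ({..<n} - {fst x, fst y}) = n - 2" using xy by (simp add: card_Diff_subset)
      then show ?thesis unfolding e card_cartesian_product by simp
    qed
    show "card {w. ?E x w \<and> ?E y w} = 2 * n - 2" if "x \<in> ?V" "y \<in> ?V" "x \<noteq> y" "\<not> ?E x y" for x y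
    proof -
      have "fst x = fst y" using that by (simp add: E)
      then have e: "{w. ?E x w \<and> ?E y w} = ({..<n} - {fst x}) \<times> {..<2}" using that by (auto simp: E)
      have "card ({..<n} - {fst x}) = n - 1" using that by (simp add: mem_Times_iff)
      then show ?thesis unfolding e card_cartesian_product by simp
    qed
    have "?E (0, 0) (1, 0) \<and> ?E (1, 0) (0, 1) \<and> (0, 0) \<noteq> (0::nat, 1::nat) \<and> \<not> ?E (0, 0) (0, 1)" using n by (simp add: E)
    then show "\<exists>x y z. ?E x y \<and> ?E y z \<and> x \<noteq> z \<and> \<not> ?E x z" by blast
  qed (auto simp: E)
qed

lemma sr_graph_rook:
  assumes n: "n \<ge> 2"
  shows "sr_graph ({..<n} \<times> {..<n}) (\<lambda>x y. x \<in> {..<n} \<times> {..<n} \<and> y \<in> {..<n} \<times> {..<n} \<and> rook x y) (2 * n - 2) (n - 2) 2"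
    (is "sr_graph ?V ?E _ _ _")
proof
  have d: "card ({..<n} - {a, b}) = n - 2" if "a < n" "b < n" "a \<noteq> b" for a b
    using that by (simp add: card_Diff_subset)
  show "card {w. ?E x w} = 2 * n - 2" if x: "x \<in> ?V" for x
  proof -
    obtain a b where ab: "x = (a, b)" "a < n" "b < n" using x by auto
    have e: "{w. ?E x w} = {a} \<times> ({..<n} - {b}) \<union> ({..<n} - {a}) \<times> {b}" using ab by (auto simp: rook_def)
    have "card ({a} \<times> ({..<n} - {b}) \<union> ({..<n} - {a}) \<times> {b})
        = card ({a} \<times> ({..<n} - {b})) + card (({..<n} - {a}) \<times> {b})"
      by (rule card_Un_disjoint) auto
    then show ?thesis unfolding e using ab by (simp add: card_cartesian_product)
  qed
  show "card {w. ?E x w \<and> ?E y w} = n - 2" if xy: "?E x y" for x y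
  proof -
    obtain a b where ab: "x = (a, b)" "a < n" "b < n" using xy by auto
    obtain c e where ce: "y = (c, e)" "c < n" "e < n" using xy by auto
    consider "a = c" "b \<noteq> e" | "b = e" "a \<noteq> c" using xy ab ce by (auto simp: rook_def)
    then show ?thesis
    proof cases
      case 1
      have eq: "{w. ?E x w \<and> ?E y w} = {a} \<times> ({..<n} - {b, e})" using 1 ab ce by (auto simp: rook_def)
      show ?thesis unfolding eq card_cartesian_product d[OF ab(3) ce(3) 1(2)] by simp
    next
      case 2
      have eq: "{w. ?E x w \<and> ?E y w} = ({..<n} - {a, c}) \<times> {b}" using 2 ab ce by (auto simp: rook_def)
      show ?thesis unfolding eq card_cartesian_product d[OF ab(2) ce(2) 2(2)] by simp
    qed
  qed
  show "card {w. ?E x w \<and> ?E y w} = 2" if xy: "x \<in> ?V" "y \<in> ?V" "x \<noteq> y" "\<not> ?E x y" for x y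
  proof -
    obtain a b where ab: "x = (a, b)" "a < n" "b < n" using xy by auto
    obtain c e where ce: "y = (c, e)" "c < n" "e < n" using xy by auto
    have ne: "a \<noteq> c" "b \<noteq> e" using xy ab ce by (auto simp: rook_def)
    have eq: "{w. ?E x w \<and> ?E y w} = {(a, e), (c, b)}" using ne ab ce by (auto simp: rook_def)
    show ?thesis unfolding eq using ne by simp
  qed
  have "?E (0, 0) (0, 1) \<and> ?E (0, 1) (1, 1) \<and> (0, 0) \<noteq> (1::nat, 1::nat) \<and> \<not> ?E (0, 0) (1, 1)"
    using n by (simp add: rook_def)
  then show "\<exists>x y z. ?E x y \<and> ?E y z \<and> x \<noteq> z \<and> \<not> ?E x z" by blast
qed (auto simp: rook_def)

lemma sr_graph_triangular:
  assumes n: "n \<ge> 4"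
  shows "sr_graph (pverts (triangular_graph n)) (gadj (triangular_graph n)) (2 * n - 4) (n - 2) 4"
    (is "sr_graph ?V ?E _ _ _")
proof -
  have V: "A \<in> ?V \<longleftrightarrow> (\<exists>a b. A = {a, b} \<and> a < n \<and> b < n \<and> a \<noteq> b)" for A
    by (auto simp: triangular_graph_eq(1) card_2_iff)
  have fin: "finite ?V" unfolding triangular_graph_eq(1) by (rule finite_subset[of _ "Pow {..<n}"]) auto
  have E: "?E A B \<longleftrightarrow> A \<in> ?V \<and> B \<in> ?V \<and> A \<noteq> B \<and> A \<inter> B \<noteq> {}" for A B
    by (simp only: triangular_graph_eq(2) meet_def)
  have star: "card ((\<lambda>x. {a, x}) ` ({..<n} - D)) = n - card D" if "D \<subseteq> {..<n}" "a \<in> D" for a D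
  proof -
    have "inj_on (\<lambda>x. {a, x}) ({..<n} - D)" by (auto intro!: inj_onI simp: doubleton_eq_iff)
    then show ?thesis using that by (simp add: card_image card_Diff_subset finite_subset[OF that(1)])
  qed
  have adj: "{a, b} \<in> ?V" if "a < n" "b < n" "a \<noteq> b" for a b using that V by blast
  show ?thesis
  proof
    show "finite ?V" by (rule fin)
    show "card {w. ?E A w} = 2 * n - 4" if A: "A \<in> ?V" for A
    proof -
      obtain a b where ab: "A = {a, b}" "a < n" "b < n" "a \<noteq> b" using A V by blast
      have eq: "{w. ?E A w} = (\<lambda>x. {a, x}) ` ({..<n} - {a, b}) \<union> (\<lambda>x. {b, x}) ` ({..<n} - {a, b})"
      proof (intro equalityI subsetI)
        fix w assume w: "w \<in> {w. ?E A w}"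
        then obtain c d where cd: "w = {c, d}" "c < n" "d < n" "c \<noteq> d" unfolding E V by blast
        have m: "{a, b} \<noteq> {c, d}" "{a, b} \<inter> {c, d} \<noteq> {}" using w unfolding E ab cd by auto
        have "(c \<in> {a, b} \<and> d \<notin> {a, b}) \<or> (d \<in> {a, b} \<and> c \<notin> {a, b})" using m cd(4) ab(4) by auto
        then show "w \<in> (\<lambda>x. {a, x}) ` ({..<n} - {a, b}) \<union> (\<lambda>x. {b, x}) ` ({..<n} - {a, b})"
          unfolding cd(1) using cd by (auto simp: insert_commute)
      next
        fix w assume "w \<in> (\<lambda>x. {a, x}) ` ({..<n} - {a, b}) \<union> (\<lambda>x. {b, x}) ` ({..<n} - {a, b})"
        then obtain x where x: "x < n" "x \<noteq> a" "x \<noteq> b" "w = {a, x} \<or> w = {b, x}" by auto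
        have "w \<in> ?V" using x adj[of a x] adj[of b x] ab by auto
        then show "w \<in> {w. ?E A w}" using x ab A unfolding E by (auto simp: doubleton_eq_iff)
      qed
      have "card ((\<lambda>x. {a, x}) ` ({..<n} - {a, b}) \<union> (\<lambda>x. {b, x}) ` ({..<n} - {a, b}))
          = card ((\<lambda>x. {a, x}) ` ({..<n} - {a, b})) + card ((\<lambda>x. {b, x}) ` ({..<n} - {a, b}))"
        by (rule card_Un_disjoint) (use ab in \<open>auto simp: doubleton_eq_iff\<close>)
      also have "\<dots> = (n - 2) + (n - 2)" using star[of "{a, b}" a] star[of "{a, b}" b] ab by simp
      finally show ?thesis unfolding eq by simp
    qed
    show "card {w. ?E A w \<and> ?E B w} = n - 2" if AB: "?E A B" for A B
    proof -
      have *: "\<exists>a b c. A = {a, b} \<and> B = {a, c} \<and> a < n \<and> b < n \<and> c < n \<and> a \<noteq> b \<and> a \<noteq> c \<and> b \<noteq> c"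
      proof -
        obtain a b where ab: "A = {a, b}" "a < n" "b < n" "a \<noteq> b" using AB unfolding E V by blast
        obtain c d where cd: "B = {c, d}" "c < n" "d < n" "c \<noteq> d" using AB unfolding E V by blast
        have m: "{a, b} \<noteq> {c, d}" "{a, b} \<inter> {c, d} \<noteq> {}" using AB unfolding E ab cd by auto
        then consider "a = c" "b \<noteq> d" | "a = d" "b \<noteq> c" | "b = c" "a \<noteq> d" | "b = d" "a \<noteq> c"
          using ab(4) cd(4) by auto
        then show ?thesis
        proof cases
          case 1 then show ?thesis using ab cd by blast
        next
          case 2 then show ?thesis using ab cd insert_commute[of c d] by (intro exI[of _ a] exI[of _ b] exI[of _ c]) auto
        next
          case 3 then show ?thesis using ab cd insert_commute[of a b] by (intro exI[of _ b] exI[of _ a] exI[of _ d]) auto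
        next
          case 4 then show ?thesis using ab cd by (intro exI[of _ b] exI[of _ a] exI[of _ c]) auto
        qed
      qed
      then obtain a b c where abc: "A = {a, b}" "B = {a, c}" "a < n" "b < n" "c < n" "a \<noteq> b" "a \<noteq> c" "b \<noteq> c" by blast
      have eq: "{w. ?E A w \<and> ?E B w} = insert {b, c} ((\<lambda>x. {a, x}) ` ({..<n} - {a, b, c}))"
      proof (intro equalityI subsetI)
        fix w assume w: "w \<in> {w. ?E A w \<and> ?E B w}"
        then obtain d e where de: "w = {d, e}" "d < n" "e < n" "d \<noteq> e" unfolding E V by blast
        have m: "{a, b} \<noteq> {d, e}" "{a, c} \<noteq> {d, e}" "{a, b} \<inter> {d, e} \<noteq> {}" "{a, c} \<inter> {d, e} \<noteq> {}"
          using w unfolding E abc de by auto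
        have "(d = a \<and> e \<notin> {a, b, c}) \<or> (e = a \<and> d \<notin> {a, b, c}) \<or> (d = b \<and> e = c) \<or> (d = c \<and> e = b)"
          using m de(4) abc(6-8) by (auto simp: doubleton_eq_iff)
        then show "w \<in> insert {b, c} ((\<lambda>x. {a, x}) ` ({..<n} - {a, b, c}))"
          unfolding de(1) using de by (auto simp: insert_commute)
      next
        fix w assume w: "w \<in> insert {b, c} ((\<lambda>x. {a, x}) ` ({..<n} - {a, b, c}))"
        then have "w \<in> ?V" using abc adj by auto
        moreover have "A \<in> ?V" "B \<in> ?V" using abc adj by auto
        ultimately show "w \<in> {w. ?E A w \<and> ?E B w}" using w abc unfolding E by (auto simp: doubleton_eq_iff)
      qed
      have ni: "{b, c} \<notin> (\<lambda>x. {a, x}) ` ({..<n} - {a, b, c})" using abc by (auto simp: doubleton_eq_iff)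
      have "card ((\<lambda>x. {a, x}) ` ({..<n} - {a, b, c})) = n - 3" using star[of "{a, b, c}" a] abc by simp
      then show ?thesis unfolding eq using n card_insert_disjoint[OF _ ni] by simp
    qed
    show "card {w. ?E A w \<and> ?E B w} = 4" if AB: "A \<in> ?V" "B \<in> ?V" "A \<noteq> B" "\<not> ?E A B" for A B
    proof -
      obtain a b where ab: "A = {a, b}" "a < n" "b < n" "a \<noteq> b" using AB V by blast
      obtain c d where cd: "B = {c, d}" "c < n" "d < n" "c \<noteq> d" using AB V by blast
      have ne: "a \<noteq> c" "a \<noteq> d" "b \<noteq> c" "b \<noteq> d" using AB unfolding E ab cd by auto
      have eq: "{w. ?E A w \<and> ?E B w} = {{a, c}, {a, d}, {b, c}, {b, d}}"
      proof (intro equalityI subsetI)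
        fix w assume w: "w \<in> {w. ?E A w \<and> ?E B w}"
        then obtain x y where xy: "w = {x, y}" unfolding E V by blast
        have m: "{a, b} \<inter> {x, y} \<noteq> {}" "{c, d} \<inter> {x, y} \<noteq> {}" using w unfolding E ab cd xy by auto
        then show "w \<in> {{a, c}, {a, d}, {b, c}, {b, d}}" unfolding xy using ne by (auto simp: doubleton_eq_iff)
      next
        fix w assume w: "w \<in> {{a, c}, {a, d}, {b, c}, {b, d}}"
        then have "w \<in> ?V" using ab cd ne adj by auto
        then show "w \<in> {w. ?E A w \<and> ?E B w}" using w ab cd ne AB unfolding E by (auto simp: doubleton_eq_iff)
      qed
      show ?thesis unfolding eq using ne ab(4) cd(4) by (simp add: doubleton_eq_iff)
    qed
    have p: "?E {0, 1} {1, 2} \<and> ?E {1, 2} {2, 3} \<and> {0, 1} \<noteq> {2, 3::nat} \<and> \<not> ?E {0, 1} {2, 3}"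
      unfolding E using adj[of 0 1] adj[of 1 2] adj[of 2 3] n by (auto simp: doubleton_eq_iff)
    show "\<exists>x y z. ?E x y \<and> ?E y z \<and> x \<noteq> z \<and> \<not> ?E x z"
      by (rule exI[of _ "{0, 1}"], rule exI[of _ "{1, 2}"], rule exI[of _ "{2, 3}"]) (rule p)
  qed (auto simp: E)
qed

text \<open>With \<open>\<mu> = k\<close> and \<open>\<lambda> = k - 2\<close> every vertex has exactly one non-neighbour.\<close>

lemma cocktail_party_unique:
  assumes "sr_graph V E k l k" and l: "l + 2 = k"
  shows "\<exists>n\<ge>2. rel_iso V E (pverts (cocktail_party_graph n)) (gadj (cocktail_party_graph n))"
proof -
  interpret sr_graph V E k l k by fact
  have "k > 0" by (rule m_pos)
  have "k * (k - 1 - l) = k * (card V - 1 - k)" by (rule parameter_identity)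
  then have "k - 1 - l = card V - 1 - k" using \<open>k > 0\<close> by simp
  then have v1: "card V - 1 - k = 1" using l by simp
  have "\<exists>y. {w \<in> V. w \<noteq> x \<and> \<not> E x w} = {y}" if "x \<in> V" for x
    using card_nonnbrs[OF that] unfolding v1 by (rule card_1_singletonE) blast
  then obtain p where p: "\<And>x. x \<in> V \<Longrightarrow> {w \<in> V. w \<noteq> x \<and> \<not> E x w} = {p x}" by metis
  have pV: "p x \<in> V" "p x \<noteq> x" "\<not> E x (p x)" if "x \<in> V" for x using p[OF that] by auto
  have pu: "w = p x" if "x \<in> V" "w \<in> V" "w \<noteq> x" "\<not> E x w" for x w using p[OF that(1)] that by auto
  have pp: "p (p x) = x" if "x \<in> V" for x using pu[of "p x" x] pV[OF that] that E_sym by metis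
  define P where "P = (\<lambda>x. {x, p x}) ` V"
  define n where "n = card P"
  obtain h where h: "bij_betw h P {..<n}"
    using ex_bij_betw_finite_nat[of P] finite_V by (auto simp: P_def n_def atLeast0LessThan)
  \<comment> \<open>\<open>c\<close> picks one element of each pair \<open>{x, p x}\<close>; this
    decides the second coordinate.\<close>
  define c where "c B = (SOME x. x \<in> B)" for B :: "'a set"
  have c: "c {x, p x} = x \<or> c {x, p x} = p x" for x
    unfolding c_def using someI[of "\<lambda>y. y \<in> {x, p x}" x] by auto
  define f where "f x = (h {x, p x}, if c {x, p x} = x then 0 else 1 :: nat)" for x
  have same: "{x, p x} = {y, p y} \<longleftrightarrow> y = x \<or> y = p x" if "x \<in> V" "y \<in> V" for x y
  proof
    assume "{x, p x} = {y, p y}"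
    then have "y \<in> {x, p x}" by blast
    then show "y = x \<or> y = p x" by blast
  next
    assume "y = x \<or> y = p x"
    then show "{x, p x} = {y, p y}" using pp[OF that(1)] by (metis insert_commute)
  qed
  have hinj: "h {x, p x} = h {y, p y} \<longleftrightarrow> {x, p x} = {y, p y}" if "x \<in> V" "y \<in> V" for x y
    using h that unfolding bij_betw_def P_def by (metis (no_types, lifting) imageI inj_on_eq_iff)
  have E_iff: "E x y \<longleftrightarrow> h {x, p x} \<noteq> h {y, p y}" if xy: "x \<in> V" "y \<in> V" for x y
    unfolding hinj[OF xy] same[OF xy] using pV[OF xy(1)] pu[OF xy] E_irrefl by blast
  have swap: "{p x, p (p x)} = {x, p x}" if "x \<in> V" for x using pp[OF that] by auto
  have bij: "bij_betw f V ({..<n} \<times> {..<2})"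
  proof (rule bij_betw_imageI)
    show "inj_on f V"
    proof (rule inj_onI)
      fix x y assume xy: "x \<in> V" "y \<in> V" "f x = f y"
      then have "{x, p x} = {y, p y}" using hinj[OF xy(1,2)] by (simp add: f_def)
      then have "y = x \<or> y = p x" using same[OF xy(1,2)] by blast
      moreover have "y \<noteq> p x"
      proof
        assume y: "y = p x"
        have "(c {x, p x} = x) = (c {x, p x} = p x)"
          using xy(3) swap[OF xy(1)] unfolding f_def y by (auto split: if_splits)
        then show False using c[of x] pV[OF xy(1)] by metis
      qed
      ultimately show "x = y" by blast
    qed
    show "f ` V = {..<n} \<times> {..<2}"
    proof (intro equalityI subsetI)
      fix z assume "z \<in> f ` V"
      then obtain x where x: "x \<in> V" "z = f x" by blast
      have "h {x, p x} \<in> {..<n}" using h x(1) unfolding bij_betw_def P_def by blast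
      then show "z \<in> {..<n} \<times> {..<2}" using x(2) by (simp add: f_def)
    next
      fix z assume z: "z \<in> {..<n} \<times> {..<2::nat}"
      then have "fst z \<in> h ` P" using h unfolding bij_betw_def by auto
      then obtain x where x: "x \<in> V" "h {x, p x} = fst z" by (auto simp: P_def)
      have two: "snd z = 0 \<or> snd z = 1" using z by auto
      have fx: "f x = (fst z, if c {x, p x} = x then 0 else 1)" using x by (simp add: f_def)
      have fp: "f (p x) = (fst z, if c {x, p x} = p x then 0 else 1)"
        using x swap[OF x(1)] by (simp add: f_def)
      have "f x = z \<or> f (p x) = z" unfolding fx fp using two c[of x] pV[OF x(1)]
        by (cases z) auto
      then show "z \<in> f ` V" using x(1) pV[OF x(1)] by blast
    qed
  qed
  have "rel_iso V E (pverts (cocktail_party_graph n)) (gadj (cocktail_party_graph n))"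
  proof (rule rel_isoI[of f])
    show "bij_betw f V (pverts (cocktail_party_graph n))"
      using bij by (simp add: cocktail_party_graph_def complete_multipartite_graph_def)
    fix x y assume xy: "x \<in> V" "y \<in> V"
    have "f x \<in> {..<n} \<times> {..<2}" "f y \<in> {..<n} \<times> {..<2}" using bij xy unfolding bij_betw_def by auto
    then show "E x y \<longleftrightarrow> gadj (cocktail_party_graph n) (f x) (f y)"
      using E_iff[OF xy] by (simp add: cocktail_party_graph_def complete_multipartite_graph_def) (simp add: f_def)
  qed
  moreover have "n \<ge> 2"
  proof -
    have "card V = n * 2" using bij_betw_same_card[OF bij] by (simp add: card_cartesian_product)
    then show ?thesis using k_less l v1 \<open>k > 0\<close> by linarith
  qed
  ultimately show ?thesis by blast
qed

section \<open>Explicit Cayley graphs with computed parameters\<close>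

definition restrict_rel :: "'a set \<Rightarrow> ('a \<Rightarrow> 'a \<Rightarrow> bool) \<Rightarrow> 'a \<Rightarrow> 'a \<Rightarrow> bool" where
  "restrict_rel V E x y \<longleftrightarrow> x \<in> V \<and> y \<in> V \<and> E x y"

lemma sr_graph_of_list:
  assumes "distinct xs" "srg_check xs adj k l m" "{u, v, w} \<subseteq> set xs" "adj u v" "adj v w" "u \<noteq> w" "\<not> adj u w"
  shows "sr_graph (set xs) (restrict_rel (set xs) adj) k l m" "card (set xs) = length xs"
proof -
  let ?G = "graph_of_list xs adj"
  have srg: "srg ?G (length xs) k l m" by (rule srg_graph_of_list[OF assms])
  then have pg: "pair_graph ?G" by (simp add: srg_def)
  have *: "pverts ?G = set xs" "gadj ?G = restrict_rel (set xs) adj"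
    by (auto simp: graph_of_list_def restrict_rel_def fun_eq_iff)
  show "sr_graph (set xs) (restrict_rel (set xs) adj) k l m" "card (set xs) = length xs"
    using srg unfolding srg_iff_sr_graph[OF pg] * by auto
qed

lemma sr_graph_of_iso:
  assumes \<Gamma>: "pair_graph \<Gamma>" and "sr_graph V E k l m" "rel_iso (pverts \<Gamma>) (gadj \<Gamma>) V E"
  shows "sr_graph (pverts \<Gamma>) (gadj \<Gamma>) k l m"
proof (rule sr_graph_rel_iso[OF assms(2) rel_iso_sym[OF assms(3)]])
  interpret pair_graph \<Gamma> by (rule \<Gamma>)
  fix x y assume "gadj \<Gamma> x y"
  then show "x \<in> pverts \<Gamma> \<and> y \<in> pverts \<Gamma>" using in_arcsD1 in_arcsD2 by blast
qed

lemma list_cayley: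
  assumes G: "group G" "carrier G = set xs"
    and inv: "\<And>a b g. a \<in> set xs \<Longrightarrow> b \<in> set xs \<Longrightarrow> g \<in> set xs \<Longrightarrow> adj a b \<Longrightarrow> adj (a \<otimes>\<^bsub>G\<^esub> g) (b \<otimes>\<^bsub>G\<^esub> g)"
    and \<Gamma>: "pair_graph \<Gamma>" and iso: "rel_iso (pverts \<Gamma>) (gadj \<Gamma>) (set xs) (restrict_rel (set xs) adj)"
  shows "is_cayley_graph \<Gamma>"
proof -
  interpret group G by (rule G)
  have cl: "a \<otimes>\<^bsub>G\<^esub> b \<in> set xs" if "a \<in> set xs" "b \<in> set xs" for a b
    using m_closed[of a b] that unfolding G(2) by blast
  show ?thesis
  proof (rule right_invariant_is_cayley[OF \<Gamma> G(1)])
    show "finite (carrier G)" unfolding G(2) by simp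
    show "rel_iso (pverts \<Gamma>) (gadj \<Gamma>) (carrier G) (restrict_rel (set xs) adj)" unfolding G(2) by (rule iso)
    show "restrict_rel (set xs) adj (a \<otimes>\<^bsub>G\<^esub> g) (b \<otimes>\<^bsub>G\<^esub> g)"
      if "a \<in> carrier G" "b \<in> carrier G" "g \<in> carrier G" "restrict_rel (set xs) adj a b" for a b g
      using that cl inv unfolding G(2) restrict_rel_def by blast
  qed
qed

definition zgrp :: "int \<Rightarrow> int \<Rightarrow> (int \<times> int) monoid" where
  "zgrp n m = \<lparr>carrier = {0..<n} \<times> {0..<m},
    mult = (\<lambda>x y. ((fst x + fst y) mod n, (snd x + snd y) mod m)), one = (0, 0)\<rparr>"

lemma group_zgrp:
  assumes "n > 0" "m > 0" shows "group (zgrp n m)"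
proof (rule groupI)
  fix x assume x: "x \<in> carrier (zgrp n m)"
  show "\<exists>y\<in>carrier (zgrp n m). y \<otimes>\<^bsub>zgrp n m\<^esub> x = \<one>\<^bsub>zgrp n m\<^esub>"
    by (rule bexI[of _ "((- fst x) mod n, (- snd x) mod m)"]) (use assms in \<open>auto simp: zgrp_def mod_simps\<close>)
qed (use assms in \<open>auto simp: zgrp_def mod_simps add.assoc\<close>)

definition zadj :: "int \<Rightarrow> int \<Rightarrow> (int \<times> int) list \<Rightarrow> int \<times> int \<Rightarrow> int \<times> int \<Rightarrow> bool" where
  "zadj n m S x y \<longleftrightarrow> ((fst x - fst y) mod n, (snd x - snd y) mod m) \<in> set S"

lemma zadj_translate: "zadj n m S (x \<otimes>\<^bsub>zgrp n m\<^esub> g) (y \<otimes>\<^bsub>zgrp n m\<^esub> g) \<longleftrightarrow> zadj n m S x y"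
  by (simp add: zadj_def zgrp_def mod_simps)

lemma zgrp_cayley:
  assumes "n > 0" "m > 0" "set xs = {0..<n} \<times> {0..<m}" and \<Gamma>: "pair_graph \<Gamma>"
    and iso: "rel_iso (pverts \<Gamma>) (gadj \<Gamma>) (set xs) (restrict_rel (set xs) (zadj n m S))"
  shows "is_cayley_graph \<Gamma>"
  by (rule list_cayley[OF group_zgrp[OF assms(1,2)] _ _ \<Gamma> iso])
    (use assms(3) in \<open>auto simp: zgrp_def zadj_translate[unfolded zgrp_def, simplified]\<close>)

lemma atLeastLessThan_4: "{0..<4::int} = {0, 1, 2, 3}" and atLeastLessThan_5: "{0..<5::int} = {0, 1, 2, 3, 4}"
  and atLeastLessThan_1: "{0..<1::int} = {0}"
  by auto

text \<open>The parameters of one explicit Cayley graph are computed, and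
  \<open>pentagon_unique\<close> identifies it with the given graph; the other sporadic graphs are
  treated alike. The second factor, of order 1, makes the cyclic group of order 5 an instance of
  \<open>zgrp\<close>.\<close>

lemma pentagon_converse:
  assumes \<Gamma>: "pair_graph \<Gamma>" and iso: "rel_iso (pverts \<Gamma>) (gadj \<Gamma>) (pverts (cycle_graph 5)) (gadj (cycle_graph 5))"
  shows "is_cayley_graph \<Gamma>" "sr_graph (pverts \<Gamma>) (gadj \<Gamma>) 2 0 1"
proof -
  define xs where "xs = List.product [0, 1, 2, 3, 4::int] [0::int]"
  let ?E = "zadj 5 1 [(1, 0), (4, 0)]"
  have chk: "srg_check xs ?E 2 0 1" unfolding xs_def by code_simp
  have sr: "sr_graph (set xs) (restrict_rel (set xs) ?E) 2 0 1" "card (set xs) = length xs"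
    by (rule sr_graph_of_list[OF _ chk, of "(0, 0)" "(1, 0)" "(2, 0)"]; simp add: xs_def zadj_def)+
  have r: "rel_iso (pverts \<Gamma>) (gadj \<Gamma>) (set xs) (restrict_rel (set xs) ?E)"
    by (rule rel_iso_trans[OF iso rel_iso_sym[OF pentagon_unique[OF sr(1)]]]) (use sr(2) in \<open>simp add: xs_def\<close>)
  show "sr_graph (pverts \<Gamma>) (gadj \<Gamma>) 2 0 1" by (rule sr_graph_of_iso[OF \<Gamma> sr(1) r])
  show "is_cayley_graph \<Gamma>"
    by (rule zgrp_cayley[OF _ _ _ \<Gamma> r]) (auto simp: xs_def atLeastLessThan_5 atLeastLessThan_1)
qed

lemma clebsch_converse:
  assumes \<Gamma>: "pair_graph \<Gamma>" and iso: "rel_iso (pverts \<Gamma>) (gadj \<Gamma>) (pverts clebsch_graph) (gadj clebsch_graph)"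
  shows "is_cayley_graph \<Gamma>" "sr_graph (pverts \<Gamma>) (gadj \<Gamma>) 10 6 6"
proof -
  define xs where "xs = List.product [0, 1, 2, 3::int] [0, 1, 2, 3::int]"
  \<comment> \<open>The omitted nonzero elements are \<open>(1, 0)\<close>, \<open>(3, 0)\<close>,
    \<open>(0, 1)\<close>, \<open>(0, 3)\<close> and \<open>(2, 2)\<close>. They give the product of
    two 4-cycles, which is the 4-cube, with antipodes joined, that is, the folded 5-cube.\<close>
  let ?E = "zadj 4 4 [(2, 0), (0, 2), (1, 1), (1, 2), (1, 3), (2, 1), (2, 3), (3, 1), (3, 2), (3, 3)]"
  have chk: "srg_check xs ?E 10 6 6" unfolding xs_def by code_simp
  have sr: "sr_graph (set xs) (restrict_rel (set xs) ?E) 10 6 6" "card (set xs) = length xs"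
    by (rule sr_graph_of_list[OF _ chk, of "(0, 0)" "(1, 1)" "(0, 3)"]; simp add: xs_def zadj_def)+
  have r: "rel_iso (pverts \<Gamma>) (gadj \<Gamma>) (set xs) (restrict_rel (set xs) ?E)"
    by (rule rel_iso_trans[OF iso rel_iso_sym[OF clebsch_unique[OF sr(1)]]]) (use sr(2) in \<open>simp add: xs_def\<close>)
  show "sr_graph (pverts \<Gamma>) (gadj \<Gamma>) 10 6 6" by (rule sr_graph_of_iso[OF \<Gamma> sr(1) r])
  show "is_cayley_graph \<Gamma>"
    by (rule zgrp_cayley[OF _ _ _ \<Gamma> r]) (auto simp: xs_def atLeastLessThan_4)
qed

lemma (in sr_minus2) claw_shrikhande:
  assumes "local_nonadj u a b" "c \<in> claw_tips u a b" "r = 2"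
  shows "rel_iso V E (set shrikhande_labels) shrikhande_rel"
proof -
  obtain h where h: "hexagon V E u h" using hexagon_of_claw[OF assms] by blast
  show ?thesis by (rule hexagon.shrikhande[OF h]) (use claw_parameters(4)[OF assms(1,2)] assms(3) in simp)
qed

text \<open>Claw-freeness would, by the number of vertices, leave the lattice graph for
  \<open>n = 4\<close>, which is excluded, or a triangular graph with
  \<open>n choose 2 = 16\<close>, which does not exist. So there is a claw.\<close>

lemma shrikhande_unique:
  assumes sr: "sr_graph V E 6 2 2" and v: "card V = 16"
    and no: "\<not> rel_iso V E (pverts (lattice_graph 4)) (gadj (lattice_graph 4))"
  shows "rel_iso V E (set shrikhande_labels) shrikhande_rel"
proof -
  interpret sr_minus2 V E 6 2 2 2 by (rule sr_minus2.intro[OF sr]) (simp add: sr_minus2_axioms_def)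
  have "\<not> claw_free"
  proof
    assume claw_free
    from claw_free_classification[OF this] consider
      (L) n where "rel_iso V E (pverts (lattice_graph n)) (gadj (lattice_graph n))"
      | (T) n where "n \<ge> 5" "rel_iso V E (pverts (triangular_graph n)) (gadj (triangular_graph n))"
      by auto
    then show False
    proof cases
      case L
      have "card V = card ({..<n} \<times> {..<n})"
        using rel_iso_card[OF L] rel_iso_card[OF lattice_graph_rel_iso[of n]] by simp
      then have "n * n = 4 * 4" using v by (simp add: card_cartesian_product)
      then have "n = 4" by (metis power2_eq_square power2_eq_iff_nonneg zero_le)
      then show False using L no by simp
    next
      case T
      have "card V = n choose 2" using rel_iso_card[OF T(2)] n_subsets[of "{..<n}" 2] by (simp add: triangular_graph_eq(1))
      then have "n choose 2 = 16" using v by simp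
      then have e: "n * (n - 1) div 2 = 16" by (simp add: choose_two)
      have ev: "even (n * (n - 1))" by (cases n) auto
      have e: "n * (n - 1) = 32" using dvd_mult_div_cancel[OF ev] unfolding e by simp
      consider "n = 5" | "n = 6" | "n \<ge> 7" using T(1) by linarith
      then show False
      proof cases
        case 3
        then have "n * (n - 1) \<ge> 7 * 6" by (intro mult_le_mono) auto
        then show False using e by simp
      qed (use e in auto)
    qed
  qed
  then obtain u a b where ab: "local_nonadj u a b" "claw_tips u a b \<noteq> {}" by (auto simp: claw_free_def)
  then obtain c where "c \<in> claw_tips u a b" by blast
  then show ?thesis by (rule claw_shrikhande[OF ab(1)]) simp
qed

lemma shrikhande_converse:
  assumes \<Gamma>: "pair_graph \<Gamma>" and iso: "rel_iso (pverts \<Gamma>) (gadj \<Gamma>) (set shrikhande_labels) shrikhande_rel"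
  shows "is_cayley_graph \<Gamma>" "sr_graph (pverts \<Gamma>) (gadj \<Gamma>) 6 2 2"
proof -
  define xs where "xs = List.product [0, 1, 2, 3::int] [0, 1, 2, 3::int]"
  let ?E = "zadj 4 4 [(1, 0), (3, 0), (0, 1), (0, 3), (1, 1), (3, 3)]"
  have chk: "srg_check xs ?E 6 2 2" unfolding xs_def by code_simp
  have sr: "sr_graph (set xs) (restrict_rel (set xs) ?E) 6 2 2" "card (set xs) = length xs"
    by (rule sr_graph_of_list[OF _ chk, of "(0, 0)" "(1, 0)" "(2, 0)"]; simp add: xs_def zadj_def)+
  interpret sr_minus2 "set xs" "restrict_rel (set xs) ?E" 6 2 2 2
    by (rule sr_minus2.intro[OF sr(1)]) (simp add: sr_minus2_axioms_def)
  \<comment> \<open>Exhibiting a claw takes the place of a comparison with the lattice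
    graph.\<close>
  have "local_nonadj (0, 0) (1, 0) (0, 1)" "(3, 3) \<in> claw_tips (0, 0) (1, 0) (0, 1)"
    unfolding claw_tips_def local_nonadj_def mem_Collect_eq
    by (simp_all add: restrict_rel_def xs_def zadj_def)
  then have u: "rel_iso (set xs) (restrict_rel (set xs) ?E) (set shrikhande_labels) shrikhande_rel"
    by (rule claw_shrikhande) simp
  have r: "rel_iso (pverts \<Gamma>) (gadj \<Gamma>) (set xs) (restrict_rel (set xs) ?E)"
    by (rule rel_iso_trans[OF iso rel_iso_sym[OF u]])
  show "sr_graph (pverts \<Gamma>) (gadj \<Gamma>) 6 2 2" by (rule sr_graph_of_iso[OF \<Gamma> sr(1) r])
  show "is_cayley_graph \<Gamma>"
    by (rule zgrp_cayley[OF _ _ _ \<Gamma> r]) (auto simp: xs_def atLeastLessThan_4)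
qed

text \<open>The Heisenberg group over the integers modulo 3: \<open>(a, b, c)\<close> is the upper
  unitriangular 3 by 3 matrix with \<open>a\<close>, \<open>b\<close> next to the diagonal and
  \<open>c\<close> in the corner.\<close>

definition heis :: "(int \<times> int \<times> int) monoid" where
  "heis = \<lparr>carrier = {0..<3} \<times> {0..<3} \<times> {0..<3},
    mult = (\<lambda>(a, b, c) (a', b', c'). ((a + a') mod 3, (b + b') mod 3, (c + c' + a * b') mod 3)), one = (0, 0, 0)\<rparr>"

text \<open>Replaces a residue by a linear expression, so that identities with products of residues
  become polynomial identities up to multiples of 3.\<close>

lemma mod_3_exists: "\<exists>k. x mod 3 = x + 3 * (k::int)"
proof
  show "x mod 3 = x + 3 * (- (x div 3))" by (simp add: minus_mult_div_eq_mod[symmetric])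
qed

lemma group_heis: "group heis"
proof (rule groupI)
  fix x assume x: "x \<in> carrier heis"
  obtain a b c where "x = (a, b, c)" by (metis surj_pair)
  moreover have "((a * b - c) mod 3 + c + - a mod 3 * b) mod 3 = 0"
  proof -
    obtain i j where ij: "(a * b - c) mod 3 = a * b - c + 3 * i" "- a mod 3 = - a + 3 * j" using mod_3_exists by metis
    have "(a * b - c) mod 3 + c + - a mod 3 * b = 3 * (i + j * b)" unfolding ij by (simp add: algebra_simps)
    then show ?thesis by simp
  qed
  ultimately show "\<exists>y\<in>carrier heis. y \<otimes>\<^bsub>heis\<^esub> x = \<one>\<^bsub>heis\<^esub>"
    by (intro bexI[of _ "((- a) mod 3, (- b) mod 3, (a * b - c) mod 3)"]) (auto simp: heis_def mod_simps)
next
  fix x y z :: "int \<times> int \<times> int"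
  obtain a b c a' b' c' a'' b'' c'' where xyz: "x = (a, b, c)" "y = (a', b', c')" "z = (a'', b'', c'')" by (metis surj_pair)
  have e: "((i + j) mod 3 + k) mod 3 = (i + (j + k) mod 3) mod 3" for i j k :: int
    by (simp add: mod_simps add.assoc)
  have t: "((c + c' + a * b') mod 3 + c'' + (a + a') mod 3 * b'') mod 3
      = (c + (c' + c'' + a' * b'') mod 3 + a * ((b' + b'') mod 3)) mod 3"
  proof -
    define s where "s = c + c' + c'' + a * b' + a * b'' + a' * b''"
    obtain i1 i2 i3 i4 where i: "(c + c' + a * b') mod 3 = c + c' + a * b' + 3 * i1" "(a + a') mod 3 = a + a' + 3 * i2"
      "(c' + c'' + a' * b'') mod 3 = c' + c'' + a' * b'' + 3 * i3" "(b' + b'') mod 3 = b' + b'' + 3 * i4"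
      using mod_3_exists by metis
    have l: "(c + c' + a * b') mod 3 + c'' + (a + a') mod 3 * b'' = s + 3 * (i1 + i2 * b'')"
      unfolding i s_def by (simp add: algebra_simps)
    have r: "c + (c' + c'' + a' * b'') mod 3 + a * ((b' + b'') mod 3) = s + 3 * (i3 + a * i4)"
      unfolding i s_def by (simp add: algebra_simps)
    show ?thesis unfolding l r mod_mult_self2 ..
  qed
  show "x \<otimes>\<^bsub>heis\<^esub> y \<otimes>\<^bsub>heis\<^esub> z = x \<otimes>\<^bsub>heis\<^esub> (y \<otimes>\<^bsub>heis\<^esub> z)"
    unfolding xyz by (simp only: heis_def prod.case monoid.simps e t)
qed (auto simp: heis_def)

text \<open>Up to reduction modulo 3, the triple tested for membership is \<open>x y\<^sup>-\<^sup>1\<close>; the listed triples form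
  the complement of the connection set.\<close>

definition heis_adj :: "int \<times> int \<times> int \<Rightarrow> int \<times> int \<times> int \<Rightarrow> bool" where
  "heis_adj x y \<longleftrightarrow> (case (x, y) of ((a, b, c), (a', b', c')) \<Rightarrow>
    ((a - a') mod 3, (b - b') mod 3, (c - c' - (a - a') * b') mod 3) \<notin>
      set [(0,0,0), (0,0,1), (0,0,2), (0,1,0), (0,2,0), (1,0,0), (2,0,0), (1,1,2), (2,2,2), (1,2,1), (2,1,1)])"

lemma heis_adj_translate:
  "heis_adj (x \<otimes>\<^bsub>heis\<^esub> g) (y \<otimes>\<^bsub>heis\<^esub> g) \<longleftrightarrow> heis_adj x y"
proof -
  obtain a b c a' b' c' d e f where xyg: "x = (a, b, c)" "y = (a', b', c')" "g = (d, e, f)" by (metis surj_pair)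
  have "((a + d) mod 3 - (a' + d) mod 3) mod 3 = (a - a') mod 3"
    "((b + e) mod 3 - (b' + e) mod 3) mod 3 = (b - b') mod 3"
    by (simp_all add: mod_simps)
  moreover have "((c + f + a * e) mod 3 - (c' + f + a' * e) mod 3 - ((a + d) mod 3 - (a' + d) mod 3) * ((b' + e) mod 3)) mod 3
      = (c - c' - (a - a') * b') mod 3"
  proof -
    obtain i1 i2 i3 i4 i5 where i: "(c + f + a * e) mod 3 = c + f + a * e + 3 * i1"
      "(c' + f + a' * e) mod 3 = c' + f + a' * e + 3 * i2" "(a + d) mod 3 = a + d + 3 * i3"
      "(a' + d) mod 3 = a' + d + 3 * i4" "(b' + e) mod 3 = b' + e + 3 * i5" using mod_3_exists by metis
    have "(c + f + a * e) mod 3 - (c' + f + a' * e) mod 3 - ((a + d) mod 3 - (a' + d) mod 3) * ((b' + e) mod 3)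
        = (c - c' - (a - a') * b') + 3 * (i1 - i2 - (i3 - i4) * (b' + e) - (a - a') * i5 - 3 * (i3 - i4) * i5)"
      unfolding i by (simp add: algebra_simps)
    then show ?thesis by (simp only: mod_mult_self2)
  qed
  ultimately show ?thesis unfolding xyg by (simp only: heis_adj_def heis_def prod.case monoid.simps)
qed

lemma schlaefli_converse:
  assumes \<Gamma>: "pair_graph \<Gamma>" and iso: "rel_iso (pverts \<Gamma>) (gadj \<Gamma>) schlaefli_labels (\<lambda>x y. x \<noteq> y \<and> \<not> schlaefli_rel x y)"
  shows "is_cayley_graph \<Gamma>" "sr_graph (pverts \<Gamma>) (gadj \<Gamma>) 16 10 8"
proof -
  define xs where "xs = List.product [0, 1, 2::int] (List.product [0, 1, 2::int] [0, 1, 2::int])"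
  have chk: "srg_check xs heis_adj 16 10 8" unfolding xs_def by code_simp
  have sr: "sr_graph (set xs) (restrict_rel (set xs) heis_adj) 16 10 8" "card (set xs) = length xs"
    by (rule sr_graph_of_list[OF _ chk, of "(0, 0, 0)" "(0, 1, 1)" "(0, 0, 2)"]; simp add: xs_def heis_adj_def)+
  have r: "rel_iso (pverts \<Gamma>) (gadj \<Gamma>) (set xs) (restrict_rel (set xs) heis_adj)"
    by (rule rel_iso_trans[OF iso rel_iso_sym[OF schlaefli_unique[OF sr(1)]]]) (use sr(2) in \<open>simp add: xs_def\<close>)
  show "sr_graph (pverts \<Gamma>) (gadj \<Gamma>) 16 10 8" by (rule sr_graph_of_iso[OF \<Gamma> sr(1) r])
  have "{0..<3::int} = {0, 1, 2}" by auto
  then have c: "carrier heis = set xs" by (simp add: heis_def xs_def)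
  show "is_cayley_graph \<Gamma>"
    by (rule list_cayley[OF group_heis c _ \<Gamma> r]) (simp add: heis_adj_translate)
qed

lemma mod_diff_eq_0_iff:
  fixes a b n :: int
  assumes "a \<in> {0..<n}" "b \<in> {0..<n}" shows "(a - b) mod n = 0 \<longleftrightarrow> a = b"
  using assms by (metis atLeastLessThan_iff mod_eq_dvd_iff mod_pos_pos_trivial mod_0_imp_dvd dvd_imp_mod_0)

text \<open>Adjacency that depends only on which coordinates agree is invariant under the
  translations of a product of two cyclic groups. The parameter \<open>P\<close> covers both the
  cocktail party graphs and the lattice graphs.\<close>

lemma grid_cayley:
  fixes n m :: nat
  assumes pos: "n > 0" "m > 0" and \<Gamma>: "pair_graph \<Gamma>"
    and iso: "rel_iso (pverts \<Gamma>) (gadj \<Gamma>) ({..<n} \<times> {..<m}) (\<lambda>x y. P (fst x = fst y) (snd x = snd y))"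
  shows "is_cayley_graph \<Gamma>"
proof -
  let ?V = "{0..<int n} \<times> {0..<int m}" and ?F = "\<lambda>x y. P (fst x = fst y) (snd x = snd y)"
  have "bij_betw (map_prod int int) ({..<n} \<times> {..<m}) ?V"
  proof (rule bij_betw_map_prod)
    have "bij_betw int {..<q} {0..<int q}" for q
      by (rule bij_betw_byWitness[where f' = nat]) auto
    then show "bij_betw int {..<n} {0..<int n}" "bij_betw int {..<m} {0..<int m}" by auto
  qed
  then have "rel_iso ({..<n} \<times> {..<m}) ?F ?V ?F" by (rule rel_isoI) (auto simp: map_prod_def split: prod.split)
  then have r: "rel_iso (pverts \<Gamma>) (gadj \<Gamma>) ?V ?F" by (rule rel_iso_trans[OF iso])
  have ca: "carrier (zgrp (int n) (int m)) = ?V" by (simp add: zgrp_def)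
  have *: "(a + g) mod q = (b + g) mod q \<longleftrightarrow> a = b" if "a \<in> {0..<q}" "b \<in> {0..<q}" for a b g q :: int
    using mod_diff_eq_0_iff[OF that] by (simp add: mod_eq_dvd_iff mod_eq_0_iff_dvd)
  show ?thesis
  proof (rule right_invariant_is_cayley[OF \<Gamma> group_zgrp])
    show "0 < int n" "0 < int m" using pos by auto
    show "finite (carrier (zgrp (int n) (int m)))" unfolding ca by simp
    show "rel_iso (pverts \<Gamma>) (gadj \<Gamma>) (carrier (zgrp (int n) (int m))) ?F" unfolding ca by (rule r)
    fix a b g assume abg: "a \<in> carrier (zgrp (int n) (int m))" "b \<in> carrier (zgrp (int n) (int m))" "?F a b"
    have "fst a \<in> {0..<int n}" "fst b \<in> {0..<int n}" "snd a \<in> {0..<int m}" "snd b \<in> {0..<int m}"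
      using abg unfolding ca by auto
    then show "?F (a \<otimes>\<^bsub>zgrp (int n) (int m)\<^esub> g) (b \<otimes>\<^bsub>zgrp (int n) (int m)\<^esub> g)"
      using abg(3) by (simp add: zgrp_def *)
  qed
qed

lemma cocktail_party_converse:
  assumes \<Gamma>: "pair_graph \<Gamma>" and n: "n \<ge> 2"
    and iso: "rel_iso (pverts \<Gamma>) (gadj \<Gamma>) (pverts (cocktail_party_graph n)) (gadj (cocktail_party_graph n))"
  shows "is_cayley_graph \<Gamma>" "sr_graph (pverts \<Gamma>) (gadj \<Gamma>) (2 * n - 2) (2 * n - 4) (2 * n - 2)"
proof -
  show "sr_graph (pverts \<Gamma>) (gadj \<Gamma>) (2 * n - 2) (2 * n - 4) (2 * n - 2)"
    by (rule sr_graph_of_iso[OF \<Gamma> sr_graph_cocktail_party[OF n] iso])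
  have V: "pverts (cocktail_party_graph n) = {..<n} \<times> {..<2::nat}"
    by (simp add: cocktail_party_graph_def complete_multipartite_graph_def)
  have "rel_iso (pverts \<Gamma>) (gadj \<Gamma>) ({..<n} \<times> {..<2::nat}) (\<lambda>x y. \<not> (fst x = fst y))"
    by (rule rel_iso_cong[OF iso[unfolded V]]) (auto simp: cocktail_party_graph_def complete_multipartite_graph_def)
  then show "is_cayley_graph \<Gamma>" by (rule grid_cayley[rotated 3, where P = "\<lambda>p q. \<not> p"]) (use \<Gamma> n in auto)
qed

lemma lattice_converse:
  assumes \<Gamma>: "pair_graph \<Gamma>" and n: "n \<ge> 2"
    and iso: "rel_iso (pverts \<Gamma>) (gadj \<Gamma>) (pverts (lattice_graph n)) (gadj (lattice_graph n))"
  shows "is_cayley_graph \<Gamma>" "sr_graph (pverts \<Gamma>) (gadj \<Gamma>) (2 * n - 2) (n - 2) 2"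
proof -
  have r: "rel_iso (pverts \<Gamma>) (gadj \<Gamma>) ({..<n} \<times> {..<n}) rook"
    by (rule rel_iso_trans[OF iso rel_iso_sym[OF lattice_graph_rel_iso]])
  have "rel_iso (pverts \<Gamma>) (gadj \<Gamma>) ({..<n} \<times> {..<n})
      (\<lambda>x y. x \<in> {..<n} \<times> {..<n} \<and> y \<in> {..<n} \<times> {..<n} \<and> rook x y)"
    by (rule rel_iso_cong[OF r]) simp
  then show "sr_graph (pverts \<Gamma>) (gadj \<Gamma>) (2 * n - 2) (n - 2) 2"
    by (rule sr_graph_of_iso[OF \<Gamma> sr_graph_rook[OF n]])
  have "rel_iso (pverts \<Gamma>) (gadj \<Gamma>) ({..<n} \<times> {..<n}) (\<lambda>x y. (fst x = fst y) \<noteq> (snd x = snd y))"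
    by (rule rel_iso_cong[OF r]) (auto simp: rook_def)
  then show "is_cayley_graph \<Gamma>" by (rule grid_cayley[rotated 3, where P = "\<lambda>p q. p \<noteq> q"]) (use \<Gamma> n in auto)
qed

lemma triangular_converse:
  assumes \<Gamma>: "pair_graph \<Gamma>" and n: "n = 4 \<or> (n > 4 \<and> [n = 3] (mod 4) \<and> primepow n)"
    and iso: "rel_iso (pverts \<Gamma>) (gadj \<Gamma>) (pverts (triangular_graph n)) (gadj (triangular_graph n))"
  shows "is_cayley_graph \<Gamma>" "sr_graph (pverts \<Gamma>) (gadj \<Gamma>) (2 * n - 4) (n - 2) 4"
proof -
  have n4: "n \<ge> 4" using n by auto
  show sr: "sr_graph (pverts \<Gamma>) (gadj \<Gamma>) (2 * n - 4) (n - 2) 4"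
    by (rule sr_graph_of_iso[OF \<Gamma> sr_graph_triangular[OF n4] iso])
  show "is_cayley_graph \<Gamma>"
  proof (cases "n = 4")
    case True
    \<comment> \<open>The triangular graph for \<open>n = 4\<close> is a cocktail party graph,
      recognised by the equality of its first and last parameters.\<close>
    have "sr_graph (pverts \<Gamma>) (gadj \<Gamma>) 4 2 4" using sr True by simp
    from cocktail_party_unique[OF this] obtain j where "j \<ge> 2"
      "rel_iso (pverts \<Gamma>) (gadj \<Gamma>) (pverts (cocktail_party_graph j)) (gadj (cocktail_party_graph j))" by auto
    then show ?thesis by (rule cocktail_party_converse(1)[OF \<Gamma>])
  next
    case False
    then have "primepow n" "n mod 4 = 3" using n by (auto simp: cong_def)
    then show ?thesis by (rule triangular_cayley[OF _ _ \<Gamma> iso])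
  qed
qed

section \<open>The classification\<close>

lemma linear_bound:
  fixes a b c :: real
  assumes "0 \<le> - (a - b) + 2 * (c - b) + 4" shows "a + b \<le> 2 * c + 4"
  using assms by argo

text \<open>The inequality on the right says that \<open>x^2 - (l - m) x - (k - m)\<close> is
  nonnegative at \<open>x = -2\<close>. This value is \<open>(r + 2) (s + 2)\<close> for the roots,
  and \<open>r \<ge> 0\<close>, so it means \<open>s \<ge> -2\<close>.\<close>

lemma least_eigenvalue_iff:
  assumes \<Gamma>: "pair_graph \<Gamma>" and sr: "sr_graph (pverts \<Gamma>) (gadj \<Gamma>) k l m"
  shows "least_eigenvalue (adjacency_matrix \<Gamma>) \<ge> -2 \<longleftrightarrow> k + m \<le> 2 * l + 4"
proof -
  interpret P: pair_graph \<Gamma> by (rule \<Gamma>)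
  interpret S: sr_graph "pverts \<Gamma>" "gadj \<Gamma>" k l m by (rule sr)
  let ?A = "adjacency_matrix \<Gamma>"
  define Sp where "Sp = {\<theta>. eigenvalue ?A \<theta>}"
  have fd: "pair_fin_digraph \<Gamma>" by unfold_locales
  have nb: "nbrs \<Gamma> u = {w. gadj \<Gamma> u w}" for u by (simp add: nbrs_def)
  note ev = eigenvalue_adjacency_matrix_iff[OF fd, unfolded nb]
  have "?A \<in> carrier_mat (length (vertex_list \<Gamma>)) (length (vertex_list \<Gamma>))"
    by (simp add: adjacency_matrix_def Let_def)
  then have fin: "finite Sp" using card_finite_spectrum(1) unfolding spectrum_def Sp_def by blast
  have "real k \<in> Sp"
  proof -
    obtain u where u: "u \<in> pverts \<Gamma>" using S.V_nonempty by blast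
    have "(\<Sum>w | gadj \<Gamma> x w. 1) = real k * 1" if "x \<in> pverts \<Gamma>" for x using S.card_nbrs[OF that] by simp
    then show ?thesis unfolding Sp_def mem_Collect_eq ev using u by (intro exI[of _ "\<lambda>_. 1"]) auto
  qed
  then have ne: "Sp \<noteq> {}" by blast
  define d where "d = real l - real m"
  have mk: "m \<le> k" by (rule S.m_le_k)
  show ?thesis
  proof
    assume le: "least_eigenvalue ?A \<ge> -2"
    define D where "D = d * d + 4 * (real k - real m)"
    define r where "r = (d + sqrt D) / 2"
    define s where "s = (d - sqrt D) / 2"
    have mk': "real m \<le> real k" using mk by (simp only: of_nat_le_iff)
    then have D: "D \<ge> d * d" unfolding D_def by simp
    then have D0: "D \<ge> 0" using zero_le_square[of d] by linarith
    have "sqrt D \<ge> sqrt (d * d)" using D by (rule real_sqrt_le_mono)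
    then have sq: "sqrt D \<ge> \<bar>d\<bar>" by simp
    have "r + s = d" unfolding r_def s_def add_divide_distrib[symmetric] by simp
    then have rs: "r + s = real l - real m" by (simp add: d_def)
    have "r * s = (d * d - sqrt D * sqrt D) / 4" by (simp add: r_def s_def algebra_simps)
    also have "sqrt D * sqrt D = D" using D0 by simp
    also have "(d * d - D) / 4 = - (real k - real m)" unfolding D_def by simp
    finally have rs2: "r * s = - (real k - real m)" .
    have "d + sqrt D \<ge> 0" using sq abs_ge_minus_self[of d] by linarith
    then have r0: "r \<ge> 0" unfolding r_def by simp
    have "s \<in> Sp" using S.smaller_root_is_eigenvalue[OF rs rs2 r0] unfolding Sp_def mem_Collect_eq ev .
    then have "least_eigenvalue ?A \<le> s" unfolding least_eigenvalue_def Sp_def[symmetric] using fin by simp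
    then have "s + 2 \<ge> 0" using le by simp
    then have "(r + 2) * (s + 2) \<ge> 0" using r0 by (intro mult_nonneg_nonneg) auto
    moreover have "(r + 2) * (s + 2) = r * s + 2 * (r + s) + 4" by (simp add: algebra_simps)
    ultimately have "r * s + 2 * (r + s) + 4 \<ge> 0" by simp
    then have "real k + real m \<le> 2 * real l + 4" unfolding rs rs2 by (rule linear_bound)
    then have "real (k + m) \<le> real (2 * l + 4)" by simp
    then show "k + m \<le> 2 * l + 4" by (simp only: of_nat_le_iff)
  next
    assume le: "k + m \<le> 2 * l + 4"
    then have ml: "m \<le> l + 2" using mk by linarith
    have "\<theta> \<ge> -2" if th: "\<theta> \<in> Sp" for \<theta>
    proof (rule ccontr)
      assume "\<not> \<theta> \<ge> -2"
      then have lt: "\<theta> < -2" by simp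
      obtain f where f: "\<exists>u\<in>pverts \<Gamma>. f u \<noteq> 0" "\<forall>u\<in>pverts \<Gamma>. (\<Sum>w | gadj \<Gamma> u w. f w) = \<theta> * f u"
        using th unfolding Sp_def mem_Collect_eq ev by blast
      then obtain u where "u \<in> pverts \<Gamma>" "f u \<noteq> 0" by blast
      then have "\<theta> = real k \<or> \<theta> * \<theta> - (real l - real m) * \<theta> - (real k - real m) = 0"
        using S.eigenvalue_root[of u f \<theta>] f(2) by blast
      moreover have "\<theta> \<noteq> real k" using lt of_nat_0_le_iff[of k] by linarith
      ultimately have q: "\<theta> * \<theta> - d * \<theta> - (real k - real m) = 0" unfolding d_def by blast
      have "real m \<le> real (l + 2)" using ml by (simp only: of_nat_le_iff)
      then have d4: "d \<ge> -2" unfolding d_def by simp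
      have "real (k + m) \<le> real (2 * l + 4)" using le by (simp only: of_nat_le_iff)
      then have q2: "4 + 2 * d - (real k - real m) \<ge> 0" unfolding d_def by simp
      \<comment> \<open>The product of the two factors is the difference of the values of the
        quadratic at \<open>\<theta>\<close> and at \<open>-2\<close>; a root below
        \<open>-2\<close> thus makes the value at \<open>-2\<close> negative.\<close>
      have "0 < - \<theta> - 2" "0 < 2 + d - \<theta>" using lt d4 by linarith+
      then have "(- \<theta> - 2) * (2 + d - \<theta>) > 0" by (rule mult_pos_pos)
      moreover have "(- \<theta> - 2) * (2 + d - \<theta>) = \<theta> * \<theta> - d * \<theta> - 4 - 2 * d" by (simp add: algebra_simps)
      ultimately show False using q q2 by linarith
    qed
    then show "least_eigenvalue ?A \<ge> -2"
      unfolding least_eigenvalue_def Sp_def[symmetric] using Min_in[OF fin ne] by blast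
  qed
qed

text \<open>The discriminant \<open>(\<lambda> - \<mu> + 4)\<^sup>2 - 4\<close> is not a square, so the multiplicities of the two
  irrational eigenvalues agree.\<close>

lemma (in sr_graph) pentagon_parameters:
  assumes eq: "k + m = 2 * l + 3" and mk: "m < k"
  shows "k = 2 \<and> l = 0 \<and> m = 1 \<and> card V = 5"
proof -
  define d where "d = int l - int m"
  \<comment> \<open>Since \<open>k - m = 2 d + 3\<close>, the discriminant
    \<open>d^2 + 4 (k - m)\<close> equals \<open>(d + 4)^2 - 4\<close>.\<close>
  define e where "e = d + 4"
  have km: "int k - int m = 2 * d + 3" using eq by (simp add: d_def)
  have "int m < int k" using mk by simp
  then have "2 * d + 3 \<ge> 1" using km by linarith
  then have e3: "e \<ge> 3" by (simp add: e_def)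
  have "3 * 3 \<le> e * e" by (rule mult_mono) (use e3 in auto)
  then have Dpos: "e * e - 4 > 0" by simp
  define x where "x = sqrt (real_of_int (e * e - 4))"
  have Dr: "real_of_int (e * e - 4) > 0" using Dpos by (simp only: of_int_0_less_iff)
  have x0: "x > 0" unfolding x_def using Dr by (simp only: real_sqrt_gt_0_iff)
  have xx: "x * x = real_of_int (e * e - 4)"
    using real_sqrt_pow2[OF less_imp_le[OF Dr]] by (simp only: x_def power2_eq_square)
  define r where "r = (real_of_int d + x) / 2"
  define s where "s = (real_of_int d - x) / 2"
  have "r + s = real_of_int d" unfolding r_def s_def add_divide_distrib[symmetric] by simp
  then have rs: "r + s = real l - real m" by (simp add: d_def)
  have "r * s = (real_of_int (d * d) - x * x) / 4" by (simp add: r_def s_def algebra_simps)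
  also have "\<dots> = - real_of_int (2 * d + 3)" unfolding xx e_def by (simp add: field_simps)
  also have "real_of_int (2 * d + 3) = real k - real m" unfolding km[symmetric] by simp
  finally have rs2: "r * s = - (real k - real m)" .
  have rsx: "r - s = x" unfolding r_def s_def diff_divide_distrib[symmetric] by simp
  then have "r \<noteq> s" using x0 by auto
  from multiplicity_integral[OF rs rs2 this] obtain f :: nat
    where f: "real f * (r - s) = - s * (real (card V) - 1) - real k" by blast
  define A where "A = 2 * int f - (int (card V) - 1)"
  define B where "B = - d * (int (card V) - 1) - 2 * int k"
  have "x * real_of_int A = real_of_int B"
  proof -
    have "real f * x = - s * (real (card V) - 1) - real k" using f unfolding rsx .
    then have "2 * (real f * x) = - (real_of_int d - x) * (real (card V) - 1) - 2 * real k"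
      by (simp add: s_def field_simps)
    then show ?thesis by (simp add: A_def B_def algebra_simps)
  qed
  then have "(x * x) * (real_of_int A * real_of_int A) = real_of_int B * real_of_int B" by (metis mult.assoc mult.left_commute)
  then have AB: "(e * e - 4) * (A * A) = B * B" unfolding xx by (metis of_int_eq_iff of_int_mult)
  \<comment> \<open>Otherwise \<open>e^2 - 4\<close> would be the square of an integer, but for
    \<open>e \<ge> 3\<close> it lies strictly between \<open>(e - 1)^2\<close> and
    \<open>e^2\<close>.\<close>
  have "A = 0"
  proof (rule ccontr)
    assume A0: "A \<noteq> 0"
    have "A ^ 2 dvd B ^ 2" using AB unfolding power2_eq_square by (metis dvd_triv_right)
    then have "A dvd B" by simp
    then obtain c where c: "B = A * c" by (elim dvdE)
    have "(e * e - 4) * (A * A) = (c * c) * (A * A)" using AB unfolding c by (simp add: algebra_simps)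
    then have cc: "e * e - 4 = c * c" using A0 by simp
    have "\<bar>c\<bar> < e"
    proof (rule ccontr)
      assume "\<not> \<bar>c\<bar> < e"
      then have "e * e \<le> \<bar>c\<bar> * \<bar>c\<bar>" using e3 by (intro mult_mono) auto
      then show False using cc by (simp add: abs_mult_self_eq)
    qed
    then have "\<bar>c\<bar> * \<bar>c\<bar> \<le> (e - 1) * (e - 1)" by (intro mult_mono) auto
    then have "c * c \<le> e * e - 2 * e + 1" by (simp add: abs_mult_self_eq algebra_simps)
    then show False using cc e3 by linarith
  qed
  then have "B = 0" using AB by simp
  then have B0: "d * (int (card V) - 1) = - 2 * int k" by (simp add: B_def)
  have "card V \<ge> 2" using k_less by simp
  then have v: "int (card V) - 1 > 0" by simp
  have k0: "k > 0" using mk by simp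
  have "d < 0"
  proof (rule ccontr)
    assume "\<not> d < 0"
    then have "d * (int (card V) - 1) \<ge> 0" using v by simp
    then show False using B0 k0 by simp
  qed
  \<comment> \<open>The bound \<open>e \<ge> 3\<close> is \<open>d \<ge> -1\<close>.\<close>
  then have d1: "d = -1" using e3 by (simp add: e_def)
  have "int (card V) - 1 = 2 * int k" using B0 unfolding d1 by simp
  then have "int (card V) = int (2 * k + 1)" by simp
  then have vk: "card V = 2 * k + 1" by (simp only: of_nat_eq_iff)
  have lm: "m = l + 1" "k = m + 1" using d1 km by (auto simp: d_def)
  have "k * (k - 1 - l) = m * (card V - 1 - k)" by (rule parameter_identity)
  then have "k = m * k" using lm vk by simp
  then have "m = 1" using k0 by simp
  then show ?thesis using lm vk by simp
qed

lemma (in group) cayley_classification: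
  assumes conn: "connection_set G S" and sr: "sr_graph (carrier G) (cadj G S) k l m" and le: "k + m \<le> 2 * l + 4"
  shows "rel_iso (carrier G) (cadj G S) (pverts (cycle_graph 5)) (gadj (cycle_graph 5)) \<or>
    rel_iso (carrier G) (cadj G S) (pverts clebsch_graph) (gadj clebsch_graph) \<or>
    rel_iso (carrier G) (cadj G S) (set shrikhande_labels) shrikhande_rel \<or>
    rel_iso (carrier G) (cadj G S) schlaefli_labels (\<lambda>x y. x \<noteq> y \<and> \<not> schlaefli_rel x y) \<or>
    (\<exists>n\<ge>2. rel_iso (carrier G) (cadj G S) (pverts (cocktail_party_graph n)) (gadj (cocktail_party_graph n))) \<or>
    (\<exists>n. (n = 4 \<or> (n > 4 \<and> [n = 3] (mod 4) \<and> primepow n)) \<and>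
      rel_iso (carrier G) (cadj G S) (pverts (triangular_graph n)) (gadj (triangular_graph n))) \<or>
    (\<exists>n\<ge>2. rel_iso (carrier G) (cadj G S) (pverts (lattice_graph n)) (gadj (lattice_graph n)))"
proof -
  interpret sr_graph "carrier G" "cadj G S" k l m by (rule sr)
  obtain u a b where "local_nonadj u a b" using exists_local_nonadj by blast
  then have ge: "2 * l + 3 \<le> k + m" using local_count(1)[of u a b] by linarith
  have "m = k \<or> m < k" using m_le_k by auto
  moreover have "k + m = 2 * l + 3 \<or> k + m = 2 * l + 4" using ge le by arith
  ultimately consider (CP) "m = k" | (C5) "m < k" "k + m = 2 * l + 3" | (int) "m < k" "k + m = 2 * l + 4"
    by blast
  then show ?thesis
  proof cases
    case CP
    then have "l + 2 = k" using l_less le by linarith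
    then show ?thesis using cocktail_party_unique[of "carrier G" "cadj G S" k l] sr CP by blast
  next
    case C5
    then have "k = 2 \<and> l = 0 \<and> m = 1 \<and> card (carrier G) = 5" by (intro pentagon_parameters)
    then show ?thesis using pentagon_unique[of "carrier G" "cadj G S"] sr by blast
  next
    case int
    \<comment> \<open>Positive because \<open>m < k\<close> and \<open>k + m = 2 l + 4\<close> give
      \<open>m < l + 2\<close>.\<close>
    define r where "r = l + 2 - m"
    interpret M: sr_minus2 "carrier G" "cadj G S" k l m r by unfold_locales (use int in \<open>auto simp: r_def\<close>)
    show ?thesis
    proof (cases M.claw_free)
      case True
      from M.claw_free_classification[OF True] consider
        (L) n where "n \<ge> 2" "rel_iso (carrier G) (cadj G S) (pverts (lattice_graph n)) (gadj (lattice_graph n))"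
        | (T) n where "n \<ge> 5" "rel_iso (carrier G) (cadj G S) (pverts (triangular_graph n)) (gadj (triangular_graph n))"
          "card (grid_lines (n - 2)) = n" "\<forall>u\<in>carrier G. card {K \<in> grid_lines (n - 2). u \<in> K} = 2"
          "\<forall>K\<in>grid_lines (n - 2). \<forall>L\<in>grid_lines (n - 2). K \<noteq> L \<longrightarrow> (\<exists>x. K \<inter> L = {x})"
        | (C) "card (carrier G) = 16" "k = 10" "l = 6" "m = 6"
        | (S) "card (carrier G) = 27" "k = 16" "l = 10" "m = 8"
        by blast
      then show ?thesis
      proof cases
        case L
        then show ?thesis by blast
      next
        case T
        \<comment> \<open>The lines are the cliques of size \<open>n - 1\<close>, a notion that
          every right translation preserves.\<close>
        interpret LG: line_group G "grid_lines (n - 2)" n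
        proof
          show "finite (carrier G)" by (rule finite_V)
          show "n \<ge> 3" using T(1) by simp
          show "card (grid_lines (n - 2)) = n" by (rule T(3))
          show "L \<subseteq> carrier G" if "L \<in> grid_lines (n - 2)" for L using that by (simp add: grid_lines_def)
          show "card {L \<in> grid_lines (n - 2). x \<in> L} = 2" if "x \<in> carrier G" for x using T(4) that by blast
          show "\<exists>x. K \<inter> L = {x}" if "K \<in> grid_lines (n - 2)" "L \<in> grid_lines (n - 2)" "K \<noteq> L" for K L
            using T(5) that by blast
          show "L #> g \<in> grid_lines (n - 2)" if L: "L \<in> grid_lines (n - 2)" and g: "g \<in> carrier G" for L g
          proof -
            have sub: "L \<subseteq> carrier G" "card L = n - 2 + 1" "clique L" using L by (auto simp: grid_lines_def)
            have im: "L #> g = (\<lambda>x. x \<otimes> g) ` L" by (auto simp: r_coset_def)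
            have "inj_on (\<lambda>x. x \<otimes> g) L" by (rule inj_onI) (use sub(1) g in \<open>simp add: subset_iff\<close>)
            then have "card (L #> g) = n - 2 + 1" unfolding im using sub(2) by (simp add: card_image)
            moreover have "L #> g \<subseteq> carrier G" by (rule r_coset_subset_G[OF sub(1) g])
            moreover have "clique (L #> g)"
              unfolding im clique_def
            proof (intro ballI impI)
              fix s t assume "s \<in> (\<lambda>x. x \<otimes> g) ` L" "t \<in> (\<lambda>x. x \<otimes> g) ` L" and ne: "s \<noteq> t"
              then obtain x y where xy: "x \<in> L" "y \<in> L" "s = x \<otimes> g" "t = y \<otimes> g" by blast
              then have "x \<noteq> y" using ne by blast
              then have "cadj G S x y" using sub(3) xy by (simp add: clique_def)
              then show "cadj G S s t" unfolding xy(3,4) by (rule cadj_translate[OF g])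
            qed
            ultimately show ?thesis by (simp add: grid_lines_def)
          qed
        qed
        have "n > 4 \<and> [n = 3] (mod 4) \<and> primepow n"
        proof (intro conjI)
          show "4 < n" by (rule less_le_trans[OF _ T(1)]) simp
          show "[n = 3] (mod 4)" unfolding cong_def LG.n_mod_4 by simp
          show "primepow n" by (rule LG.primepow_n)
        qed
        then have "\<exists>n. (n = 4 \<or> (n > 4 \<and> [n = 3] (mod 4) \<and> primepow n)) \<and>
            rel_iso (carrier G) (cadj G S) (pverts (triangular_graph n)) (gadj (triangular_graph n))"
          using T(2) by (intro exI[of _ n] conjI disjI2) auto
        then show ?thesis by (rule disjI2[OF disjI2[OF disjI2[OF disjI2[OF disjI2[OF disjI1]]]]])
      next
        case C
        then show ?thesis using clebsch_unique[of "carrier G" "cadj G S"] sr by blast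
      next
        case S
        then show ?thesis using schlaefli_unique[of "carrier G" "cadj G S"] sr by blast
      qed
    next
      case False
      then obtain u a b where ab: "local_nonadj u a b" "claw_tips u a b \<noteq> {}" by (auto simp: M.claw_free_def)
      then obtain c where c: "c \<in> claw_tips u a b" by blast
      note par = M.claw_parameters[OF ab(1) c]
      from par(5) consider "r = 1" | "r = 2" | "r = 4" by blast
      then show ?thesis
      proof cases
        case 1
        then have "k = 3" "l = 0" "m = 1" using par by auto
        then show ?thesis using petersen_not_cayley[OF conn] sr by blast
      next
        case 2
        then show ?thesis using M.claw_shrikhande[OF ab(1) c] by blast
      next
        case 3
        then have p: "k = 12" "l = 6" "m = 4" "card (carrier G) = 28" using par by auto
        have "sr_minus2 (carrier G) (cadj G S) 12 6 4 4" using M.sr_minus2_axioms p 3 by simp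
        then show ?thesis using chang_not_cayley[OF conn _ p(4) ab(1) c] by blast
      qed
    qed
  qed
qed

lemma pair_wf_line_graph: "pair_wf_digraph (line_graph H)"
  by unfold_locales (auto simp: line_graph_def Let_def)

lemma pair_wf_graphs:
  "pair_wf_digraph (cycle_graph n)" "pair_wf_digraph (cocktail_party_graph n)"
  "pair_wf_digraph (triangular_graph n)" "pair_wf_digraph (lattice_graph n)" "pair_wf_digraph clebsch_graph"
proof -
  show "pair_wf_digraph (triangular_graph n)" "pair_wf_digraph (lattice_graph n)"
    unfolding triangular_graph_def lattice_graph_def by (rule pair_wf_line_graph)+
  show "pair_wf_digraph (cycle_graph n)" by unfold_locales (auto simp: cycle_graph_def)
  show "pair_wf_digraph (cocktail_party_graph n)"
    unfolding cocktail_party_graph_def by unfold_locales (auto simp: complete_multipartite_graph_def)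
  show "pair_wf_digraph clebsch_graph"
    unfolding clebsch_graph_def by unfold_locales (auto simp: complement_graph_def)
qed

theorem theorem4p8:
  fixes \<Gamma> :: "'a pair_pre_digraph"
  assumes "pair_graph \<Gamma>"
  shows "strongly_regular \<Gamma> \<and> is_cayley_graph \<Gamma> \<and> least_eigenvalue (adjacency_matrix \<Gamma>) \<ge> -2 \<longleftrightarrow>
    (graph_iso \<Gamma> (cycle_graph 5) \<or> graph_iso \<Gamma> clebsch_graph \<or>
      graph_iso \<Gamma> shrikhande_graph \<or> graph_iso \<Gamma> schlaefli_graph) \<or>
    (\<exists>n\<ge>2. graph_iso \<Gamma> (cocktail_party_graph n)) \<or>
    (\<exists>n. (n = 4 \<or> (n > 4 \<and> [n = 3] (mod 4) \<and> primepow n)) \<and> graph_iso \<Gamma> (triangular_graph n)) \<or>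
    (\<exists>n\<ge>2. graph_iso \<Gamma> (lattice_graph n))"
    (is "?L \<longleftrightarrow> ?R")
proof -
  interpret P: pair_graph \<Gamma> by (rule assms)
  have wf: "pair_wf_digraph \<Gamma>" by unfold_locales
  have pgs: "pair_graph shrikhande_graph" "pair_graph schlaefli_graph"
    using shrikhande_graph_spec(1) schlaefli_graph_spec by (simp_all add: srg_def)
  have pw: "pair_wf_digraph H" if "pair_graph H" for H :: "nat pair_pre_digraph"
  proof -
    interpret pair_graph H by (rule that)
    show ?thesis by unfold_locales
  qed
  note wfs = pw[OF pgs(1)] pw[OF pgs(2)]
  note iso = graph_iso_iff_rel_iso[OF wf pair_wf_graphs(1)] graph_iso_iff_rel_iso[OF wf pair_wf_graphs(2)]
    graph_iso_iff_rel_iso[OF wf pair_wf_graphs(3)] graph_iso_iff_rel_iso[OF wf pair_wf_graphs(4)]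
    graph_iso_iff_rel_iso[OF wf pair_wf_graphs(5)] graph_iso_iff_rel_iso[OF wf wfs(1)] graph_iso_iff_rel_iso[OF wf wfs(2)]
  let ?I = "rel_iso (pverts \<Gamma>) (gadj \<Gamma>)"
  \<comment> \<open>The graph behind the choice operator is known only through its specification;
    uniqueness ties it to the label model, through which all isomorphisms are then composed.\<close>
  have shr: "rel_iso (pverts shrikhande_graph) (gadj shrikhande_graph) (set shrikhande_labels) shrikhande_rel"
  proof (rule shrikhande_unique)
    show "sr_graph (pverts shrikhande_graph) (gadj shrikhande_graph) 6 2 2" "card (pverts shrikhande_graph) = 16"
      using shrikhande_graph_spec(1) unfolding srg_iff_sr_graph[OF pgs(1)] by auto
    show "\<not> rel_iso (pverts shrikhande_graph) (gadj shrikhande_graph) (pverts (lattice_graph 4)) (gadj (lattice_graph 4))"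
      using shrikhande_graph_spec(2) unfolding graph_iso_iff_rel_iso[OF wfs(1) pair_wf_graphs(4)] .
  qed
  have schl: "rel_iso (pverts schlaefli_graph) (gadj schlaefli_graph) schlaefli_labels (\<lambda>x y. x \<noteq> y \<and> \<not> schlaefli_rel x y)"
    by (rule schlaefli_unique) (use schlaefli_graph_spec in \<open>auto simp: srg_iff_sr_graph[OF pgs(2)]\<close>)
  show ?thesis
  proof
    assume L: ?L
    then obtain v k l m where "srg \<Gamma> v k l m" by (auto simp: strongly_regular_def)
    then have sr: "sr_graph (pverts \<Gamma>) (gadj \<Gamma>) k l m" by (simp add: srg_iff_sr_graph[OF assms])
    have le: "k + m \<le> 2 * l + 4" using L least_eigenvalue_iff[OF assms sr] by blast
    obtain G :: "'a monoid" and S where G: "group G" "connection_set G S" "graph_iso \<Gamma> (cayley_graph G S)"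
      using L by (auto simp: is_cayley_graph_def)
    have i: "?I (carrier G) (cadj G S)"
      using G(3) unfolding graph_iso_iff_rel_iso[OF wf pair_wf_digraph_cayley_graph] cayley_graph_simps .
    have "sr_graph (carrier G) (cadj G S) k l m"
      by (rule sr_graph_rel_iso[OF sr i]) (simp add: cadj_def)
    note cls = group.cayley_classification[OF G(1,2) this le]
    let ?J = "rel_iso (carrier G) (cadj G S)"
    have "?J (pverts (cycle_graph 5)) (gadj (cycle_graph 5)) \<Longrightarrow> ?I (pverts (cycle_graph 5)) (gadj (cycle_graph 5))"
      "?J (pverts clebsch_graph) (gadj clebsch_graph) \<Longrightarrow> ?I (pverts clebsch_graph) (gadj clebsch_graph)"
      "?J (set shrikhande_labels) shrikhande_rel \<Longrightarrow> ?I (pverts shrikhande_graph) (gadj shrikhande_graph)"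
      "?J schlaefli_labels (\<lambda>x y. x \<noteq> y \<and> \<not> schlaefli_rel x y) \<Longrightarrow> ?I (pverts schlaefli_graph) (gadj schlaefli_graph)"
      "\<And>n. ?J (pverts (cocktail_party_graph n)) (gadj (cocktail_party_graph n)) \<Longrightarrow>
        ?I (pverts (cocktail_party_graph n)) (gadj (cocktail_party_graph n))"
      "\<And>n. ?J (pverts (triangular_graph n)) (gadj (triangular_graph n)) \<Longrightarrow>
        ?I (pverts (triangular_graph n)) (gadj (triangular_graph n))"
      "\<And>n. ?J (pverts (lattice_graph n)) (gadj (lattice_graph n)) \<Longrightarrow>
        ?I (pverts (lattice_graph n)) (gadj (lattice_graph n))"
      by (rule rel_iso_trans[OF i], assumption | rule rel_iso_trans[OF rel_iso_trans[OF i] rel_iso_sym[OF shr]], assumption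
        | rule rel_iso_trans[OF rel_iso_trans[OF i] rel_iso_sym[OF schl]], assumption)+
    then show ?R unfolding iso using cls by blast
  next
    have I: "is_cayley_graph \<Gamma> \<and> (\<exists>k l m. sr_graph (pverts \<Gamma>) (gadj \<Gamma>) k l m \<and> k + m \<le> 2 * l + 4)"
      if "is_cayley_graph \<Gamma>" "sr_graph (pverts \<Gamma>) (gadj \<Gamma>) k l m" "k + m \<le> 2 * l + 4" for k l m
      using that by blast
    assume ?R
    then have "is_cayley_graph \<Gamma> \<and> (\<exists>k l m. sr_graph (pverts \<Gamma>) (gadj \<Gamma>) k l m \<and> k + m \<le> 2 * l + 4)"
      unfolding iso
    proof (elim disjE exE conjE)
      assume i: "?I (pverts (cycle_graph 5)) (gadj (cycle_graph 5))"
      show ?thesis by (rule I[OF pentagon_converse[OF assms i]]) simp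
    next
      assume i: "?I (pverts clebsch_graph) (gadj clebsch_graph)"
      show ?thesis by (rule I[OF clebsch_converse[OF assms i]]) simp
    next
      assume i: "?I (pverts shrikhande_graph) (gadj shrikhande_graph)"
      show ?thesis by (rule I[OF shrikhande_converse[OF assms rel_iso_trans[OF i shr]]]) simp
    next
      assume i: "?I (pverts schlaefli_graph) (gadj schlaefli_graph)"
      show ?thesis by (rule I[OF schlaefli_converse[OF assms rel_iso_trans[OF i schl]]]) simp
    next
      fix n assume n: "2 \<le> n" "?I (pverts (cocktail_party_graph n)) (gadj (cocktail_party_graph n))"
      \<comment> \<open>Removes the truncated subtractions from the inequality between the
        parameters.\<close>
      obtain j where j: "n = 2 + j" using le_Suc_ex[OF n(1)] by blast
      show ?thesis by (rule I[OF cocktail_party_converse[OF assms n]]) (simp add: j)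
    next
      fix n assume n: "n = 4" "?I (pverts (triangular_graph n)) (gadj (triangular_graph n))"
      have "n = 4 \<or> (n > 4 \<and> [n = 3] (mod 4) \<and> primepow n)" using n by blast
      from triangular_converse[OF assms this n(2)] show ?thesis by (rule I) (simp add: n(1))
    next
      fix n assume n: "?I (pverts (triangular_graph n)) (gadj (triangular_graph n))"
        "4 < n" "[n = 3] (mod 4)" "primepow n"
      have "n = 4 \<or> (n > 4 \<and> [n = 3] (mod 4) \<and> primepow n)" using n by blast
      note conv = triangular_converse[OF assms this n(1)]
      obtain j where j: "n = 4 + j" using le_Suc_ex[OF less_imp_le[OF n(2)]] by blast
      show ?thesis by (rule I[OF conv]) (simp add: j)
    next
      fix n assume n: "2 \<le> n" "?I (pverts (lattice_graph n)) (gadj (lattice_graph n))"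
      obtain j where j: "n = 2 + j" using le_Suc_ex[OF n(1)] by blast
      show ?thesis by (rule I[OF lattice_converse[OF assms n]]) (simp add: j)
    qed
    then obtain k l m where c: "is_cayley_graph \<Gamma>" and sr: "sr_graph (pverts \<Gamma>) (gadj \<Gamma>) k l m" and le: "k + m \<le> 2 * l + 4"
      by blast
    have "strongly_regular \<Gamma>" unfolding strongly_regular_def srg_iff_sr_graph[OF assms] using sr by blast
    then show ?L using c least_eigenvalue_iff[OF assms sr] le by blast
  qed
qed

end
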